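(* Let $\gamma\in(-1,2]$ and suppose that the noise condition (N), the nonlinearity conditions (F1)–(F2) and the initial data condition (I) stated in the context hold with this $\gamma$. Let $X(t)=(u(t),v(t))'$, $t\in[0,T]$, be the unique mild solution of the stochastic strongly damped wave equation $$\mathrm{d}X(t)=-\mathcal{A}X(t)\,\mathrm{d}t+\mathbf{F}(X(t))\,\mathrm{d}t+\mathbf{B}\,\mathrm{d}W(t),\quad t\in(0,T],\qquad X(0)=X_0=(u_0,v_0)',$$ and, for $N\in\mathbb{N}$ and $k=T/M$ with $M\in\mathbb{N}^+$, let $(u_m^N,v_m^N)'$, $m=0,1,\dots,M$, be produced by the full-discrete accelerated exponential Euler scheme described in the context. Then there is a constant $C$, independent of $N$, $k$ and $m$, such that for all $N$, $M$ and $m\in\{0,1,\dots,M\}$, with $t_m=mk$, $$\|u(t_m)-u^N_m\|_{L^2(\Omega;\dot{H}^0)}\leq C\Big(k^{\min\{1+\gamma,1\}}+\lambda_{N+1}^{-\frac{1+\min\{\gamma,1\}}{2}}\Big),$$ and, if in addition $\gamma\in[0,2]$, $$\|v(t_m)-v^N_m\|_{L^2(\Omega;\dot{H}^0)}\leq C\Big(k+\lambda_{N+1}^{-\frac{\gamma}{2}}\Big).$$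
   Context: **Spaces and operators.** $\mathcal{D}\subset\mathbb{R}^d$, $d\in\{1,2,3\}$, is a bounded open domain, $T>0$, $\alpha>0$ are fixed, and $H:=L_2(\mathcal{D})$ with inner product $\langle\cdot,\cdot\rangle$ and norm $\|\cdot\|$. $L=\sum_{i,j=1}^d\frac{\partial}{\partial x_i}\big(l_{ij}(x)\frac{\partial}{\partial x_j}\big)$ is a second-order elliptic operator with smooth, uniformly positive definite coefficients, and $A:=-L$ with domain $D(A)=H^2(\mathcal{D})\cap H_0^1(\mathcal{D})$ is self-adjoint and positive definite. $\{(\lambda_j,\phi_j)\}_{j\ge1}$ are the eigenpairs of $A$ with orthonormal eigenvectors, $0<\lambda_1\le\lambda_2\le\cdots$. For $s\in\mathbb{R}$, $\dot{H}^s:=D(A^{s/2})$ with norm $\|v\|_s:=\|A^{s/2}v\|=\big(\sum_{j}\lambda_j^s\langle v,\phi_j\rangle^2\big)^{1/2}$ (for $s<0$ the corresponding completion); $\dot{H}^0=H$. $\|\cdot\|_{\mathrm{HS}}$ is the Hilbert–Schmidt norm on $H$. $\|\cdot\|_{L^p(\Omega;V)}$ is $(\mathbf{E}\|\cdot\|_V^p)^{1/p}$. $(\Omega,\mathcal{F},\mathbb{P},\{\mathcal{F}_t\}_{t\in[0,T]})$ is a stochastic basis with normal filtration. **Assumptions.** (N) $W$ is a (possibly cylindrical) $Q$-Wiener process on this basis, with covariance operator $Q:H\to H$ symmetric nonnegative and $\|A^{\frac{\gamma-1}{2}}Q^{\frac12}\|_{\mathrm{HS}}<\infty$. (F1)–(F2)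 $F:H\to H$ is deterministic and twice differentiable, and there is $K>0$ such that, with $\beta:=\min\{1,1+\gamma\}$: (F1) $\|F(x)-F(y)\|\le K\|x-y\|$ for all $x,y\in H$; (F2) for some $\theta\in[1,2)$, $\|A^{-\theta/2}F'(y)z\|\le K(\|y\|_\beta+1)\|z\|_{-\beta}$ for all $y\in\dot{H}^\beta$, $z\in\dot{H}^{-\beta}$. (I) $u_0,v_0$ are $\mathcal{F}_0$-measurable and $(u_0,v_0)'\in L^p(\Omega;\dot{H}^{\min\{2,\gamma+1\}}\times\dot{H}^\gamma)$ for any $p\ge2$. **Abstract equation and semigroup.** $$\mathcal{A}=\begin{bmatrix}0&-I\\ A&\alpha A\end{bmatrix},\quad \mathbf{F}(X)=\begin{bmatrix}0\\ F(u)\end{bmatrix}\ \text{ for } X=(u,v)',\quad \mathbf{B}=\begin{bmatrix}0\\ I\end{bmatrix}.$$ $-\mathcal{A}$ generates an analytic semigroup $\mathcal{S}(t)=e^{-t\mathcal{A}}=\begin{bmatrix}\mathcal{S}_1(t)&\mathcal{S}_2(t)\\ \mathcal{S}_3(t)&\mathcal{S}_4(t)\end{bmatrix}$. With $\lambda_j^\pm$ the solutions of $z^2-\alpha\lambda_jz+\lambda_j=0$ (so $\lambda_j^-\sim1/\alpha$, $\lambda_j^+\sim\alpha\lambda_j$ as $\lambda_j\to\infty$), $$\mathcal{S}_1(t)\varphi=\sum_j\tfrac{\lambda_j^+e^{-t\lambda_j^-}-\lambda_j^-e^{-t\lambda_j^+}}{\lambda_j^+-\lambda_j^-}\langle\varphi,\phi_j\rangle\phi_j,\qquad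 \mathcal{S}_2(t)\varphi=\sum_j\tfrac{e^{-t\lambda_j^-}-e^{-t\lambda_j^+}}{\lambda_j^+-\lambda_j^-}\langle\varphi,\phi_j\rangle\phi_j,$$ $$\mathcal{S}_3(t)\varphi=\sum_j\tfrac{\lambda_j(e^{-t\lambda_j^+}-e^{-t\lambda_j^-})}{\lambda_j^+-\lambda_j^-}\langle\varphi,\phi_j\rangle\phi_j,\qquad \mathcal{S}_4(t)\varphi=\sum_j\tfrac{\lambda_j^+e^{-t\lambda_j^+}-\lambda_j^-e^{-t\lambda_j^-}}{\lambda_j^+-\lambda_j^-}\langle\varphi,\phi_j\rangle\phi_j$$ (coefficients understood by continuity if $\lambda_j^+=\lambda_j^-$). If $W$ is a $Q$-Wiener process with $\|A^{\frac{\gamma-1}{2}}Q^{\frac12}\|_{\mathrm{HS}}<\infty$ (condition (N)), $F$ is twice differentiable with $\|F(x)-F(y)\|\le K\|x-y\|$ for all $x,y\in H$ and, for some $\theta\in[1,2)$, $\|A^{-\theta/2}F'(y)z\|\le K(\|y\|_\beta+1)\|z\|_{-\beta}$ for all $y\in\dot{H}^\beta$, $z\in\dot{H}^{-\beta}$ (conditions (F1)–(F2)), and $u_0,v_0$ are $\mathcal{F}_0$-measurable with $(u_0,v_0)'\in L^p(\Omega;\dot{H}^{\min\{2,\gamma+1\}}\times\dot{H}^\gamma)$ for any $p\ge2$ (condition (I)), then there is a unique mild solution $X(t)=(u(t),v(t))'$, i.e. $$X(t)=\mathcal{S}(t)X_0+\int_0^t\mathcal{S}(t-s)\mathbf{F}(X(s))\,\mathrm{d}s+\int_0^t\mathcal{S}(t-s)\mathbf{B}\,\mathrm{d}W(s).$$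 **Scheme.** $H_N=\mathrm{span}\{\phi_1,\dots,\phi_N\}$, $\mathcal{P}_Nv=\sum_{j=1}^N\langle v,\phi_j\rangle\phi_j$, and $\mathcal{S}_{i,N}(t)$, $i=1,2,3,4$, is the restriction of $\mathcal{S}_i(t)$ to $H_N$ (the same series truncated at $j=N$). With $k=T/M$, $t_m=mk$, set $u_0^N=\mathcal{P}_Nu_0$, $v_0^N=\mathcal{P}_Nv_0$ and for $m=0,\dots,M-1$ $$u_{m+1}^N=\mathcal{S}_{1,N}(k)u_m^N+\mathcal{S}_{2,N}(k)v_m^N+k\,\mathcal{S}_{2,N}(k)\mathcal{P}_NF(u_m^N)+\int_{t_m}^{t_{m+1}}\mathcal{S}_{2,N}(t_{m+1}-s)\mathcal{P}_N\,\mathrm{d}W(s),$$ $$v_{m+1}^N=\mathcal{S}_{3,N}(k)u_m^N+\mathcal{S}_{4,N}(k)v_m^N+k\,\mathcal{S}_{4,N}(k)\mathcal{P}_NF(u_m^N)+\int_{t_m}^{t_{m+1}}\mathcal{S}_{4,N}(t_{m+1}-s)\mathcal{P}_N\,\mathrm{d}W(s).$$ **Constants.** $C$ is a generic constant depending only on $K$, $T$, $\|F(0)\|$, $\|A^{\frac{\gamma-1}{2}}Q^{\frac12}\|_{\mathrm{HS}}$, the initial data, and the fixed data of the problem ($\alpha$, $\mathcal{D}$, $L$, $\gamma$, $\theta$). *)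

theory Defs
  imports "HOL-Probability.Probability"
begin

section \<open>The space of square integrable functions on D and the elliptic operator\<close>

text \<open>Points of \<open>D\<close> are vectors \<open>real ^ 'd\<close>. Square integrable functions are represented by
  functions on the whole space of which only the values on \<open>D\<close>, up to null sets, matter.\<close>

definition square_integrable_on :: "(real^'d) set \<Rightarrow> (real^'d \<Rightarrow> real) \<Rightarrow> bool" where
  "square_integrable_on D f \<longleftrightarrow> f \<in> borel_measurable (lebesgue_on D) \<and>
     integrable (lebesgue_on D) (\<lambda>x. (f x)\<^sup>2)"

text \<open>\<open>'h\<close> is (a copy of) the Hilbert space of classes of square integrable functions on \<open>D\<close>:
  \<open>J\<close> picks a representative of each class and is linear, isometric and onto, up to null sets.\<close>

definition L2_space :: "(real^'d) set \<Rightarrow> ('h::{real_inner,banach} \<Rightarrow> real^'d \<Rightarrow> real) \<Rightarrow> bool" where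
  "L2_space D J \<longleftrightarrow>
     (\<forall>g. square_integrable_on D (J g)) \<and>
     (\<forall>a b g h. AE x in lebesgue_on D. J (a *\<^sub>R g + b *\<^sub>R h) x = a * J g x + b * J h x) \<and>
     (\<forall>g h. g \<bullet> h = (\<integral>x. J g x * J h x \<partial>lebesgue_on D)) \<and>
     (\<forall>f. square_integrable_on D f \<longrightarrow> (\<exists>h. AE x in lebesgue_on D. J h x = f x))"

primrec Ck_on :: "nat \<Rightarrow> (real^'d) set \<Rightarrow> (real^'d \<Rightarrow> real) \<Rightarrow> bool" where
  "Ck_on 0 U f \<longleftrightarrow> continuous_on U f"
| "Ck_on (Suc n) U f \<longleftrightarrow>
     (\<exists>g. (\<forall>x\<in>U. (f has_derivative (\<lambda>h. g x \<bullet> h)) (at x)) \<and> (\<forall>i. Ck_on n U (\<lambda>x. g x $ i)))"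

definition smooth_on :: "(real^'d) set \<Rightarrow> (real^'d \<Rightarrow> real) \<Rightarrow> bool" where
  "smooth_on U f \<longleftrightarrow> (\<forall>n. Ck_on n U f)"

definition test_functions :: "(real^'d) set \<Rightarrow> (real^'d \<Rightarrow> real) set" where
  "test_functions D = {\<psi>. smooth_on UNIV \<psi> \<and> compact (closure {x. \<psi> x \<noteq> 0}) \<and>
     closure {x. \<psi> x \<noteq> 0} \<subseteq> D}"

definition partial :: "'d \<Rightarrow> (real^'d \<Rightarrow> real) \<Rightarrow> real^'d \<Rightarrow> real" where
  "partial i f x = frechet_derivative f (at x) (axis i 1)"

definition weak_partial :: "(real^'d) set \<Rightarrow> 'd \<Rightarrow> (real^'d \<Rightarrow> real) \<Rightarrow> (real^'d \<Rightarrow> real) \<Rightarrow> bool" where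
  "weak_partial D i f g \<longleftrightarrow> square_integrable_on D f \<and> square_integrable_on D g \<and>
     (\<forall>\<psi>\<in>test_functions D.
        (\<integral>x. f x * partial i \<psi> x \<partial>lebesgue_on D) = - (\<integral>x. g x * \<psi> x \<partial>lebesgue_on D))"

definition Sobolev_H2 :: "(real^'d) set \<Rightarrow> (real^'d \<Rightarrow> real) set" where
  "Sobolev_H2 D = {f. \<exists>p r. (\<forall>i. weak_partial D i f (p i)) \<and>
     (\<forall>i j. weak_partial D j (p i) (r i j))}"

text \<open>The closure of the test functions in the norm of the first order Sobolev space.\<close>

definition Sobolev_H10 :: "(real^'d) set \<Rightarrow> (real^'d \<Rightarrow> real) set" where
  "Sobolev_H10 D = {f. \<exists>p \<psi>. (\<forall>i. weak_partial D i f (p i)) \<and>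
     (\<forall>n. \<psi> n \<in> test_functions D) \<and>
     (\<lambda>n. \<integral>x. (\<psi> n x - f x)\<^sup>2 \<partial>lebesgue_on D) \<longlonglongrightarrow> 0 \<and>
     (\<forall>i. (\<lambda>n. \<integral>x. (partial i (\<psi> n) x - p i x)\<^sup>2 \<partial>lebesgue_on D) \<longlonglongrightarrow> 0)}"

definition elliptic_coefficients :: "(real^'d) set \<Rightarrow> ('d \<Rightarrow> 'd \<Rightarrow> real^'d \<Rightarrow> real) \<Rightarrow> bool" where
  "elliptic_coefficients D l \<longleftrightarrow>
     (\<exists>U. open U \<and> closure D \<subseteq> U \<and> (\<forall>i j. smooth_on U (l i j))) \<and>
     (\<exists>c>0. \<forall>x\<in>D. \<forall>\<xi>. (\<Sum>i\<in>UNIV. \<Sum>j\<in>UNIV. l i j x * \<xi> $ i * \<xi> $ j) \<ge> c * (norm \<xi>)\<^sup>2)"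

definition divergence_form ::
  "(real^'d) set \<Rightarrow> ('d \<Rightarrow> 'd \<Rightarrow> real^'d \<Rightarrow> real) \<Rightarrow> (real^'d \<Rightarrow> real) \<Rightarrow> (real^'d \<Rightarrow> real) \<Rightarrow> bool" where
  "divergence_form D l f g \<longleftrightarrow> (\<exists>p r. (\<forall>j. weak_partial D j f (p j)) \<and>
     (\<forall>i j. weak_partial D i (\<lambda>x. l i j x * p j x) (r i j)) \<and>
     (AE x in lebesgue_on D. g x = (\<Sum>i\<in>UNIV. \<Sum>j\<in>UNIV. r i j x)))"

text \<open>The graph of \<open>A = - L\<close>, an unbounded operator on \<open>'h\<close>.\<close>

definition A_graph ::
  "(real^'d) set \<Rightarrow> ('d \<Rightarrow> 'd \<Rightarrow> real^'d \<Rightarrow> real) \<Rightarrow> ('h \<Rightarrow> real^'d \<Rightarrow> real) \<Rightarrow> ('h \<times> 'h) set" where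
  "A_graph D l J = {(x, w). J x \<in> Sobolev_H2 D \<inter> Sobolev_H10 D \<and>
     divergence_form D l (J x) (\<lambda>y. - J w y)}"

definition self_adjoint_graph :: "('h::real_inner \<times> 'h) set \<Rightarrow> bool" where
  "self_adjoint_graph G \<longleftrightarrow> closure (fst ` G) = UNIV \<and>
     G = {(y, z). \<forall>(x, w)\<in>G. w \<bullet> y = x \<bullet> z}"

definition pos_def_graph :: "('h::real_inner \<times> 'h) set \<Rightarrow> bool" where
  "pos_def_graph G \<longleftrightarrow> (\<forall>(x, w)\<in>G. x \<noteq> 0 \<longrightarrow> w \<bullet> x > 0)"

text \<open>Indices start at \<open>0\<close>: \<open>lam j\<close> and \<open>phi j\<close> are the eigenvalue and eigenvector
  numbered \<open>j + 1\<close> in the usual counting.\<close>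

definition eigenbasis :: "('h::real_inner \<times> 'h) set \<Rightarrow> (nat \<Rightarrow> real) \<Rightarrow> (nat \<Rightarrow> 'h) \<Rightarrow> bool" where
  "eigenbasis G lam phi \<longleftrightarrow> 0 < lam 0 \<and> incseq lam \<and>
     (\<forall>j. (phi j, lam j *\<^sub>R phi j) \<in> G) \<and>
     (\<forall>i j. phi i \<bullet> phi j = (if i = j then 1 else 0)) \<and>
     closure (span (range phi)) = UNIV"


section \<open>The scale of spaces generated by A\<close>

text \<open>An element of any space of the scale is represented by its sequence of coefficients with
  respect to \<open>phi\<close>. For a negative order this realises the completion of \<open>'h\<close>, since finite
  sequences are dense; \<open>coef phi\<close> is the embedding of \<open>'h\<close>.\<close>

definition coef :: "(nat \<Rightarrow> 'h::real_inner) \<Rightarrow> 'h \<Rightarrow> nat \<Rightarrow> real" where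
  "coef phi x j = x \<bullet> phi j"

definition Apow :: "(nat \<Rightarrow> real) \<Rightarrow> real \<Rightarrow> (nat \<Rightarrow> real) \<Rightarrow> nat \<Rightarrow> real" where
  "Apow lam r a j = lam j powr r * a j"

definition l2sq :: "(nat \<Rightarrow> real) \<Rightarrow> ennreal" where
  "l2sq a = (\<Sum>j. ennreal ((a j)\<^sup>2))"

definition Hdot :: "(nat \<Rightarrow> real) \<Rightarrow> real \<Rightarrow> (nat \<Rightarrow> real) set" where
  "Hdot lam s = {a. l2sq (Apow lam (s/2) a) < \<infinity>}"

definition hnorm :: "(nat \<Rightarrow> real) \<Rightarrow> real \<Rightarrow> (nat \<Rightarrow> real) \<Rightarrow> real" where
  "hnorm lam s a = sqrt (enn2real (l2sq (Apow lam (s/2) a)))"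

text \<open>Operators from \<open>'h\<close> to coefficient sequences. The sum is taken over the orthonormal
  basis \<open>phi\<close>; the Hilbert-Schmidt norm does not depend on the basis.\<close>

definition HSsq :: "(nat \<Rightarrow> 'h) \<Rightarrow> ('h \<Rightarrow> nat \<Rightarrow> real) \<Rightarrow> ennreal" where
  "HSsq phi \<Psi> = (\<Sum>k. l2sq (\<Psi> (phi k)))"

definition hilbert_schmidt :: "(nat \<Rightarrow> 'h) \<Rightarrow> ('h \<Rightarrow> nat \<Rightarrow> real) \<Rightarrow> bool" where
  "hilbert_schmidt phi \<Psi> \<longleftrightarrow> HSsq phi \<Psi> < \<infinity>"

definition HS_norm :: "(nat \<Rightarrow> 'h) \<Rightarrow> ('h \<Rightarrow> nat \<Rightarrow> real) \<Rightarrow> real" where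
  "HS_norm phi \<Psi> = sqrt (enn2real (HSsq phi \<Psi>))"

definition in_Lp :: "(nat \<Rightarrow> real) \<Rightarrow> 'w measure \<Rightarrow> real \<Rightarrow> real \<Rightarrow> ('w \<Rightarrow> nat \<Rightarrow> real) \<Rightarrow> bool" where
  "in_Lp lam M p s X \<longleftrightarrow> (AE \<omega> in M. X \<omega> \<in> Hdot lam s) \<and>
     (\<forall>j. (\<lambda>\<omega>. X \<omega> j) \<in> borel_measurable M) \<and>
     integrable M (\<lambda>\<omega>. hnorm lam s (X \<omega>) powr p)"

definition Lp_norm :: "(nat \<Rightarrow> real) \<Rightarrow> 'w measure \<Rightarrow> real \<Rightarrow> real \<Rightarrow> ('w \<Rightarrow> nat \<Rightarrow> real) \<Rightarrow> ennreal" where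
  "Lp_norm lam M p s X = (if in_Lp lam M p s X
     then ennreal ((\<integral>\<omega>. hnorm lam s (X \<omega>) powr p \<partial>M) powr (1/p)) else \<infinity>)"


section \<open>The semigroup\<close>

definition root_plus :: "real \<Rightarrow> real \<Rightarrow> complex" where
  "root_plus \<alpha> \<mu> = (of_real (\<alpha> * \<mu>) + csqrt (of_real ((\<alpha> * \<mu>)\<^sup>2 - 4 * \<mu>))) / 2"

definition root_minus :: "real \<Rightarrow> real \<Rightarrow> complex" where
  "root_minus \<alpha> \<mu> = (of_real (\<alpha> * \<mu>) - csqrt (of_real ((\<alpha> * \<mu>)\<^sup>2 - 4 * \<mu>))) / 2"

lemma roots_characteristic:
  fixes z :: complex
  shows "z\<^sup>2 - of_real (\<alpha> * \<mu>) * z + of_real \<mu> = (z - root_plus \<alpha> \<mu>) * (z - root_minus \<alpha> \<mu>)"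
proof -
  define w where "w = csqrt (of_real ((\<alpha> * \<mu>)\<^sup>2 - 4 * \<mu>))"
  have w: "w\<^sup>2 = of_real ((\<alpha> * \<mu>)\<^sup>2 - 4 * \<mu>)" by (simp add: w_def)
  have "(z - root_plus \<alpha> \<mu>) * (z - root_minus \<alpha> \<mu>)
      = z\<^sup>2 - of_real (\<alpha> * \<mu>) * z + ((of_real (\<alpha> * \<mu>))\<^sup>2 - w\<^sup>2) / 4"
    unfolding root_plus_def root_minus_def w_def[symmetric]
    by (simp add: field_simps power2_eq_square)
  also have "((of_real (\<alpha> * \<mu>))\<^sup>2 - w\<^sup>2) / 4 = (of_real \<mu> :: complex)"
    unfolding w by simp
  finally show ?thesis by simp
qed

text \<open>The roots are complex conjugate when \<open>\<alpha>\<^sup>2 * \<mu> < 4\<close>; the quotients are real in all cases.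
  The second alternative is the limit of the first one as the two roots merge.\<close>

definition s1 :: "real \<Rightarrow> real \<Rightarrow> real \<Rightarrow> real" where
  "s1 \<alpha> t \<mu> = (let p = root_plus \<alpha> \<mu>; m = root_minus \<alpha> \<mu> in Re (
     if p \<noteq> m then (p * exp (- of_real t * m) - m * exp (- of_real t * p)) / (p - m)
     else (1 + of_real t * p) * exp (- of_real t * p)))"

definition s2 :: "real \<Rightarrow> real \<Rightarrow> real \<Rightarrow> real" where
  "s2 \<alpha> t \<mu> = (let p = root_plus \<alpha> \<mu>; m = root_minus \<alpha> \<mu> in Re (
     if p \<noteq> m then (exp (- of_real t * m) - exp (- of_real t * p)) / (p - m)
     else of_real t * exp (- of_real t * p)))"

definition s3 :: "real \<Rightarrow> real \<Rightarrow> real \<Rightarrow> real" where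
  "s3 \<alpha> t \<mu> = (let p = root_plus \<alpha> \<mu>; m = root_minus \<alpha> \<mu> in Re (
     if p \<noteq> m then of_real \<mu> * (exp (- of_real t * p) - exp (- of_real t * m)) / (p - m)
     else - of_real \<mu> * of_real t * exp (- of_real t * p)))"

definition s4 :: "real \<Rightarrow> real \<Rightarrow> real \<Rightarrow> real" where
  "s4 \<alpha> t \<mu> = (let p = root_plus \<alpha> \<mu>; m = root_minus \<alpha> \<mu> in Re (
     if p \<noteq> m then (p * exp (- of_real t * p) - m * exp (- of_real t * m)) / (p - m)
     else (1 - of_real t * p) * exp (- of_real t * p)))"

text \<open>For \<open>c = si \<alpha> t\<close> these are the block \<open>i\<close> of the semigroup at time \<open>t\<close>, acting on \<open>'h\<close>
  and on coefficient sequences, and its restriction to \<open>span {phi 0, \<dots>, phi (N - 1)}\<close>.\<close>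

definition Sop :: "(nat \<Rightarrow> real) \<Rightarrow> (nat \<Rightarrow> 'h::{real_inner,banach}) \<Rightarrow> (real \<Rightarrow> real) \<Rightarrow> 'h \<Rightarrow> 'h" where
  "Sop lam phi c x = (\<Sum>j. (c (lam j) * (x \<bullet> phi j)) *\<^sub>R phi j)"

definition Sseq :: "(nat \<Rightarrow> real) \<Rightarrow> (real \<Rightarrow> real) \<Rightarrow> (nat \<Rightarrow> real) \<Rightarrow> nat \<Rightarrow> real" where
  "Sseq lam c a j = c (lam j) * a j"

definition SopN :: "(nat \<Rightarrow> real) \<Rightarrow> (nat \<Rightarrow> 'h::real_inner) \<Rightarrow> nat \<Rightarrow> (real \<Rightarrow> real) \<Rightarrow> 'h \<Rightarrow> 'h" where
  "SopN lam phi N c x = (\<Sum>j<N. (c (lam j) * (x \<bullet> phi j)) *\<^sub>R phi j)"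

definition PN :: "(nat \<Rightarrow> 'h::real_vector) \<Rightarrow> nat \<Rightarrow> (nat \<Rightarrow> real) \<Rightarrow> 'h" where
  "PN phi N a = (\<Sum>j<N. a j *\<^sub>R phi j)"


section \<open>Stochastic basis, Wiener process, stochastic integral\<close>

definition normal_filtration :: "real \<Rightarrow> 'w measure \<Rightarrow> (real \<Rightarrow> 'w measure) \<Rightarrow> bool" where
  "normal_filtration T M Filt \<longleftrightarrow>
     (\<forall>t\<in>{0..T}. subalgebra M (Filt t)) \<and>
     (\<forall>s t. 0 \<le> s \<and> s \<le> t \<and> t \<le> T \<longrightarrow> sets (Filt s) \<subseteq> sets (Filt t)) \<and>
     null_sets M \<subseteq> sets (Filt 0) \<and>
     (\<forall>t\<in>{0..<T}. sets (Filt t) = (\<Inter>s\<in>{t<..T}. sets (Filt s)))"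

definition covariance_operator :: "('h::real_inner \<Rightarrow> 'h) \<Rightarrow> bool" where
  "covariance_operator Q \<longleftrightarrow> bounded_linear Q \<and> (\<forall>g h. Q g \<bullet> h = g \<bullet> Q h) \<and> (\<forall>h. 0 \<le> Q h \<bullet> h)"

definition is_sqrt_of :: "('h::real_inner \<Rightarrow> 'h) \<Rightarrow> ('h \<Rightarrow> 'h) \<Rightarrow> bool" where
  "is_sqrt_of R Q \<longleftrightarrow> covariance_operator R \<and> (\<forall>h. R (R h) = Q h)"

text \<open>A (possibly cylindrical) \<open>Q\<close>-Wiener process, where \<open>W t h\<close> stands for the pairing of
  \<open>W(t)\<close> with \<open>h\<close>. If \<open>Q\<close> is of trace class and \<open>W\<close> takes values in \<open>'h\<close>, it is the inner
  product of \<open>W(t)\<close> and \<open>h\<close>.\<close>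

definition Q_Wiener ::
  "real \<Rightarrow> 'w measure \<Rightarrow> (real \<Rightarrow> 'w measure) \<Rightarrow> ('h::real_inner \<Rightarrow> 'h) \<Rightarrow> (real \<Rightarrow> 'h \<Rightarrow> 'w \<Rightarrow> real) \<Rightarrow> bool" where
  "Q_Wiener T M Filt Q W \<longleftrightarrow>
     (\<forall>t\<in>{0..T}. \<forall>h. W t h \<in> borel_measurable (Filt t)) \<and>
     (\<forall>t\<in>{0..T}. \<forall>a b g h. AE \<omega> in M. W t (a *\<^sub>R g + b *\<^sub>R h) \<omega> = a * W t g \<omega> + b * W t h \<omega>) \<and>
     (\<forall>h. AE \<omega> in M. W 0 h \<omega> = 0) \<and>
     (\<forall>h. AE \<omega> in M. continuous_on {0..T} (\<lambda>t. W t h \<omega>)) \<and>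
     (\<forall>s t h. 0 \<le> s \<and> s < t \<and> t \<le> T \<longrightarrow>
        prob_space.indep_set M (sets (Filt s))
          {(\<lambda>\<omega>. W t h \<omega> - W s h \<omega>) -` B \<inter> space M | B. B \<in> sets borel} \<and>
        (if Q h \<bullet> h = 0 then AE \<omega> in M. W t h \<omega> - W s h \<omega> = 0
         else distributed M lborel (\<lambda>\<omega>. W t h \<omega> - W s h \<omega>)
                (normal_density 0 (sqrt ((t - s) * (Q h \<bullet> h))))))"

text \<open>A list of tuples \<open>(c, d, h, g)\<close> encodes the elementary integrand that is the sum of the
  rank one operators mapping \<open>x\<close> to \<open>(h \<bullet> x) *\<^sub>R g\<close>, each active on the interval \<open>{c<..d}\<close>.\<close>

definition elem_op :: "(real \<times> real \<times> 'h \<times> 'h) list \<Rightarrow> real \<Rightarrow> 'h::real_inner \<Rightarrow> 'h" where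
  "elem_op es s x = (\<Sum>(c, d, h, g)\<leftarrow>es. (indicator {c<..d} s * (h \<bullet> x)) *\<^sub>R g)"

definition elem_int ::
  "(real \<Rightarrow> 'h \<Rightarrow> 'w \<Rightarrow> real) \<Rightarrow> (real \<times> real \<times> 'h \<times> 'h) list \<Rightarrow> 'w \<Rightarrow> 'h::real_inner" where
  "elem_int W es \<omega> = (\<Sum>(c, d, h, g)\<leftarrow>es. (W d h \<omega> - W c h \<omega>) *\<^sub>R g)"

text \<open>\<open>Y\<close> is (a version of) the Ito integral over \<open>[a, b]\<close> of the deterministic operator valued
  function \<open>\<Phi>\<close> against \<open>W\<close>, in the space of order \<open>r\<close>: elementary integrands converge to \<open>\<Phi>\<close> in
  the norm of the Ito isometry, and their integrals converge to \<open>Y\<close> in mean square. \<open>Qh\<close> is the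
  square root of the covariance operator.\<close>

definition is_stoch_integral ::
  "(nat \<Rightarrow> real) \<Rightarrow> (nat \<Rightarrow> 'h::real_inner) \<Rightarrow> 'w measure \<Rightarrow> (real \<Rightarrow> 'h \<Rightarrow> 'w \<Rightarrow> real) \<Rightarrow> ('h \<Rightarrow> 'h) \<Rightarrow>
   real \<Rightarrow> real \<Rightarrow> real \<Rightarrow> (real \<Rightarrow> 'h \<Rightarrow> nat \<Rightarrow> real) \<Rightarrow> ('w \<Rightarrow> nat \<Rightarrow> real) \<Rightarrow> bool" where
  "is_stoch_integral lam phi M W Qh r a b \<Phi> Y \<longleftrightarrow>
     (\<forall>j. (\<lambda>\<omega>. Y \<omega> j) \<in> borel_measurable M) \<and>
     (\<exists>es :: nat \<Rightarrow> (real \<times> real \<times> 'h \<times> 'h) list.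
        (\<forall>n. \<forall>(c, d, h, g)\<in>set (es n). a \<le> c \<and> c \<le> d \<and> d \<le> b) \<and>
        (\<lambda>n. \<integral>\<^sup>+s\<in>{a..b}. HSsq phi
            (\<lambda>x. Apow lam (r/2) (\<lambda>j. \<Phi> s (Qh x) j - coef phi (elem_op (es n) s (Qh x)) j)) \<partial>lborel)
          \<longlonglongrightarrow> 0 \<and>
        (\<lambda>n. \<integral>\<^sup>+\<omega>. l2sq (Apow lam (r/2) (\<lambda>j. Y \<omega> j - coef phi (elem_int W (es n) \<omega>) j)) \<partial>M)
          \<longlonglongrightarrow> 0)"


section \<open>The assumptions on noise, nonlinearity and initial data\<close>

text \<open>\<open>q\<close> is the value of the Hilbert-Schmidt norm.\<close>

definition cond_N ::
  "(nat \<Rightarrow> real) \<Rightarrow> (nat \<Rightarrow> 'h::real_inner) \<Rightarrow> real \<Rightarrow> 'w measure \<Rightarrow> (real \<Rightarrow> 'w measure) \<Rightarrow> real \<Rightarrow> real \<Rightarrow>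
   ('h \<Rightarrow> 'h) \<Rightarrow> ('h \<Rightarrow> 'h) \<Rightarrow> (real \<Rightarrow> 'h \<Rightarrow> 'w \<Rightarrow> real) \<Rightarrow> bool" where
  "cond_N lam phi T M Filt \<gamma> q Q Qh W \<longleftrightarrow>
     covariance_operator Q \<and> is_sqrt_of Qh Q \<and> Q_Wiener T M Filt Q W \<and>
     hilbert_schmidt phi (\<lambda>x. Apow lam ((\<gamma> - 1)/2) (coef phi (Qh x))) \<and>
     HS_norm phi (\<lambda>x. Apow lam ((\<gamma> - 1)/2) (coef phi (Qh x))) = q"

text \<open>In the last condition \<open>G\<close> is the extension of the derivative at \<open>y\<close> to the space of
  negative order, without which the bound would only make sense on \<open>'h\<close>.\<close>

definition cond_F ::
  "(nat \<Rightarrow> real) \<Rightarrow> (nat \<Rightarrow> 'h::real_inner) \<Rightarrow> real \<Rightarrow> real \<Rightarrow> real \<Rightarrow> ('h \<Rightarrow> 'h) \<Rightarrow> bool" where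
  "cond_F lam phi \<gamma> \<theta> K F \<longleftrightarrow> (let \<beta> = min 1 (1 + \<gamma>) in
     (\<forall>x y. norm (F x - F y) \<le> K * norm (x - y)) \<and>
     (\<exists>F' :: 'h \<Rightarrow> 'h \<Rightarrow>\<^sub>L 'h.
        (\<forall>y. (F has_derivative blinfun_apply (F' y)) (at y)) \<and>
        (\<forall>y. F' differentiable (at y)) \<and>
        (\<forall>y. coef phi y \<in> Hdot lam \<beta> \<longrightarrow>
          (\<exists>G :: (nat \<Rightarrow> real) \<Rightarrow> nat \<Rightarrow> real.
             (\<forall>z\<in>Hdot lam (-\<beta>). \<forall>z'\<in>Hdot lam (-\<beta>). \<forall>a b.
                G (\<lambda>j. a * z j + b * z' j) = (\<lambda>j. a * G z j + b * G z' j)) \<and>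
             (\<forall>x. G (coef phi x) = coef phi (blinfun_apply (F' y) x)) \<and>
             (\<forall>z\<in>Hdot lam (-\<beta>). Apow lam (-\<theta>/2) (G z) \<in> Hdot lam 0 \<and>
                hnorm lam 0 (Apow lam (-\<theta>/2) (G z))
                  \<le> K * (hnorm lam \<beta> (coef phi y) + 1) * hnorm lam (-\<beta>) z)))))"

definition cond_I ::
  "(nat \<Rightarrow> real) \<Rightarrow> (nat \<Rightarrow> 'h::real_inner) \<Rightarrow> 'w measure \<Rightarrow> (real \<Rightarrow> 'w measure) \<Rightarrow> real \<Rightarrow>
   ('w \<Rightarrow> 'h) \<Rightarrow> ('w \<Rightarrow> nat \<Rightarrow> real) \<Rightarrow> bool" where
  "cond_I lam phi M Filt \<gamma> u0 v0 \<longleftrightarrow>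
     u0 \<in> borel_measurable (Filt 0) \<and> (\<forall>j. (\<lambda>\<omega>. v0 \<omega> j) \<in> borel_measurable (Filt 0)) \<and>
     (\<forall>p\<ge>2. in_Lp lam M p (min 2 (\<gamma> + 1)) (\<lambda>\<omega>. coef phi (u0 \<omega>)) \<and> in_Lp lam M p \<gamma> v0)"


section \<open>Mild solution and numerical scheme\<close>

definition predictable :: "real \<Rightarrow> 'w measure \<Rightarrow> (real \<Rightarrow> 'w measure) \<Rightarrow> (real \<times> 'w) measure" where
  "predictable T M Filt = sigma ({0..T} \<times> space M)
     ({{s<..t} \<times> B | s t B. 0 \<le> s \<and> s \<le> t \<and> t \<le> T \<and> B \<in> sets (Filt s)} \<union>
      {{0} \<times> B | B. B \<in> sets (Filt 0)})"

text \<open>For negative \<open>\<gamma>\<close> the velocity \<open>v\<close> (like its initial value) does not take values in \<open>'h\<close>,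
  so it is given by coefficient sequences. The state space is \<open>'h\<close> times the space of order
  \<open>min \<gamma> 0\<close>; a mild solution is a predictable process with square integrable paths in it.\<close>

definition mild_solution ::
  "(nat \<Rightarrow> real) \<Rightarrow> (nat \<Rightarrow> 'h::{real_inner,banach,second_countable_topology}) \<Rightarrow> real \<Rightarrow> real \<Rightarrow>
   'w measure \<Rightarrow> (real \<Rightarrow> 'w measure) \<Rightarrow> real \<Rightarrow> ('h \<Rightarrow> 'h) \<Rightarrow> (real \<Rightarrow> 'h \<Rightarrow> 'w \<Rightarrow> real) \<Rightarrow> ('h \<Rightarrow> 'h) \<Rightarrow>
   ('w \<Rightarrow> 'h) \<Rightarrow> ('w \<Rightarrow> nat \<Rightarrow> real) \<Rightarrow> (real \<Rightarrow> 'w \<Rightarrow> 'h) \<Rightarrow> (real \<Rightarrow> 'w \<Rightarrow> nat \<Rightarrow> real) \<Rightarrow> bool" where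
  "mild_solution lam phi \<alpha> T M Filt \<gamma> Qh W F u0 v0 u v \<longleftrightarrow>
     (\<lambda>(t, \<omega>). u t \<omega>) \<in> borel_measurable (predictable T M Filt) \<and>
     (\<forall>j. (\<lambda>(t, \<omega>). v t \<omega> j) \<in> borel_measurable (predictable T M Filt)) \<and>
     (\<forall>t\<in>{0..T}. AE \<omega> in M. v t \<omega> \<in> Hdot lam (min \<gamma> 0)) \<and>
     (AE \<omega> in M. (\<integral>\<^sup>+s\<in>{0..T}.
        (ennreal ((norm (u s \<omega>))\<^sup>2) + l2sq (Apow lam (min \<gamma> 0 / 2) (v s \<omega>))) \<partial>lborel) < \<infinity>) \<and>
     (\<forall>t\<in>{0..T}. \<exists>(I2 :: 'w \<Rightarrow> 'h) (I4 :: 'w \<Rightarrow> nat \<Rightarrow> real).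
        is_stoch_integral lam phi M W Qh 0 0 t
          (\<lambda>s x. coef phi (Sop lam phi (s2 \<alpha> (t - s)) x)) (\<lambda>\<omega>. coef phi (I2 \<omega>)) \<and>
        is_stoch_integral lam phi M W Qh (min \<gamma> 0) 0 t
          (\<lambda>s x. coef phi (Sop lam phi (s4 \<alpha> (t - s)) x)) I4 \<and>
        (AE \<omega> in M.
           (\<forall>j. coef phi (u t \<omega>) j =
              Sseq lam (s1 \<alpha> t) (coef phi (u0 \<omega>)) j + Sseq lam (s2 \<alpha> t) (v0 \<omega>) j
              + coef phi (LBINT s:{0..t}. Sop lam phi (s2 \<alpha> (t - s)) (F (u s \<omega>))) j
              + coef phi (I2 \<omega>) j) \<and>
           (\<forall>j. v t \<omega> j =
              Sseq lam (s3 \<alpha> t) (coef phi (u0 \<omega>)) j + Sseq lam (s4 \<alpha> t) (v0 \<omega>) j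
              + coef phi (LBINT s:{0..t}. Sop lam phi (s4 \<alpha> (t - s)) (F (u s \<omega>))) j
              + I4 \<omega> j)))"

text \<open>\<open>n\<close> is the number of time steps, so that the step size is \<open>T / n\<close>.\<close>

definition exp_Euler_scheme ::
  "(nat \<Rightarrow> real) \<Rightarrow> (nat \<Rightarrow> 'h::real_inner) \<Rightarrow> real \<Rightarrow> real \<Rightarrow>
   'w measure \<Rightarrow> ('h \<Rightarrow> 'h) \<Rightarrow> (real \<Rightarrow> 'h \<Rightarrow> 'w \<Rightarrow> real) \<Rightarrow> ('h \<Rightarrow> 'h) \<Rightarrow>
   ('w \<Rightarrow> 'h) \<Rightarrow> ('w \<Rightarrow> nat \<Rightarrow> real) \<Rightarrow> nat \<Rightarrow> nat \<Rightarrow> (nat \<Rightarrow> 'w \<Rightarrow> 'h) \<Rightarrow> (nat \<Rightarrow> 'w \<Rightarrow> 'h) \<Rightarrow> bool" where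
  "exp_Euler_scheme lam phi \<alpha> T M Qh W F u0 v0 N n uN vN \<longleftrightarrow>
    (let k = T / real n; P = (\<lambda>x. PN phi N (coef phi x)); S = SopN lam phi N in
     (\<forall>m\<le>n. uN m \<in> borel_measurable M \<and> vN m \<in> borel_measurable M) \<and>
     (AE \<omega> in M. uN 0 \<omega> = P (u0 \<omega>) \<and> vN 0 \<omega> = PN phi N (v0 \<omega>)) \<and>
     (\<forall>m<n. \<exists>(I2 :: 'w \<Rightarrow> 'h) (I4 :: 'w \<Rightarrow> 'h).
        is_stoch_integral lam phi M W Qh 0 (real m * k) (real (Suc m) * k)
          (\<lambda>s x. coef phi (S (s2 \<alpha> (real (Suc m) * k - s)) (P x))) (\<lambda>\<omega>. coef phi (I2 \<omega>)) \<and>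
        is_stoch_integral lam phi M W Qh 0 (real m * k) (real (Suc m) * k)
          (\<lambda>s x. coef phi (S (s4 \<alpha> (real (Suc m) * k - s)) (P x))) (\<lambda>\<omega>. coef phi (I4 \<omega>)) \<and>
        (AE \<omega> in M.
           uN (Suc m) \<omega> = S (s1 \<alpha> k) (uN m \<omega>) + S (s2 \<alpha> k) (vN m \<omega>)
             + k *\<^sub>R S (s2 \<alpha> k) (P (F (uN m \<omega>))) + I2 \<omega> \<and>
           vN (Suc m) \<omega> = S (s3 \<alpha> k) (uN m \<omega>) + S (s4 \<alpha> k) (vN m \<omega>)
             + k *\<^sub>R S (s4 \<alpha> k) (P (F (uN m \<omega>))) + I4 \<omega>)))"

end

theory Submission
  imports Defs
begin

text \<open>
  In the basis \<open>phi\<close> the semigroup is diagonal, so every estimate is made for one coefficient and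
  then summed. As functions of time, \<open>s1\<close> and \<open>s2\<close> solve \<open>y'' + \<alpha> \<mu> y' + \<mu> y = 0\<close> with unit initial
  data, and the energy identity with \<open>s1 - s4 = \<alpha> \<mu> s2\<close> gives, uniformly in \<open>\<mu>\<close>, \<open>\<bar>s1\<bar>, \<bar>s4\<bar> \<le> 1\<close>,
  \<open>\<mu> \<bar>s2\<bar> \<le> 2/\<alpha>\<close> and \<open>\<bar>s4\<bar> \<le> exp (- \<alpha> \<mu> t) + C/\<mu>\<close>. With the Ito isometry for the noise and
  Gronwall's inequality these yield the spatial regularity of \<open>u\<close> and \<open>v\<close> and
  \<open>\<parallel>u(t) - u(s)\<parallel> \<le> C \<bar>t - s\<bar>\<close> to the power \<open>min (1 + \<gamma>) 1\<close> in mean square. Iterating the scheme with the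
  addition formulas of the semigroup, its noise is exactly that of the mild solution, so only the
  Lipschitz nonlinearity is discretised, and a discrete Gronwall argument bounds the error of \<open>u\<close>.
  For \<open>v\<close> the kernel \<open>s4\<close> is singular: \<open>\<bar>s4 x - s4 y\<bar> \<le> C (y - x)/y\<close>. Writing
  \<open>F(u(r)) = (F(u(r)) - F(u(t))) + F(u(t))\<close>, the first part gains a factor \<open>t - r\<close>, and the second part only
  sees a quadrature error, bounded by the step size times the total variation of \<open>s4\<close>; no
  logarithm is lost.
\<close>

section \<open>The scalar semigroup coefficients\<close>

text \<open>Three obstacles shape the proof. For negative \<gamma> the velocity has no values in the
  Hilbert space, the noise may be cylindrical, and W is linear in the test vector only almost
  surely. Operator valued integrals are therefore never manipulated as such: every coordinate is a
  scalar integral determined by its kernel, and two integrals are identified by comparing kernels.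
  Next, no moments in time of the solution or of the scheme are known beforehand; sums and
  expectations are taken in the extended nonnegative reals, and finiteness comes out of the Gronwall
  arguments. Finally, the exponent min (1 + \<gamma>) 1 arises from interpolation: the squared
  increment of the noise kernel over a time h is bounded by a multiple of h^2/\<mu> and by a
  multiple of 1/\<mu>^2, and the geometric mean with weight \<open>dl\<close> leaves the power
  \<open>dl - 2\<close> of \<mu>, which condition (N) absorbs exactly when \<open>dl\<close> is at
  most 1 + \<gamma>. Leftover powers of eigenvalues are bounded through the smallest one, whence the
  factors \<open>lam 0 powr _\<close> in the constants.\<close>

lemma roots_sum: "root_plus \<alpha> \<mu> + root_minus \<alpha> \<mu> = of_real (\<alpha> * \<mu>)"
  by (simp add: root_plus_def root_minus_def field_simps)

lemma roots_prod: "root_plus \<alpha> \<mu> * root_minus \<alpha> \<mu> = of_real \<mu>"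
  using roots_characteristic[of 0 \<alpha> \<mu>] by simp

text \<open>This and \<open>s1_eq\<close> eliminate \<open>s3\<close> and \<open>s1\<close>, so that
  only \<open>s2\<close> and \<open>s4\<close> remain, which form a closed first order system. The
  case split follows the two branches of the definitions, distinct roots and a double root.\<close>

lemma s3_eq: "s3 \<alpha> t \<mu> = - \<mu> * s2 \<alpha> t \<mu>"
proof (cases "root_plus \<alpha> \<mu> = root_minus \<alpha> \<mu>")
  case True
  then show ?thesis
    by (simp add: s3_def s2_def Let_def mult.assoc)
next
  case False
  define p m where "p = root_plus \<alpha> \<mu>" and "m = root_minus \<alpha> \<mu>"
  define q where "q = (exp (- of_real t * m) - exp (- of_real t * p)) / (p - m)"
  have "of_real \<mu> * (exp (- of_real t * p) - exp (- of_real t * m)) / (p - m) = of_real (-\<mu>) * q"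
    using False by (simp add: q_def p_def m_def field_simps)
  moreover have "Re (of_real (-\<mu>) * q) = - \<mu> * Re q" by simp
  ultimately have "Re (of_real \<mu> * (exp (- of_real t * p) - exp (- of_real t * m)) / (p - m)) = - \<mu> * Re q"
    by simp
  then show ?thesis using False
    by (simp add: s3_def s2_def Let_def q_def p_def m_def)
qed

lemma Re_of_real_mult: "Re (of_real c * z) = c * Re z"
  by simp

lemma s1_eq: "s1 \<alpha> t \<mu> = s4 \<alpha> t \<mu> + \<alpha> * \<mu> * s2 \<alpha> t \<mu>"
proof -
  define p m where "p = root_plus \<alpha> \<mu>" and "m = root_minus \<alpha> \<mu>"
  have pm: "of_real (\<alpha> * \<mu>) = p + m"
    using roots_sum[of \<alpha> \<mu>] by (simp add: p_def m_def)
  show ?thesis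
  proof (cases "p = m")
    case True
    define e where "e = exp (- of_real t * p)"
    have "(1 + of_real t * p) * e = (1 - of_real t * p) * e + of_real (\<alpha> * \<mu>) * (of_real t * e)"
      unfolding pm using True by (simp add: algebra_simps)
    then have "Re ((1 + of_real t * p) * e) = Re ((1 - of_real t * p) * e) + Re (of_real (\<alpha> * \<mu>) * (of_real t * e))"
      by (metis plus_complex.sel(1))
    then show ?thesis using True
      unfolding s1_def s2_def s4_def Let_def p_def[symmetric] m_def[symmetric] e_def
      by simp
  next
    case False
    define a b where "a = exp (- of_real t * m)" and "b = exp (- of_real t * p)"
    have "(p * a - m * b) / (p - m) = (p * b - m * a) / (p - m) + of_real (\<alpha> * \<mu>) * ((a - b) / (p - m))"
    proof -
      have "p * a - m * b = (p * b - m * a) + (p + m) * (a - b)" by (simp add: algebra_simps)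
      then show ?thesis unfolding pm by (simp add: add_divide_distrib)
    qed
    then have "Re ((p * a - m * b) / (p - m)) = Re ((p * b - m * a) / (p - m)) + \<alpha> * \<mu> * Re ((a - b) / (p - m))"
      by (simp only: plus_complex.sel(1) Re_of_real_mult)
    then show ?thesis using False
      unfolding s1_def s2_def s4_def Let_def p_def[symmetric] m_def[symmetric] a_def b_def
      by simp
  qed
qed

lemma s2_0 [simp]: "s2 \<alpha> 0 \<mu> = 0"
  by (simp add: s2_def Let_def)

lemma s4_0 [simp]: "s4 \<alpha> 0 \<mu> = 1"
  by (simp add: s4_def Let_def)

section \<open>The kernels as a first order system, and their addition formulas\<close>

text \<open>The kernels are real parts of complex exponentials restricted to the real axis;
  differentiating before taking the real part treats real and complex conjugate roots alike.\<close>

lemma has_real_derivative_Re_of_real: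
  assumes "(g has_field_derivative d) (at (of_real t))"
  shows "((\<lambda>x. Re (g (of_real x))) has_real_derivative Re d) (at t)"
  using has_vector_derivative_real_field[of g d t UNIV] assms
  by (auto simp: has_real_derivative_iff_has_vector_derivative o_def
      intro!: bounded_linear.has_vector_derivative[OF bounded_linear_Re])

lemma s2_deriv: "((\<lambda>t. s2 \<alpha> t \<mu>) has_real_derivative s4 \<alpha> t \<mu>) (at t)"
proof -
  define p m where "p = root_plus \<alpha> \<mu>" and "m = root_minus \<alpha> \<mu>"
  show ?thesis
  proof (cases "p = m")
    case True
    have "((\<lambda>z. z * exp (- z * p)) has_field_derivative (1 - of_real t * p) * exp (- of_real t * p)) (at (of_real t))"
      by (auto intro!: derivative_eq_intros simp: algebra_simps)
    from has_real_derivative_Re_of_real[OF this] show ?thesis using True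
      unfolding s2_def s4_def Let_def p_def[symmetric] m_def[symmetric] by simp
  next
    case False
    have "((\<lambda>z. (exp (- z * m) - exp (- z * p)) / (p - m)) has_field_derivative
        (p * exp (- of_real t * p) - m * exp (- of_real t * m)) / (p - m)) (at (of_real t))"
      by (rule DERIV_cdivide) (auto intro!: derivative_eq_intros simp: algebra_simps)
    from has_real_derivative_Re_of_real[OF this] show ?thesis using False
      unfolding s2_def s4_def Let_def p_def[symmetric] m_def[symmetric] by simp
  qed
qed

lemma s4_deriv:
  "((\<lambda>t. s4 \<alpha> t \<mu>) has_real_derivative - (\<alpha> * \<mu> * s4 \<alpha> t \<mu>) - \<mu> * s2 \<alpha> t \<mu>) (at t)"
proof -
  define p m where "p = root_plus \<alpha> \<mu>" and "m = root_minus \<alpha> \<mu>"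
  have pm: "of_real (\<alpha> * \<mu>) = p + m" "of_real \<mu> = p * m"
    using roots_sum[of \<alpha> \<mu>] roots_prod[of \<alpha> \<mu>] by (simp_all add: p_def m_def)
  have Re_lin: "Re (- (of_real a * x) - of_real c * y) = - (a * Re x) - c * Re y" for a c x y
    by simp
  show ?thesis
  proof (cases "p = m")
    case True
    define e where "e = exp (- of_real t * p)"
    have "((\<lambda>z. (1 - z * p) * exp (- z * p)) has_field_derivative
        - (of_real (\<alpha> * \<mu>) * ((1 - of_real t * p) * e)) - of_real \<mu> * (of_real t * e)) (at (of_real t))"
      unfolding pm e_def using True
      by (auto intro!: derivative_eq_intros simp: algebra_simps)
    from has_real_derivative_Re_of_real[OF this, unfolded Re_lin] show ?thesis using True
      unfolding s2_def s4_def Let_def p_def[symmetric] m_def[symmetric] e_def by simp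
  next
    case False
    define a b where "a = exp (- of_real t * m)" and "b = exp (- of_real t * p)"
    have "((\<lambda>z. (p * exp (- z * p) - m * exp (- z * m)) / (p - m)) has_field_derivative
        (m * m * a - p * p * b) / (p - m)) (at (of_real t))"
      unfolding a_def b_def by (rule DERIV_cdivide) (auto intro!: derivative_eq_intros simp: algebra_simps)
    moreover have "(m * m * a - p * p * b) / (p - m) =
        - (of_real (\<alpha> * \<mu>) * ((p * b - m * a) / (p - m))) - of_real \<mu> * ((a - b) / (p - m))"
    proof -
      have "m * m * a - p * p * b = - ((p + m) * (p * b - m * a)) - p * m * (a - b)"
        by (simp add: algebra_simps)
      then show ?thesis unfolding pm by (metis (no_types, lifting) diff_divide_distrib minus_divide_left times_divide_eq_right)
    qed
    ultimately have "((\<lambda>z. (p * exp (- z * p) - m * exp (- z * m)) / (p - m)) has_field_derivative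
       - (of_real (\<alpha> * \<mu>) * ((p * b - m * a) / (p - m))) - of_real \<mu> * ((a - b) / (p - m))) (at (of_real t))"
      by simp
    from has_real_derivative_Re_of_real[OF this, unfolded Re_lin] show ?thesis using False
      unfolding s2_def s4_def Let_def p_def[symmetric] m_def[symmetric] a_def b_def by simp
  qed
qed

lemma s2_deriv' [derivative_intros]:
  "(f has_real_derivative d) (at x) \<Longrightarrow>
   ((\<lambda>x. s2 \<alpha> (f x) \<mu>) has_real_derivative s4 \<alpha> (f x) \<mu> * d) (at x)"
  by (rule DERIV_chain2[OF s2_deriv])

lemma s4_deriv' [derivative_intros]:
  "(f has_real_derivative d) (at x) \<Longrightarrow>
   ((\<lambda>x. s4 \<alpha> (f x) \<mu>) has_real_derivative
      (- (\<alpha> * \<mu> * s4 \<alpha> (f x) \<mu>) - \<mu> * s2 \<alpha> (f x) \<mu>) * d) (at x)"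
  by (rule DERIV_chain2[OF s4_deriv])

text \<open>A consequence of the differential equations rather than of the explicit exponentials:
  evolving for the time \<open>x\<close> and then for \<open>t + s - x\<close> gives a result with
  zero derivative in \<open>x\<close>. Its values at \<open>0\<close> and at \<open>s\<close> are
  the two sides. The proof of \<open>s4_add\<close> is the same.\<close>

lemma s2_add: "s2 \<alpha> (t + s) \<mu> = s1 \<alpha> t \<mu> * s2 \<alpha> s \<mu> + s2 \<alpha> t \<mu> * s4 \<alpha> s \<mu>"
proof -
  define g where "g x = s1 \<alpha> (t + s - x) \<mu> * s2 \<alpha> x \<mu> + s2 \<alpha> (t + s - x) \<mu> * s4 \<alpha> x \<mu>" for x
  have "(g has_real_derivative 0) (at x)" for x
    unfolding g_def s1_eq by (auto intro!: derivative_eq_intros simp: algebra_simps)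
  then have "g 0 = g s" by (rule DERIV_isconst_all[rule_format]) 
  then show ?thesis by (simp add: g_def)
qed

lemma s4_add: "s4 \<alpha> (t + s) \<mu> = s3 \<alpha> t \<mu> * s2 \<alpha> s \<mu> + s4 \<alpha> t \<mu> * s4 \<alpha> s \<mu>"
proof -
  define g where "g x = s3 \<alpha> (t + s - x) \<mu> * s2 \<alpha> x \<mu> + s4 \<alpha> (t + s - x) \<mu> * s4 \<alpha> x \<mu>" for x
  have "(g has_real_derivative 0) (at x)" for x
    unfolding g_def s3_eq by (auto intro!: derivative_eq_intros simp: algebra_simps)
  then have "g 0 = g s" by (rule DERIV_isconst_all[rule_format])
  then show ?thesis by (simp add: g_def)
qed

lemma s1_add: "s1 \<alpha> (t + s) \<mu> = s1 \<alpha> t \<mu> * s1 \<alpha> s \<mu> + s2 \<alpha> t \<mu> * s3 \<alpha> s \<mu>"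
proof -
  have "s2 \<alpha> (t + s) \<mu> = s2 \<alpha> (s + t) \<mu>" "s4 \<alpha> (t + s) \<mu> = s4 \<alpha> (s + t) \<mu>"
    by (simp_all add: add.commute)
  then show ?thesis
    unfolding s1_eq s2_add s4_add s3_eq by (simp add: algebra_simps)
qed

lemma s3_add: "s3 \<alpha> (t + s) \<mu> = s3 \<alpha> t \<mu> * s1 \<alpha> s \<mu> + s4 \<alpha> t \<mu> * s3 \<alpha> s \<mu>"
  unfolding s3_eq s2_add s1_eq by (simp add: algebra_simps)

text \<open>The energies \<open>s4\<^sup>2 + \<mu> s2\<^sup>2\<close> and \<open>s1\<^sup>2 + \<mu> s2\<^sup>2\<close> do not increase.\<close>

lemma
  assumes "\<alpha> > 0" "\<mu> > 0" "t \<ge> 0"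
  shows s4_bound: "\<bar>s4 \<alpha> t \<mu>\<bar> \<le> 1" and s1_bound: "\<bar>s1 \<alpha> t \<mu>\<bar> \<le> 1"
proof -
  define g where "g x = (s4 \<alpha> x \<mu>)\<^sup>2 + \<mu> * (s2 \<alpha> x \<mu>)\<^sup>2" for x
  have "g t \<le> g 0"
    using assms(3)
  proof (rule DERIV_nonpos_imp_nonincreasing)
    fix x
    have "(g has_real_derivative - (2 * \<alpha> * \<mu>) * (s4 \<alpha> x \<mu>)\<^sup>2) (at x)"
      unfolding g_def by (auto intro!: derivative_eq_intros simp: algebra_simps power2_eq_square)
    moreover have "- (2 * \<alpha> * \<mu>) * (s4 \<alpha> x \<mu>)\<^sup>2 \<le> 0" using assms by simp
    ultimately show "\<exists>y. DERIV g x :> y \<and> y \<le> 0" by blast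
  qed
  then have "(s4 \<alpha> t \<mu>)\<^sup>2 + \<mu> * (s2 \<alpha> t \<mu>)\<^sup>2 \<le> 1" by (simp add: g_def)
  then have "(s4 \<alpha> t \<mu>)\<^sup>2 \<le> 1\<^sup>2"
    using mult_nonneg_nonneg[OF less_imp_le[OF assms(2)] zero_le_power2[of "s2 \<alpha> t \<mu>"]]
    unfolding one_power2 by linarith
  then show "\<bar>s4 \<alpha> t \<mu>\<bar> \<le> 1" by (metis abs_le_square_iff abs_one)
  define h where "h x = (s1 \<alpha> x \<mu>)\<^sup>2 + \<mu> * (s2 \<alpha> x \<mu>)\<^sup>2" for x
  have "h t \<le> h 0"
    using assms(3)
  proof (rule DERIV_nonpos_imp_nonincreasing)
    fix x
    have "(h has_real_derivative - (2 * \<alpha> * \<mu> * \<mu>) * (s2 \<alpha> x \<mu>)\<^sup>2) (at x)"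
      unfolding h_def s1_eq
      by (auto intro!: derivative_eq_intros simp: algebra_simps power2_eq_square)
    moreover have "- (2 * \<alpha> * \<mu> * \<mu>) * (s2 \<alpha> x \<mu>)\<^sup>2 \<le> 0" using assms by simp
    ultimately show "\<exists>y. DERIV h x :> y \<and> y \<le> 0" by blast
  qed
  then have "(s1 \<alpha> t \<mu>)\<^sup>2 + \<mu> * (s2 \<alpha> t \<mu>)\<^sup>2 \<le> 1" by (simp add: h_def s1_eq[of _ 0])
  then have "(s1 \<alpha> t \<mu>)\<^sup>2 \<le> 1\<^sup>2"
    using mult_nonneg_nonneg[OF less_imp_le[OF assms(2)] zero_le_power2[of "s2 \<alpha> t \<mu>"]]
    unfolding one_power2 by linarith
  then show "\<bar>s1 \<alpha> t \<mu>\<bar> \<le> 1" by (metis abs_le_square_iff abs_one)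
qed

section \<open>Bounds and increments of the kernels, uniform in the eigenvalue\<close>

text \<open>The energy alone would only give the order 1/2 in 1/\<mu>. The full order 1 comes from
  writing \<open>s2\<close> as a difference of two bounded kernels divided by \<alpha>
  \<mu>.\<close>

lemma s2_bound:
  assumes "\<alpha> > 0" "\<mu> > 0" "t \<ge> 0"
  shows "\<bar>s2 \<alpha> t \<mu>\<bar> \<le> 2 / \<alpha> / \<mu>"
proof -
  have "\<alpha> * \<mu> * s2 \<alpha> t \<mu> = s1 \<alpha> t \<mu> - s4 \<alpha> t \<mu>" by (simp add: s1_eq)
  then have "\<bar>\<alpha> * \<mu> * s2 \<alpha> t \<mu>\<bar> \<le> 2"
    using s4_bound[OF assms] s1_bound[OF assms] by linarith
  then show ?thesis using assms by (simp add: abs_mult field_simps)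
qed

lemma s3_bound:
  assumes "\<alpha> > 0" "\<mu> > 0" "t \<ge> 0"
  shows "\<bar>s3 \<alpha> t \<mu>\<bar> \<le> 2 / \<alpha>"
proof -
  have "\<mu> * \<bar>s2 \<alpha> t \<mu>\<bar> \<le> \<mu> * (2 / \<alpha> / \<mu>)"
    using s2_bound[OF assms] assms by (intro mult_left_mono) auto
  then show ?thesis using assms by (simp add: s3_eq abs_mult)
qed

text \<open>A mean value inequality with a varying bound: \<open>g - f\<close> and
  \<open>g + f\<close> are both nondecreasing. Every increment estimate below reduces to naming an
  antiderivative \<open>g\<close> of the bound on the derivative, so that no integrals are
  needed.\<close>

lemma derivative_bound_diff:
  fixes f :: "real \<Rightarrow> real"
  assumes "x \<le> y" and f: "\<And>z. (f has_real_derivative f' z) (at z)"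
    and g: "\<And>z. (g has_real_derivative g' z) (at z)"
    and le: "\<And>z. x \<le> z \<Longrightarrow> z \<le> y \<Longrightarrow> \<bar>f' z\<bar> \<le> g' z"
  shows "\<bar>f y - f x\<bar> \<le> g y - g x"
proof -
  have "g x - f x \<le> g y - f y"
  proof (rule DERIV_nonneg_imp_nondecreasing[OF assms(1), where f = "\<lambda>z. g z - f z"])
    fix z assume "x \<le> z" "z \<le> y"
    then have "0 \<le> g' z - f' z" using le[of z] by linarith
    then show "\<exists>d. ((\<lambda>z. g z - f z) has_real_derivative d) (at z) \<and> 0 \<le> d"
      using DERIV_diff[OF g f] by blast
  qed
  moreover have "g x + f x \<le> g y + f y"
  proof (rule DERIV_nonneg_imp_nondecreasing[OF assms(1), where f = "\<lambda>z. g z + f z"])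
    fix z assume "x \<le> z" "z \<le> y"
    then have "0 \<le> g' z + f' z" using le[of z] by linarith
    then show "\<exists>d. ((\<lambda>z. g z + f z) has_real_derivative d) (at z) \<and> 0 \<le> d"
      using DERIV_add[OF g f] by blast
  qed
  ultimately show ?thesis by linarith
qed

lemma s2_diff:
  assumes "\<alpha> > 0" "\<mu> > 0" "0 \<le> x" "x \<le> y"
  shows "\<bar>s2 \<alpha> y \<mu> - s2 \<alpha> x \<mu>\<bar> \<le> y - x"
  using assms s4_bound
  by (intro derivative_bound_diff[where f' = "\<lambda>t. s4 \<alpha> t \<mu>" and g = "\<lambda>x. x" and g' = "\<lambda>_. 1"] s2_deriv)
    auto

lemma s2_le: "\<alpha> > 0 \<Longrightarrow> \<mu> > 0 \<Longrightarrow> 0 \<le> x \<Longrightarrow> \<bar>s2 \<alpha> x \<mu>\<bar> \<le> x"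
  using s2_diff[of \<alpha> \<mu> 0 x] by simp

lemma s1_diff:
  assumes "\<alpha> > 0" "\<mu> > 0" "0 \<le> x" "x \<le> y"
  shows "\<bar>s1 \<alpha> y \<mu> - s1 \<alpha> x \<mu>\<bar> \<le> 2 / \<alpha> * (y - x)"
proof -
  have "\<bar>s1 \<alpha> y \<mu> - s1 \<alpha> x \<mu>\<bar> \<le> 2 / \<alpha> * y - 2 / \<alpha> * x"
  proof (rule derivative_bound_diff[where f' = "\<lambda>t. s3 \<alpha> t \<mu>" and g' = "\<lambda>_. 2 / \<alpha>"])
    show "((\<lambda>t. s1 \<alpha> t \<mu>) has_real_derivative s3 \<alpha> z \<mu>) (at z)" for z
      unfolding s1_eq s3_eq by (auto intro!: derivative_eq_intros)
    show "((*) (2 / \<alpha>) has_real_derivative 2 / \<alpha>) (at z)" for z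
      using DERIV_cmult_Id by blast
  qed (use assms s3_bound in auto)
  then show ?thesis by (simp add: right_diff_distrib)
qed

text \<open>Variation of constants: \<open>s4\<close> solves y' + \<alpha> \<mu> y = - \<mu>
  \<open>s2\<close>, whose right hand side is bounded by 2/\<alpha> because \<open>s2\<close> gains
  a full power of \<mu>. The integrating factor is \<open>exp (c * t)\<close>; the first term is the
  fast parabolic mode, the second the slow mode that does not decay with \<mu> t.\<close>

lemma s4_decay:
  assumes "\<alpha> > 0" "\<mu> > 0" "t \<ge> 0"
  shows "\<bar>s4 \<alpha> t \<mu>\<bar> \<le> exp (- (\<alpha> * \<mu> * t)) + 2 / \<alpha> / (\<alpha> * \<mu>)"
proof -
  define c where "c = \<alpha> * \<mu>"
  have c: "c > 0" using assms by (simp add: c_def)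
  have "\<bar>exp (c * t) * s4 \<alpha> t \<mu> - exp (c * 0) * s4 \<alpha> 0 \<mu>\<bar>
      \<le> 2 / \<alpha> / c * exp (c * t) - 2 / \<alpha> / c * exp (c * 0)"
  proof (rule derivative_bound_diff[where f' = "\<lambda>t. - \<mu> * s2 \<alpha> t \<mu> * exp (c * t)"
        and g' = "\<lambda>t. 2 / \<alpha> * exp (c * t)"])
    show "((\<lambda>a. exp (c * a) * s4 \<alpha> a \<mu>) has_real_derivative - \<mu> * s2 \<alpha> z \<mu> * exp (c * z)) (at z)" for z
      by (auto intro!: derivative_eq_intros simp: algebra_simps c_def)
    show "((\<lambda>a. 2 / \<alpha> / c * exp (c * a)) has_real_derivative 2 / \<alpha> * exp (c * z)) (at z)" for z
    proof -
      have "((\<lambda>a. 2 / \<alpha> / c * exp (c * a)) has_real_derivative 2 / \<alpha> / c * (exp (c * z) * c)) (at z)"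
        by (intro DERIV_cmult) (auto intro!: derivative_eq_intros)
      moreover have "2 / \<alpha> / c * (exp (c * z) * c) = 2 / \<alpha> * exp (c * z)"
        using c assms(1) by simp
      ultimately show ?thesis by (simp only:)
    qed
    show "\<bar>- \<mu> * s2 \<alpha> z \<mu> * exp (c * z)\<bar> \<le> 2 / \<alpha> * exp (c * z)" if "0 \<le> z" for z
      using mult_right_mono[OF s3_bound[OF assms(1,2) that], of "exp (c * z)"]
      by (simp add: s3_eq abs_mult)
  qed (use assms in auto)
  then have "\<bar>exp (c * t) * s4 \<alpha> t \<mu> - 1\<bar> \<le> 2 / \<alpha> / c * exp (c * t) - 2 / \<alpha> / c" by simp
  moreover have "0 \<le> 2 / \<alpha> / c" using c assms by simp
  ultimately have "\<bar>exp (c * t) * s4 \<alpha> t \<mu>\<bar> \<le> 1 + 2 / \<alpha> / c * exp (c * t)" by linarith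
  then have "exp (- (c * t)) * \<bar>exp (c * t) * s4 \<alpha> t \<mu>\<bar> \<le> exp (- (c * t)) * (1 + 2 / \<alpha> / c * exp (c * t))"
    by (intro mult_left_mono) auto
  moreover have "exp (- (c * t)) * \<bar>exp (c * t) * s4 \<alpha> t \<mu>\<bar> = \<bar>s4 \<alpha> t \<mu>\<bar>"
    by (simp add: abs_mult exp_minus)
  moreover have "exp (- (c * t)) * (1 + 2 / \<alpha> / c * exp (c * t)) = exp (- (c * t)) + 2 / \<alpha> / c"
    by (simp add: distrib_left exp_minus)
  ultimately show ?thesis unfolding c_def[symmetric] by linarith
qed

text \<open>The derivative is not bounded uniformly in \<mu>, but its large part has time integral
  at most 1. Hence the total variation of \<open>s4\<close> on a bounded interval is uniform in
  \<mu>, which is what the quadrature error of the velocity needs.\<close>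

lemma s4_deriv_bound:
  assumes "\<alpha> > 0" "\<mu> > 0" "t \<ge> 0"
  shows "\<bar>- (\<alpha> * \<mu> * s4 \<alpha> t \<mu>) - \<mu> * s2 \<alpha> t \<mu>\<bar> \<le> \<alpha> * \<mu> * exp (- (\<alpha> * \<mu> * t)) + 2 * (2 / \<alpha>)"
proof -
  have "\<alpha> * \<mu> * \<bar>s4 \<alpha> t \<mu>\<bar> \<le> \<alpha> * \<mu> * (exp (- (\<alpha> * \<mu> * t)) + 2 / \<alpha> / (\<alpha> * \<mu>))"
    using s4_decay[OF assms] assms by (intro mult_left_mono) auto
  also have "\<dots> = \<alpha> * \<mu> * exp (- (\<alpha> * \<mu> * t)) + 2 / \<alpha>"
    using assms by (simp add: distrib_left)
  finally have "\<bar>\<alpha> * \<mu> * s4 \<alpha> t \<mu>\<bar> \<le> \<alpha> * \<mu> * exp (- (\<alpha> * \<mu> * t)) + 2 / \<alpha>"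
    using assms by (simp add: abs_mult)
  moreover have "\<bar>\<mu> * s2 \<alpha> t \<mu>\<bar> \<le> 2 / \<alpha>" using s3_bound[OF assms] by (simp add: s3_eq)
  ultimately show ?thesis by linarith
qed

lemma s4_diff:
  assumes "\<alpha> > 0" "\<mu> > 0" "0 \<le> x" "x \<le> y"
  shows "\<bar>s4 \<alpha> y \<mu> - s4 \<alpha> x \<mu>\<bar> \<le> exp (- (\<alpha> * \<mu> * x)) - exp (- (\<alpha> * \<mu> * y)) + 2 * (2 / \<alpha>) * (y - x)"
proof -
  have "\<bar>s4 \<alpha> y \<mu> - s4 \<alpha> x \<mu>\<bar> \<le> (2 * (2 / \<alpha>) * y - exp (- (\<alpha> * \<mu> * y)))
     - (2 * (2 / \<alpha>) * x - exp (- (\<alpha> * \<mu> * x)))"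
    using assms s4_deriv_bound
    by (intro derivative_bound_diff[where f' = "\<lambda>t. - (\<alpha> * \<mu> * s4 \<alpha> t \<mu>) - \<mu> * s2 \<alpha> t \<mu>"
        and g' = "\<lambda>t. \<alpha> * \<mu> * exp (- (\<alpha> * \<mu> * t)) + 2 * (2 / \<alpha>)"] s4_deriv)
      (auto intro!: derivative_eq_intros)
  then show ?thesis unfolding right_diff_distrib by linarith
qed

lemma mult_exp_minus_le: "(x::real) \<ge> 0 \<Longrightarrow> x * exp (- x) \<le> 1"
proof -
  assume "x \<ge> 0"
  have "x \<le> exp x" using exp_ge_add_one_self[of x] by linarith
  then show ?thesis by (simp add: exp_minus field_simps)
qed

text \<open>The bound x exp (- x) \<le> 1 trades \<mu> for the reciprocal of a time and so makes the
  estimate uniform in \<mu>. Dividing by the later time \<open>y\<close> keeps it meaningful for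
  \<open>x = 0\<close>. If the increment is at least half of \<open>y\<close>, the trivial bound 2
  suffices; otherwise 1/x is at most 2/y.\<close>

lemma s4_diff':
  assumes "\<alpha> > 0" "\<mu> > 0" "0 \<le> x" "x \<le> y" "y > 0" "y \<le> T"
  shows "\<bar>s4 \<alpha> y \<mu> - s4 \<alpha> x \<mu>\<bar> \<le> (4 + 4 / \<alpha> * T) * (y - x) / y"
proof (cases "y - x \<ge> y / 2")
  case True
  have "\<bar>s4 \<alpha> y \<mu> - s4 \<alpha> x \<mu>\<bar> \<le> 2"
    using s4_bound[OF assms(1,2), of x] s4_bound[OF assms(1,2), of y] assms by linarith
  also have "\<dots> \<le> 4 * (y - x) / y" using True assms by (simp add: field_simps)
  also have "\<dots> \<le> (4 + 4 / \<alpha> * T) * (y - x) / y"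
    using assms by (intro divide_right_mono mult_right_mono) auto
  finally show ?thesis .
next
  case False
  then have x: "x \<ge> y / 2" "x > 0" using assms by auto
  define c where "c = \<alpha> * \<mu>"
  have c: "c > 0" using assms by (simp add: c_def)
  have "exp (- (c * x)) - exp (- (c * y)) = exp (- (c * x)) * (1 - exp (- (c * (y - x))))"
    by (simp add: algebra_simps flip: exp_add)
  also have "\<dots> \<le> exp (- (c * x)) * (c * (y - x))"
    using exp_ge_add_one_self[of "- (c * (y - x))"] by (intro mult_left_mono) auto
  also have "\<dots> = (c * x * exp (- (c * x))) * ((y - x) / x)" using x by simp
  also have "\<dots> \<le> 1 * ((y - x) / x)"
    using x c assms by (intro mult_right_mono mult_exp_minus_le) auto
  also have "1 * ((y - x) / x) = 2 * (y - x) / (2 * x)" using x by (simp add: field_simps)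
  also have "\<dots> \<le> 2 * (y - x) / y" using x assms by (intro divide_left_mono) auto
  also have "\<dots> \<le> 4 * (y - x) / y" using assms by (intro divide_right_mono mult_right_mono) auto
  finally have 1: "exp (- (c * x)) - exp (- (c * y)) \<le> 4 * (y - x) / y" .
  have "2 * (2 / \<alpha>) * (y - x) = (4 / \<alpha> * y) * (y - x) / y" using assms by simp
  also have "\<dots> \<le> (4 / \<alpha> * T) * (y - x) / y"
    using assms by (intro divide_right_mono mult_right_mono mult_left_mono) auto
  finally have "2 * (2 / \<alpha>) * (y - x) \<le> (4 / \<alpha> * T) * (y - x) / y" .
  then show ?thesis using 1 s4_diff[OF assms(1-4)]
    by (simp add: c_def add_divide_distrib distrib_right)
qed

text \<open>Smoothing of order two by the velocity kernel. It costs the factor 1/x, which is not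
  integrable at zero, so it is only used against quantities that vanish at the same rate.\<close>

lemma s4_singular:
  assumes "\<alpha> > 0" "\<mu> > 0" "0 \<le> x" "x \<le> T"
  shows "\<mu> * \<bar>s4 \<alpha> x \<mu>\<bar> * x \<le> (1 + 2 / \<alpha> * T) / \<alpha>"
proof -
  have "\<alpha> * \<mu> * x * \<bar>s4 \<alpha> x \<mu>\<bar> \<le> \<alpha> * \<mu> * x * (exp (- (\<alpha> * \<mu> * x)) + 2 / \<alpha> / (\<alpha> * \<mu>))"
    using s4_decay[OF assms(1-3)] assms by (intro mult_left_mono) auto
  also have "\<dots> = \<alpha> * \<mu> * x * exp (- (\<alpha> * \<mu> * x)) + 2 / \<alpha> * x"
    using assms by (simp add: field_simps)
  also have "\<dots> \<le> 1 + 2 / \<alpha> * T"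
    using assms by (intro add_mono mult_exp_minus_le mult_left_mono) auto
  finally show ?thesis using assms by (simp add: field_simps)
qed

section \<open>Expansion in eigenvectors\<close>

locale eigen =
  fixes lam :: "nat \<Rightarrow> real" and phi :: "nat \<Rightarrow> 'h::{real_inner,banach,second_countable_topology}"
  assumes lam0: "0 < lam 0" and incseq_lam: "incseq lam"
    and orth: "phi i \<bullet> phi j = (if i = j then 1 else 0)"
    and dense: "closure (span (range phi)) = UNIV"
begin

lemma lam_ge: "lam 0 \<le> lam j"
  using incseq_lam by (simp add: incseq_def)

lemma lam_pos: "0 < lam j"
  using lam0 lam_ge[of j] by linarith

text \<open>The embedding of the scale of spaces: eigenvalues are bounded below by
  \<open>lam 0\<close>, so a surplus of order costs a fixed factor. All the powers of
  \<open>lam 0\<close> in the later constants come from here.\<close>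

lemma lam_powr_le:
  assumes "a \<le> b" shows "lam j powr a \<le> lam 0 powr (a - b) * lam j powr b"
proof -
  have "lam j powr a = lam j powr (a - b) * lam j powr b"
    by (simp flip: powr_add)
  also have "lam j powr (a - b) \<le> lam 0 powr (a - b)"
    using assms lam0 lam_ge[of j] by (intro powr_mono2') auto
  finally show ?thesis by (simp add: mult_right_mono)
qed

lemma norm_phi [simp]: "norm (phi j) = 1"
  using orth[of j j] by (simp add: norm_eq_1)

definition proj :: "nat \<Rightarrow> 'h \<Rightarrow> 'h" where
  "proj n x = (\<Sum>k<n. (x \<bullet> phi k) *\<^sub>R phi k)"

lemma inner_sum_phi:
  "(\<Sum>k<n. a k *\<^sub>R phi k) \<bullet> phi j = (if j < n then a j else 0)"
proof -
  have "(\<Sum>k<n. a k *\<^sub>R phi k) \<bullet> phi j = (\<Sum>k<n. if k = j then a k else 0)"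
    by (simp add: inner_sum_left orth if_distrib cong: if_cong)
  then show ?thesis by simp
qed

lemma norm_sum_phi: "finite A \<Longrightarrow> (norm (\<Sum>k\<in>A. a k *\<^sub>R phi k))\<^sup>2 = (\<Sum>k\<in>A. (a k)\<^sup>2)"
proof -
  assume A: "finite A"
  have "(norm (\<Sum>k\<in>A. a k *\<^sub>R phi k))\<^sup>2 = (\<Sum>i\<in>A. \<Sum>k\<in>A. a i * a k * (phi k \<bullet> phi i))"
    by (simp add: power2_norm_eq_inner inner_sum_left inner_sum_right sum_distrib_left mult.assoc)
  also have "\<dots> = (\<Sum>i\<in>A. \<Sum>k\<in>A. if i = k then (a k)\<^sup>2 else 0)"
    by (intro sum.cong) (auto simp: orth power2_eq_square)
  also have "\<dots> = (\<Sum>k\<in>A. (a k)\<^sup>2)" using A by simp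
  finally show ?thesis .
qed

lemma norm_proj_le: "norm (proj n x) \<le> norm x"
proof -
  have "(norm (proj n x))\<^sup>2 = (\<Sum>k<n. (x \<bullet> phi k)\<^sup>2)"
    unfolding proj_def by (rule norm_sum_phi) simp
  also have "\<dots> = x \<bullet> proj n x"
    by (simp add: proj_def inner_sum_right power2_eq_square)
  also have "\<dots> \<le> norm x * norm (proj n x)" by (rule norm_cauchy_schwarz)
  finally show ?thesis
    by (metis mult_le_cancel_right norm_ge_zero not_le power2_eq_square order.trans)
qed

lemma proj_diff: "proj n (x - y) = proj n x - proj n y"
  by (simp add: proj_def inner_diff_left scaleR_diff_left sum_subtractf)

text \<open>Finite combinations of the eigenvectors are eventually fixed by \<open>proj\<close>, and
  the projections are contractions, so density of the span carries the convergence to every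
  vector.\<close>

lemma proj_tendsto: "(\<lambda>n. proj n x) \<longlonglongrightarrow> x"
proof (rule LIMSEQ_I)
  fix r :: real assume "r > 0"
  have ev: "\<exists>n0. \<forall>n\<ge>n0. proj n y = y" if "y \<in> span (range phi)" for y
    using that
  proof (induction rule: span_induct_alt)
    case base
    show ?case by (simp add: proj_def)
  next
    case (step c x y)
    then obtain n0 j where n0: "\<forall>n\<ge>n0. proj n y = y" and j: "x = phi j" by auto
    have "proj n (c *\<^sub>R x + y) = c *\<^sub>R x + y" if "n \<ge> max n0 (Suc j)" for n
    proof -
      have "proj n (c *\<^sub>R x + y) = c *\<^sub>R proj n x + proj n y"
        by (simp add: proj_def inner_add_left scaleR_add_left sum.distrib scaleR_sum_right)
      moreover have "proj n x = (\<Sum>k<n. if k = j then phi k else 0)"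
        unfolding proj_def j orth by (intro sum.cong) auto
      ultimately show ?thesis using n0 that j by simp
    qed
    then show ?case by blast
  qed
  obtain y where y: "y \<in> span (range phi)" "dist y x < r / 2"
    using dense \<open>r > 0\<close> by (metis UNIV_I closure_approachable half_gt_zero)
  obtain n0 where n0: "\<forall>n\<ge>n0. proj n y = y" using ev[OF y(1)] by blast
  have "norm (proj n x - x) < r" if "n \<ge> n0" for n
  proof -
    have "proj n x - x = proj n (x - y) - (x - y)" using n0 that by (simp add: proj_diff)
    then have "norm (proj n x - x) \<le> norm (proj n (x - y)) + norm (x - y)"
      by (metis norm_triangle_ineq4)
    also have "\<dots> \<le> norm (x - y) + norm (x - y)" using norm_proj_le by simp
    finally show ?thesis using y(2) by (simp add: dist_norm norm_minus_commute)
  qed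
  then show "\<exists>no. \<forall>n\<ge>no. norm (proj n x - x) < r" by blast
qed

lemma parseval: "(\<lambda>k. (x \<bullet> phi k)\<^sup>2) sums (norm x)\<^sup>2"
proof -
  have "(\<lambda>n. (norm (proj n x))\<^sup>2) \<longlonglongrightarrow> (norm x)\<^sup>2"
    by (intro tendsto_intros proj_tendsto)
  then show ?thesis unfolding sums_def proj_def by (simp add: norm_sum_phi)
qed

lemma l2sq_coef: "l2sq (coef phi x) = ennreal ((norm x)\<^sup>2)"
  unfolding l2sq_def coef_def
  by (rule suminf_ennreal_eq[OF _ parseval]) simp

lemma coef_sums: "(\<lambda>j. (x \<bullet> phi j) *\<^sub>R phi j) sums x"
  using proj_tendsto[of x] by (simp add: sums_def proj_def)

lemma summable_phi:
  assumes "summable (\<lambda>j. (a j)\<^sup>2)" shows "summable (\<lambda>j. a j *\<^sub>R phi j)"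
  unfolding summable_Cauchy
proof (intro allI impI)
  fix e :: real assume e: "e > 0"
  then obtain N where N: "\<And>m n. m \<ge> N \<Longrightarrow> norm (\<Sum>j=m..<n. (a j)\<^sup>2) < e\<^sup>2"
    using assms unfolding summable_Cauchy by (metis zero_less_power)
  have "norm (\<Sum>j=m..<n. a j *\<^sub>R phi j) < e" if "m \<ge> N" for m n
  proof -
    have "(norm (\<Sum>j=m..<n. a j *\<^sub>R phi j))\<^sup>2 < e\<^sup>2"
      using N[OF that, of n] by (simp add: norm_sum_phi)
    then show ?thesis using e by (simp add: power2_less_imp_less)
  qed
  then show "\<exists>N. \<forall>m\<ge>N. \<forall>n. norm (\<Sum>j=m..<n. a j *\<^sub>R phi j) < e" by blast
qed

lemma Sop_summable:
  assumes "\<And>j. \<bar>c (lam j)\<bar> \<le> B"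
  shows "summable (\<lambda>j. (c (lam j) * (x \<bullet> phi j)) *\<^sub>R phi j)"
proof (rule summable_phi, rule summable_comparison_test)
  show "summable (\<lambda>j. B\<^sup>2 * (x \<bullet> phi j)\<^sup>2)"
    using parseval[of x] by (intro summable_mult) (auto simp: sums_iff)
  have "(c (lam j))\<^sup>2 \<le> B\<^sup>2" for j
    using assms[of j] by (metis abs_ge_zero power2_abs power_mono)
  then show "\<exists>N. \<forall>n\<ge>N. norm ((c (lam n) * (x \<bullet> phi n))\<^sup>2) \<le> B\<^sup>2 * (x \<bullet> phi n)\<^sup>2"
    by (auto simp: power_mult_distrib intro!: mult_right_mono)
qed

lemma coef_Sop:
  assumes "\<And>j. \<bar>c (lam j)\<bar> \<le> B"
  shows "Sop lam phi c x \<bullet> phi j = c (lam j) * (x \<bullet> phi j)"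
proof -
  have "(\<lambda>i. ((c (lam i) * (x \<bullet> phi i)) *\<^sub>R phi i) \<bullet> phi j) sums (Sop lam phi c x \<bullet> phi j)"
    unfolding Sop_def
    by (intro bounded_linear.sums[OF bounded_linear_inner_left] summable_sums Sop_summable[of c B] assms)
  moreover have "(\<lambda>i. ((c (lam i) * (x \<bullet> phi i)) *\<^sub>R phi i) \<bullet> phi j)
      = (\<lambda>i. if i = j then c (lam i) * (x \<bullet> phi i) else 0)"
    by (rule ext) (simp add: orth)
  ultimately have "(\<lambda>i. if i = j then c (lam i) * (x \<bullet> phi i) else 0) sums (Sop lam phi c x \<bullet> phi j)"
    by simp
  from sums_unique2[OF this sums_single] show ?thesis .
qed

lemma coef_SopN: "SopN lam phi N c x \<bullet> phi j = (if j < N then c (lam j) * (x \<bullet> phi j) else 0)"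
  unfolding SopN_def by (rule inner_sum_phi)

lemma coef_PN: "PN phi N a \<bullet> phi j = (if j < N then a j else 0)"
  unfolding PN_def by (rule inner_sum_phi)

end

section \<open>Wiener integrals of deterministic functions\<close>

lemma real_sq_add_le: "((a::real) + b)\<^sup>2 \<le> 2 * a\<^sup>2 + 2 * b\<^sup>2"
  using zero_le_power2[of "a - b"] by (simp add: power2_sum power2_diff)

lemma norm_sq_add_le: "(norm (a + b))\<^sup>2 \<le> 2 * (norm a)\<^sup>2 + 2 * (norm b)\<^sup>2"
  using power_mono[OF norm_triangle_ineq[of a b] norm_ge_zero, of 2] real_sq_add_le[of "norm a" "norm b"]
  by linarith

lemma nn_integral_sq_add:
  assumes [measurable]: "f \<in> borel_measurable M" "g \<in> borel_measurable M"
    and le: "\<And>x. x \<in> space M \<Longrightarrow> (h x)\<^sup>2 \<le> 2 * (f x)\<^sup>2 + 2 * ((g x)::real)\<^sup>2"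
  shows "(\<integral>\<^sup>+x. ennreal ((h x)\<^sup>2) \<partial>M)
    \<le> 2 * (\<integral>\<^sup>+x. ennreal ((f x)\<^sup>2) \<partial>M) + 2 * (\<integral>\<^sup>+x. ennreal ((g x)\<^sup>2) \<partial>M)"
proof -
  have "(\<integral>\<^sup>+x. ennreal ((h x)\<^sup>2) \<partial>M)
      \<le> (\<integral>\<^sup>+x. 2 * ennreal ((f x)\<^sup>2) + 2 * ennreal ((g x)\<^sup>2) \<partial>M)"
  proof (rule nn_integral_mono)
    fix x assume "x \<in> space M"
    have "2 * ennreal ((f x)\<^sup>2) + 2 * ennreal ((g x)\<^sup>2) = ennreal (2 * (f x)\<^sup>2 + 2 * (g x)\<^sup>2)"
      by (simp add: ennreal_plus ennreal_mult)
    then show "ennreal ((h x)\<^sup>2) \<le> 2 * ennreal ((f x)\<^sup>2) + 2 * ennreal ((g x)\<^sup>2)"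
      using le[OF \<open>x \<in> space M\<close>] by (simp only: ennreal_leI)
  qed
  also have "\<dots> = 2 * (\<integral>\<^sup>+x. ennreal ((f x)\<^sup>2) \<partial>M) + 2 * (\<integral>\<^sup>+x. ennreal ((g x)\<^sup>2) \<partial>M)"
    by (subst nn_integral_add) (auto simp: nn_integral_cmult)
  finally show ?thesis .
qed

definition valid_elems :: "real \<Rightarrow> (real \<times> real \<times> 'h) list \<Rightarrow> bool" where
  "valid_elems T es \<longleftrightarrow> (\<forall>(c, d, h)\<in>set es. 0 \<le> c \<and> c \<le> d \<and> d \<le> T)"

text \<open>The vector that represents a functional valued elementary integrand. A coordinate of a
  rank one operator is a multiple of the pairing with \<open>h\<close>, so a triple without the
  target vector is enough; the intervals in a list may overlap.\<close>

definition step :: "(real \<times> real \<times> 'h::real_inner) list \<Rightarrow> real \<Rightarrow> 'h" where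
  "step es s = (\<Sum>(c, d, h)\<leftarrow>es. indicator {c<..d} s *\<^sub>R h)"

definition sint :: "(real \<Rightarrow> 'h \<Rightarrow> 'w \<Rightarrow> real) \<Rightarrow> (real \<times> real \<times> 'h) list \<Rightarrow> 'w \<Rightarrow> real" where
  "sint W es \<omega> = (\<Sum>(c, d, h)\<leftarrow>es. W d h \<omega> - W c h \<omega>)"

lemma step_simps [simp]:
  "step [] s = 0" "step ((c, d, h) # es) s = indicator {c<..d} s *\<^sub>R h + step es s"
  "step (es @ fs) s = step es s + step fs s"
  by (simp_all add: step_def)

lemma sint_simps [simp]:
  "sint W [] \<omega> = 0" "sint W ((c, d, h) # es) \<omega> = (W d h \<omega> - W c h \<omega>) + sint W es \<omega>"
  "sint W (es @ fs) \<omega> = sint W es \<omega> + sint W fs \<omega>"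
  by (simp_all add: sint_def)

lemma valid_simps [simp]:
  "valid_elems T []"
  "valid_elems T ((c, d, h) # es) \<longleftrightarrow> 0 \<le> c \<and> c \<le> d \<and> d \<le> T \<and> valid_elems T es"
  "valid_elems T (es @ fs) \<longleftrightarrow> valid_elems T es \<and> valid_elems T fs"
    apply (simp add: valid_elems_def)
   apply (auto simp: valid_elems_def)[1]
  apply (simp only: valid_elems_def set_append ball_Un)
  done

definition scale_elems :: "real \<Rightarrow> (real \<times> real \<times> 'h::real_vector) list \<Rightarrow> (real \<times> real \<times> 'h) list" where
  "scale_elems a es = map (\<lambda>(c, d, h). (c, d, a *\<^sub>R h)) es"

lemma valid_scale [simp]: "valid_elems T (scale_elems a es) \<longleftrightarrow> valid_elems T es"
  by (auto simp: valid_elems_def scale_elems_def)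

lemma step_scale: "step (scale_elems a es) s = a *\<^sub>R step es s"
  unfolding step_def scale_elems_def by (induction es) (auto simp: scaleR_add_right)

lemma step_measurable [measurable]:
  fixes es :: "(real \<times> real \<times> 'h::{real_inner,second_countable_topology}) list"
  shows "step es \<in> borel_measurable (borel :: real measure)"
proof (induction es)
  case Nil
  have "step [] = (\<lambda>s. 0)" by (rule ext) simp
  then show ?case by simp
next
  case (Cons e es)
  obtain c d h where e: "e = (c, d, h)" by (cases e)
  have "step (e # es) = (\<lambda>s. indicator {c<..d} s *\<^sub>R h + step es s)" by (rule ext) (simp add: e)
  then show ?case using Cons by simp
qed

section \<open>Covariance of the Wiener process and the isometry for elementary integrands\<close>

locale wiener = eigen lam phi + prob_space M
  for lam :: "nat \<Rightarrow> real" and phi :: "nat \<Rightarrow> 'h::{real_inner,banach,second_countable_topology}"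
    and M :: "'w measure" +
  fixes T :: real and Filt :: "real \<Rightarrow> 'w measure"
    and Q Qh :: "'h \<Rightarrow> 'h" and W :: "real \<Rightarrow> 'h \<Rightarrow> 'w \<Rightarrow> real"
  assumes T: "T > 0" and filtration: "normal_filtration T M Filt"
    and covQ: "covariance_operator Q" and sqrtQ: "is_sqrt_of Qh Q"
    and QW: "Q_Wiener T M Filt Q W"
begin

lemma subalg: "t \<in> {0..T} \<Longrightarrow> subalgebra M (Filt t)"
  using filtration by (auto simp: normal_filtration_def)

lemma W_adapted: "t \<in> {0..T} \<Longrightarrow> W t h \<in> borel_measurable (Filt t)"
  using QW by (auto simp: Q_Wiener_def)

lemma W_measurable [measurable (raw)]: "t \<in> {0..T} \<Longrightarrow> W t h \<in> borel_measurable M"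
  using W_adapted subalg measurable_from_subalg by blast

lemma W_lin: "t \<in> {0..T} \<Longrightarrow> AE \<omega> in M. W t (a *\<^sub>R g + b *\<^sub>R h) \<omega> = a * W t g \<omega> + b * W t h \<omega>"
  using QW by (auto simp: Q_Wiener_def)

lemma W_incr:
  assumes "0 \<le> s" "s < t" "t \<le> T"
  shows "indep_set (sets (Filt s)) {(\<lambda>\<omega>. W t h \<omega> - W s h \<omega>) -` B \<inter> space M | B. B \<in> sets borel}"
    and "Q h \<bullet> h = 0 \<Longrightarrow> AE \<omega> in M. W t h \<omega> - W s h \<omega> = 0"
    and "Q h \<bullet> h \<noteq> 0 \<Longrightarrow> distributed M lborel (\<lambda>\<omega>. W t h \<omega> - W s h \<omega>)
      (normal_density 0 (sqrt ((t - s) * (Q h \<bullet> h))))"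
proof -
  have "indep_set (sets (Filt s)) {(\<lambda>\<omega>. W t h \<omega> - W s h \<omega>) -` B \<inter> space M | B. B \<in> sets borel} \<and>
        (if Q h \<bullet> h = 0 then AE \<omega> in M. W t h \<omega> - W s h \<omega> = 0
         else distributed M lborel (\<lambda>\<omega>. W t h \<omega> - W s h \<omega>)
                (normal_density 0 (sqrt ((t - s) * (Q h \<bullet> h)))))"
    using QW assms unfolding Q_Wiener_def by blast
  then show "indep_set (sets (Filt s)) {(\<lambda>\<omega>. W t h \<omega> - W s h \<omega>) -` B \<inter> space M | B. B \<in> sets borel}"
    and "Q h \<bullet> h = 0 \<Longrightarrow> AE \<omega> in M. W t h \<omega> - W s h \<omega> = 0"
    and "Q h \<bullet> h \<noteq> 0 \<Longrightarrow> distributed M lborel (\<lambda>\<omega>. W t h \<omega> - W s h \<omega>)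
      (normal_density 0 (sqrt ((t - s) * (Q h \<bullet> h))))"
    by (metis (mono_tags, lifting))+
qed

lemma W_0: "AE \<omega> in M. W 0 h \<omega> = 0"
  using QW by (auto simp: Q_Wiener_def)

lemma Q_lin: "bounded_linear Q" and Q_sym: "Q g \<bullet> h = g \<bullet> Q h"
  using covQ by (auto simp: covariance_operator_def)

lemma Qh_lin: "bounded_linear Qh" and Qh_sym: "Qh g \<bullet> h = g \<bullet> Qh h" and Qh_Qh: "Qh (Qh h) = Q h"
  using sqrtQ by (auto simp: is_sqrt_of_def covariance_operator_def)

lemma Q_inner: "Q g \<bullet> h = Qh g \<bullet> Qh h"
  by (simp add: Qh_sym flip: Qh_Qh)

lemma Qh_measurable [measurable]: "Qh \<in> borel_measurable borel"
  using Qh_lin by (intro borel_measurable_continuous_onI linear_continuous_on)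

lemma W_incr_moments:
  assumes "0 \<le> s" "s < t" "t \<le> T"
  shows "integrable M (\<lambda>\<omega>. (W t h \<omega> - W s h \<omega>)\<^sup>2)"
    and "expectation (\<lambda>\<omega>. W t h \<omega> - W s h \<omega>) = 0"
    and "expectation (\<lambda>\<omega>. (W t h \<omega> - W s h \<omega>)\<^sup>2) = (t - s) * (Q h \<bullet> h)"
proof -
  define X where "X \<omega> = W t h \<omega> - W s h \<omega>" for \<omega>
  have mt: "t \<in> {0..T}" "s \<in> {0..T}" using assms by auto
  note [measurable] = W_measurable[OF mt(1)] W_measurable[OF mt(2)]
  have X[measurable]: "X \<in> borel_measurable M" unfolding X_def by simp
  have *: "integrable M (\<lambda>\<omega>. (X \<omega>)\<^sup>2) \<and> expectation X = 0
      \<and> expectation (\<lambda>\<omega>. (X \<omega>)\<^sup>2) = (t - s) * (Q h \<bullet> h)"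
  \<comment> \<open>A Gaussian of variance zero has no density, so the degenerate direction is a
    separate clause in the definition of the process.\<close>
  proof (cases "Q h \<bullet> h = 0")
    case True
    then have "AE \<omega> in M. X \<omega> = 0"
      unfolding X_def by (rule W_incr(2)[OF assms])
    then have 1: "AE \<omega> in M. (X \<omega>)\<^sup>2 = 0" and 2: "AE \<omega> in M. X \<omega> = 0" by auto
    have "integrable M (\<lambda>\<omega>. (X \<omega>)\<^sup>2)"
      by (subst integrable_cong_AE[OF _ _ 1]) auto
    moreover have "expectation X = 0"
      by (subst integral_cong_AE[OF _ _ 2]) auto
    moreover have "expectation (\<lambda>\<omega>. (X \<omega>)\<^sup>2) = 0"
      by (subst integral_cong_AE[OF _ _ 1]) auto
    ultimately show ?thesis using True by simp
  next
    case False
    define \<sigma> where "\<sigma> = sqrt ((t - s) * (Q h \<bullet> h))"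
    have D: "distributed M lborel X (normal_density 0 \<sigma>)"
      unfolding X_def \<sigma>_def by (rule W_incr(3)[OF assms False])
    have Qpos: "0 < Q h \<bullet> h"
      using covQ False by (auto simp: covariance_operator_def less_le)
    then have \<sigma>: "\<sigma> > 0" using assms by (simp add: \<sigma>_def)
    have "integrable lborel (\<lambda>x. normal_density 0 \<sigma> x * (x - 0) ^ 2)"
      by (rule integrable_normal_moment[OF \<sigma>])
    then have "integrable M (\<lambda>\<omega>. (X \<omega>)\<^sup>2)"
      using distributed_integrable[OF D, of "\<lambda>x. x\<^sup>2"] by simp
    moreover have E: "expectation X = 0" by (rule normal_distributed_expectation[OF \<sigma> D])
    moreover have "expectation (\<lambda>\<omega>. (X \<omega>)\<^sup>2) = \<sigma>\<^sup>2"
      using normal_distributed_variance[OF \<sigma> D] E by simp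
    moreover have "\<sigma>\<^sup>2 = (t - s) * (Q h \<bullet> h)" using Qpos assms by (simp add: \<sigma>_def)
    ultimately show ?thesis by simp
  qed
  then show "integrable M (\<lambda>\<omega>. (W t h \<omega> - W s h \<omega>)\<^sup>2)"
    and "expectation (\<lambda>\<omega>. W t h \<omega> - W s h \<omega>) = 0"
    and "expectation (\<lambda>\<omega>. (W t h \<omega> - W s h \<omega>)\<^sup>2) = (t - s) * (Q h \<bullet> h)"
    unfolding X_def by auto
qed

lemma W_moments:
  assumes t: "t \<in> {0..T}"
  shows "integrable M (\<lambda>\<omega>. (W t h \<omega>)\<^sup>2)"
    and "expectation (\<lambda>\<omega>. (W t h \<omega>)\<^sup>2) = t * (Q h \<bullet> h)"
proof -
  have mt: "0 \<in> {0..T}" using T by auto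
  note [measurable] = W_measurable[OF mt(1)] W_measurable[OF t]
  have "integrable M (\<lambda>\<omega>. (W t h \<omega>)\<^sup>2) \<and> expectation (\<lambda>\<omega>. (W t h \<omega>)\<^sup>2) = t * (Q h \<bullet> h)"
  proof (cases "t = 0")
    case True
    have 1: "AE \<omega> in M. (W t h \<omega>)\<^sup>2 = 0" using W_0[of h] True by auto
    have "integrable M (\<lambda>\<omega>. (W t h \<omega>)\<^sup>2)"
      by (subst integrable_cong_AE[OF _ _ 1]) auto
    moreover have "expectation (\<lambda>\<omega>. (W t h \<omega>)\<^sup>2) = 0"
      by (subst integral_cong_AE[OF _ _ 1]) auto
    ultimately show ?thesis using True by simp
  next
    case False
    then have t': "0 \<le> (0::real)" "0 < t" "t \<le> T" using t by auto
    have 1: "AE \<omega> in M. (W t h \<omega>)\<^sup>2 = (W t h \<omega> - W 0 h \<omega>)\<^sup>2" using W_0[of h] by auto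
    have "integrable M (\<lambda>\<omega>. (W t h \<omega>)\<^sup>2)"
      by (subst integrable_cong_AE[OF _ _ 1]) (use W_incr_moments[OF t'] in auto)
    moreover have "expectation (\<lambda>\<omega>. (W t h \<omega>)\<^sup>2) = t * (Q h \<bullet> h)"
      by (subst integral_cong_AE[OF _ _ 1]) (use W_incr_moments[OF t'] in auto)
    ultimately show ?thesis by simp
  qed
  then show "integrable M (\<lambda>\<omega>. (W t h \<omega>)\<^sup>2)"
    and "expectation (\<lambda>\<omega>. (W t h \<omega>)\<^sup>2) = t * (Q h \<bullet> h)" by auto
qed

lemma L2_mult_integrable:
  fixes X Y :: "'w \<Rightarrow> real"
  assumes [measurable]: "X \<in> borel_measurable M" "Y \<in> borel_measurable M"
    and "integrable M (\<lambda>\<omega>. (X \<omega>)\<^sup>2)" "integrable M (\<lambda>\<omega>. (Y \<omega>)\<^sup>2)"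
  shows "integrable M (\<lambda>\<omega>. X \<omega> * Y \<omega>)"
proof (rule Bochner_Integration.integrable_bound)
  show "integrable M (\<lambda>\<omega>. (X \<omega>)\<^sup>2 + (Y \<omega>)\<^sup>2)" using assms by simp
  show "AE \<omega> in M. norm (X \<omega> * Y \<omega>) \<le> norm ((X \<omega>)\<^sup>2 + (Y \<omega>)\<^sup>2)"
  proof (rule AE_I2)
    fix \<omega>
    have "2 * (\<bar>X \<omega>\<bar> * \<bar>Y \<omega>\<bar>) \<le> (X \<omega>)\<^sup>2 + (Y \<omega>)\<^sup>2"
      using sum_squares_bound[of "\<bar>X \<omega>\<bar>" "\<bar>Y \<omega>\<bar>"] by (simp add: mult.assoc)
    moreover have "0 \<le> \<bar>X \<omega>\<bar> * \<bar>Y \<omega>\<bar>" by simp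
    ultimately have "\<bar>X \<omega>\<bar> * \<bar>Y \<omega>\<bar> \<le> (X \<omega>)\<^sup>2 + (Y \<omega>)\<^sup>2" by linarith
    then show "norm (X \<omega> * Y \<omega>) \<le> norm ((X \<omega>)\<^sup>2 + (Y \<omega>)\<^sup>2)" by (simp add: abs_mult)
  qed
qed simp

lemma W_mult_integrable:
  "s \<in> {0..T} \<Longrightarrow> t \<in> {0..T} \<Longrightarrow> integrable M (\<lambda>\<omega>. W s g \<omega> * W t h \<omega>)"
  by (intro L2_mult_integrable W_measurable W_moments)

text \<open>Polarisation of the variance. Additivity in the test vector holds only almost surely for
  each pair of vectors, so it is used under the expectation.\<close>

lemma W_cov_same:
  assumes t: "t \<in> {0..T}"
  shows "expectation (\<lambda>\<omega>. W t g \<omega> * W t h \<omega>) = t * (Q g \<bullet> h)"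
proof -
  note [measurable] = W_measurable[OF t]
  have 1: "AE \<omega> in M. (W t (g + h) \<omega>)\<^sup>2 = (W t g \<omega>)\<^sup>2 + 2 * (W t g \<omega> * W t h \<omega>) + (W t h \<omega>)\<^sup>2"
    using W_lin[OF t, of 1 g 1 h] by (auto elim!: eventually_mono simp: power2_sum)
  have "t * (Q (g + h) \<bullet> (g + h)) = expectation (\<lambda>\<omega>. (W t (g + h) \<omega>)\<^sup>2)"
    using W_moments[OF t] by simp
  also have "\<dots> = expectation (\<lambda>\<omega>. (W t g \<omega>)\<^sup>2 + 2 * (W t g \<omega> * W t h \<omega>) + (W t h \<omega>)\<^sup>2)"
    by (rule integral_cong_AE[OF _ _ 1]) auto
  also have "\<dots> = t * (Q g \<bullet> g) + 2 * expectation (\<lambda>\<omega>. W t g \<omega> * W t h \<omega>) + t * (Q h \<bullet> h)"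
    using W_moments[OF t] W_mult_integrable[OF t t] by simp
  also have "Q (g + h) \<bullet> (g + h) = Q g \<bullet> g + 2 * (Q g \<bullet> h) + Q h \<bullet> h"
    using Q_sym[of h g]
    by (simp add: linear_add[OF bounded_linear.linear[OF Q_lin]] inner_add_left inner_add_right inner_commute)
  finally show ?thesis by (simp add: algebra_simps)
qed

lemma W_incr_indep:
  assumes "0 \<le> s" "s < t" "t \<le> T"
  shows "expectation (\<lambda>\<omega>. W s g \<omega> * (W t h \<omega> - W s h \<omega>)) = 0"
proof -
  have mt: "t \<in> {0..T}" "s \<in> {0..T}" using assms by auto
  note [measurable] = W_measurable[OF mt(1)] W_measurable[OF mt(2)]
  let ?Y = "\<lambda>\<omega>. W t h \<omega> - W s h \<omega>"
  have sp: "space (Filt s) = space M" using subalg[OF mt(2)] by (simp add: subalgebra_def)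
  have ind: "indep_set (sets (Filt s)) {?Y -` B \<inter> space M | B. B \<in> sets borel}"
    by (rule W_incr(1)[OF assms])
  have "indep_var borel (W s g) borel ?Y"
    unfolding indep_var_eq
  proof (intro conjI)
    have 1: "sigma_sets (space M) {W s g -` A \<inter> space M | A. A \<in> sets borel} \<subseteq> sets (Filt s)"
    proof -
      have "{W s g -` A \<inter> space M | A. A \<in> sets borel} \<subseteq> sets (Filt s)"
        using measurable_sets[OF W_adapted[OF mt(2), of g]] sp by auto
      then show ?thesis using sets.sigma_sets_subset[of _ "Filt s"] sp by simp
    qed
    \<comment> \<open>The process is defined through independence of the family of preimages. This
      family is already a sigma algebra, so independence in the sense of random variables follows
      without a generator argument on this side.\<close>
    have 2: "sigma_sets (space M) {?Y -` A \<inter> space M | A. A \<in> sets borel}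
        = {?Y -` A \<inter> space M | A. A \<in> sets borel}"
    proof -
      have "sigma_sets UNIV (sets borel :: real set set) = sets borel"
        using sets.sigma_sets_eq[of "borel :: real measure"] by simp
      then show ?thesis
        using sigma_sets_vimage_commute[of ?Y "space M" UNIV "sets borel"] by simp
    qed
    show "indep_set (sigma_sets (space M) {W s g -` A \<inter> space M | A. A \<in> sets borel})
      (sigma_sets (space M) {?Y -` A \<inter> space M | A. A \<in> sets borel})"
      unfolding 2 indep_set_def
      by (rule indep_sets_mono_sets[OF ind[unfolded indep_set_def]]) (use 1 in \<open>auto split: bool.split\<close>)
  qed auto
  moreover have "integrable M (W s g)"
    by (rule square_integrable_imp_integrable[OF _ W_moments(1)[OF mt(2)]]) measurable
  moreover have "integrable M ?Y"
    by (rule square_integrable_imp_integrable[OF _ W_incr_moments(1)[OF assms]]) measurable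
  ultimately have "expectation (\<lambda>\<omega>. W s g \<omega> * ?Y \<omega>) = expectation (W s g) * expectation ?Y"
    by (rule indep_var_lebesgue_integral)
  then show ?thesis using W_incr_moments(2)[OF assms] by simp
qed

lemma W_cov:
  assumes "s \<in> {0..T}" "t \<in> {0..T}"
  shows "expectation (\<lambda>\<omega>. W s g \<omega> * W t h \<omega>) = min s t * (Q g \<bullet> h)"
proof -
  have *: "expectation (\<lambda>\<omega>. W s g \<omega> * W t h \<omega>) = s * (Q g \<bullet> h)"
    if "s \<in> {0..T}" "t \<in> {0..T}" "s \<le> t" for s t g h
  proof (cases "s = t")
    case True
    then show ?thesis using W_cov_same[OF that(1)] by simp
  next
    case False
    have "expectation (\<lambda>\<omega>. W s g \<omega> * (W t h \<omega> - W s h \<omega>))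
        = expectation (\<lambda>\<omega>. W s g \<omega> * W t h \<omega>) - expectation (\<lambda>\<omega>. W s g \<omega> * W s h \<omega>)"
      using W_mult_integrable that by (simp add: right_diff_distrib)
    then show ?thesis using W_incr_indep[of s t g h] W_cov_same[OF that(1)] that False by simp
  qed
  show ?thesis
  proof (cases "s \<le> t")
    case True
    then show ?thesis using *[OF assms] by simp
  next
    case False
    then have "expectation (\<lambda>\<omega>. W t h \<omega> * W s g \<omega>) = t * (Q h \<bullet> g)"
      using *[OF assms(2,1)] by simp
    then show ?thesis using False Q_sym[of h g] by (simp add: mult.commute inner_commute)
  qed
qed

text \<open>The length of the overlap of two intervals, written with the same four minima as the
  covariance of two increments. With this form both sides of the isometry agree term by
  term.\<close>

lemma indicator_interval_integral:
  fixes c d c' d' :: real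
  assumes "c \<le> d" "c' \<le> d'"
  shows "has_bochner_integral lborel (\<lambda>s. indicator {c<..d} s * indicator {c'<..d'} s :: real)
    (min d d' - min d c' - min c d' + min c c')"
proof -
  have eq: "(\<lambda>s. indicator {c<..d} s * indicator {c'<..d'} s :: real) = indicator {max c c'<..min d d'}"
    by (auto simp: indicator_def fun_eq_iff)
  have "emeasure lborel {max c c'<..min d d'} = ennreal (max 0 (min d d' - max c c'))"
    by (cases "max c c' \<le> min d d'") (auto simp: max_def)
  moreover have "max 0 (min d d' - max c c') = min d d' - min d c' - min c d' + min c c'"
    using assms by (auto simp: max_def min_def)
  ultimately have m: "emeasure lborel {max c c'<..min d d'} = ennreal (min d d' - min d c' - min c d' + min c c')"
    and "0 \<le> min d d' - min d c' - min c d' + min c c'" 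
    by auto (metis max.cobounded1)
  then have "measure lborel {max c c'<..min d d'} = min d d' - min d c' - min c d' + min c c'"
    by (simp add: measure_def)
  then show ?thesis unfolding eq
    using has_bochner_integral_real_indicator[of "{max c c'<..min d d'}" lborel] m by auto
qed

lemma covariance_incr:
  assumes "0 \<le> c" "c \<le> d" "d \<le> T" "0 \<le> c'" "c' \<le> d'" "d' \<le> T"
  shows "has_bochner_integral M (\<lambda>\<omega>. (W d h \<omega> - W c h \<omega>) * (W d' h' \<omega> - W c' h' \<omega>))
    ((min d d' - min d c' - min c d' + min c c') * (Q h \<bullet> h'))"
proof -
  have *: "has_bochner_integral M (\<lambda>\<omega>. W s h \<omega> * W t h' \<omega>) (min s t * (Q h \<bullet> h'))"
    if "s \<in> {0..T}" "t \<in> {0..T}" for s t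
    using W_mult_integrable[OF that] W_cov[OF that] by (simp add: has_bochner_integral_iff)
  have "has_bochner_integral M (\<lambda>\<omega>. W d h \<omega> * W d' h' \<omega> - W d h \<omega> * W c' h' \<omega>
      - W c h \<omega> * W d' h' \<omega> + W c h \<omega> * W c' h' \<omega>)
    (min d d' * (Q h \<bullet> h') - min d c' * (Q h \<bullet> h') - min c d' * (Q h \<bullet> h') + min c c' * (Q h \<bullet> h'))"
    using assms by (intro has_bochner_integral_add has_bochner_integral_diff *) auto
  then show ?thesis by (simp add: algebra_simps)
qed

text \<open>In bilinear form the isometry follows by induction over each list separately, and
  overlapping intervals need not be refined to a common partition. The common value \<open>x\<close>
  carries both integrability statements through the induction.\<close>

lemma ito_isometry_bilinear:
  assumes "valid_elems T es" "valid_elems T fs"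
  shows "\<exists>x. has_bochner_integral M (\<lambda>\<omega>. sint W es \<omega> * sint W fs \<omega>) x \<and>
    has_bochner_integral lborel (\<lambda>s. Q (step es s) \<bullet> step fs s) x"
  using assms(1)
proof (induction es)
  case Nil
  have "Q 0 = 0" using Q_lin by (simp add: bounded_linear.linear linear_0)
  then show ?case by (auto intro!: exI[of _ 0])
next
  case (Cons e es)
  obtain c d h where e: "e = (c, d, h)" by (cases e)
  have v: "0 \<le> c" "c \<le> d" "d \<le> T" "valid_elems T es" using Cons.prems by (auto simp: e)
  obtain x where x: "has_bochner_integral M (\<lambda>\<omega>. sint W es \<omega> * sint W fs \<omega>) x"
    "has_bochner_integral lborel (\<lambda>s. Q (step es s) \<bullet> step fs s) x"
    using Cons.IH[OF v(4)] by blast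
  have "\<exists>y. has_bochner_integral M (\<lambda>\<omega>. (W d h \<omega> - W c h \<omega>) * sint W fs \<omega>) y \<and>
    has_bochner_integral lborel (\<lambda>s. indicator {c<..d} s * (Q h \<bullet> step fs s)) y"
    using assms(2)
  proof (induction fs)
    case Nil
    then show ?case by (auto intro!: exI[of _ 0])
  next
    case (Cons f fs)
    obtain c' d' h' where f: "f = (c', d', h')" by (cases f)
    have v': "0 \<le> c'" "c' \<le> d'" "d' \<le> T" "valid_elems T fs" using Cons.prems by (auto simp: f)
    obtain y where y: "has_bochner_integral M (\<lambda>\<omega>. (W d h \<omega> - W c h \<omega>) * sint W fs \<omega>) y"
      "has_bochner_integral lborel (\<lambda>s. indicator {c<..d} s * (Q h \<bullet> step fs s)) y"
      using Cons.IH[OF v'(4)] by blast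
    have "has_bochner_integral lborel (\<lambda>s. indicator {c<..d} s * indicator {c'<..d'} s * (Q h \<bullet> h'))
       ((min d d' - min d c' - min c d' + min c c') * (Q h \<bullet> h'))"
      by (intro has_bochner_integral_mult_left indicator_interval_integral v v')
    from has_bochner_integral_add[OF this y(2)]
    have 1: "has_bochner_integral lborel (\<lambda>s. indicator {c<..d} s * (Q h \<bullet> step (f # fs) s))
       ((min d d' - min d c' - min c d' + min c c') * (Q h \<bullet> h') + y)"
      by (simp add: f distrib_left inner_add_right mult.assoc)
    from has_bochner_integral_add[OF covariance_incr[OF v(1-3) v'(1-3), of h h'] y(1)]
    have 2: "has_bochner_integral M (\<lambda>\<omega>. (W d h \<omega> - W c h \<omega>) * sint W (f # fs) \<omega>)
       ((min d d' - min d c' - min c d' + min c c') * (Q h \<bullet> h') + y)"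
      by (simp only: f sint_simps distrib_left)
    from 1 2 show ?case by blast
  qed
  then obtain y where y: "has_bochner_integral M (\<lambda>\<omega>. (W d h \<omega> - W c h \<omega>) * sint W fs \<omega>) y"
    "has_bochner_integral lborel (\<lambda>s. indicator {c<..d} s * (Q h \<bullet> step fs s)) y" by blast
  from has_bochner_integral_add[OF y(1) x(1)]
  have 1: "has_bochner_integral M (\<lambda>\<omega>. sint W (e # es) \<omega> * sint W fs \<omega>) (y + x)"
    by (simp only: e sint_simps distrib_right)
  have "Q (step (e # es) s) \<bullet> step fs s
      = indicator {c<..d} s * (Q h \<bullet> step fs s) + Q (step es s) \<bullet> step fs s" for s
    by (simp add: e inner_add_left linear_add[OF bounded_linear.linear[OF Q_lin]]
        linear_scale[OF bounded_linear.linear[OF Q_lin]])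
  with has_bochner_integral_add[OF y(2) x(2)]
  have 2: "has_bochner_integral lborel (\<lambda>s. Q (step (e # es) s) \<bullet> step fs s) (y + x)"
    by (simp only:)
  from 1 2 show ?case by blast
qed

lemma sint_measurable:
  assumes "valid_elems T es" shows "sint W es \<in> borel_measurable M"
  using assms
proof (induction es)
  case Nil
  have "sint W [] = (\<lambda>s. 0)" by (rule ext) simp
  then show ?case by simp
next
  case (Cons e es)
  obtain c d h where e: "e = (c, d, h)" by (cases e)
  have "sint W (e # es) = (\<lambda>\<omega>. (W d h \<omega> - W c h \<omega>) + sint W es \<omega>)" by (rule ext) (simp add: e)
  moreover have "W d h \<in> borel_measurable M" "W c h \<in> borel_measurable M"
    using Cons.prems by (auto simp: e intro!: W_measurable)
  ultimately show ?case using Cons by (simp add: e)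
qed

lemma ito_isometry:
  assumes "valid_elems T es"
  shows "(\<integral>\<^sup>+\<omega>. ennreal ((sint W es \<omega>)\<^sup>2) \<partial>M) = (\<integral>\<^sup>+s. ennreal ((norm (Qh (step es s)))\<^sup>2) \<partial>lborel)"
proof -
  obtain x where x: "has_bochner_integral M (\<lambda>\<omega>. (sint W es \<omega>)\<^sup>2) x"
    "has_bochner_integral lborel (\<lambda>s. (norm (Qh (step es s)))\<^sup>2) x"
    using ito_isometry_bilinear[OF assms assms]
    by (auto simp: Q_inner power2_norm_eq_inner power2_eq_square[of "sint _ _ _"])
  have "(\<integral>\<^sup>+\<omega>. ennreal ((sint W es \<omega>)\<^sup>2) \<partial>M) = ennreal x"
    using x(1) by (subst nn_integral_eq_integral) (auto simp: has_bochner_integral_iff)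
  moreover have "(\<integral>\<^sup>+s. ennreal ((norm (Qh (step es s)))\<^sup>2) \<partial>lborel) = ennreal x"
    using x(2) by (subst nn_integral_eq_integral) (auto simp: has_bochner_integral_iff)
  ultimately show ?thesis by simp
qed

lemma sint_scale:
  assumes "valid_elems T es"
  shows "AE \<omega> in M. sint W (scale_elems a es) \<omega> = a * sint W es \<omega>"
  using assms
proof (induction es)
  case Nil
  then show ?case by (simp add: scale_elems_def)
next
  case (Cons e es)
  obtain c d h where e: "e = (c, d, h)" by (cases e)
  have v: "c \<in> {0..T}" "d \<in> {0..T}" "valid_elems T es" using Cons.prems by (auto simp: e)
  show ?case
    using Cons.IH[OF v(3)] W_lin[OF v(1), of a h 0 h] W_lin[OF v(2), of a h 0 h]
    by eventually_elim (simp add: e scale_elems_def algebra_simps)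
qed

end

lemma tendsto_0_bound_ennreal:
  fixes f g h :: "nat \<Rightarrow> ennreal"
  assumes "f \<longlonglongrightarrow> 0" "g \<longlonglongrightarrow> 0" "\<And>n. h n \<le> ennreal a * f n + ennreal b * g n"
  shows "h \<longlonglongrightarrow> 0"
proof (rule tendsto_sandwich[OF _ _ tendsto_const])
  have "(\<lambda>n. ennreal a * f n + ennreal b * g n) \<longlonglongrightarrow> ennreal a * 0 + ennreal b * 0"
    by (intro tendsto_add ennreal_tendsto_cmult assms(1,2)) auto
  then show "(\<lambda>n. ennreal a * f n + ennreal b * g n) \<longlonglongrightarrow> 0" by simp
qed (use assms(3) in auto)

section \<open>Scalar Wiener integrals\<close>

context wiener begin

text \<open>\<open>Y\<close> is the integral of \<open>f\<close>, paired with the noise, over the time interval from \<open>0\<close> to \<open>T\<close>;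
  integrals over shorter intervals are covered by functions \<open>f\<close> that vanish outside. Each
  coefficient of an operator valued integral has this form.\<close>

definition wint :: "(real \<Rightarrow> 'h) \<Rightarrow> ('w \<Rightarrow> real) \<Rightarrow> bool" where
  "wint f Y \<longleftrightarrow> f \<in> borel_measurable borel \<and> Y \<in> borel_measurable M \<and>
    (\<exists>es. (\<forall>n::nat. valid_elems T (es n)) \<and>
      (\<lambda>n. \<integral>\<^sup>+s. ennreal ((norm (Qh (f s - step (es n) s)))\<^sup>2) \<partial>lborel) \<longlonglongrightarrow> 0 \<and>
      (\<lambda>n. \<integral>\<^sup>+\<omega>. ennreal ((Y \<omega> - sint W (es n) \<omega>)\<^sup>2) \<partial>M) \<longlonglongrightarrow> 0)"

lemma Qh_add: "Qh (x + y) = Qh x + Qh y" and Qh_diff: "Qh (x - y) = Qh x - Qh y"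
  and Qh_scale: "Qh (r *\<^sub>R x) = r *\<^sub>R Qh x" and Qh_0 [simp]: "Qh 0 = 0"
  using bounded_linear.linear[OF Qh_lin]
  by (simp_all add: linear_add linear_diff linear_scale linear_0)

text \<open>Passing to the limit crudely costs the factor \<open>4\<close>, which is harmless for the rates.\<close>

lemma wint_bound:
  assumes "wint f Y"
  shows "(\<integral>\<^sup>+\<omega>. ennreal ((Y \<omega>)\<^sup>2) \<partial>M) \<le> 4 * (\<integral>\<^sup>+s. ennreal ((norm (Qh (f s)))\<^sup>2) \<partial>lborel)"
proof -
  obtain es where f [measurable]: "f \<in> borel_measurable borel" and Y [measurable]: "Y \<in> borel_measurable M"
    and v: "\<And>n. valid_elems T (es n)"
    and a: "(\<lambda>n. \<integral>\<^sup>+s. ennreal ((norm (Qh (f s - step (es n) s)))\<^sup>2) \<partial>lborel) \<longlonglongrightarrow> 0" (is "?a \<longlonglongrightarrow> 0")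
    and b: "(\<lambda>n. \<integral>\<^sup>+\<omega>. ennreal ((Y \<omega> - sint W (es n) \<omega>)\<^sup>2) \<partial>M) \<longlonglongrightarrow> 0" (is "?b \<longlonglongrightarrow> 0")
    using assms unfolding wint_def by blast
  let ?A = "\<integral>\<^sup>+\<omega>. ennreal ((Y \<omega>)\<^sup>2) \<partial>M" and ?B = "\<integral>\<^sup>+s. ennreal ((norm (Qh (f s)))\<^sup>2) \<partial>lborel"
  have le: "?A \<le> 4 * ?B + (4 * ?a n + 2 * ?b n)" for n
  proof -
    note [measurable] = sint_measurable[OF v]
    have "?A \<le> 2 * (\<integral>\<^sup>+\<omega>. ennreal ((sint W (es n) \<omega>)\<^sup>2) \<partial>M) + 2 * ?b n"
    proof (rule nn_integral_sq_add)
      fix \<omega> show "(Y \<omega>)\<^sup>2 \<le> 2 * (sint W (es n) \<omega>)\<^sup>2 + 2 * (Y \<omega> - sint W (es n) \<omega>)\<^sup>2"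
        using real_sq_add_le[of "sint W (es n) \<omega>" "Y \<omega> - sint W (es n) \<omega>"] by simp
    qed auto
    also have "(\<integral>\<^sup>+\<omega>. ennreal ((sint W (es n) \<omega>)\<^sup>2) \<partial>M)
        = (\<integral>\<^sup>+s. ennreal ((norm (Qh (step (es n) s)))\<^sup>2) \<partial>lborel)"
      by (rule ito_isometry[OF v])
    also have "\<dots> \<le> 2 * ?B + 2 * ?a n"
    proof (rule nn_integral_sq_add)
      fix s
      have "norm (Qh (step (es n) s)) = norm (Qh (f s) + (- Qh (f s - step (es n) s)))"
        by (simp add: Qh_diff)
      then show "(norm (Qh (step (es n) s)))\<^sup>2 \<le> 2 * (norm (Qh (f s)))\<^sup>2
          + 2 * (norm (Qh (f s - step (es n) s)))\<^sup>2"
        using norm_sq_add_le[of "Qh (f s)" "- Qh (f s - step (es n) s)"] by simp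
    qed auto
    finally have "?A \<le> 2 * (2 * ?B + 2 * ?a n) + 2 * ?b n"
      by (simp add: mult_left_mono add_right_mono)
    also have "\<dots> = 4 * ?B + (4 * ?a n + 2 * ?b n)"
      by (simp add: distrib_left add.assoc mult.assoc[symmetric])
    finally show ?thesis .
  qed
  have "(\<lambda>n. 4 * ?B + (4 * ?a n + 2 * ?b n)) \<longlonglongrightarrow> 4 * ?B + (4 * 0 + 2 * 0)"
    by (intro tendsto_add tendsto_const ennreal_tendsto_cmult a b) auto
  then have "?A \<le> 4 * ?B + (4 * 0 + 2 * 0)"
    by (rule LIMSEQ_le_const) (use le in auto)
  then show ?thesis by simp
qed

lemma wint_measurable: "wint f Y \<Longrightarrow> Y \<in> borel_measurable M"
  by (simp add: wint_def)

lemma wint_add: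
  assumes "wint f Y" "wint g Z" shows "wint (\<lambda>s. f s + g s) (\<lambda>\<omega>. Y \<omega> + Z \<omega>)"
proof -
  obtain es where f [measurable]: "f \<in> borel_measurable borel" and Y [measurable]: "Y \<in> borel_measurable M"
    and v: "\<And>n. valid_elems T (es n)"
    and a: "(\<lambda>n. \<integral>\<^sup>+s. ennreal ((norm (Qh (f s - step (es n) s)))\<^sup>2) \<partial>lborel) \<longlonglongrightarrow> 0"
    and b: "(\<lambda>n. \<integral>\<^sup>+\<omega>. ennreal ((Y \<omega> - sint W (es n) \<omega>)\<^sup>2) \<partial>M) \<longlonglongrightarrow> 0"
    using assms(1) unfolding wint_def by blast
  obtain fs where g [measurable]: "g \<in> borel_measurable borel" and Z [measurable]: "Z \<in> borel_measurable M"
    and v': "\<And>n. valid_elems T (fs n)"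
    and a': "(\<lambda>n. \<integral>\<^sup>+s. ennreal ((norm (Qh (g s - step (fs n) s)))\<^sup>2) \<partial>lborel) \<longlonglongrightarrow> 0"
    and b': "(\<lambda>n. \<integral>\<^sup>+\<omega>. ennreal ((Z \<omega> - sint W (fs n) \<omega>)\<^sup>2) \<partial>M) \<longlonglongrightarrow> 0"
    using assms(2) unfolding wint_def by blast
  note [measurable] = sint_measurable[OF v] sint_measurable[OF v']
  show ?thesis unfolding wint_def
  proof (intro conjI exI allI)
    show "valid_elems T (es n @ fs n)" for n using v v' by simp
    show "(\<lambda>n. \<integral>\<^sup>+s. ennreal ((norm (Qh (f s + g s - step (es n @ fs n) s)))\<^sup>2) \<partial>lborel) \<longlonglongrightarrow> 0"
    proof (rule tendsto_0_bound_ennreal[OF a a', of _ 2 2, unfolded ennreal_numeral], rule nn_integral_sq_add)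
      fix n s
      have "Qh (f s + g s - step (es n @ fs n) s) = Qh (f s - step (es n) s) + Qh (g s - step (fs n) s)"
        by (simp add: Qh_diff Qh_add)
      then show "(norm (Qh (f s + g s - step (es n @ fs n) s)))\<^sup>2
        \<le> 2 * (norm (Qh (f s - step (es n) s)))\<^sup>2 + 2 * (norm (Qh (g s - step (fs n) s)))\<^sup>2"
        using norm_sq_add_le by metis
    qed auto
    show "(\<lambda>n. \<integral>\<^sup>+\<omega>. ennreal ((Y \<omega> + Z \<omega> - sint W (es n @ fs n) \<omega>)\<^sup>2) \<partial>M) \<longlonglongrightarrow> 0"
    proof (rule tendsto_0_bound_ennreal[OF b b', of _ 2 2, unfolded ennreal_numeral], rule nn_integral_sq_add)
      fix n \<omega>
      have "Y \<omega> + Z \<omega> - sint W (es n @ fs n) \<omega> = (Y \<omega> - sint W (es n) \<omega>) + (Z \<omega> - sint W (fs n) \<omega>)"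
        by simp
      then show "(Y \<omega> + Z \<omega> - sint W (es n @ fs n) \<omega>)\<^sup>2
        \<le> 2 * (Y \<omega> - sint W (es n) \<omega>)\<^sup>2 + 2 * (Z \<omega> - sint W (fs n) \<omega>)\<^sup>2"
        using real_sq_add_le by metis
    qed auto
  qed simp_all
qed

lemma wint_scale:
  assumes "wint f Y" shows "wint (\<lambda>s. r *\<^sub>R f s) (\<lambda>\<omega>. r * Y \<omega>)"
proof -
  obtain es where f [measurable]: "f \<in> borel_measurable borel" and Y [measurable]: "Y \<in> borel_measurable M"
    and v: "\<And>n. valid_elems T (es n)"
    and a: "(\<lambda>n. \<integral>\<^sup>+s. ennreal ((norm (Qh (f s - step (es n) s)))\<^sup>2) \<partial>lborel) \<longlonglongrightarrow> 0" (is "?a \<longlonglongrightarrow> 0")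
    and b: "(\<lambda>n. \<integral>\<^sup>+\<omega>. ennreal ((Y \<omega> - sint W (es n) \<omega>)\<^sup>2) \<partial>M) \<longlonglongrightarrow> 0" (is "?b \<longlonglongrightarrow> 0")
    using assms unfolding wint_def by blast
  note [measurable] = sint_measurable[OF v]
  show ?thesis unfolding wint_def
  proof (intro conjI exI allI)
    show "valid_elems T (scale_elems r (es n))" for n using v by simp
    have "Qh (r *\<^sub>R f s - step (scale_elems r (es n)) s) = r *\<^sub>R Qh (f s - step (es n) s)" for n s
      by (simp add: step_scale Qh_scale Qh_diff scaleR_diff_right)
    then have "(\<integral>\<^sup>+s. ennreal ((norm (Qh (r *\<^sub>R f s - step (scale_elems r (es n)) s)))\<^sup>2) \<partial>lborel)
        = ennreal (r\<^sup>2) * ?a n" for n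
      by (simp add: power_mult_distrib ennreal_mult nn_integral_cmult)
    then show "(\<lambda>n. \<integral>\<^sup>+s. ennreal ((norm (Qh (r *\<^sub>R f s - step (scale_elems r (es n)) s)))\<^sup>2) \<partial>lborel) \<longlonglongrightarrow> 0"
      using ennreal_tendsto_cmult[OF _ a, of "ennreal (r\<^sup>2)"] by simp
    have "(\<integral>\<^sup>+\<omega>. ennreal ((r * Y \<omega> - sint W (scale_elems r (es n)) \<omega>)\<^sup>2) \<partial>M) = ennreal (r\<^sup>2) * ?b n" for n
    proof -
      have "(\<integral>\<^sup>+\<omega>. ennreal ((r * Y \<omega> - sint W (scale_elems r (es n)) \<omega>)\<^sup>2) \<partial>M)
          = (\<integral>\<^sup>+\<omega>. ennreal (r\<^sup>2) * ennreal ((Y \<omega> - sint W (es n) \<omega>)\<^sup>2) \<partial>M)"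
        by (rule nn_integral_cong_AE, use sint_scale[OF v, of r n] in eventually_elim)
          (simp add: power_mult_distrib flip: ennreal_mult right_diff_distrib)
      then show ?thesis by (simp add: nn_integral_cmult)
    qed
    then show "(\<lambda>n. \<integral>\<^sup>+\<omega>. ennreal ((r * Y \<omega> - sint W (scale_elems r (es n)) \<omega>)\<^sup>2) \<partial>M) \<longlonglongrightarrow> 0"
      using ennreal_tendsto_cmult[OF _ b, of "ennreal (r\<^sup>2)"] by simp
  qed simp_all
qed

text \<open>The kernel matters only up to null sets. This disposes of the grid points, where the
  kernels of two neighbouring time steps are both nonzero.\<close>

lemma wint_cong:
  assumes "wint f Y" and [measurable]: "g \<in> borel_measurable borel" "Z \<in> borel_measurable M"
    and fg: "AE s in lborel. f s = g s" and YZ: "AE \<omega> in M. Y \<omega> = Z \<omega>"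
  shows "wint g Z"
proof -
  obtain es where v: "\<And>n. valid_elems T (es n)"
    and a: "(\<lambda>n. \<integral>\<^sup>+s. ennreal ((norm (Qh (f s - step (es n) s)))\<^sup>2) \<partial>lborel) \<longlonglongrightarrow> 0"
    and b: "(\<lambda>n. \<integral>\<^sup>+\<omega>. ennreal ((Y \<omega> - sint W (es n) \<omega>)\<^sup>2) \<partial>M) \<longlonglongrightarrow> 0"
    using assms(1) unfolding wint_def by blast
  have "(\<integral>\<^sup>+s. ennreal ((norm (Qh (f s - step (es n) s)))\<^sup>2) \<partial>lborel)
      = (\<integral>\<^sup>+s. ennreal ((norm (Qh (g s - step (es n) s)))\<^sup>2) \<partial>lborel)" for n
    by (rule nn_integral_cong_AE, use fg in eventually_elim) simp
  moreover have "(\<integral>\<^sup>+\<omega>. ennreal ((Y \<omega> - sint W (es n) \<omega>)\<^sup>2) \<partial>M)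
      = (\<integral>\<^sup>+\<omega>. ennreal ((Z \<omega> - sint W (es n) \<omega>)\<^sup>2) \<partial>M)" for n
    by (rule nn_integral_cong_AE, use YZ in eventually_elim) simp
  ultimately show ?thesis unfolding wint_def using v a b by (intro conjI exI[of _ es]) auto
qed

text \<open>The difference of the two variables is an integral of the zero kernel and has second
  moment zero. In this way the noise of the scheme is recognised as the noise of the mild solution
  once the kernels agree.\<close>

lemma wint_unique:
  assumes "wint f Y" "wint f Z" shows "AE \<omega> in M. Y \<omega> = Z \<omega>"
proof -
  have [measurable]: "Y \<in> borel_measurable M" "Z \<in> borel_measurable M"
    using assms wint_measurable by auto
  have "wint (\<lambda>s. f s + (-1) *\<^sub>R f s) (\<lambda>\<omega>. Y \<omega> + (-1) * Z \<omega>)"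
    by (intro wint_add wint_scale assms)
  from wint_bound[OF this] have "(\<integral>\<^sup>+\<omega>. ennreal ((Y \<omega> - Z \<omega>)\<^sup>2) \<partial>M) = 0"
    by simp
  then have "AE \<omega> in M. ennreal ((Y \<omega> - Z \<omega>)\<^sup>2) = 0"
    by (subst (asm) nn_integral_0_iff_AE) auto
  then show ?thesis by eventually_elim (simp add: ennreal_eq_0_iff)
qed

section \<open>Coordinates of operator valued stochastic integrals\<close>

lemma suminf_ge_term_ennreal: "(f j :: ennreal) \<le> (\<Sum>i. f i)"
  using sum_le_suminf[of f "{j}"] by auto

text \<open>Pairing a rank one operator with an eigenvector turns its target \<open>g\<close> into a
  number, which is moved into the vector \<open>h\<close> that is paired with the noise.\<close>

definition coord_elems :: "nat \<Rightarrow> (real \<times> real \<times> 'h \<times> 'h) list \<Rightarrow> (real \<times> real \<times> 'h) list" where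
  "coord_elems j es = map (\<lambda>(c, d, h, g). (c, d, (g \<bullet> phi j) *\<^sub>R h)) es"

lemma coord_elem_op: "elem_op es s x \<bullet> phi j = step (coord_elems j es) s \<bullet> x"
  unfolding elem_op_def coord_elems_def
  by (induction es) (auto simp: inner_add_left step_def)

lemma coord_elem_int:
  assumes "\<forall>(c, d, h, g)\<in>set es. 0 \<le> c \<and> c \<le> d \<and> d \<le> T"
  shows "AE \<omega> in M. elem_int W es \<omega> \<bullet> phi j = sint W (coord_elems j es) \<omega>"
  using assms
proof (induction es)
  case Nil
  then show ?case by (simp add: elem_int_def coord_elems_def)
next
  case (Cons e es)
  obtain c d h g where e: "e = (c, d, h, g)" by (cases e)
  have v: "c \<in> {0..T}" "d \<in> {0..T}" using Cons.prems by (auto simp: e)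
  have "AE \<omega> in M. elem_int W es \<omega> \<bullet> phi j = sint W (coord_elems j es) \<omega>"
    using Cons by auto
  then show ?case
    using W_lin[OF v(1), of "g \<bullet> phi j" h 0 h] W_lin[OF v(2), of "g \<bullet> phi j" h 0 h]
    by eventually_elim (simp add: e elem_int_def coord_elems_def inner_add_left algebra_simps)
qed

lemma valid_coord:
  "\<forall>(c, d, h, g)\<in>set es. 0 \<le> c \<and> c \<le> d \<and> d \<le> T \<Longrightarrow> valid_elems T (coord_elems j es)"
  unfolding valid_elems_def coord_elems_def by fastforce

text \<open>The definition of the stochastic integral controls the approximation on its own interval
  only, whereas \<open>wint\<close> integrates over the whole line; outside the interval both the
  kernel and its approximations vanish.\<close>

lemma step_outside:
  assumes "\<forall>(c, d, h, g)\<in>set es. a \<le> c \<and> c \<le> d \<and> d \<le> b" "s \<notin> {a..b}"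
  shows "step (coord_elems j es) s = 0"
  using assms(1)
proof (induction es)
  case Nil
  then show ?case by (simp add: coord_elems_def)
next
  case (Cons e es)
  obtain c d h g where e: "e = (c, d, h, g)" by (cases e)
  have "step (coord_elems j es) s = 0" using Cons by auto
  moreover have "s \<notin> {c<..d}" using Cons.prems assms(2) by (auto simp: e)
  ultimately show ?case by (simp add: e coord_elems_def)
qed

text \<open>A single row of an operator matrix is bounded by all of it. By symmetry of
  \<open>Qh\<close> and the identity of Parseval, the row has square sum
  \<open>(norm (Qh y))\<^sup>2\<close>, with the weight of its coordinate in front.\<close>

lemma HSsq_ge_coord:
  assumes "\<And>x. \<Psi> x j = y \<bullet> Qh x"
  shows "ennreal (lam j powr r) * ennreal ((norm (Qh y))\<^sup>2) \<le> HSsq phi (\<lambda>x. Apow lam (r/2) (\<Psi> x))"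
proof -
  have sq: "(lam j powr (r/2) * z)\<^sup>2 = lam j powr r * z\<^sup>2" for z
    by (simp add: power_mult_distrib powr_add[symmetric] power2_eq_square[of "_ powr _"])
  have "(\<Sum>k. ennreal (lam j powr r * (Qh y \<bullet> phi k)\<^sup>2)) = ennreal (lam j powr r * (norm (Qh y))\<^sup>2)"
    by (rule suminf_ennreal_eq) (auto intro!: sums_mult parseval)
  then have "ennreal (lam j powr r) * ennreal ((norm (Qh y))\<^sup>2)
      = (\<Sum>k. ennreal (lam j powr r * (Qh y \<bullet> phi k)\<^sup>2))"
    by (simp add: ennreal_mult)
  also have "\<dots> \<le> (\<Sum>k. l2sq (Apow lam (r/2) (\<Psi> (phi k))))"
  proof (rule suminf_le)
    fix k
    have "ennreal (lam j powr r * (Qh y \<bullet> phi k)\<^sup>2) = ennreal ((Apow lam (r/2) (\<Psi> (phi k)) j)\<^sup>2)"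
      by (simp add: Apow_def assms sq Qh_sym)
    also have "\<dots> \<le> l2sq (Apow lam (r/2) (\<Psi> (phi k)))"
      unfolding l2sq_def by (rule suminf_ge_term_ennreal)
    finally show "ennreal (lam j powr r * (Qh y \<bullet> phi k)\<^sup>2) \<le> l2sq (Apow lam (r/2) (\<Psi> (phi k)))" .
  qed auto
  finally show ?thesis unfolding HSsq_def .
qed

lemma tendsto_0_cmult_le:
  fixes f g :: "nat \<Rightarrow> ennreal"
  assumes "g \<longlonglongrightarrow> 0" "c > 0" "\<And>n. ennreal c * f n \<le> g n"
  shows "f \<longlonglongrightarrow> 0"
proof (rule tendsto_0_bound_ennreal[OF assms(1) tendsto_const[of 0], of _ "1/c" 0])
  fix n
  have "f n = ennreal (1/c) * (ennreal c * f n)"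
    using assms(2) by (simp add: mult.assoc[symmetric] flip: ennreal_mult)
  also have "\<dots> \<le> ennreal (1/c) * g n" by (intro mult_left_mono assms(3)) auto
  finally show "f n \<le> ennreal (1 / c) * g n + ennreal 0 * 0" by simp
qed

text \<open>For fixed \<open>j\<close> the weight \<open>lam j powr r\<close> is a positive
  constant, so convergence in the space of order \<open>r\<close>, negative or not, forces
  convergence of every coordinate to a scalar integral.\<close>

lemma is_stoch_integral_coord:
  assumes Y: "is_stoch_integral lam phi M W Qh r a b \<Phi> Y" and ab: "0 \<le> a" "b \<le> T"
    and f [measurable]: "f \<in> borel_measurable borel"
    and f\<Phi>: "\<And>s x. s \<in> {a..b} \<Longrightarrow> \<Phi> s x j = f s \<bullet> x"
    and f0: "\<And>s. s \<notin> {a..b} \<Longrightarrow> f s = 0"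
  shows "wint f (\<lambda>\<omega>. Y \<omega> j)"
proof -
  obtain es :: "nat \<Rightarrow> (real \<times> real \<times> 'h \<times> 'h) list"
    where Ym [measurable]: "(\<lambda>\<omega>. Y \<omega> j) \<in> borel_measurable M"
    and v: "\<And>n. \<forall>(c, d, h, g)\<in>set (es n). a \<le> c \<and> c \<le> d \<and> d \<le> b"
    and A: "(\<lambda>n. \<integral>\<^sup>+s\<in>{a..b}. HSsq phi
            (\<lambda>x. Apow lam (r/2) (\<lambda>j. \<Phi> s (Qh x) j - coef phi (elem_op (es n) s (Qh x)) j)) \<partial>lborel)
          \<longlonglongrightarrow> 0"
    and B: "(\<lambda>n. \<integral>\<^sup>+\<omega>. l2sq (Apow lam (r/2) (\<lambda>j. Y \<omega> j - coef phi (elem_int W (es n) \<omega>) j)) \<partial>M)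
          \<longlonglongrightarrow> 0"
    using Y unfolding is_stoch_integral_def by blast
  have v0: "\<forall>(c, d, h, g)\<in>set (es n). 0 \<le> c \<and> c \<le> d \<and> d \<le> T" for n
    using v[of n] ab by fastforce
  have vc: "valid_elems T (coord_elems j (es n))" for n
    by (rule valid_coord[OF v0])
  note [measurable] = sint_measurable[OF vc]
  have pos: "lam j powr r > 0" using lam_pos[of j] by simp
  show ?thesis unfolding wint_def
  proof (intro conjI exI allI)
    show "valid_elems T (coord_elems j (es n))" for n by (rule vc)
    show "(\<lambda>n. \<integral>\<^sup>+s. ennreal ((norm (Qh (f s - step (coord_elems j (es n)) s)))\<^sup>2) \<partial>lborel) \<longlonglongrightarrow> 0"
    proof (rule tendsto_0_cmult_le[OF A pos])
      fix n
      have "ennreal (lam j powr r) * (\<integral>\<^sup>+s. ennreal ((norm (Qh (f s - step (coord_elems j (es n)) s)))\<^sup>2) \<partial>lborel)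
        = (\<integral>\<^sup>+s. ennreal (lam j powr r) * ennreal ((norm (Qh (f s - step (coord_elems j (es n)) s)))\<^sup>2) \<partial>lborel)"
        by (simp add: nn_integral_cmult)
      also have "\<dots> \<le> (\<integral>\<^sup>+s\<in>{a..b}. HSsq phi
            (\<lambda>x. Apow lam (r/2) (\<lambda>j. \<Phi> s (Qh x) j - coef phi (elem_op (es n) s (Qh x)) j)) \<partial>lborel)"
      proof (rule nn_integral_mono)
        fix s :: real
        show "ennreal (lam j powr r) * ennreal ((norm (Qh (f s - step (coord_elems j (es n)) s)))\<^sup>2)
          \<le> HSsq phi (\<lambda>x. Apow lam (r/2) (\<lambda>j. \<Phi> s (Qh x) j - coef phi (elem_op (es n) s (Qh x)) j))
            * indicator {a..b} s"
        proof (cases "s \<in> {a..b}")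
          case True
          have "ennreal (lam j powr r) * ennreal ((norm (Qh (f s - step (coord_elems j (es n)) s)))\<^sup>2)
            \<le> HSsq phi (\<lambda>x. Apow lam (r/2) (\<lambda>j. \<Phi> s (Qh x) j - coef phi (elem_op (es n) s (Qh x)) j))"
            by (rule HSsq_ge_coord) (simp add: f\<Phi>[OF True] coef_def coord_elem_op inner_diff_left)
          then show ?thesis using True by simp
        next
          case False
          then show ?thesis using f0[OF False] step_outside[OF v False] by simp
        qed
      qed
      finally show "ennreal (lam j powr r) * (\<integral>\<^sup>+s. ennreal ((norm (Qh (f s - step (coord_elems j (es n)) s)))\<^sup>2) \<partial>lborel)
        \<le> (\<integral>\<^sup>+s\<in>{a..b}. HSsq phi
            (\<lambda>x. Apow lam (r/2) (\<lambda>j. \<Phi> s (Qh x) j - coef phi (elem_op (es n) s (Qh x)) j)) \<partial>lborel)" .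
    qed
    show "(\<lambda>n. \<integral>\<^sup>+\<omega>. ennreal ((Y \<omega> j - sint W (coord_elems j (es n)) \<omega>)\<^sup>2) \<partial>M) \<longlonglongrightarrow> 0"
    proof (rule tendsto_0_cmult_le[OF B pos])
      fix n
      have sq: "(lam j powr (r/2) * z)\<^sup>2 = lam j powr r * z\<^sup>2" for z
        by (simp add: power_mult_distrib powr_add[symmetric] power2_eq_square[of "_ powr _"])
      have "ennreal (lam j powr r) * (\<integral>\<^sup>+\<omega>. ennreal ((Y \<omega> j - sint W (coord_elems j (es n)) \<omega>)\<^sup>2) \<partial>M)
        = (\<integral>\<^sup>+\<omega>. ennreal (lam j powr r) * ennreal ((Y \<omega> j - sint W (coord_elems j (es n)) \<omega>)\<^sup>2) \<partial>M)"
        by (simp add: nn_integral_cmult)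
      also have "\<dots> \<le> (\<integral>\<^sup>+\<omega>. l2sq (Apow lam (r/2) (\<lambda>j. Y \<omega> j - coef phi (elem_int W (es n) \<omega>) j)) \<partial>M)"
      proof (rule nn_integral_mono_AE, use coord_elem_int[OF v0, of n j] in eventually_elim)
        fix \<omega> assume *: "elem_int W (es n) \<omega> \<bullet> phi j = sint W (coord_elems j (es n)) \<omega>"
        have "ennreal (lam j powr r) * ennreal ((Y \<omega> j - sint W (coord_elems j (es n)) \<omega>)\<^sup>2)
           = ennreal ((Apow lam (r/2) (\<lambda>j. Y \<omega> j - coef phi (elem_int W (es n) \<omega>) j) j)\<^sup>2)"
          by (simp add: Apow_def sq coef_def * flip: ennreal_mult)
        also have "\<dots> \<le> l2sq (Apow lam (r/2) (\<lambda>j. Y \<omega> j - coef phi (elem_int W (es n) \<omega>) j))"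
          unfolding l2sq_def by (rule suminf_ge_term_ennreal)
        finally show "ennreal (lam j powr r) * ennreal ((Y \<omega> j - sint W (coord_elems j (es n)) \<omega>)\<^sup>2)
          \<le> l2sq (Apow lam (r/2) (\<lambda>j. Y \<omega> j - coef phi (elem_int W (es n) \<omega>) j))" .
      qed
      finally show "ennreal (lam j powr r) * (\<integral>\<^sup>+\<omega>. ennreal ((Y \<omega> j - sint W (coord_elems j (es n)) \<omega>)\<^sup>2) \<partial>M)
        \<le> (\<integral>\<^sup>+\<omega>. l2sq (Apow lam (r/2) (\<lambda>j. Y \<omega> j - coef phi (elem_int W (es n) \<omega>) j)) \<partial>M)" .
    qed
  qed (fact Ym f)+
qed

end

section \<open>Weighted sums of second moments\<close>

text \<open>A measure of its own, since the processes are jointly measurable only for times in this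
  interval. It is finite, which makes the theorem of Fubini and the Cauchy-Schwarz inequality in
  time available.\<close>

definition tmeas :: "real \<Rightarrow> real measure" where
  "tmeas T = restrict_space lborel {0..T}"

lemma space_tmeas [simp]: "space (tmeas T) = {0..T}"
  by (simp add: tmeas_def space_restrict_space)

lemma sets_tmeas [measurable_cong]: "sets (tmeas T) = sets (restrict_space borel {0..T})"
  unfolding tmeas_def by (rule sets_restrict_space_cong) simp

lemma borel_tmeas: "f \<in> borel_measurable borel \<Longrightarrow> f \<in> borel_measurable (tmeas T)"
  unfolding tmeas_def by (intro measurable_restrict_space1) simp

lemma finite_tmeas: "finite_measure (tmeas T)"
  by (rule finite_measureI)
    (simp add: tmeas_def emeasure_restrict_space space_restrict_space emeasure_lborel_Icc_eq)

lemma emeasure_tmeas: "T \<ge> 0 \<Longrightarrow> emeasure (tmeas T) (space (tmeas T)) = ennreal T"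
  by (simp add: tmeas_def emeasure_restrict_space space_restrict_space)

lemma nn_integral_tmeas: "(\<integral>\<^sup>+x. f x \<partial>tmeas T) = (\<integral>\<^sup>+x. f x * indicator {0..T} x \<partial>lborel)"
  unfolding tmeas_def by (rule nn_integral_restrict_space) simp

lemma integral_tmeas:
  "(LINT x|tmeas T. (f x :: 'b::{banach, second_countable_topology})) = (LINT x|lborel. indicator {0..T} x *\<^sub>R f x)"
  unfolding tmeas_def by (rule integral_restrict_space) simp

lemma integral_sq_le:
  fixes f :: "'a \<Rightarrow> real"
  assumes [measurable]: "f \<in> borel_measurable N"
  shows "ennreal ((LINT x|N. f x)\<^sup>2) \<le> emeasure N (space N) * (\<integral>\<^sup>+x. ennreal ((f x)\<^sup>2) \<partial>N)"
proof (cases "integrable N f")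
  case True
  have "ennreal ((LINT x|N. f x)\<^sup>2) = (ennreal \<bar>LINT x|N. f x\<bar>)\<^sup>2"
    by (simp add: ennreal_power)
  also have "\<dots> \<le> (\<integral>\<^sup>+x. ennreal \<bar>f x\<bar> \<partial>N)\<^sup>2"
    using integral_norm_bound_ennreal[OF True] by (intro power_mono) auto
  also have "\<dots> = (\<integral>\<^sup>+x. ennreal \<bar>f x\<bar> * 1 \<partial>N)\<^sup>2" by simp
  also have "\<dots> \<le> (\<integral>\<^sup>+x. ennreal \<bar>f x\<bar> ^ 2 \<partial>N) * (\<integral>\<^sup>+x. 1 ^ 2 \<partial>N)"
    by (rule Cauchy_Schwarz_nn_integral) auto
  also have "\<dots> = emeasure N (space N) * (\<integral>\<^sup>+x. ennreal ((f x)\<^sup>2) \<partial>N)"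
    by (simp add: ennreal_power mult.commute)
  finally show ?thesis .
\<comment> \<open>A function that is not integrable has integral 0 by convention, so the inequality
  persists.\<close>
qed (simp add: not_integrable_integral_eq)

context wiener begin

definition esq :: "('w \<Rightarrow> real) \<Rightarrow> ennreal" where
  "esq X = (\<integral>\<^sup>+\<omega>. ennreal ((X \<omega>)\<^sup>2) \<partial>M)"

abbreviation msq :: "('w \<Rightarrow> 'h) \<Rightarrow> ennreal" where
  "msq X \<equiv> \<integral>\<^sup>+\<omega>. ennreal ((norm (X \<omega>))\<^sup>2) \<partial>M"

text \<open>The mean square of the norm of order \<open>s\<close>, with the sum taken outside the
  expectation. As an extended real it makes sense for any family of measurable coordinates, before
  anything is known about convergence.\<close>

definition hsum :: "real \<Rightarrow> (nat \<Rightarrow> 'w \<Rightarrow> real) \<Rightarrow> ennreal" where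
  "hsum s X = (\<Sum>j. ennreal (lam j powr s) * esq (X j))"

lemma esq_add:
  assumes "X \<in> borel_measurable M" "Y \<in> borel_measurable M"
  shows "esq (\<lambda>\<omega>. X \<omega> + Y \<omega>) \<le> 2 * esq X + 2 * esq Y"
  unfolding esq_def by (rule nn_integral_sq_add[OF assms]) (rule real_sq_add_le)

lemma esq_cong_AE: "AE \<omega> in M. X \<omega> = Y \<omega> \<Longrightarrow> esq X = esq Y"
  unfolding esq_def by (rule nn_integral_cong_AE) (auto elim: eventually_mono)

lemma esq_mult: "X \<in> borel_measurable M \<Longrightarrow> esq (\<lambda>\<omega>. c * X \<omega>) = ennreal (c\<^sup>2) * esq X"
  unfolding esq_def by (simp add: power_mult_distrib ennreal_mult nn_integral_cmult)

lemma hsum_cong_AE: "(\<And>j. AE \<omega> in M. X j \<omega> = Y j \<omega>) \<Longrightarrow> hsum s X = hsum s Y"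
  unfolding hsum_def using esq_cong_AE[of "X j" "Y j" for j] by simp

lemma hsum_add:
  assumes [measurable]: "\<And>j. X j \<in> borel_measurable M" "\<And>j. Y j \<in> borel_measurable M"
  shows "hsum s (\<lambda>j \<omega>. X j \<omega> + Y j \<omega>) \<le> 2 * hsum s X + 2 * hsum s Y"
proof -
  have "hsum s (\<lambda>j \<omega>. X j \<omega> + Y j \<omega>)
      \<le> (\<Sum>j. ennreal (lam j powr s) * (2 * esq (X j) + 2 * esq (Y j)))"
    unfolding hsum_def by (intro suminf_le mult_left_mono esq_add) auto
  also have "\<dots> = (\<Sum>j. 2 * (ennreal (lam j powr s) * esq (X j)) + 2 * (ennreal (lam j powr s) * esq (Y j)))"
    by (simp add: distrib_left mult.left_commute)
  also have "\<dots> = 2 * hsum s X + 2 * hsum s Y"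
    unfolding hsum_def by (subst suminf_add[symmetric]) (auto simp: ennreal_suminf_cmult)
  finally show ?thesis .
qed

lemma hsum_mult:
  assumes [measurable]: "\<And>j. X j \<in> borel_measurable M"
    and le: "\<And>j. lam j powr s * (c j)\<^sup>2 \<le> B * lam j powr s'" and "B \<ge> 0"
  shows "hsum s (\<lambda>j \<omega>. c j * X j \<omega>) \<le> ennreal B * hsum s' X"
proof -
  have "ennreal (lam j powr s) * (ennreal ((c j)\<^sup>2) * esq (X j))
      \<le> ennreal B * (ennreal (lam j powr s') * esq (X j))" for j
  proof -
    have "ennreal (lam j powr s) * (ennreal ((c j)\<^sup>2) * esq (X j)) = ennreal (lam j powr s * (c j)\<^sup>2) * esq (X j)"
      by (simp add: ennreal_mult mult.assoc)
    also have "\<dots> \<le> ennreal (B * lam j powr s') * esq (X j)"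
      by (intro mult_right_mono ennreal_leI le) auto
    also have "\<dots> = ennreal B * (ennreal (lam j powr s') * esq (X j))"
      using \<open>B \<ge> 0\<close> by (simp add: ennreal_mult mult.assoc)
    finally show ?thesis .
  qed
  then show ?thesis
    unfolding hsum_def by (simp add: esq_mult suminf_le flip: ennreal_suminf_cmult)
qed

lemma hsum_l2sq:
  assumes [measurable]: "\<And>j. X j \<in> borel_measurable M"
  shows "hsum s X = (\<integral>\<^sup>+\<omega>. l2sq (Apow lam (s/2) (\<lambda>j. X j \<omega>)) \<partial>M)"
proof -
  have sq: "(lam j powr (s/2) * z)\<^sup>2 = lam j powr s * z\<^sup>2" for z j
    by (simp add: power_mult_distrib powr_add[symmetric] power2_eq_square[of "_ powr _"])
  show ?thesis
    unfolding hsum_def l2sq_def Apow_def esq_def sq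
    by (subst nn_integral_suminf) (auto simp: ennreal_mult nn_integral_cmult)
qed

lemma hsum_norm:
  assumes [measurable]: "G \<in> borel_measurable M"
  shows "hsum 0 (\<lambda>j \<omega>. G \<omega> \<bullet> phi j) = msq G"
proof -
  have "Apow lam (0/2) (\<lambda>j. x \<bullet> phi j) = coef phi x" for x
    using lam_pos[THEN less_imp_neq] by (auto simp: Apow_def coef_def fun_eq_iff)
  then show ?thesis by (simp add: hsum_l2sq l2sq_coef)
qed

text \<open>Only second moments of single coordinates are added, so correlations between coordinates
  do not enter. What remains of the noise is the weighted sum of
  \<open>(norm (Qh (phi j)))\<^sup>2\<close>, which condition (N) controls.\<close>

lemma hsum_noise:
  assumes X: "\<And>j. wint (\<lambda>r. f j r *\<^sub>R phi j) (X j)"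
    and f: "\<And>j. f j \<in> borel_measurable borel"
    and I: "\<And>j. (\<integral>\<^sup>+r. ennreal ((f j r)\<^sup>2) \<partial>lborel) \<le> ennreal (I j)" "\<And>j. I j \<ge> 0"
    and le: "\<And>j. lam j powr s * I j \<le> B * lam j powr s'" and B: "B \<ge> 0"
  shows "hsum s X \<le> ennreal (4 * B) * (\<Sum>j. ennreal (lam j powr s' * (norm (Qh (phi j)))\<^sup>2))"
proof -
  have "ennreal (lam j powr s) * esq (X j) \<le> ennreal (4 * B) * ennreal (lam j powr s' * (norm (Qh (phi j)))\<^sup>2)" for j
  proof -
    note [measurable] = f
    let ?q = "(norm (Qh (phi j)))\<^sup>2"
    have "esq (X j) \<le> 4 * (\<integral>\<^sup>+r. ennreal ((norm (Qh (f j r *\<^sub>R phi j)))\<^sup>2) \<partial>lborel)"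
      unfolding esq_def by (rule wint_bound[OF X])
    also have "\<dots> = 4 * (ennreal ?q * (\<integral>\<^sup>+r. ennreal ((f j r)\<^sup>2) \<partial>lborel))"
      by (simp add: Qh_scale power_mult_distrib ennreal_mult mult.commute[of "ennreal ((f j _)\<^sup>2)"] nn_integral_cmult)
    also have "\<dots> \<le> 4 * (ennreal ?q * ennreal (I j))"
      by (intro mult_left_mono I) auto
    also have "\<dots> = ennreal (4 * (?q * I j))"
      using I by (simp add: ennreal_mult)
    finally have "ennreal (lam j powr s) * esq (X j) \<le> ennreal (lam j powr s) * ennreal (4 * (?q * I j))"
      by (intro mult_left_mono) auto
    also have "\<dots> = ennreal (lam j powr s * (4 * (?q * I j)))"
      using I by (simp add: ennreal_mult)
    also have "lam j powr s * (4 * (?q * I j)) = 4 * ?q * (lam j powr s * I j)" by simp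
    also have "\<dots> \<le> 4 * ?q * (B * lam j powr s')" by (intro mult_left_mono le) auto
    also have "ennreal (4 * ?q * (B * lam j powr s')) = ennreal (4 * B) * ennreal (lam j powr s' * ?q)"
      using B by (subst ennreal_mult[symmetric]) (auto simp: mult_ac)
    finally show ?thesis by (simp add: ennreal_leI)
  qed
  then show ?thesis unfolding hsum_def ennreal_suminf_cmult[symmetric] by (intro suminf_le) auto
qed

lemma pair_sigma_finite_tmeas: "pair_sigma_finite (tmeas T) M"
  by (intro pair_sigma_finite.intro finite_measure.sigma_finite_measure finite_tmeas)
    unfold_locales

lemma drift_measurable:
  assumes [measurable]: "(\<lambda>(r, \<omega>). G r \<omega>) \<in> borel_measurable (tmeas T \<Otimes>\<^sub>M M)"
    and [measurable]: "a \<in> borel_measurable (tmeas T)"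
  shows "(\<lambda>\<omega>. LINT r|tmeas T. a r * (G r \<omega> \<bullet> phi j)) \<in> borel_measurable M"
proof -
  interpret tm: sigma_finite_measure "tmeas T"
    by (rule finite_measure.sigma_finite_measure[OF finite_tmeas])
  have [measurable]: "(\<lambda>(\<omega>, r). G r \<omega>) \<in> borel_measurable (M \<Otimes>\<^sub>M tmeas T)"
    using measurable_pair_swap[OF assms(1)] by simp
  show ?thesis by measurable
qed

lemma hsum_drift:
  assumes G [measurable]: "(\<lambda>(r, \<omega>). G r \<omega>) \<in> borel_measurable (tmeas T \<Otimes>\<^sub>M M)"
    and a [measurable]: "\<And>j. a j \<in> borel_measurable (tmeas T)"
    and \<kappa> [measurable]: "\<kappa> \<in> borel_measurable (tmeas T)"
    and le: "\<And>j r. r \<in> {0..T} \<Longrightarrow> ennreal (lam j powr s * (a j r)\<^sup>2) \<le> \<kappa> r"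
  shows "hsum s (\<lambda>j \<omega>. LINT r|tmeas T. a j r * (G r \<omega> \<bullet> phi j))
    \<le> ennreal T * (\<integral>\<^sup>+r. \<kappa> r * msq (G r) \<partial>tmeas T)"
proof -
  interpret pair_sigma_finite "tmeas T" M by (rule pair_sigma_finite_tmeas)
  have G' [measurable]: "(\<lambda>(\<omega>, r). G r \<omega>) \<in> borel_measurable (M \<Otimes>\<^sub>M tmeas T)"
    using measurable_pair_swap[OF assms(1)] by simp
  have [measurable]: "(\<lambda>r. G r \<omega>) \<in> borel_measurable (tmeas T)" if "\<omega> \<in> space M" for \<omega>
    using measurable_compose_Pair1[OF that G'] by simp
  have [measurable]: "(\<lambda>\<omega>. G r \<omega>) \<in> borel_measurable M" if "r \<in> space (tmeas T)" for r
    using measurable_compose_Pair1[OF that G] by simp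
  have "hsum s (\<lambda>j \<omega>. LINT r|tmeas T. a j r * (G r \<omega> \<bullet> phi j))
      \<le> (\<Sum>j. \<integral>\<^sup>+\<omega>. ennreal T * (\<integral>\<^sup>+r. \<kappa> r * ennreal ((G r \<omega> \<bullet> phi j)\<^sup>2) \<partial>tmeas T) \<partial>M)"
    unfolding hsum_def
  proof (intro suminf_le allI)
    fix j
    have "ennreal (lam j powr s) * esq (\<lambda>\<omega>. LINT r|tmeas T. a j r * (G r \<omega> \<bullet> phi j))
      = (\<integral>\<^sup>+\<omega>. ennreal (lam j powr s) * ennreal ((LINT r|tmeas T. a j r * (G r \<omega> \<bullet> phi j))\<^sup>2) \<partial>M)"
      unfolding esq_def using drift_measurable[OF G a] by (subst nn_integral_cmult) auto
    also have "\<dots> \<le> (\<integral>\<^sup>+\<omega>. ennreal T * (\<integral>\<^sup>+r. \<kappa> r * ennreal ((G r \<omega> \<bullet> phi j)\<^sup>2) \<partial>tmeas T) \<partial>M)"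
    proof (rule nn_integral_mono)
      fix \<omega> assume \<omega> [simp]: "\<omega> \<in> space M"
      have "ennreal (lam j powr s) * ennreal ((LINT r|tmeas T. a j r * (G r \<omega> \<bullet> phi j))\<^sup>2)
        \<le> ennreal (lam j powr s) * (ennreal T * (\<integral>\<^sup>+r. ennreal ((a j r * (G r \<omega> \<bullet> phi j))\<^sup>2) \<partial>tmeas T))"
        using integral_sq_le[of "\<lambda>r. a j r * (G r \<omega> \<bullet> phi j)" "tmeas T"] T
        by (intro mult_left_mono) (auto simp: emeasure_tmeas simp del: space_tmeas)
      also have "\<dots> = ennreal T * (\<integral>\<^sup>+r. ennreal (lam j powr s) * ennreal ((a j r * (G r \<omega> \<bullet> phi j))\<^sup>2) \<partial>tmeas T)"
        by (simp add: nn_integral_cmult mult.left_commute)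
      also have "\<dots> \<le> ennreal T * (\<integral>\<^sup>+r. \<kappa> r * ennreal ((G r \<omega> \<bullet> phi j)\<^sup>2) \<partial>tmeas T)"
      proof (intro mult_left_mono nn_integral_mono)
        fix r assume "r \<in> space (tmeas T)"
        then have "ennreal (lam j powr s * (a j r)\<^sup>2) * ennreal ((G r \<omega> \<bullet> phi j)\<^sup>2)
            \<le> \<kappa> r * ennreal ((G r \<omega> \<bullet> phi j)\<^sup>2)"
          using le[of r j] by (intro mult_right_mono) auto
        then show "ennreal (lam j powr s) * ennreal ((a j r * (G r \<omega> \<bullet> phi j))\<^sup>2)
            \<le> \<kappa> r * ennreal ((G r \<omega> \<bullet> phi j)\<^sup>2)"
          by (simp add: power_mult_distrib mult.assoc flip: ennreal_mult)
      qed auto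
      finally show "ennreal (lam j powr s) * ennreal ((LINT r|tmeas T. a j r * (G r \<omega> \<bullet> phi j))\<^sup>2)
        \<le> ennreal T * (\<integral>\<^sup>+r. \<kappa> r * ennreal ((G r \<omega> \<bullet> phi j)\<^sup>2) \<partial>tmeas T)" .
    qed
    finally show "ennreal (lam j powr s) * esq (\<lambda>\<omega>. LINT r|tmeas T. a j r * (G r \<omega> \<bullet> phi j))
      \<le> (\<integral>\<^sup>+\<omega>. ennreal T * (\<integral>\<^sup>+r. \<kappa> r * ennreal ((G r \<omega> \<bullet> phi j)\<^sup>2) \<partial>tmeas T) \<partial>M)" .
  qed auto
  also have "\<dots> = (\<integral>\<^sup>+\<omega>. (\<Sum>j. ennreal T * (\<integral>\<^sup>+r. \<kappa> r * ennreal ((G r \<omega> \<bullet> phi j)\<^sup>2) \<partial>tmeas T)) \<partial>M)"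
    by (rule nn_integral_suminf[symmetric]) measurable
  also have "\<dots> = (\<integral>\<^sup>+\<omega>. ennreal T * (\<integral>\<^sup>+r. \<kappa> r * ennreal ((norm (G r \<omega>))\<^sup>2) \<partial>tmeas T) \<partial>M)"
  proof (rule nn_integral_cong)
    fix \<omega> assume [simp]: "\<omega> \<in> space M"
    have "(\<Sum>j. ennreal T * (\<integral>\<^sup>+r. \<kappa> r * ennreal ((G r \<omega> \<bullet> phi j)\<^sup>2) \<partial>tmeas T))
      = ennreal T * (\<integral>\<^sup>+r. (\<Sum>j. \<kappa> r * ennreal ((G r \<omega> \<bullet> phi j)\<^sup>2)) \<partial>tmeas T)"
      by (subst nn_integral_suminf) auto
    also have "(\<lambda>r. \<Sum>j. \<kappa> r * ennreal ((G r \<omega> \<bullet> phi j)\<^sup>2)) = (\<lambda>r. \<kappa> r * ennreal ((norm (G r \<omega>))\<^sup>2))"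
      using l2sq_coef by (simp add: l2sq_def coef_def)
    finally show "(\<Sum>j. ennreal T * (\<integral>\<^sup>+r. \<kappa> r * ennreal ((G r \<omega> \<bullet> phi j)\<^sup>2) \<partial>tmeas T))
      = ennreal T * (\<integral>\<^sup>+r. \<kappa> r * ennreal ((norm (G r \<omega>))\<^sup>2) \<partial>tmeas T)" .
  qed
  also have "\<dots> = ennreal T * (\<integral>\<^sup>+\<omega>. (\<integral>\<^sup>+r. \<kappa> r * ennreal ((norm (G r \<omega>))\<^sup>2) \<partial>tmeas T) \<partial>M)"
    by (rule nn_integral_cmult) measurable
  also have "(\<integral>\<^sup>+\<omega>. (\<integral>\<^sup>+r. \<kappa> r * ennreal ((norm (G r \<omega>))\<^sup>2) \<partial>tmeas T) \<partial>M)
    = (\<integral>\<^sup>+r. (\<integral>\<^sup>+\<omega>. \<kappa> r * ennreal ((norm (G r \<omega>))\<^sup>2) \<partial>M) \<partial>tmeas T)"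
    by (rule Fubini') measurable
  also have "\<dots> = (\<integral>\<^sup>+r. \<kappa> r * msq (G r) \<partial>tmeas T)"
    by (rule nn_integral_cong, rule nn_integral_cmult) measurable
  finally show ?thesis .
qed

end

section \<open>A Gronwall inequality for extended nonnegative functions\<close>

text \<open>The constant \<open>R\<close> only serves to make \<open>g\<close> bounded, so that a
  supremum exists; it does not enter the conclusion, which is why the result can be used on events
  depending on a parameter.\<close>

lemma gronwall_nn:
  fixes g :: "real \<Rightarrow> ennreal"
  assumes [measurable]: "g \<in> borel_measurable (tmeas T)"
    and "B > 0" "A \<ge> 0" "R \<ge> 0"
    and le: "\<And>t. t \<in> {0..T} \<Longrightarrow> g t \<le> ennreal A + ennreal B * (\<integral>\<^sup>+s. indicator {0..t} s * g s \<partial>tmeas T)"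
    and fin: "(\<integral>\<^sup>+s. g s \<partial>tmeas T) \<le> ennreal R"
    and t: "t \<in> {0..T}"
  shows "g t \<le> ennreal (2 * A * exp (2 * B * T))"
proof -
  have gb: "g s \<le> ennreal (A + B * R)" if "s \<in> {0..T}" for s
  proof -
    have "(\<integral>\<^sup>+x. indicator {0..s} x * g x \<partial>tmeas T) \<le> (\<integral>\<^sup>+x. g x \<partial>tmeas T)"
      by (intro nn_integral_mono) (auto simp: indicator_def)
    then have "g s \<le> ennreal A + ennreal B * ennreal R"
      using le[OF that] fin by (meson add_left_mono mult_left_mono order_trans zero_le)
    then show ?thesis using assms by (simp add: ennreal_mult ennreal_plus)
  qed
  define h where "h s = enn2real (g s)" for s
  have gh: "g s = ennreal (h s)" if "s \<in> {0..T}" for s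
    using le_less_trans[OF gb[OF that] ennreal_less_top] by (simp add: h_def)
  have h0: "h s \<ge> 0" for s by (simp add: h_def)
  have hb: "h s \<le> A + B * R" if "s \<in> {0..T}" for s
  proof -
    have "ennreal (h s) \<le> ennreal (A + B * R)" using gb[OF that] gh[OF that] by simp
    then show ?thesis using assms by (subst (asm) ennreal_le_iff) auto
  qed
  \<comment> \<open>With the weight \<open>exp (- (2 * B * s))\<close> the integral operator has
    norm at most 1/2 in the supremum norm, so \<open>G \<le> A + G / 2\<close>. This explains both
    factors 2 in the conclusion.\<close>
  define G where "G = (SUP s\<in>{0..T}. exp (- (2 * B * s)) * h s)"
  have bdd: "bdd_above ((\<lambda>s. exp (- (2 * B * s)) * h s) ` {0..T})"
  proof (rule bdd_aboveI2)
    fix s assume s: "s \<in> {0..T}"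
    have "exp (- (2 * B * s)) * h s \<le> 1 * (A + B * R)"
      using hb[OF s] h0 s \<open>B > 0\<close> by (intro mult_mono) auto
    then show "exp (- (2 * B * s)) * h s \<le> A + B * R" by simp
  qed
  have hG: "exp (- (2 * B * s)) * h s \<le> G" if "s \<in> {0..T}" for s
    unfolding G_def by (rule cSUP_upper[OF that bdd])
  have G0: "G \<ge> 0" by (rule order_trans[OF mult_nonneg_nonneg[OF exp_ge_zero h0] hG[OF t]])
  have "exp (- (2 * B * s)) * h s \<le> A + G / 2" if s: "s \<in> {0..T}" for s
  proof -
    have "ennreal (h s) \<le> ennreal A + ennreal B * (\<integral>\<^sup>+x. indicator {0..s} x * g x \<partial>tmeas T)"
      using le[OF s] gh[OF s] by simp
    also have "(\<integral>\<^sup>+x. indicator {0..s} x * g x \<partial>tmeas T)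
        = (\<integral>\<^sup>+x. indicator {0..s} x * g x * indicator {0..T} x \<partial>lborel)"
      by (rule nn_integral_tmeas)
    also have "\<dots> \<le> (\<integral>\<^sup>+x. ennreal (G * exp (2 * B * x)) * indicator {0..s} x \<partial>lborel)"
    proof (rule nn_integral_mono)
      fix x :: real
      have "g x \<le> ennreal (G * exp (2 * B * x))" if x: "x \<in> {0..T}"
      proof -
        have "h x = exp (2 * B * x) * (exp (- (2 * B * x)) * h x)" by (simp add: exp_minus)
        also have "\<dots> \<le> exp (2 * B * x) * G" by (intro mult_left_mono hG x) auto
        finally show ?thesis using gh[OF x] by (simp add: mult.commute ennreal_leI)
      qed
      then show "indicator {0..s} x * g x * indicator {0..T} x \<le> ennreal (G * exp (2 * B * x)) * indicator {0..s} x"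
        by (auto simp: indicator_def)
    qed
    also have "\<dots> = ennreal (G / (2 * B) * exp (2 * B * s) - G / (2 * B) * exp (2 * B * 0))"
    proof (rule nn_integral_FTC_Icc)
      show "((\<lambda>x. G / (2 * B) * exp (2 * B * x)) has_real_derivative G * exp (2 * B * x)) (at x)" for x
      proof -
        have "((\<lambda>x. G / (2 * B) * exp (2 * B * x)) has_real_derivative G / (2 * B) * (exp (2 * B * x) * (2 * B))) (at x)"
          by (intro DERIV_cmult) (auto intro!: derivative_eq_intros)
        moreover have "G / (2 * B) * (exp (2 * B * x) * (2 * B)) = G * exp (2 * B * x)"
          using \<open>B > 0\<close> by simp
        ultimately show ?thesis by (simp only:)
      qed
    qed (use s G0 in auto)
    also have "\<dots> \<le> ennreal (G / (2 * B) * exp (2 * B * s))"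
      using G0 \<open>B > 0\<close> by (intro ennreal_leI) simp
    finally have "ennreal (h s) \<le> ennreal A + ennreal B * ennreal (G / (2 * B) * exp (2 * B * s))"
      by (meson add_left_mono mult_left_mono order_trans zero_le)
    also have "\<dots> = ennreal (A + G / 2 * exp (2 * B * s))"
      using G0 assms by (simp add: ennreal_plus flip: ennreal_mult)
    finally have "h s \<le> A + G / 2 * exp (2 * B * s)"
      using G0 assms by (subst (asm) ennreal_le_iff) auto
    then have "exp (- (2 * B * s)) * h s \<le> exp (- (2 * B * s)) * (A + G / 2 * exp (2 * B * s))"
      by (intro mult_left_mono) auto
    also have "\<dots> = exp (- (2 * B * s)) * A + G / 2" by (simp add: distrib_left exp_minus)
    also have "\<dots> \<le> 1 * A + G / 2"
      using s assms by (intro add_right_mono mult_right_mono) auto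
    finally show ?thesis by simp
  qed
  then have "G \<le> A + G / 2" unfolding G_def by (intro cSUP_least) (use t in auto)
  then have "G \<le> 2 * A" by simp
  have "h t = exp (2 * B * t) * (exp (- (2 * B * t)) * h t)" by (simp add: exp_minus)
  also have "\<dots> \<le> exp (2 * B * T) * (2 * A)"
    by (rule mult_mono[OF _ order_trans[OF hG[OF t] \<open>G \<le> 2 * A\<close>]])
      (use t \<open>B > 0\<close> h0 in auto)
  finally show ?thesis using gh[OF t] by (simp add: mult.commute ennreal_leI)
qed

section \<open>Bounds for the convolution kernels\<close>

text \<open>The causal kernel extended by zero, so that integrals up to different times live over
  the same interval and can be subtracted. It is closed at both ends: at \<open>r = t\<close> it has
  the value \<open>c 0\<close>, which is 1 for \<open>s4\<close>.\<close>

definition kern :: "(real \<Rightarrow> real) \<Rightarrow> real \<Rightarrow> real \<Rightarrow> real" where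
  "kern c t r = (if 0 \<le> r \<and> r \<le> t then c (t - r) else 0)"

lemma s2_measurable [measurable]: "(\<lambda>t. s2 \<alpha> t \<mu>) \<in> borel_measurable borel"
  by (intro borel_measurable_continuous_onI continuous_at_imp_continuous_on ballI DERIV_isCont[OF s2_deriv])

lemma s4_measurable [measurable]: "(\<lambda>t. s4 \<alpha> t \<mu>) \<in> borel_measurable borel"
  by (intro borel_measurable_continuous_onI continuous_at_imp_continuous_on ballI DERIV_isCont[OF s4_deriv])

lemma kern_measurable [measurable (raw)]:
  assumes [measurable]: "c \<in> borel_measurable borel"
  shows "kern c t \<in> borel_measurable borel"
  unfolding kern_def by measurable

lemma kern_bound: "(\<And>x. 0 \<le> x \<Longrightarrow> x \<le> t \<Longrightarrow> \<bar>c x\<bar> \<le> B) \<Longrightarrow> 0 \<le> B \<Longrightarrow> \<bar>kern c t r\<bar> \<le> B"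
  by (auto simp: kern_def)

lemma square_le: "\<bar>x::real\<bar> \<le> y \<Longrightarrow> x\<^sup>2 \<le> y\<^sup>2"
  using power_mono[of "\<bar>x\<bar>" y 2] by simp

lemma nn_integral_exp_le:
  assumes "c > 0" "s \<ge> 0"
  shows "(\<integral>\<^sup>+r. ennreal (exp (- (c * (s - r)))) * indicator {0..s} r \<partial>lborel) \<le> ennreal (1 / c)"
proof -
  have "(\<integral>\<^sup>+r. ennreal (exp (- (c * (s - r)))) * indicator {0..s} r \<partial>lborel)
      = ennreal (1 / c * exp (- (c * (s - s))) - 1 / c * exp (- (c * (s - 0))))"
  proof (rule nn_integral_FTC_Icc)
    fix x
    have "((\<lambda>x. 1 / c * exp (- (c * (s - x)))) has_real_derivative 1 / c * (exp (- (c * (s - x))) * c)) (at x)"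
      by (intro DERIV_cmult) (auto intro!: derivative_eq_intros)
    then show "((\<lambda>x. 1 / c * exp (- (c * (s - x)))) has_real_derivative exp (- (c * (s - x)))) (at x)"
      using assms by simp
  qed (use assms in auto)
  also have "\<dots> \<le> ennreal (1 / c)" using assms by (intro ennreal_leI) simp
  finally show ?thesis .
qed

lemma nn_integral_indicator_Icc_le:
  "A \<ge> 0 \<Longrightarrow> (b::real) \<ge> a \<Longrightarrow> (\<integral>\<^sup>+r. ennreal A * indicator {a..b} r \<partial>lborel) = ennreal (A * (b - a))"
  by (simp add: nn_integral_cmult ennreal_mult)

lemma kern_s2_sq_integral:
  assumes "\<alpha> > 0" "\<mu> > 0" "0 \<le> t" "t \<le> T"
  shows "(\<integral>\<^sup>+r. ennreal ((kern (\<lambda>x. s2 \<alpha> x \<mu>) t r)\<^sup>2) \<partial>lborel) \<le> ennreal (T * (2 / \<alpha> / \<mu>)\<^sup>2)"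
proof -
  have "(\<integral>\<^sup>+r. ennreal ((kern (\<lambda>x. s2 \<alpha> x \<mu>) t r)\<^sup>2) \<partial>lborel)
      \<le> (\<integral>\<^sup>+r. ennreal ((2 / \<alpha> / \<mu>)\<^sup>2) * indicator {0..t} r \<partial>lborel)"
    using s2_bound[OF assms(1,2)]
    by (intro nn_integral_mono) (auto simp: kern_def indicator_def simp del: divide_divide_eq_left
        intro!: square_le ennreal_leI)
  also have "\<dots> = ennreal ((2 / \<alpha> / \<mu>)\<^sup>2 * (t - 0))"
    by (rule nn_integral_indicator_Icc_le) (use assms in auto)
  also have "\<dots> \<le> ennreal (T * (2 / \<alpha> / \<mu>)\<^sup>2)"
    using assms by (intro ennreal_leI) (simp add: mult.commute mult_left_mono)
  finally show ?thesis .
qed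

lemma exp_plus_sq_le: "0 \<le> y \<Longrightarrow> (exp (- y) + x)\<^sup>2 \<le> 2 * exp (- y) + 2 * (x::real)\<^sup>2"
proof -
  assume "0 \<le> y"
  then have "(exp (- y))\<^sup>2 \<le> exp (- y)" by (simp add: power2_eq_square mult_left_le)
  then show ?thesis using real_sq_add_le[of "exp (- y)" x] by linarith
qed

lemma nn_integral_exp_plus_le:
  assumes "c > 0" "0 \<le> s" "s \<le> T" "A \<ge> 0" "B \<ge> 0"
  shows "(\<integral>\<^sup>+r. ennreal (A * exp (- (c * (s - r))) + B) * indicator {0..s} r \<partial>lborel) \<le> ennreal (A / c + T * B)"
proof -
  have "(\<integral>\<^sup>+r. ennreal (A * exp (- (c * (s - r))) + B) * indicator {0..s} r \<partial>lborel)
     = (\<integral>\<^sup>+r. ennreal A * (ennreal (exp (- (c * (s - r)))) * indicator {0..s} r) + ennreal B * indicator {0..s} r \<partial>lborel)"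
    using assms by (intro nn_integral_cong) (auto simp: ennreal_plus ennreal_mult indicator_def)
  also have "\<dots> = ennreal A * (\<integral>\<^sup>+r. ennreal (exp (- (c * (s - r)))) * indicator {0..s} r \<partial>lborel)
     + (\<integral>\<^sup>+r. ennreal B * indicator {0..s} r \<partial>lborel)"
    by (subst nn_integral_add) (auto simp: nn_integral_cmult)
  also have "\<dots> \<le> ennreal A * ennreal (1 / c) + ennreal (B * (s - 0))"
    using assms by (intro add_mono mult_left_mono nn_integral_exp_le nn_integral_indicator_Icc_le[THEN eq_refl]) auto
  also have "\<dots> = ennreal (A / c + B * s)"
    using assms by (simp add: ennreal_plus flip: ennreal_mult)
  also have "\<dots> \<le> ennreal (A / c + T * B)"
    using assms by (intro ennreal_leI) (simp add: mult.commute mult_left_mono)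
  finally show ?thesis .
qed

text \<open>The exponential part integrates to a multiple of 1/\<mu>, the gain of one order over the
  pointwise bound. The remainder is of size 1/\<mu>^2, and one of its factors is absorbed by the
  lower bound \<open>L\<close>.\<close>

lemma kern_s4_sq_integral:
  assumes "\<alpha> > 0" "\<mu> \<ge> L" "L > 0" "0 \<le> t" "t \<le> T"
  shows "(\<integral>\<^sup>+r. ennreal ((kern (\<lambda>x. s4 \<alpha> x \<mu>) t r)\<^sup>2) \<partial>lborel)
    \<le> ennreal ((2 / \<alpha> + T * (2 * (2 / \<alpha> / \<alpha>)\<^sup>2 / L)) / \<mu>)"
proof -
  let ?x = "2 / \<alpha> / (\<alpha> * \<mu>)"
  have \<mu>: "\<mu> > 0" using assms by simp
  have "(\<integral>\<^sup>+r. ennreal ((kern (\<lambda>x. s4 \<alpha> x \<mu>) t r)\<^sup>2) \<partial>lborel)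
      \<le> (\<integral>\<^sup>+r. ennreal (2 * exp (- (\<alpha> * \<mu> * (t - r))) + 2 * ?x\<^sup>2) * indicator {0..t} r \<partial>lborel)"
  proof (rule nn_integral_mono)
    fix r
    have "(s4 \<alpha> (t - r) \<mu>)\<^sup>2 \<le> 2 * exp (- (\<alpha> * \<mu> * (t - r))) + 2 * ?x\<^sup>2" if "0 \<le> r" "r \<le> t"
      using square_le[OF s4_decay[OF assms(1) \<mu>, of "t - r"]] exp_plus_sq_le[of "\<alpha> * \<mu> * (t - r)" ?x] that assms
      by fastforce
    then show "ennreal ((kern (\<lambda>x. s4 \<alpha> x \<mu>) t r)\<^sup>2)
      \<le> ennreal (2 * exp (- (\<alpha> * \<mu> * (t - r))) + 2 * ?x\<^sup>2) * indicator {0..t} r"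
      by (auto simp: kern_def indicator_def simp del: ennreal_plus intro!: ennreal_leI)
  qed
  also have "\<dots> \<le> ennreal (2 / (\<alpha> * \<mu>) + T * (2 * ?x\<^sup>2))"
    by (rule nn_integral_exp_plus_le) (use assms in auto)
  also have "\<dots> \<le> ennreal ((2 / \<alpha> + T * (2 * (2 / \<alpha> / \<alpha>)\<^sup>2 / L)) / \<mu>)"
  proof (rule ennreal_leI)
    have "?x\<^sup>2 = (2 / \<alpha> / \<alpha>)\<^sup>2 / \<mu> / \<mu>" by (simp add: power2_eq_square)
    also have "\<dots> \<le> (2 / \<alpha> / \<alpha>)\<^sup>2 / L / \<mu>"
      using assms by (intro divide_right_mono divide_left_mono) auto
    finally have "T * (2 * ?x\<^sup>2) \<le> T * (2 * ((2 / \<alpha> / \<alpha>)\<^sup>2 / L / \<mu>))"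
      using assms by (intro mult_left_mono) auto
    then show "2 / (\<alpha> * \<mu>) + T * (2 * ?x\<^sup>2) \<le> (2 / \<alpha> + T * (2 * (2 / \<alpha> / \<alpha>)\<^sup>2 / L)) / \<mu>"
      by (simp add: add_divide_distrib)
  qed
  finally show ?thesis .
qed

text \<open>Because \<open>s2\<close> vanishes at time zero, its extension by zero has no jump and
  stays Lipschitz. The kernel of \<open>s4\<close> jumps, which is what makes the velocity
  harder.\<close>

lemma kern_s2_lipschitz:
  assumes "\<alpha> > 0" "\<mu> > 0" "s \<le> t"
  shows "\<bar>kern (\<lambda>x. s2 \<alpha> x \<mu>) t r - kern (\<lambda>x. s2 \<alpha> x \<mu>) s r\<bar> \<le> t - s"
  using s2_diff[OF assms(1,2), of "s - r" "t - r"] s2_le[OF assms(1,2), of "t - r"] assms(3)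
  by (auto simp: kern_def)

lemma s2_diff_decay:
  assumes "\<alpha> > 0" "\<mu> > 0" "0 \<le> x" "x \<le> y"
  shows "\<bar>s2 \<alpha> y \<mu> - s2 \<alpha> x \<mu>\<bar> \<le> (exp (- (\<alpha> * \<mu> * x)) + 2 / \<alpha> / (\<alpha> * \<mu>)) * (y - x)"
proof -
  let ?c = "exp (- (\<alpha> * \<mu> * x)) + 2 / \<alpha> / (\<alpha> * \<mu>)"
  have "\<bar>s2 \<alpha> y \<mu> - s2 \<alpha> x \<mu>\<bar> \<le> ?c * y - ?c * x"
  proof (rule derivative_bound_diff[where f' = "\<lambda>t. s4 \<alpha> t \<mu>" and g' = "\<lambda>_. ?c"])
    show "((*) ?c has_real_derivative ?c) (at z)" for z using DERIV_cmult_Id by blast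
    fix z assume "x \<le> z" "z \<le> y"
    then have "\<bar>s4 \<alpha> z \<mu>\<bar> \<le> exp (- (\<alpha> * \<mu> * z)) + 2 / \<alpha> / (\<alpha> * \<mu>)"
      using assms by (intro s4_decay) auto
    also have "\<dots> \<le> ?c" using \<open>x \<le> z\<close> assms by auto
    finally show "\<bar>s4 \<alpha> z \<mu>\<bar> \<le> ?c" .
  qed (use assms s2_deriv in auto)
  then show ?thesis by (simp only: right_diff_distrib)
qed

text \<open>Before \<open>s\<close> the increment is a time difference times the decay of
  \<open>s4\<close>, and the exponential integrates to 1/\<mu>. Between \<open>s\<close> and
  \<open>t\<close> only one kernel is present: one factor of its square is bounded by the length of
  the interval, the other by 2/(\<alpha> \<mu>), and the interval contributes its length once
  more.\<close>

lemma kern_s2_diff_sq_integral: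
  assumes "\<alpha> > 0" "\<mu> \<ge> L" "L > 0" "0 \<le> s" "s \<le> t" "t \<le> T"
  shows "(\<integral>\<^sup>+r. ennreal ((kern (\<lambda>x. s2 \<alpha> x \<mu>) t r - kern (\<lambda>x. s2 \<alpha> x \<mu>) s r)\<^sup>2) \<partial>lborel)
    \<le> ennreal ((2 / \<alpha> + T * (2 * (2 / \<alpha> / \<alpha>)\<^sup>2 / L) + 2 / \<alpha>) * (t - s)\<^sup>2 / \<mu>)"
proof -
  let ?x = "2 / \<alpha> / (\<alpha> * \<mu>)" and ?h = "t - s"
  have \<mu>: "\<mu> > 0" using assms by simp
  have "(\<integral>\<^sup>+r. ennreal ((kern (\<lambda>x. s2 \<alpha> x \<mu>) t r - kern (\<lambda>x. s2 \<alpha> x \<mu>) s r)\<^sup>2) \<partial>lborel)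
      \<le> (\<integral>\<^sup>+r. ennreal (2 * ?h\<^sup>2 * exp (- (\<alpha> * \<mu> * (s - r))) + 2 * ?h\<^sup>2 * ?x\<^sup>2) * indicator {0..s} r
          + ennreal (?h * (2 / \<alpha> / \<mu>)) * indicator {s..t} r \<partial>lborel)"
  proof (rule nn_integral_mono)
    fix r
    consider "0 \<le> r" "r \<le> s" | "s < r" "r \<le> t" | "r < 0 \<or> t < r" using assms by linarith
    then show "ennreal ((kern (\<lambda>x. s2 \<alpha> x \<mu>) t r - kern (\<lambda>x. s2 \<alpha> x \<mu>) s r)\<^sup>2)
      \<le> ennreal (2 * ?h\<^sup>2 * exp (- (\<alpha> * \<mu> * (s - r))) + 2 * ?h\<^sup>2 * ?x\<^sup>2) * indicator {0..s} r
          + ennreal (?h * (2 / \<alpha> / \<mu>)) * indicator {s..t} r"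
    proof cases
      case 1
      have "(s2 \<alpha> (t - r) \<mu> - s2 \<alpha> (s - r) \<mu>)\<^sup>2
          \<le> ((exp (- (\<alpha> * \<mu> * (s - r))) + ?x) * ?h)\<^sup>2"
        using s2_diff_decay[OF assms(1) \<mu>, of "s - r" "t - r"] 1 assms by (intro square_le) auto
      also have "\<dots> = (exp (- (\<alpha> * \<mu> * (s - r))) + ?x)\<^sup>2 * ?h\<^sup>2" by (rule power_mult_distrib)
      also have "\<dots> \<le> (2 * exp (- (\<alpha> * \<mu> * (s - r))) + 2 * ?x\<^sup>2) * ?h\<^sup>2"
        using 1 assms by (intro mult_right_mono exp_plus_sq_le) auto
      finally have "(s2 \<alpha> (t - r) \<mu> - s2 \<alpha> (s - r) \<mu>)\<^sup>2
          \<le> 2 * ?h\<^sup>2 * exp (- (\<alpha> * \<mu> * (s - r))) + 2 * ?h\<^sup>2 * ?x\<^sup>2"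
        by (simp only: distrib_left mult_ac)
      then have "ennreal ((s2 \<alpha> (t - r) \<mu> - s2 \<alpha> (s - r) \<mu>)\<^sup>2)
          \<le> ennreal (2 * ?h\<^sup>2 * exp (- (\<alpha> * \<mu> * (s - r))) + 2 * ?h\<^sup>2 * ?x\<^sup>2)"
        by (rule ennreal_leI)
      then show ?thesis using 1 assms by (simp add: kern_def add_increasing2 del: ennreal_plus)
    next
      case 2
      have "(s2 \<alpha> (t - r) \<mu>)\<^sup>2 = \<bar>s2 \<alpha> (t - r) \<mu>\<bar> * \<bar>s2 \<alpha> (t - r) \<mu>\<bar>" by (simp add: power2_eq_square)
      also have "\<dots> \<le> ?h * (2 / \<alpha> / \<mu>)"
        using s2_le[OF assms(1) \<mu>, of "t - r"] s2_bound[OF assms(1) \<mu>, of "t - r"] 2 assms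
        by (intro mult_mono) auto
      finally show ?thesis using 2 assms by (auto simp: kern_def intro!: ennreal_leI)
    next
      case 3
      then show ?thesis using assms by (auto simp: kern_def)
    qed
  qed
  also have "\<dots> = (\<integral>\<^sup>+r. ennreal (2 * ?h\<^sup>2 * exp (- (\<alpha> * \<mu> * (s - r))) + 2 * ?h\<^sup>2 * ?x\<^sup>2) * indicator {0..s} r \<partial>lborel)
      + (\<integral>\<^sup>+r. ennreal (?h * (2 / \<alpha> / \<mu>)) * indicator {s..t} r \<partial>lborel)"
    by (rule nn_integral_add) auto
  also have "\<dots> \<le> ennreal (2 * ?h\<^sup>2 / (\<alpha> * \<mu>) + T * (2 * ?h\<^sup>2 * ?x\<^sup>2)) + ennreal (?h * (2 / \<alpha> / \<mu>) * ?h)"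
    using assms \<mu> by (intro add_mono nn_integral_exp_plus_le nn_integral_indicator_Icc_le[THEN eq_refl]) auto
  also have "\<dots> = ennreal (2 * ?h\<^sup>2 / (\<alpha> * \<mu>) + T * (2 * ?h\<^sup>2 * ?x\<^sup>2) + ?h * (2 / \<alpha> / \<mu>) * ?h)"
    using assms \<mu> by (intro ennreal_plus[symmetric]) auto
  also have "\<dots> \<le> ennreal ((2 / \<alpha> + T * (2 * (2 / \<alpha> / \<alpha>)\<^sup>2 / L) + 2 / \<alpha>) * ?h\<^sup>2 / \<mu>)"
  proof (rule ennreal_leI)
    have "?x\<^sup>2 = (2 / \<alpha> / \<alpha>)\<^sup>2 / \<mu> / \<mu>" by (simp add: power2_eq_square)
    also have "\<dots> \<le> (2 / \<alpha> / \<alpha>)\<^sup>2 / L / \<mu>"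
      using assms \<mu> by (intro divide_right_mono divide_left_mono) auto
    finally have "T * (2 * ?h\<^sup>2 * ?x\<^sup>2) \<le> T * (2 * ?h\<^sup>2 * ((2 / \<alpha> / \<alpha>)\<^sup>2 / L / \<mu>))"
      using assms by (intro mult_left_mono) auto
    moreover have "(2 / \<alpha> + T * (2 * (2 / \<alpha> / \<alpha>)\<^sup>2 / L) + 2 / \<alpha>) * ?h\<^sup>2 / \<mu>
      = 2 * ?h\<^sup>2 / (\<alpha> * \<mu>) + T * (2 * ?h\<^sup>2 * ((2 / \<alpha> / \<alpha>)\<^sup>2 / L / \<mu>)) + ?h * (2 / \<alpha> / \<mu>) * ?h"
    proof -
      have "(2 / \<alpha> + T * (2 * y / L) + 2 / \<alpha>) * h\<^sup>2 / \<mu>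
        = 2 * h\<^sup>2 / (\<alpha> * \<mu>) + T * (2 * h\<^sup>2 * (y / L / \<mu>)) + h * (2 / \<alpha> / \<mu>) * h" for h y
        using assms \<mu> by (simp add: field_simps power2_eq_square)
      then show ?thesis .
    qed
    ultimately show "2 * ?h\<^sup>2 / (\<alpha> * \<mu>) + T * (2 * ?h\<^sup>2 * ?x\<^sup>2) + ?h * (2 / \<alpha> / \<mu>) * ?h
      \<le> (2 / \<alpha> + T * (2 * (2 / \<alpha> / \<alpha>)\<^sup>2 / L) + 2 / \<alpha>) * ?h\<^sup>2 / \<mu>" by linarith
  qed
  finally show ?thesis .
qed

lemma geometric_interpolation:
  fixes x A B \<delta> :: real
  assumes "0 \<le> x" "x \<le> A" "x \<le> B" "0 \<le> \<delta>" "\<delta> \<le> 1"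
  shows "x \<le> A powr \<delta> * B powr (1 - \<delta>)"
proof (cases "x = 0")
  case False
  then have "x = x powr \<delta> * x powr (1 - \<delta>)"
    using assms by (simp flip: powr_add)
  also have "\<dots> \<le> A powr \<delta> * B powr (1 - \<delta>)"
    using assms by (intro mult_mono powr_mono2) auto
  finally show ?thesis .
qed simp

section \<open>Regularity of the mild solution\<close>

lemma ennreal_affine: "a \<ge> 0 \<Longrightarrow> b \<ge> 0 \<Longrightarrow> x \<ge> 0 \<Longrightarrow> ennreal a + ennreal b * ennreal x = ennreal (a + b * x)"
  by (simp add: ennreal_plus ennreal_mult)

text \<open>A real number even if the moment is infinite, so that constants can be formed from it
  before condition (I) is assumed; under (I) it is the true moment.\<close>

definition moment2 :: "(nat \<Rightarrow> real) \<Rightarrow> 'w measure \<Rightarrow> real \<Rightarrow> ('w \<Rightarrow> nat \<Rightarrow> real) \<Rightarrow> real" where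
  "moment2 lam M s X = enn2real (\<integral>\<^sup>+\<omega>. l2sq (Apow lam (s/2) (X \<omega>)) \<partial>M)"

lemma in_Lp_moment2:
  assumes "in_Lp lam M 2 s X"
  shows "(\<integral>\<^sup>+\<omega>. l2sq (Apow lam (s/2) (X \<omega>)) \<partial>M) = ennreal (moment2 lam M s X)"
proof -
  have eq: "hnorm lam s (X \<omega>) powr 2 = enn2real (l2sq (Apow lam (s/2) (X \<omega>)))" for \<omega>
    by (cases "enn2real (l2sq (Apow lam (s/2) (X \<omega>))) = 0") (simp_all add: hnorm_def)
  have "(\<integral>\<^sup>+\<omega>. l2sq (Apow lam (s/2) (X \<omega>)) \<partial>M) = (\<integral>\<^sup>+\<omega>. ennreal (hnorm lam s (X \<omega>) powr 2) \<partial>M)"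
  proof (rule nn_integral_cong_AE)
    have "AE \<omega> in M. X \<omega> \<in> Hdot lam s" using assms by (simp add: in_Lp_def)
    then show "AE \<omega> in M. l2sq (Apow lam (s/2) (X \<omega>)) = ennreal (hnorm lam s (X \<omega>) powr 2)"
      by eventually_elim (simp add: eq Hdot_def)
  qed
  also have "\<dots> < \<infinity>"
    using assms unfolding in_Lp_def integrable_iff_bounded by (simp add: eq)
  finally show ?thesis unfolding moment2_def by simp
qed

lemma suminf_commute_ennreal:
  fixes f :: "nat \<Rightarrow> nat \<Rightarrow> ennreal"
  shows "(\<Sum>i. \<Sum>j. f i j) = (\<Sum>j. \<Sum>i. f i j)"
proof -
  have "(\<Sum>i. \<Sum>j. f i j) = (\<integral>\<^sup>+i. (\<Sum>j. f i j) \<partial>count_space UNIV)"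
    by (simp add: nn_integral_count_space_nat)
  also have "\<dots> = (\<Sum>j. \<integral>\<^sup>+i. f i j \<partial>count_space UNIV)"
    by (rule nn_integral_suminf) simp
  finally show ?thesis by (simp add: nn_integral_count_space_nat)
qed

context eigen begin

lemma norm_Sop_le:
  assumes "\<And>j. \<bar>c (lam j)\<bar> \<le> B" shows "norm (Sop lam phi c x) \<le> B * norm x"
proof -
  have B: "B \<ge> 0" using assms[of 0] by linarith
  have "(norm (Sop lam phi c x))\<^sup>2 \<le> B\<^sup>2 * (norm x)\<^sup>2"
  proof (rule sums_le[OF _ parseval sums_mult[OF parseval]])
    fix j
    show "(Sop lam phi c x \<bullet> phi j)\<^sup>2 \<le> B\<^sup>2 * (x \<bullet> phi j)\<^sup>2"
      using square_le[OF assms[of j]] by (simp add: coef_Sop[of c B, OF assms] power_mult_distrib mult_right_mono)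
  qed
  then show ?thesis
    using B by (metis mult_nonneg_nonneg norm_ge_zero power2_le_imp_le power_mult_distrib)
qed

text \<open>The boundedness of the multipliers makes the vector integral converge, and only then may
  the inner product with an eigenvector be pulled inside. The second claim is recorded because later
  differences of integrals need it.\<close>

lemma integral_Sop:
  assumes [measurable]: "\<And>\<mu>. (\<lambda>t. c t \<mu>) \<in> borel_measurable borel"
    and B: "\<And>s j. 0 \<le> s \<Longrightarrow> s \<le> T \<Longrightarrow> \<bar>c s (lam j)\<bar> \<le> B"
    and g [measurable]: "g \<in> borel_measurable (tmeas T)"
    and fin: "(\<integral>\<^sup>+s. ennreal (norm (g s)) \<partial>tmeas T) < \<infinity>"
    and t: "t \<in> {0..T}"
  shows "coef phi (LBINT s:{0..t}. Sop lam phi (c (t - s)) (g s)) j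
     = (LINT s|tmeas T. kern (\<lambda>x. c x (lam j)) t s * (g s \<bullet> phi j))"
    and "integrable (tmeas T) (\<lambda>s. kern (\<lambda>x. c x (lam j)) t s * (g s \<bullet> phi j))"
proof -
  define h where "h s = (indicator {0..t} s :: real) *\<^sub>R Sop lam phi (c (t - s)) (g s)" for s
  have B0: "B \<ge> 0" using B[of 0 0] t by force
  have Bt: "\<bar>c (t - s) (lam j)\<bar> \<le> B" if "s \<in> {0..t}" for s j using B[of "t - s" j] that t by auto
  have hj: "h s \<bullet> phi j = kern (\<lambda>x. c x (lam j)) t s * (g s \<bullet> phi j)" for s j
    using coef_Sop[of "c (t - s)" B "g s" j, OF Bt]
    by (cases "s \<in> {0..t}") (auto simp: h_def kern_def)
  have hn: "norm (h s) \<le> B * norm (g s)" for s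
    using norm_Sop_le[of "c (t - s)" B "g s", OF Bt] B0 by (cases "s \<in> {0..t}") (auto simp: h_def)
  have kb: "kern (\<lambda>x. c x (lam j)) t \<in> borel_measurable (tmeas T)" for j
    by (intro borel_tmeas kern_measurable) simp
  \<comment> \<open>\<open>Sop\<close> is defined by a series, so measurability of the integrand is
    obtained from its partial sums, which depend on time through the scalar kernels only.\<close>
  have h [measurable]: "h \<in> borel_measurable (tmeas T)"
  proof (rule borel_measurable_LIMSEQ_metric)
    note [measurable] = kb
    show "(\<lambda>s. \<Sum>j<i. (kern (\<lambda>x. c x (lam j)) t s * (g s \<bullet> phi j)) *\<^sub>R phi j) \<in> borel_measurable (tmeas T)" for i
      by measurable
    show "(\<lambda>i. \<Sum>j<i. (kern (\<lambda>x. c x (lam j)) t s * (g s \<bullet> phi j)) *\<^sub>R phi j) \<longlonglongrightarrow> h s" for s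
      using coef_sums[of "h s"] by (simp add: hj sums_def)
  qed
  have int: "integrable (tmeas T) h"
    unfolding integrable_iff_bounded
  proof (intro conjI h)
    have "(\<integral>\<^sup>+s. ennreal (norm (h s)) \<partial>tmeas T) \<le> (\<integral>\<^sup>+s. ennreal B * ennreal (norm (g s)) \<partial>tmeas T)"
      using hn B0 by (intro nn_integral_mono) (simp add: ennreal_leI flip: ennreal_mult)
    also have "\<dots> = ennreal B * (\<integral>\<^sup>+s. ennreal (norm (g s)) \<partial>tmeas T)"
      by (rule nn_integral_cmult) simp
    also have "\<dots> < \<infinity>" using fin by (simp add: ennreal_mult_less_top)
    finally show "(\<integral>\<^sup>+s. ennreal (norm (h s)) \<partial>tmeas T) < \<infinity>" .
  qed
  have "(LBINT s:{0..t}. Sop lam phi (c (t - s)) (g s)) = (LINT s|tmeas T. h s)"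
    unfolding set_lebesgue_integral_def integral_tmeas h_def
    by (rule Bochner_Integration.integral_cong) (use t in \<open>auto simp: indicator_def\<close>)
  then have "coef phi (LBINT s:{0..t}. Sop lam phi (c (t - s)) (g s)) j = (LINT s|tmeas T. h s \<bullet> phi j)"
    unfolding coef_def using int by simp
  then show "coef phi (LBINT s:{0..t}. Sop lam phi (c (t - s)) (g s)) j
     = (LINT s|tmeas T. kern (\<lambda>x. c x (lam j)) t s * (g s \<bullet> phi j))"
    by (simp only: hj)
  show "integrable (tmeas T) (\<lambda>s. kern (\<lambda>x. c x (lam j)) t s * (g s \<bullet> phi j))"
    using integrable_inner_left[of "phi j" "tmeas T" h] int by (simp only: hj simp_thms)
qed

end

section \<open>The mild solution in coordinates\<close>

locale damped = wiener lam phi M T Filt Q Qh W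
  for lam :: "nat \<Rightarrow> real" and phi :: "nat \<Rightarrow> 'h::{real_inner,banach,second_countable_topology}"
    and M :: "'w measure" and T :: real and Filt :: "real \<Rightarrow> 'w measure"
    and Q Qh :: "'h \<Rightarrow> 'h" and W :: "real \<Rightarrow> 'h \<Rightarrow> 'w \<Rightarrow> real" +
  fixes \<alpha> \<gamma> K q f0 :: real and F :: "'h \<Rightarrow> 'h"
    and u0 :: "'w \<Rightarrow> 'h" and v0 :: "'w \<Rightarrow> nat \<Rightarrow> real"
    and u :: "real \<Rightarrow> 'w \<Rightarrow> 'h" and v :: "real \<Rightarrow> 'w \<Rightarrow> nat \<Rightarrow> real"
  assumes \<alpha>: "\<alpha> > 0" and K: "K > 0" and \<gamma>: "-1 < \<gamma>" "\<gamma> \<le> 2"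
    and HS: "hilbert_schmidt phi (\<lambda>x. Apow lam ((\<gamma> - 1)/2) (coef phi (Qh x)))"
    and HSq: "HS_norm phi (\<lambda>x. Apow lam ((\<gamma> - 1)/2) (coef phi (Qh x))) = q"
    and lip: "norm (F x - F y) \<le> K * norm (x - y)" and F0: "norm (F 0) = f0"
    and init: "cond_I lam phi M Filt \<gamma> u0 v0"
    and mild: "mild_solution lam phi \<alpha> T M Filt \<gamma> Qh W F u0 v0 u v"
begin

text \<open>Condition (N) weights the output of \<open>Qh\<close>, while a coordinate of the noise
  sees \<open>Qh (phi j)\<close>. Symmetry of \<open>Qh\<close> and an exchange of the two sums
  convert one into the other: an operator and its adjoint have the same Hilbert-Schmidt
  norm.\<close>

lemma noise_sum: "(\<Sum>j. ennreal (lam j powr (\<gamma> - 1) * (norm (Qh (phi j)))\<^sup>2)) = ennreal (q\<^sup>2)"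
proof -
  have sq: "(lam j powr ((\<gamma> - 1)/2) * z)\<^sup>2 = lam j powr (\<gamma> - 1) * z\<^sup>2" for z j
    by (simp add: power_mult_distrib powr_add[symmetric] power2_eq_square[of "_ powr _"])
  let ?H = "HSsq phi (\<lambda>x. Apow lam ((\<gamma> - 1)/2) (coef phi (Qh x)))"
  have "?H = (\<Sum>k. \<Sum>j. ennreal (lam j powr (\<gamma> - 1) * (Qh (phi j) \<bullet> phi k)\<^sup>2))"
  proof -
    have "Qh (phi k) \<bullet> phi j = Qh (phi j) \<bullet> phi k" for j k by (metis Qh_sym inner_commute)
    then show ?thesis unfolding HSsq_def l2sq_def Apow_def coef_def sq by simp
  qed
  also have "\<dots> = (\<Sum>j. \<Sum>k. ennreal (lam j powr (\<gamma> - 1) * (Qh (phi j) \<bullet> phi k)\<^sup>2))"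
    by (rule suminf_commute_ennreal)
  also have "\<dots> = (\<Sum>j. ennreal (lam j powr (\<gamma> - 1) * (norm (Qh (phi j)))\<^sup>2))"
    by (intro suminf_cong suminf_ennreal_eq sums_mult parseval) auto
  finally have "?H = (\<Sum>j. ennreal (lam j powr (\<gamma> - 1) * (norm (Qh (phi j)))\<^sup>2))" .
  moreover have "?H = ennreal (q\<^sup>2)"
    using HS unfolding HSq[symmetric] HS_norm_def hilbert_schmidt_def by simp
  ultimately show ?thesis by simp
qed

definition mexp :: real where "mexp = min 2 (\<gamma> + 1)"
definition U0 :: real where "U0 = moment2 lam M mexp (\<lambda>\<omega>. coef phi (u0 \<omega>))"
definition V0 :: real where "V0 = moment2 lam M \<gamma> v0"

lemma u0_coef_measurable [measurable]: "(\<lambda>\<omega>. u0 \<omega> \<bullet> phi j) \<in> borel_measurable M"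
  and v0_measurable [measurable]: "(\<lambda>\<omega>. v0 \<omega> j) \<in> borel_measurable M"
  and U0: "hsum mexp (\<lambda>j \<omega>. u0 \<omega> \<bullet> phi j) = ennreal U0"
  and V0: "hsum \<gamma> (\<lambda>j \<omega>. v0 \<omega> j) = ennreal V0"
  and U0_nonneg: "U0 \<ge> 0" and V0_nonneg: "V0 \<ge> 0"
proof -
  have L: "in_Lp lam M 2 mexp (\<lambda>\<omega>. coef phi (u0 \<omega>))" "in_Lp lam M 2 \<gamma> v0"
    using init unfolding cond_I_def mexp_def by auto
  show 1: "(\<lambda>\<omega>. u0 \<omega> \<bullet> phi j) \<in> borel_measurable M" for j
    using L(1) unfolding in_Lp_def coef_def by auto
  show 2: "(\<lambda>\<omega>. v0 \<omega> j) \<in> borel_measurable M" for j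
    using L(2) unfolding in_Lp_def by auto
  show "hsum mexp (\<lambda>j \<omega>. u0 \<omega> \<bullet> phi j) = ennreal U0"
    using in_Lp_moment2[OF L(1)] by (simp add: hsum_l2sq[OF 1] U0_def coef_def[abs_def])
  show "hsum \<gamma> (\<lambda>j \<omega>. v0 \<omega> j) = ennreal V0"
    using in_Lp_moment2[OF L(2)] by (simp add: hsum_l2sq[OF 2] V0_def)
qed (simp_all add: U0_def V0_def moment2_def)

text \<open>The generators of the predictable sigma algebra are measurable rectangles. Joint
  measurability is all that is used later, in the theorem of Fubini.\<close>

lemma predictable_measurable:
  assumes f: "f \<in> measurable (predictable T M Filt) N"
  shows "f \<in> measurable (tmeas T \<Otimes>\<^sub>M M) N"
proof -
  let ?G = "{{s<..t} \<times> B | s t B. 0 \<le> s \<and> s \<le> t \<and> t \<le> T \<and> B \<in> sets (Filt s)} \<union>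
      {{0} \<times> B | B. B \<in> sets (Filt 0)}"
  have B: "B \<in> sets M" "B \<subseteq> space M" if "B \<in> sets (Filt s)" "s \<in> {0..T}" for B s
    using subalg[OF that(2)] that(1) sets.sets_into_space[of B M] by (auto simp: subalgebra_def)
  have G: "?G \<subseteq> Pow ({0..T} \<times> space M)"
    using B T by fastforce
  have iv: "A \<in> sets (tmeas T)" if "A \<subseteq> {0..T}" "A \<in> sets borel" for A
    using that by (simp add: tmeas_def sets_restrict_space_iff)
  have "?G \<subseteq> sets (tmeas T \<Otimes>\<^sub>M M)"
  proof
    fix E assume "E \<in> ?G"
    then consider s t B where "E = {s<..t} \<times> B" "0 \<le> s" "s \<le> t" "t \<le> T" "B \<in> sets (Filt s)"
      | B where "E = {0} \<times> B" "B \<in> sets (Filt 0)" by blast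
    then show "E \<in> sets (tmeas T \<Otimes>\<^sub>M M)"
    proof cases
      case 1
      then show ?thesis using B(1)[of B s] by (auto intro!: pair_measureI iv)
    next
      case 2
      then show ?thesis using B(1)[of B 0] T by (auto intro!: pair_measureI iv)
    qed
  qed
  then have "sigma_sets ({0..T} \<times> space M) ?G \<subseteq> sets (tmeas T \<Otimes>\<^sub>M M)"
    using sets.sigma_sets_subset[of ?G "tmeas T \<Otimes>\<^sub>M M"] by (simp add: space_pair_measure)
  then have "sets (predictable T M Filt) \<subseteq> sets (tmeas T \<Otimes>\<^sub>M M)"
    unfolding predictable_def using sets_measure_of[OF G] by simp
  moreover have "space (predictable T M Filt) = space (tmeas T \<Otimes>\<^sub>M M)"
    unfolding predictable_def using space_measure_of[OF G] by (simp add: space_pair_measure)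
  ultimately show ?thesis using f measurable_mono[of N N "predictable T M Filt" "tmeas T \<Otimes>\<^sub>M M"] by auto
qed

lemma u_joint [measurable]: "(\<lambda>(t, \<omega>). u t \<omega>) \<in> borel_measurable (tmeas T \<Otimes>\<^sub>M M)"
  and v_joint: "(\<lambda>(t, \<omega>). v t \<omega> j) \<in> borel_measurable (tmeas T \<Otimes>\<^sub>M M)"
  using mild unfolding mild_solution_def by (auto intro: predictable_measurable)

lemma u_measurable [measurable (raw)]: "t \<in> {0..T} \<Longrightarrow> u t \<in> borel_measurable M"
  using measurable_compose_Pair1[OF _ u_joint, of t] by simp

lemma v_measurable [measurable (raw)]: "t \<in> {0..T} \<Longrightarrow> (\<lambda>\<omega>. v t \<omega> j) \<in> borel_measurable M"
  using measurable_compose_Pair1[OF _ v_joint, of t] by simp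

lemma u_path_measurable: "\<omega> \<in> space M \<Longrightarrow> (\<lambda>t. u t \<omega>) \<in> borel_measurable (tmeas T)"
  using measurable_Pair2[OF u_joint] by simp

lemma F_measurable [measurable]: "F \<in> borel_measurable borel"
proof (rule borel_measurable_continuous_onI)
  have "(K)-lipschitz_on UNIV F"
    using lip K by (intro lipschitz_onI) (auto simp: dist_norm)
  then show "continuous_on UNIV F" by (rule lipschitz_on_continuous_on)
qed

lemma norm_F_le: "norm (F x) \<le> f0 + K * norm x"
  using lip[of x 0] norm_triangle_ineq2[of "F x" "F 0"] F0 by simp

lemma f0_nonneg: "f0 \<ge> 0" using F0 norm_ge_zero by metis

lemma norm_F_sq_le: "(norm (F x))\<^sup>2 \<le> 2 * f0\<^sup>2 + 2 * K\<^sup>2 * (norm x)\<^sup>2"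
proof -
  have "(norm (F x))\<^sup>2 \<le> (f0 + K * norm x)\<^sup>2" using norm_F_le by (intro power_mono) auto
  also have "\<dots> \<le> 2 * f0\<^sup>2 + 2 * (K * norm x)\<^sup>2" by (rule real_sq_add_le)
  finally show ?thesis by (simp add: power_mult_distrib mult.assoc)
qed

definition usq :: "'w \<Rightarrow> ennreal" where
  "usq \<omega> = (\<integral>\<^sup>+s. ennreal ((norm (u s \<omega>))\<^sup>2) \<partial>tmeas T)"

lemma usq_finite: "AE \<omega> in M. usq \<omega> < \<infinity>"
proof -
  have "AE \<omega> in M. (\<integral>\<^sup>+s\<in>{0..T}.
        (ennreal ((norm (u s \<omega>))\<^sup>2) + l2sq (Apow lam (min \<gamma> 0 / 2) (v s \<omega>))) \<partial>lborel) < \<infinity>"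
    using mild unfolding mild_solution_def by blast
  then show ?thesis
  proof eventually_elim
    case (elim \<omega>)
    have "usq \<omega> \<le> (\<integral>\<^sup>+s\<in>{0..T}. (ennreal ((norm (u s \<omega>))\<^sup>2) + l2sq (Apow lam (min \<gamma> 0 / 2) (v s \<omega>))) \<partial>lborel)"
      unfolding usq_def nn_integral_tmeas by (intro nn_integral_mono mult_right_mono) auto
    then show ?case using elim by (rule le_less_trans)
  qed
qed

lemma Fu_path_integrable:
  assumes "\<omega> \<in> space M" "usq \<omega> < \<infinity>"
  shows "(\<integral>\<^sup>+s. ennreal (norm (F (u s \<omega>))) \<partial>tmeas T) < \<infinity>"
proof -
  note [measurable] = u_path_measurable[OF assms(1)]
  have "(\<integral>\<^sup>+s. ennreal (norm (F (u s \<omega>))) \<partial>tmeas T)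
      \<le> (\<integral>\<^sup>+s. ennreal (f0 + K) + ennreal K * ennreal ((norm (u s \<omega>))\<^sup>2) \<partial>tmeas T)"
  proof (rule nn_integral_mono)
    fix s
    have "norm (u s \<omega>) \<le> 1 + (norm (u s \<omega>))\<^sup>2"
    proof -
      have "2 * norm (u s \<omega>) \<le> (norm (u s \<omega>))\<^sup>2 + 1"
        using sum_squares_bound[of "norm (u s \<omega>)" 1] by simp
      then show ?thesis using norm_ge_zero[of "u s \<omega>"] by linarith
    qed
    then have "K * norm (u s \<omega>) \<le> K * (1 + (norm (u s \<omega>))\<^sup>2)" using K by (intro mult_left_mono) auto
    then have "norm (F (u s \<omega>)) \<le> (f0 + K) + K * (norm (u s \<omega>))\<^sup>2"
      using norm_F_le[of "u s \<omega>"] by (simp add: distrib_left)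
    then have "ennreal (norm (F (u s \<omega>))) \<le> ennreal ((f0 + K) + K * (norm (u s \<omega>))\<^sup>2)"
      by (rule ennreal_leI)
    then show "ennreal (norm (F (u s \<omega>))) \<le> ennreal (f0 + K) + ennreal K * ennreal ((norm (u s \<omega>))\<^sup>2)"
      using f0_nonneg K by (simp only: ennreal_affine add_nonneg_nonneg less_imp_le zero_le_power2)
  qed
  also have "\<dots> = ennreal (f0 + K) * emeasure (tmeas T) (space (tmeas T)) + ennreal K * usq \<omega>"
    unfolding usq_def by (subst nn_integral_add) (auto simp: nn_integral_cmult)
  also have "\<dots> < \<infinity>"
    using assms T by (simp add: emeasure_tmeas ennreal_mult_less_top del: space_tmeas)
  finally show ?thesis .
qed

definition k2 :: "real \<Rightarrow> nat \<Rightarrow> real \<Rightarrow> real" where "k2 t j = kern (\<lambda>x. s2 \<alpha> x (lam j)) t"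
definition k4 :: "real \<Rightarrow> nat \<Rightarrow> real \<Rightarrow> real" where "k4 t j = kern (\<lambda>x. s4 \<alpha> x (lam j)) t"

lemma k_measurable [measurable]: "k2 t j \<in> borel_measurable borel" "k4 t j \<in> borel_measurable borel"
  unfolding k2_def k4_def by measurable

lemma k_measurable' [measurable]: "k2 t j \<in> borel_measurable (tmeas T)" "k4 t j \<in> borel_measurable (tmeas T)"
  by (intro borel_tmeas k_measurable)+

lemma s2_uniform: "0 \<le> s \<Longrightarrow> \<bar>s2 \<alpha> s (lam j)\<bar> \<le> 2 / \<alpha> / lam 0"
proof -
  assume "0 \<le> s"
  have "2 / \<alpha> / lam j \<le> 2 / \<alpha> / lam 0"
    using \<alpha> lam_pos[of j] lam0 lam_ge[of j] by (intro divide_left_mono) auto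
  then show ?thesis using s2_bound[OF \<alpha> lam_pos \<open>0 \<le> s\<close>, of j] by linarith
qed

lemma mild_formula:
  assumes t: "t \<in> {0..T}"
  shows "\<exists>(I2 :: 'w \<Rightarrow> 'h) (I4 :: 'w \<Rightarrow> nat \<Rightarrow> real).
    is_stoch_integral lam phi M W Qh 0 0 t
      (\<lambda>s x. coef phi (Sop lam phi (s2 \<alpha> (t - s)) x)) (\<lambda>\<omega>. coef phi (I2 \<omega>)) \<and>
    is_stoch_integral lam phi M W Qh (min \<gamma> 0) 0 t
      (\<lambda>s x. coef phi (Sop lam phi (s4 \<alpha> (t - s)) x)) I4 \<and>
    (AE \<omega> in M.
       (\<forall>j. coef phi (u t \<omega>) j =
          Sseq lam (s1 \<alpha> t) (coef phi (u0 \<omega>)) j + Sseq lam (s2 \<alpha> t) (v0 \<omega>) j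
          + coef phi (LBINT s:{0..t}. Sop lam phi (s2 \<alpha> (t - s)) (F (u s \<omega>))) j
          + coef phi (I2 \<omega>) j) \<and>
       (\<forall>j. v t \<omega> j =
          Sseq lam (s3 \<alpha> t) (coef phi (u0 \<omega>)) j + Sseq lam (s4 \<alpha> t) (v0 \<omega>) j
          + coef phi (LBINT s:{0..t}. Sop lam phi (s4 \<alpha> (t - s)) (F (u s \<omega>))) j
          + I4 \<omega> j))"
  using mild t unfolding mild_solution_def by blast

text \<open>A single null set serves all coordinates. The noise coordinate is characterised by its
  kernel alone, which fixes it up to null sets.\<close>

lemma u_decomp:
  assumes t: "t \<in> {0..T}"
  obtains Z where "\<And>j. wint (\<lambda>r. k2 t j r *\<^sub>R phi j) (Z j)"
    "AE \<omega> in M. \<forall>j. u t \<omega> \<bullet> phi j = s1 \<alpha> t (lam j) * (u0 \<omega> \<bullet> phi j) + s2 \<alpha> t (lam j) * v0 \<omega> j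
       + (LINT r|tmeas T. k2 t j r * (F (u r \<omega>) \<bullet> phi j)) + Z j \<omega>"
proof -
  obtain I2 :: "'w \<Rightarrow> 'h" where I2: "is_stoch_integral lam phi M W Qh 0 0 t
          (\<lambda>s x. coef phi (Sop lam phi (s2 \<alpha> (t - s)) x)) (\<lambda>\<omega>. coef phi (I2 \<omega>))"
    and eq: "AE \<omega> in M. \<forall>j. coef phi (u t \<omega>) j =
              Sseq lam (s1 \<alpha> t) (coef phi (u0 \<omega>)) j + Sseq lam (s2 \<alpha> t) (v0 \<omega>) j
              + coef phi (LBINT s:{0..t}. Sop lam phi (s2 \<alpha> (t - s)) (F (u s \<omega>))) j
              + coef phi (I2 \<omega>) j"
    using mild_formula[OF t] that by (auto elim: eventually_mono)
  show ?thesis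
  proof (rule that)
    show "wint (\<lambda>r. k2 t j r *\<^sub>R phi j) (\<lambda>\<omega>. coef phi (I2 \<omega>) j)" for j
    proof (rule is_stoch_integral_coord[OF I2])
      fix s x assume s: "s \<in> {0..t}"
      have "coef phi (Sop lam phi (s2 \<alpha> (t - s)) x) j = s2 \<alpha> (t - s) (lam j) * (x \<bullet> phi j)"
        unfolding coef_def by (rule coef_Sop[where B = "2 / \<alpha> / lam 0"], rule s2_uniform) (use s in auto)
      then show "coef phi (Sop lam phi (s2 \<alpha> (t - s)) x) j = (k2 t j s *\<^sub>R phi j) \<bullet> x"
        using s by (simp add: k2_def kern_def inner_commute)
    qed (use t in \<open>auto simp: k2_def kern_def\<close>)
    show "AE \<omega> in M. \<forall>j. u t \<omega> \<bullet> phi j = s1 \<alpha> t (lam j) * (u0 \<omega> \<bullet> phi j) + s2 \<alpha> t (lam j) * v0 \<omega> j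
       + (LINT r|tmeas T. k2 t j r * (F (u r \<omega>) \<bullet> phi j)) + coef phi (I2 \<omega>) j"
      using eq usq_finite AE_space
    proof eventually_elim
      case (elim \<omega>)
      note [measurable] = u_path_measurable[OF elim(3)]
      have "coef phi (LBINT s:{0..t}. Sop lam phi (s2 \<alpha> (t - s)) (F (u s \<omega>))) j
        = (LINT r|tmeas T. k2 t j r * (F (u r \<omega>) \<bullet> phi j))" for j
        unfolding k2_def
        by (rule integral_Sop(1)[where c = "s2 \<alpha>" and B = "2 / \<alpha> / lam 0"])
          (use s2_uniform Fu_path_integrable[OF elim(3,2)] t in auto)
      then show ?case using elim(1) by (simp add: Sseq_def coef_def)
    qed
  qed
qed

lemma v_decomp:
  assumes t: "t \<in> {0..T}"
  obtains Z where "\<And>j. wint (\<lambda>r. k4 t j r *\<^sub>R phi j) (Z j)"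
    "AE \<omega> in M. \<forall>j. v t \<omega> j = s3 \<alpha> t (lam j) * (u0 \<omega> \<bullet> phi j) + s4 \<alpha> t (lam j) * v0 \<omega> j
       + (LINT r|tmeas T. k4 t j r * (F (u r \<omega>) \<bullet> phi j)) + Z j \<omega>"
proof -
  obtain I4 :: "'w \<Rightarrow> nat \<Rightarrow> real" where I4: "is_stoch_integral lam phi M W Qh (min \<gamma> 0) 0 t
          (\<lambda>s x. coef phi (Sop lam phi (s4 \<alpha> (t - s)) x)) I4"
    and eq: "AE \<omega> in M. \<forall>j. v t \<omega> j =
              Sseq lam (s3 \<alpha> t) (coef phi (u0 \<omega>)) j + Sseq lam (s4 \<alpha> t) (v0 \<omega>) j
              + coef phi (LBINT s:{0..t}. Sop lam phi (s4 \<alpha> (t - s)) (F (u s \<omega>))) j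
              + I4 \<omega> j"
    using mild_formula[OF t] that by (auto elim: eventually_mono)
  have s4u: "\<bar>s4 \<alpha> s (lam j)\<bar> \<le> 1" if "0 \<le> s" for s j by (rule s4_bound[OF \<alpha> lam_pos that])
  show ?thesis
  proof (rule that)
    show "wint (\<lambda>r. k4 t j r *\<^sub>R phi j) (\<lambda>\<omega>. I4 \<omega> j)" for j
    proof (rule is_stoch_integral_coord[OF I4])
      fix s x assume s: "s \<in> {0..t}"
      have "coef phi (Sop lam phi (s4 \<alpha> (t - s)) x) j = s4 \<alpha> (t - s) (lam j) * (x \<bullet> phi j)"
        unfolding coef_def by (rule coef_Sop[where B = 1], rule s4u) (use s in auto)
      then show "coef phi (Sop lam phi (s4 \<alpha> (t - s)) x) j = (k4 t j s *\<^sub>R phi j) \<bullet> x"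
        using s by (simp add: k4_def kern_def inner_commute)
    qed (use t in \<open>auto simp: k4_def kern_def\<close>)
    show "AE \<omega> in M. \<forall>j. v t \<omega> j = s3 \<alpha> t (lam j) * (u0 \<omega> \<bullet> phi j) + s4 \<alpha> t (lam j) * v0 \<omega> j
       + (LINT r|tmeas T. k4 t j r * (F (u r \<omega>) \<bullet> phi j)) + I4 \<omega> j"
      using eq usq_finite AE_space
    proof eventually_elim
      case (elim \<omega>)
      note [measurable] = u_path_measurable[OF elim(3)]
      have "coef phi (LBINT s:{0..t}. Sop lam phi (s4 \<alpha> (t - s)) (F (u s \<omega>))) j
        = (LINT r|tmeas T. k4 t j r * (F (u r \<omega>) \<bullet> phi j))" for j
        unfolding k4_def
        by (rule integral_Sop(1)[where c = "s4 \<alpha>" and B = 1])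
          (use s4u Fu_path_integrable[OF elim(3,2)] t in auto)
      then show ?case using elim(1) by (simp add: Sseq_def coef_def)
    qed
  qed
qed

end

lemma ennreal_affine_nested:
  assumes "a \<ge> 0" "b \<ge> 0" "c \<ge> 0" "d \<ge> 0" "t \<ge> 0"
  shows "2 * ennreal a + 2 * (ennreal t * (ennreal b * (ennreal (t * c) + ennreal d * x)))
    = ennreal (2 * a + 2 * (t * (t * (b * c)))) + ennreal (2 * (t * (b * d))) * x"
  using assms
  by (simp add: ennreal_plus ennreal_mult distrib_left mult.assoc add.assoc mult.left_commute[of "ennreal b" "ennreal t"])

lemma (in wiener) hsum_add_le:
  assumes "\<And>j. X j \<in> borel_measurable M" "\<And>j. Y j \<in> borel_measurable M"
    and "hsum s X \<le> ennreal a" "hsum s Y \<le> ennreal b" "0 \<le> a" "0 \<le> b"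
  shows "hsum s (\<lambda>j \<omega>. X j \<omega> + Y j \<omega>) \<le> ennreal (2 * a + 2 * b)"
proof -
  have "hsum s (\<lambda>j \<omega>. X j \<omega> + Y j \<omega>) \<le> 2 * ennreal a + 2 * ennreal b"
    by (rule order_trans[OF hsum_add[OF assms(1,2)]]) (intro add_mono mult_left_mono assms; simp)
  also have "\<dots> = ennreal (2 * a + 2 * b)" using assms by (simp add: ennreal_plus ennreal_mult)
  finally show ?thesis .
qed

lemma (in wiener) hsum_mult_le:
  assumes "\<And>j. X j \<in> borel_measurable M"
    and "\<And>j. lam j powr s * (c j)\<^sup>2 \<le> B * lam j powr s'" and "B \<ge> 0"
    and "hsum s' X \<le> ennreal a" "0 \<le> a"
  shows "hsum s (\<lambda>j \<omega>. c j * X j \<omega>) \<le> ennreal (B * a)"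
  using order_trans[OF hsum_mult[OF assms(1-3)] mult_left_mono[OF assms(4)]] assms
  by (simp add: ennreal_mult)

lemma (in wiener) hsum_exponent_le:
  assumes "\<And>j. X j \<in> borel_measurable M" "s \<le> s'"
    and "hsum s' X \<le> ennreal a" "0 \<le> a"
  shows "hsum s X \<le> ennreal (lam 0 powr (s - s') * a)"
  using hsum_mult_le[of X s "\<lambda>_. 1" "lam 0 powr (s - s')" s' a] lam_powr_le[OF assms(2)] assms
  by simp

lemma (in eigen) lam_powr_div_sq: "lam j powr s * (x / lam j)\<^sup>2 = x\<^sup>2 * lam j powr (s - 2)"
proof -
  have "lam j powr (s - 2) = lam j powr s / (lam j)\<^sup>2"
    using lam_pos[of j] by (simp add: powr_diff)
  then show ?thesis by (simp add: power_divide)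
qed

lemma (in wiener) hsum_drift_const:
  assumes "(\<lambda>(r, \<omega>). G r \<omega>) \<in> borel_measurable (tmeas T \<Otimes>\<^sub>M M)"
    and "\<And>j. a j \<in> borel_measurable (tmeas T)"
    and le: "\<And>j r. r \<in> {0..T} \<Longrightarrow> lam j powr s * (a j r)\<^sup>2 \<le> c"
    and E: "\<And>r. r \<in> {0..T} \<Longrightarrow> msq (G r) \<le> ennreal e" "0 \<le> c" "0 \<le> e"
  shows "hsum s (\<lambda>j \<omega>. LINT r|tmeas T. a j r * (G r \<omega> \<bullet> phi j)) \<le> ennreal (T * (T * (c * e)))"
proof -
  have "hsum s (\<lambda>j \<omega>. LINT r|tmeas T. a j r * (G r \<omega> \<bullet> phi j))
    \<le> ennreal T * (\<integral>\<^sup>+r. ennreal c * msq (G r) \<partial>tmeas T)"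
    by (rule hsum_drift) (use assms in \<open>auto intro!: ennreal_leI\<close>)
  also have "\<dots> \<le> ennreal T * (\<integral>\<^sup>+r. ennreal (c * e) \<partial>tmeas T)"
    using E by (intro mult_left_mono nn_integral_mono) (auto simp: ennreal_mult intro!: mult_left_mono)
  also have "\<dots> = ennreal (T * (T * (c * e)))"
    using T E by (simp add: emeasure_tmeas ennreal_mult mult.commute del: space_tmeas)
  finally show ?thesis .
qed

text \<open>The first bound is of second order in the time increment, the second gains more powers
  of the eigenvalue. Their geometric mean with weight \<delta> trades regularity in time for
  regularity in space.\<close>

lemma (in eigen) interpolated_power:
  assumes "0 \<le> x" "x \<le> A * h\<^sup>2 * lam j powr a" "x \<le> B * lam j powr c"
    "0 \<le> \<delta>" "\<delta> \<le> 1" "0 \<le> A" "0 \<le> B" "0 \<le> h"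
  shows "x \<le> A powr \<delta> * B powr (1 - \<delta>) * h powr (2 * \<delta>) * lam j powr (a * \<delta> + c * (1 - \<delta>))"
proof -
  have h: "(h\<^sup>2) powr \<delta> = h powr (2 * \<delta>)"
    using assms by (cases "h = 0") (simp_all add: powr_powr flip: powr_numeral)
  have "x \<le> (A * h\<^sup>2 * lam j powr a) powr \<delta> * (B * lam j powr c) powr (1 - \<delta>)"
    using assms by (intro geometric_interpolation) auto
  also have "\<dots> = A powr \<delta> * B powr (1 - \<delta>) * h powr (2 * \<delta>) * lam j powr (a * \<delta> + c * (1 - \<delta>))"
    using assms lam_pos[of j] by (simp add: powr_mult powr_powr h powr_add)
  finally show ?thesis .
qed

section \<open>Second moments of u and its spatial regularity\<close>

context damped begin

lemma mexp_bounds: "0 < mexp" "mexp \<le> 2" "mexp \<le> \<gamma> + 1"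
  using \<gamma> by (auto simp: mexp_def)

lemma k2_bound: "r \<in> {0..T} \<Longrightarrow> \<bar>k2 t j r\<bar> \<le> 2 / \<alpha> / lam j"
  unfolding k2_def using \<alpha> lam_pos[of j] by (intro kern_bound s2_bound) auto

lemma k_integrable:
  assumes "\<omega> \<in> space M" "usq \<omega> < \<infinity>" "t \<in> {0..T}"
  shows "integrable (tmeas T) (\<lambda>r. k2 t j r * (F (u r \<omega>) \<bullet> phi j))"
    and "integrable (tmeas T) (\<lambda>r. k4 t j r * (F (u r \<omega>) \<bullet> phi j))"
proof -
  note [measurable] = u_path_measurable[OF assms(1)]
  show "integrable (tmeas T) (\<lambda>r. k2 t j r * (F (u r \<omega>) \<bullet> phi j))"
    unfolding k2_def by (rule integral_Sop(2)[where c = "s2 \<alpha>" and B = "2 / \<alpha> / lam 0"])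
      (use s2_uniform Fu_path_integrable[OF assms(1,2)] assms(3) in auto)
  show "integrable (tmeas T) (\<lambda>r. k4 t j r * (F (u r \<omega>) \<bullet> phi j))"
    unfolding k4_def by (rule integral_Sop(2)[where c = "s4 \<alpha>" and B = 1])
      (use s4_bound[OF \<alpha> lam_pos] Fu_path_integrable[OF assms(1,2)] assms(3) in auto)
qed

lemma Fu_joint [measurable]: "(\<lambda>(r, \<omega>). F (u r \<omega>)) \<in> borel_measurable (tmeas T \<Otimes>\<^sub>M M)"
  using measurable_compose[OF u_joint F_measurable] by (simp add: case_prod_beta')

lemma drift2_measurable [measurable]: "(\<lambda>\<omega>. LINT r|tmeas T. k2 t j r * (F (u r \<omega>) \<bullet> phi j)) \<in> borel_measurable M"
  and drift4_measurable [measurable]: "(\<lambda>\<omega>. LINT r|tmeas T. k4 t j r * (F (u r \<omega>) \<bullet> phi j)) \<in> borel_measurable M"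
  by (rule drift_measurable[OF Fu_joint k_measurable'(1)], rule drift_measurable[OF Fu_joint k_measurable'(2)])

lemma usq_measurable [measurable]: "usq \<in> borel_measurable M"
proof -
  interpret tm: sigma_finite_measure "tmeas T"
    by (rule finite_measure.sigma_finite_measure[OF finite_tmeas])
  have [measurable]: "(\<lambda>(\<omega>, r). u r \<omega>) \<in> borel_measurable (M \<Otimes>\<^sub>M tmeas T)"
    using measurable_pair_swap[OF u_joint] by simp
  show ?thesis unfolding usq_def[abs_def] by measurable
qed

text \<open>The constants are explicit because the one in the theorem has to be chosen before the noise,
  the nonlinearity and the solution: they depend on the data only through \<open>lam\<close>, \<open>\<alpha>\<close>, \<open>T\<close>, \<open>\<gamma>\<close>,
  \<open>K\<close>, \<open>q\<close>, \<open>f0\<close> and the moments \<open>U0\<close> and \<open>V0\<close> of the initial values.\<close>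

definition CA :: real where
  "CA = 2 * (2 * U0 + 2 * ((2 / \<alpha>)\<^sup>2 * lam 0 powr (mexp - 2 - \<gamma>) * V0))
     + 2 * (4 * (T * (2 / \<alpha>)\<^sup>2 * lam 0 powr (mexp - 2 - (\<gamma> - 1))) * q\<^sup>2)"

lemma CA_nonneg: "CA \<ge> 0"
  unfolding CA_def using U0_nonneg V0_nonneg T by (intro add_nonneg_nonneg mult_nonneg_nonneg) auto

text \<open>All terms of the mild formula except the drift. As \<open>s2\<close> gains two orders of
  the eigenvalue in the squared norm, the initial velocity needs
  \<open>mexp - 2 \<le> \<gamma>\<close> and the noise \<open>mexp - 2 \<le> \<gamma> - 1\<close>.
  The second is the binding one and leads to the order \<gamma> + 1; the cap 2 in
  \<open>mexp\<close> is the most that the drift allows.\<close>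

lemma homogeneous_bound:
  assumes t: "t \<in> {0..T}" and Z: "\<And>j. wint (\<lambda>r. k2 t j r *\<^sub>R phi j) (Z j)"
  shows "hsum mexp (\<lambda>j \<omega>. s1 \<alpha> t (lam j) * (u0 \<omega> \<bullet> phi j) + s2 \<alpha> t (lam j) * v0 \<omega> j + Z j \<omega>) \<le> ennreal CA"
  unfolding CA_def
\<comment> \<open>The sum is nested to the left, and the bound for its inner sum is the third
  premise of \<open>hsum_add_le\<close>.\<close>
proof (rule hsum_add_le, rule_tac[3] hsum_add_le)
  have [measurable]: "Z j \<in> borel_measurable M" for j by (rule wint_measurable[OF Z])
  show "hsum mexp (\<lambda>j \<omega>. s1 \<alpha> t (lam j) * (u0 \<omega> \<bullet> phi j)) \<le> ennreal U0"
  proof -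
    have "hsum mexp (\<lambda>j \<omega>. s1 \<alpha> t (lam j) * (u0 \<omega> \<bullet> phi j)) \<le> ennreal (1 * U0)"
    proof (rule hsum_mult_le)
      fix j
      have "(s1 \<alpha> t (lam j))\<^sup>2 \<le> 1"
        using square_le[OF s1_bound[OF \<alpha> lam_pos, of t j]] t by simp
      then show "lam j powr mexp * (s1 \<alpha> t (lam j))\<^sup>2 \<le> 1 * lam j powr mexp"
        by (simp add: mult_left_le)
    qed (use U0 U0_nonneg in auto)
    then show ?thesis by simp
  qed
  show "hsum mexp (\<lambda>j \<omega>. s2 \<alpha> t (lam j) * v0 \<omega> j) \<le> ennreal ((2 / \<alpha>)\<^sup>2 * lam 0 powr (mexp - 2 - \<gamma>) * V0)"
  proof (rule hsum_mult_le)
    fix j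
    have "lam j powr mexp * (s2 \<alpha> t (lam j))\<^sup>2 \<le> lam j powr mexp * (2 / \<alpha> / lam j)\<^sup>2"
      using square_le[OF s2_bound[OF \<alpha> lam_pos, of t j]] t by (intro mult_left_mono) auto
    also have "\<dots> = (2 / \<alpha>)\<^sup>2 * lam j powr (mexp - 2)" by (rule lam_powr_div_sq)
    also have "\<dots> \<le> (2 / \<alpha>)\<^sup>2 * (lam 0 powr (mexp - 2 - \<gamma>) * lam j powr \<gamma>)"
      using mexp_bounds by (intro mult_left_mono lam_powr_le) auto
    finally show "lam j powr mexp * (s2 \<alpha> t (lam j))\<^sup>2 \<le> (2 / \<alpha>)\<^sup>2 * lam 0 powr (mexp - 2 - \<gamma>) * lam j powr \<gamma>"
      by (simp add: mult.assoc)
  qed (use V0 V0_nonneg in auto)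
  show "hsum mexp Z \<le> ennreal (4 * (T * (2 / \<alpha>)\<^sup>2 * lam 0 powr (mexp - 2 - (\<gamma> - 1))) * q\<^sup>2)"
  proof -
    have "hsum mexp Z \<le> ennreal (4 * (T * (2 / \<alpha>)\<^sup>2 * lam 0 powr (mexp - 2 - (\<gamma> - 1))))
        * (\<Sum>j. ennreal (lam j powr (\<gamma> - 1) * (norm (Qh (phi j)))\<^sup>2))"
    proof (rule hsum_noise[OF Z])
      fix j
      show "(\<integral>\<^sup>+r. ennreal ((k2 t j r)\<^sup>2) \<partial>lborel) \<le> ennreal (T * (2 / \<alpha> / lam j)\<^sup>2)"
        unfolding k2_def using t by (intro kern_s2_sq_integral \<alpha> lam_pos) auto
      have "lam j powr mexp * (T * (2 / \<alpha> / lam j)\<^sup>2) = T * (lam j powr mexp * (2 / \<alpha> / lam j)\<^sup>2)" by simp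
      also have "\<dots> = T * ((2 / \<alpha>)\<^sup>2 * lam j powr (mexp - 2))" by (simp only: lam_powr_div_sq)
      also have "\<dots> \<le> T * ((2 / \<alpha>)\<^sup>2 * (lam 0 powr (mexp - 2 - (\<gamma> - 1)) * lam j powr (\<gamma> - 1)))"
        using mexp_bounds T by (intro mult_left_mono lam_powr_le) auto
      finally show "lam j powr mexp * (T * (2 / \<alpha> / lam j)\<^sup>2)
        \<le> T * (2 / \<alpha>)\<^sup>2 * lam 0 powr (mexp - 2 - (\<gamma> - 1)) * lam j powr (\<gamma> - 1)"
        by (simp add: mult.assoc)
    qed (use T in auto)
    also have "\<dots> = ennreal (4 * (T * (2 / \<alpha>)\<^sup>2 * lam 0 powr (mexp - 2 - (\<gamma> - 1))) * q\<^sup>2)"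
      unfolding noise_sum using T by (intro ennreal_mult[symmetric]) auto
    finally show ?thesis .
  qed
qed (use wint_measurable[OF Z] U0_nonneg V0_nonneg T in auto)

text \<open>\<open>MA\<close> and \<open>MB\<close> are the two coefficients of the Gronwall
  inequality for the localised second moment of \<open>u\<close>: the former collects everything but
  the drift together with the part of the drift from \<open>f0\<close>, the latter the linear growth
  of \<open>F\<close>.\<close>

definition MA :: real where
  "MA = 2 * (lam 0 powr (0 - mexp) * CA) + 2 * (T * (T * ((2 / \<alpha> / lam 0)\<^sup>2 * (2 * f0\<^sup>2))))"
definition MB :: real where
  "MB = 2 * (T * ((2 / \<alpha> / lam 0)\<^sup>2 * (2 * K\<^sup>2)))"
definition CU :: real where "CU = 2 * MA * exp (2 * MB * T)"
definition CF :: real where "CF = 2 * f0\<^sup>2 + 2 * K\<^sup>2 * CU"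

lemma MA_nonneg: "MA \<ge> 0" and MB_pos: "MB > 0"
  using CA_nonneg T K \<alpha> lam0 by (auto simp: MA_def MB_def)

lemma CU_nonneg: "CU \<ge> 0" and CF_nonneg: "CF \<ge> 0"
  using MA_nonneg by (auto simp: CU_def CF_def)

lemma F_moment_le:
  assumes [measurable]: "X \<in> borel_measurable M" "A \<in> sets M"
  shows "msq (\<lambda>\<omega>. indicator A \<omega> *\<^sub>R F (X \<omega>))
    \<le> ennreal (2 * f0\<^sup>2) + ennreal (2 * K\<^sup>2) * msq (\<lambda>\<omega>. indicator A \<omega> *\<^sub>R X \<omega>)"
proof -
  have "msq (\<lambda>\<omega>. indicator A \<omega> *\<^sub>R F (X \<omega>))
      \<le> (\<integral>\<^sup>+\<omega>. ennreal (2 * f0\<^sup>2) + ennreal (2 * K\<^sup>2) * ennreal ((norm (indicator A \<omega> *\<^sub>R X \<omega>))\<^sup>2) \<partial>M)"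
  proof (rule nn_integral_mono)
    fix \<omega>
    have "(norm (indicator A \<omega> *\<^sub>R F (X \<omega>)))\<^sup>2 \<le> 2 * f0\<^sup>2 + 2 * K\<^sup>2 * (norm (indicator A \<omega> *\<^sub>R X \<omega>))\<^sup>2"
      using norm_F_sq_le[of "X \<omega>"] by (simp add: indicator_def)
    then show "ennreal ((norm (indicator A \<omega> *\<^sub>R F (X \<omega>)))\<^sup>2)
      \<le> ennreal (2 * f0\<^sup>2) + ennreal (2 * K\<^sup>2) * ennreal ((norm (indicator A \<omega> *\<^sub>R X \<omega>))\<^sup>2)"
      by (subst ennreal_affine) (auto intro!: ennreal_leI simp del: ennreal_plus)
  qed
  also have "\<dots> = ennreal (2 * f0\<^sup>2) + ennreal (2 * K\<^sup>2) * msq (\<lambda>\<omega>. indicator A \<omega> *\<^sub>R X \<omega>)"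
    by (subst nn_integral_add) (auto simp: nn_integral_cmult emeasure_space_1)
  finally show ?thesis .
qed

text \<open>A priori only the paths of \<open>u\<close> are square integrable in time, so Gronwall's inequality is
  applied on the event where the path norm is at most \<open>n\<close>; the bound does not depend on \<open>n\<close>.\<close>

lemma localised_moment:
  assumes t: "t \<in> {0..T}"
  shows "msq (\<lambda>\<omega>. indicator {\<omega>\<in>space M. usq \<omega> \<le> of_nat n} \<omega> *\<^sub>R u t \<omega>) \<le> ennreal CU"
proof -
  define A where "A = {\<omega>\<in>space M. usq \<omega> \<le> of_nat n}"
  have A [measurable]: "A \<in> sets M" unfolding A_def by measurable
  define g where "g t = msq (\<lambda>\<omega>. indicator A \<omega> *\<^sub>R u t \<omega>)" for t
  have joint: "(\<lambda>(r, \<omega>). indicator A \<omega> *\<^sub>R u r \<omega>) \<in> borel_measurable (tmeas T \<Otimes>\<^sub>M M)"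
    "(\<lambda>(r, \<omega>). indicator A \<omega> *\<^sub>R F (u r \<omega>)) \<in> borel_measurable (tmeas T \<Otimes>\<^sub>M M)"
    by measurable
  note [measurable] = joint
  have g_meas [measurable]: "g \<in> borel_measurable (tmeas T)"
    unfolding g_def by measurable
  interpret pair_sigma_finite "tmeas T" M by (rule pair_sigma_finite_tmeas)
  have [measurable]: "(\<lambda>(\<omega>, r). u r \<omega>) \<in> borel_measurable (M \<Otimes>\<^sub>M tmeas T)"
    using measurable_pair_swap[OF u_joint] by simp
  have "(\<integral>\<^sup>+s. g s \<partial>tmeas T)
      = (\<integral>\<^sup>+\<omega>. (\<integral>\<^sup>+s. ennreal ((norm (indicator A \<omega> *\<^sub>R u s \<omega>))\<^sup>2) \<partial>tmeas T) \<partial>M)"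
    unfolding g_def by (rule Fubini'[symmetric]) measurable
  also have "\<dots> \<le> (\<integral>\<^sup>+\<omega>. ennreal (real n) \<partial>M)"
  proof (rule nn_integral_mono)
    fix \<omega> assume "\<omega> \<in> space M"
    show "(\<integral>\<^sup>+s. ennreal ((norm (indicator A \<omega> *\<^sub>R u s \<omega>))\<^sup>2) \<partial>tmeas T) \<le> ennreal (real n)"
      by (cases "\<omega> \<in> A") (auto simp: A_def usq_def ennreal_of_nat_eq_real_of_nat)
  qed
  also have "\<dots> = ennreal (real n)" by (simp add: emeasure_space_1)
  finally have fin: "(\<integral>\<^sup>+s. g s \<partial>tmeas T) \<le> ennreal (real n)" .
  have "g t \<le> ennreal MA + ennreal MB * (\<integral>\<^sup>+s. indicator {0..t} s * g s \<partial>tmeas T)" if t: "t \<in> {0..T}" for t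
  proof -
    obtain Z where Z: "\<And>j. wint (\<lambda>r. k2 t j r *\<^sub>R phi j) (Z j)"
      and eq: "AE \<omega> in M. \<forall>j. u t \<omega> \<bullet> phi j = s1 \<alpha> t (lam j) * (u0 \<omega> \<bullet> phi j) + s2 \<alpha> t (lam j) * v0 \<omega> j
       + (LINT r|tmeas T. k2 t j r * (F (u r \<omega>) \<bullet> phi j)) + Z j \<omega>"
      using u_decomp[OF t] by blast
    have [measurable]: "Z j \<in> borel_measurable M" for j by (rule wint_measurable[OF Z])
    define X where "X j \<omega> = s1 \<alpha> t (lam j) * (u0 \<omega> \<bullet> phi j) + s2 \<alpha> t (lam j) * v0 \<omega> j + Z j \<omega>" for j \<omega>
    have [measurable]: "X j \<in> borel_measurable M" for j unfolding X_def by measurable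
    \<comment> \<open>An indicator of an event commutes with the time integral, so the localisation
      passes into the drift and the localised moment reappears there.\<close>
    define Y where "Y j \<omega> = (LINT r|tmeas T. k2 t j r * ((indicator A \<omega> *\<^sub>R F (u r \<omega>)) \<bullet> phi j))" for j \<omega>
    have [measurable]: "Y j \<in> borel_measurable M" for j
      unfolding Y_def using drift_measurable[OF joint(2) k_measurable'(1)] by simp
    have "g t = hsum 0 (\<lambda>j \<omega>. (indicator A \<omega> *\<^sub>R u t \<omega>) \<bullet> phi j)"
      unfolding g_def using t by (intro hsum_norm[symmetric]) measurable
    also have "\<dots> = hsum 0 (\<lambda>j \<omega>. indicator A \<omega> * X j \<omega> + Y j \<omega>)"
    proof (rule hsum_cong_AE)
      fix j
      show "AE \<omega> in M. (indicator A \<omega> *\<^sub>R u t \<omega>) \<bullet> phi j = indicator A \<omega> * X j \<omega> + Y j \<omega>"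
        using eq by eventually_elim (auto simp: X_def Y_def indicator_def algebra_simps)
    qed
    also have "\<dots> \<le> 2 * hsum 0 (\<lambda>j \<omega>. indicator A \<omega> * X j \<omega>) + 2 * hsum 0 Y"
      by (rule hsum_add) measurable
    also have "\<dots> \<le> 2 * ennreal (lam 0 powr (0 - mexp) * CA)
        + 2 * (ennreal T * (ennreal ((2 / \<alpha> / lam 0)\<^sup>2) *
           (ennreal (T * (2 * f0\<^sup>2)) + ennreal (2 * K\<^sup>2) * (\<integral>\<^sup>+s. indicator {0..t} s * g s \<partial>tmeas T))))"
    proof (intro add_mono mult_left_mono)
      \<comment> \<open>The event depends on the whole path and is not adapted, so it is not moved
        into the stochastic integral. It is simply dropped, since the bound for these terms holds
        without it.\<close>
      have "hsum 0 (\<lambda>j \<omega>. indicator A \<omega> * X j \<omega>) \<le> hsum 0 X"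
        unfolding hsum_def esq_def
        by (intro suminf_le mult_left_mono nn_integral_mono) (auto simp: indicator_def)
      also have "\<dots> \<le> ennreal (lam 0 powr (0 - mexp) * CA)"
        using homogeneous_bound[OF t Z] mexp_bounds CA_nonneg
        by (intro hsum_exponent_le) (auto simp: X_def[abs_def])
      finally show "hsum 0 (\<lambda>j \<omega>. indicator A \<omega> * X j \<omega>) \<le> ennreal (lam 0 powr (0 - mexp) * CA)" .
      have "hsum 0 Y \<le> ennreal T * (\<integral>\<^sup>+r. (ennreal ((2 / \<alpha> / lam 0)\<^sup>2) * indicator {0..t} r)
          * msq (\<lambda>\<omega>. indicator A \<omega> *\<^sub>R F (u r \<omega>)) \<partial>tmeas T)"
        unfolding Y_def
      proof (rule hsum_drift[OF joint(2) k_measurable'(1)])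
        fix j r assume r: "r \<in> {0..T}"
        have "(k2 t j r)\<^sup>2 \<le> (2 / \<alpha> / lam 0)\<^sup>2"
          unfolding k2_def using s2_uniform \<alpha> lam0 by (intro square_le kern_bound) auto
        then show "ennreal (lam j powr 0 * (k2 t j r)\<^sup>2) \<le> ennreal ((2 / \<alpha> / lam 0)\<^sup>2) * indicator {0..t} r"
          using lam_pos[of j] by (auto simp: indicator_def k2_def kern_def ennreal_leI)
      qed (intro borel_tmeas; measurable)
      also have "(\<integral>\<^sup>+r. (ennreal ((2 / \<alpha> / lam 0)\<^sup>2) * indicator {0..t} r)
          * msq (\<lambda>\<omega>. indicator A \<omega> *\<^sub>R F (u r \<omega>)) \<partial>tmeas T)
        \<le> (\<integral>\<^sup>+r. ennreal ((2 / \<alpha> / lam 0)\<^sup>2) *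
            (ennreal (2 * f0\<^sup>2) + ennreal (2 * K\<^sup>2) * (indicator {0..t} r * g r)) \<partial>tmeas T)"
      proof (rule nn_integral_mono)
        fix r assume "r \<in> space (tmeas T)"
        then have [measurable]: "u r \<in> borel_measurable M" using u_measurable by simp
        show "(ennreal ((2 / \<alpha> / lam 0)\<^sup>2) * indicator {0..t} r)
            * msq (\<lambda>\<omega>. indicator A \<omega> *\<^sub>R F (u r \<omega>))
          \<le> ennreal ((2 / \<alpha> / lam 0)\<^sup>2) *
            (ennreal (2 * f0\<^sup>2) + ennreal (2 * K\<^sup>2) * (indicator {0..t} r * g r))"
          using F_moment_le[of "u r" A] by (auto simp: indicator_def g_def intro!: mult_left_mono)
      qed
      also have "\<dots> = ennreal ((2 / \<alpha> / lam 0)\<^sup>2) *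
           (ennreal (T * (2 * f0\<^sup>2)) + ennreal (2 * K\<^sup>2) * (\<integral>\<^sup>+s. indicator {0..t} s * g s \<partial>tmeas T))"
      proof -
        have [measurable]: "(indicator {0..t} :: real \<Rightarrow> ennreal) \<in> borel_measurable (tmeas T)"
          by (intro borel_tmeas) measurable
        show ?thesis
        proof -
          have "(\<integral>\<^sup>+r. ennreal (2 * f0\<^sup>2) + ennreal (2 * K\<^sup>2) * (indicator {0..t} r * g r) \<partial>tmeas T)
            = (\<integral>\<^sup>+r. ennreal (2 * f0\<^sup>2) \<partial>tmeas T) + (\<integral>\<^sup>+r. ennreal (2 * K\<^sup>2) * (indicator {0..t} r * g r) \<partial>tmeas T)"
            by (rule nn_integral_add) auto
          also have "(\<integral>\<^sup>+r. ennreal (2 * f0\<^sup>2) \<partial>tmeas T) = ennreal (2 * f0\<^sup>2) * ennreal T"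
            using T by (simp add: emeasure_tmeas del: space_tmeas)
          also have "\<dots> = ennreal (T * (2 * f0\<^sup>2))"
            using T by (subst ennreal_mult[symmetric]) (auto simp: mult.commute)
          also have "(\<integral>\<^sup>+r. ennreal (2 * K\<^sup>2) * (indicator {0..t} r * g r) \<partial>tmeas T)
            = ennreal (2 * K\<^sup>2) * (\<integral>\<^sup>+r. indicator {0..t} r * g r \<partial>tmeas T)"
            by (rule nn_integral_cmult) auto
          finally show ?thesis by (subst nn_integral_cmult) auto
        qed
      qed
      finally show "hsum 0 Y \<le> ennreal T * (ennreal ((2 / \<alpha> / lam 0)\<^sup>2) *
           (ennreal (T * (2 * f0\<^sup>2)) + ennreal (2 * K\<^sup>2) * (\<integral>\<^sup>+s. indicator {0..t} s * g s \<partial>tmeas T)))"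
        by (simp add: mult_left_mono)
    qed auto
    also have "\<dots> = ennreal MA + ennreal MB * (\<integral>\<^sup>+s. indicator {0..t} s * g s \<partial>tmeas T)"
      unfolding MA_def MB_def using CA_nonneg T by (intro ennreal_affine_nested) auto
    finally show ?thesis .
  qed
  then have "g t \<le> ennreal CU"
    unfolding CU_def using fin t MA_nonneg MB_pos by (intro gronwall_nn[where R = "real n"]) auto
  then show ?thesis by (simp add: g_def A_def)
qed

text \<open>Almost every path has finite norm, so the events of the localisation increase to the
  whole space up to a null set, and monotone convergence applies to a bound free of
  \<open>n\<close>.\<close>

lemma u_moment:
  assumes t: "t \<in> {0..T}"
  shows "msq (u t) \<le> ennreal CU"
proof -
  define f where "f n \<omega> = ennreal ((norm (indicator {\<omega>\<in>space M. usq \<omega> \<le> of_nat n} \<omega> *\<^sub>R u t \<omega>))\<^sup>2)" for n :: nat and \<omega>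
  have [measurable]: "f n \<in> borel_measurable M" for n
    unfolding f_def using t by measurable
  have "incseq f"
  proof (intro incseq_SucI le_funI)
    fix n \<omega>
    have "usq \<omega> \<le> of_nat n \<Longrightarrow> usq \<omega> \<le> of_nat (Suc n)"
      by (erule order_trans) (simp add: add_increasing)
    then show "f n \<omega> \<le> f (Suc n) \<omega>" by (auto simp: f_def indicator_def)
  qed
  have "msq (u t) = (\<integral>\<^sup>+\<omega>. (SUP n. f n \<omega>) \<partial>M)"
  proof (rule nn_integral_cong_AE, use usq_finite AE_space in eventually_elim)
    case (elim \<omega>)
    obtain n where n: "usq \<omega> < of_nat n"
      using elim(1) ennreal_Ex_less_of_nat[of "usq \<omega>"] by auto
    have "f n \<omega> = ennreal ((norm (u t \<omega>))\<^sup>2)" using n elim(2) by (simp add: f_def)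
    moreover have "f m \<omega> \<le> ennreal ((norm (u t \<omega>))\<^sup>2)" for m by (auto simp: f_def indicator_def)
    ultimately show ?case by (metis (no_types, lifting) SUP_upper SUP_least UNIV_I antisym)
  qed
  also have "\<dots> = (SUP n. \<integral>\<^sup>+\<omega>. f n \<omega> \<partial>M)"
    by (rule nn_integral_monotone_convergence_SUP[OF \<open>incseq f\<close>]) simp
  also have "\<dots> \<le> ennreal CU"
    unfolding f_def by (intro SUP_least localised_moment t)
  finally show ?thesis .
qed

lemma Fu_moment:
  assumes t: "t \<in> {0..T}"
  shows "msq (\<lambda>\<omega>. F (u t \<omega>)) \<le> ennreal CF"
proof -
  have [measurable]: "u t \<in> borel_measurable M" using t by measurable
  have "msq (\<lambda>\<omega>. indicator (space M) \<omega> *\<^sub>R F (u t \<omega>))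
    = msq (\<lambda>\<omega>. F (u t \<omega>))"
    "msq (\<lambda>\<omega>. indicator (space M) \<omega> *\<^sub>R u t \<omega>)
    = msq (u t)"
    by (auto intro!: nn_integral_cong)
  then have "msq (\<lambda>\<omega>. F (u t \<omega>))
    \<le> ennreal (2 * f0\<^sup>2) + ennreal (2 * K\<^sup>2) * msq (u t)"
    using F_moment_le[of "u t" "space M"] by simp
  also have "\<dots> \<le> ennreal (2 * f0\<^sup>2) + ennreal (2 * K\<^sup>2) * ennreal CU"
    using u_moment[OF t] by (intro add_left_mono mult_left_mono) auto
  also have "\<dots> = ennreal CF" unfolding CF_def using CU_nonneg by (intro ennreal_affine) auto
  finally show ?thesis .
qed

definition CM :: real where
  "CM = 2 * CA + 2 * (T * (T * ((2 / \<alpha>)\<^sup>2 * lam 0 powr (mexp - 2) * CF)))"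

lemma CM_nonneg: "CM \<ge> 0"
  unfolding CM_def using CA_nonneg CF_nonneg T by (intro add_nonneg_nonneg mult_nonneg_nonneg) auto

lemma u_regularity:
  assumes t: "t \<in> {0..T}"
  shows "hsum mexp (\<lambda>j \<omega>. u t \<omega> \<bullet> phi j) \<le> ennreal CM"
proof -
  obtain Z where Z: "\<And>j. wint (\<lambda>r. k2 t j r *\<^sub>R phi j) (Z j)"
    and eq: "AE \<omega> in M. \<forall>j. u t \<omega> \<bullet> phi j = s1 \<alpha> t (lam j) * (u0 \<omega> \<bullet> phi j) + s2 \<alpha> t (lam j) * v0 \<omega> j
       + (LINT r|tmeas T. k2 t j r * (F (u r \<omega>) \<bullet> phi j)) + Z j \<omega>"
    using u_decomp[OF t] by blast
  have [measurable]: "Z j \<in> borel_measurable M" for j by (rule wint_measurable[OF Z])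
  have "hsum mexp (\<lambda>j \<omega>. u t \<omega> \<bullet> phi j)
    = hsum mexp (\<lambda>j \<omega>. (s1 \<alpha> t (lam j) * (u0 \<omega> \<bullet> phi j) + s2 \<alpha> t (lam j) * v0 \<omega> j + Z j \<omega>)
       + (LINT r|tmeas T. k2 t j r * (F (u r \<omega>) \<bullet> phi j)))"
    by (rule hsum_cong_AE) (use eq in \<open>auto elim!: eventually_mono\<close>)
  also have "\<dots> \<le> ennreal CM"
    unfolding CM_def
  proof (rule hsum_add_le[OF _ _ homogeneous_bound[OF t Z]])
    show "hsum mexp (\<lambda>j \<omega>. LINT r|tmeas T. k2 t j r * (F (u r \<omega>) \<bullet> phi j))
      \<le> ennreal (T * (T * ((2 / \<alpha>)\<^sup>2 * lam 0 powr (mexp - 2) * CF)))"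
    proof (rule hsum_drift_const[OF Fu_joint k_measurable'(1)])
      fix j r assume r: "r \<in> {0..T}"
      have "lam j powr mexp * (k2 t j r)\<^sup>2 \<le> lam j powr mexp * (2 / \<alpha> / lam j)\<^sup>2"
        by (intro mult_left_mono square_le k2_bound r) auto
      also have "\<dots> = (2 / \<alpha>)\<^sup>2 * lam j powr (mexp - 2)" by (rule lam_powr_div_sq)
      also have "\<dots> \<le> (2 / \<alpha>)\<^sup>2 * lam 0 powr (mexp - 2)"
        using lam_powr_le[of "mexp - 2" 0 j] mexp_bounds lam_pos[of j] by (intro mult_left_mono) auto
      finally show "lam j powr mexp * (k2 t j r)\<^sup>2 \<le> (2 / \<alpha>)\<^sup>2 * lam 0 powr (mexp - 2)" .
    qed (use Fu_moment CF_nonneg in auto)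
  qed (use CA_nonneg CF_nonneg T in auto)
  finally show ?thesis .
qed

end

lemma ennreal_le_min: "x \<le> ennreal a \<Longrightarrow> x \<le> ennreal b \<Longrightarrow> x \<le> ennreal (min a b)"
  by (simp add: min_def)

section \<open>Increments of u in time\<close>

lemma ennreal_two_add: "x \<ge> 0 \<Longrightarrow> y \<ge> 0 \<Longrightarrow> 2 * ennreal x + 2 * ennreal y = ennreal (2 * x + 2 * y)"
  by (simp add: ennreal_plus ennreal_mult)

context damped begin

definition dl :: real where "dl = min (1 + \<gamma>) 1"

lemma dl_bounds: "0 < dl" "dl \<le> 1" "dl \<le> 1 + \<gamma>"
  using \<gamma> by (auto simp: dl_def)

definition CT :: real where "CT = T powr (2 - 2 * dl)"
text \<open>\<open>P2c\<close> and \<open>P4c\<close> are the constants that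
  \<open>interpolated_power\<close> delivers for the initial velocity and for the noise: powers of
  the two competing bounds, followed by the embedding constant for the exponent that is left
  over.\<close>

definition P2c :: real where
  "P2c = 1 powr dl * (4 * (2 / \<alpha>)\<^sup>2) powr (1 - dl) * lam 0 powr (0 * dl + (-2) * (1 - dl) - \<gamma>)"
definition C4 :: real where "C4 = 2 / \<alpha> + T * (2 * (2 / \<alpha> / \<alpha>)\<^sup>2 / lam 0)"
definition P4c :: real where
  "P4c = (C4 + 2 / \<alpha>) powr dl * (4 * (T * (2 / \<alpha>)\<^sup>2)) powr (1 - dl)
     * lam 0 powr ((-1) * dl + (-2) * (1 - dl) - (\<gamma> - 1))"
definition CR :: real where
  "CR = 2 * (2 * (2 * ((2 / \<alpha>)\<^sup>2 * CT * lam 0 powr (0 - mexp) * U0) + 2 * (P2c * V0)) + 2 * (4 * P4c * q\<^sup>2))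
     + 2 * (T * (T * (CT * CF)))"

lemma C4_nonneg: "C4 \<ge> 0"
  using \<alpha> T lam0 by (auto simp: C4_def intro!: add_nonneg_nonneg)

lemma CT_nonneg: "CT \<ge> 0" and P2c_nonneg: "P2c \<ge> 0" and P4c_nonneg: "P4c \<ge> 0"
  by (simp_all add: CT_def P2c_def P4c_def)

lemma CR_nonneg: "CR \<ge> 0"
  unfolding CR_def using CT_nonneg P2c_nonneg P4c_nonneg U0_nonneg V0_nonneg CF_nonneg T
  by (intro add_nonneg_nonneg mult_nonneg_nonneg) auto

lemma sq_le_powr: "0 \<le> h \<Longrightarrow> h \<le> T \<Longrightarrow> h\<^sup>2 \<le> CT * h powr (2 * dl)"
proof (cases "h = 0")
  case False
  assume h: "0 \<le> h" "h \<le> T"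
  have "h\<^sup>2 = h powr (2 - 2 * dl) * h powr (2 * dl)"
    using h False by (simp flip: powr_add powr_numeral)
  also have "\<dots> \<le> CT * h powr (2 * dl)"
    unfolding CT_def using h dl_bounds by (intro mult_right_mono powr_mono2) auto
  finally show ?thesis .
qed simp

text \<open>Interpolation between the Lipschitz bound and the decay 1/\<mu>. The leftover exponent
  \<open>- 2 * (1 - dl)\<close> is 0 for nonnegative \<gamma> and 2 \<gamma> for negative \<gamma>,
  hence at most \<gamma> in both cases.\<close>

lemma s2_increment:
  assumes "0 \<le> s" "s \<le> t"
  shows "lam j powr 0 * (s2 \<alpha> t (lam j) - s2 \<alpha> s (lam j))\<^sup>2 \<le> (P2c * (t - s) powr (2 * dl)) * lam j powr \<gamma>"
proof -
  let ?c = "(s2 \<alpha> t (lam j) - s2 \<alpha> s (lam j))\<^sup>2" and ?h = "t - s"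
  have "\<bar>s2 \<alpha> t (lam j) - s2 \<alpha> s (lam j)\<bar> \<le> 2 * (2 / \<alpha> / lam j)"
    using s2_bound[OF \<alpha> lam_pos, of t j] s2_bound[OF \<alpha> lam_pos, of s j] assms by linarith
  then have "?c \<le> (2 * (2 / \<alpha> / lam j))\<^sup>2" by (rule square_le)
  also have "\<dots> = 4 * (lam j powr 0 * (2 / \<alpha> / lam j)\<^sup>2)"
    using lam_pos[of j] by (simp only: power_mult_distrib) simp
  also have "\<dots> = 4 * (2 / \<alpha>)\<^sup>2 * lam j powr (-2)" unfolding lam_powr_div_sq by simp
  finally have "?c \<le> 1 powr dl * (4 * (2 / \<alpha>)\<^sup>2) powr (1 - dl) * ?h powr (2 * dl)
      * lam j powr (0 * dl + (-2) * (1 - dl))"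
    using square_le[OF s2_diff[OF \<alpha> lam_pos assms, of j]] lam_pos[of j] dl_bounds assms
    by (intro interpolated_power) auto
  also have "\<dots> \<le> 1 powr dl * (4 * (2 / \<alpha>)\<^sup>2) powr (1 - dl) * ?h powr (2 * dl)
      * (lam 0 powr (0 * dl + (-2) * (1 - dl) - \<gamma>) * lam j powr \<gamma>)"
    using dl_bounds \<gamma> by (intro mult_left_mono lam_powr_le) (auto simp: dl_def min_def)
  finally show ?thesis using lam_pos[of j] by (simp add: P2c_def mult_ac)
qed

text \<open>The step that fixes the order in time: interpolation leaves the exponent
  \<open>dl - 2\<close>, and comparison with \<open>\<gamma> - 1\<close> is the requirement
  \<open>dl \<le> 1 + \<gamma>\<close>.\<close>

lemma k2_increment_noise:
  assumes "0 \<le> s" "s \<le> t" "t \<le> T"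
  obtains I where "(\<integral>\<^sup>+r. ennreal ((k2 t j r - k2 s j r)\<^sup>2) \<partial>lborel) \<le> ennreal I" "0 \<le> I"
    "lam j powr 0 * I \<le> (P4c * (t - s) powr (2 * dl)) * lam j powr (\<gamma> - 1)"
proof -
  let ?h = "t - s"
  \<comment> \<open>Interpolation needs one number below both bounds; the minimum of the bounds
    still dominates the integral.\<close>
  define I where "I = min ((C4 + 2 / \<alpha>) * ?h\<^sup>2 / lam j) (2 * (T * (2 / \<alpha> / lam j)\<^sup>2) + 2 * (T * (2 / \<alpha> / lam j)\<^sup>2))"
  have nn: "(C4 + 2 / \<alpha>) \<ge> 0" using C4_nonneg \<alpha> by simp
  have 1: "(\<integral>\<^sup>+r. ennreal ((k2 t j r - k2 s j r)\<^sup>2) \<partial>lborel) \<le> ennreal ((C4 + 2 / \<alpha>) * ?h\<^sup>2 / lam j)"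
    unfolding k2_def C4_def by (rule kern_s2_diff_sq_integral[OF \<alpha> lam_ge lam0 assms])
  have "(\<integral>\<^sup>+r. ennreal ((k2 t j r - k2 s j r)\<^sup>2) \<partial>lborel)
    \<le> 2 * (\<integral>\<^sup>+r. ennreal ((k2 t j r)\<^sup>2) \<partial>lborel) + 2 * (\<integral>\<^sup>+r. ennreal ((k2 s j r)\<^sup>2) \<partial>lborel)"
  proof (rule nn_integral_sq_add)
    fix r show "(k2 t j r - k2 s j r)\<^sup>2 \<le> 2 * (k2 t j r)\<^sup>2 + 2 * (k2 s j r)\<^sup>2"
      using real_sq_add_le[of "k2 t j r" "- k2 s j r"] by simp
  qed auto
  also have "\<dots> \<le> 2 * ennreal (T * (2 / \<alpha> / lam j)\<^sup>2) + 2 * ennreal (T * (2 / \<alpha> / lam j)\<^sup>2)"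
    unfolding k2_def using assms by (intro add_mono mult_left_mono kern_s2_sq_integral \<alpha> lam_pos) auto
  also have "\<dots> = ennreal (2 * (T * (2 / \<alpha> / lam j)\<^sup>2) + 2 * (T * (2 / \<alpha> / lam j)\<^sup>2))"
    using T by (intro ennreal_two_add) auto
  finally have 2: "(\<integral>\<^sup>+r. ennreal ((k2 t j r - k2 s j r)\<^sup>2) \<partial>lborel)
    \<le> ennreal (2 * (T * (2 / \<alpha> / lam j)\<^sup>2) + 2 * (T * (2 / \<alpha> / lam j)\<^sup>2))" .
  have "0 \<le> (C4 + 2 / \<alpha>) * ?h\<^sup>2 / lam j"
    using nn lam_pos[of j] by (intro divide_nonneg_pos mult_nonneg_nonneg) auto
  moreover have "0 \<le> T * (2 / \<alpha> / lam j)\<^sup>2" using T by simp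
  ultimately have I0: "0 \<le> I" unfolding I_def by (intro min.boundedI) linarith+
  have "I \<le> (C4 + 2 / \<alpha>) powr dl * (4 * (T * (2 / \<alpha>)\<^sup>2)) powr (1 - dl) * ?h powr (2 * dl)
      * lam j powr ((-1) * dl + (-2) * (1 - dl))"
  proof (rule interpolated_power[OF I0])
    have "lam j powr (-1) = 1 / lam j" using lam_pos[of j] by (simp add: powr_minus_divide)
    then show "I \<le> (C4 + 2 / \<alpha>) * ?h\<^sup>2 * lam j powr (-1)" by (simp add: I_def)
    have "2 * (T * (2 / \<alpha> / lam j)\<^sup>2) + 2 * (T * (2 / \<alpha> / lam j)\<^sup>2) = 4 * T * (lam j powr 0 * (2 / \<alpha> / lam j)\<^sup>2)"
      using lam_pos[of j] by simp
    also have "\<dots> = 4 * (T * (2 / \<alpha>)\<^sup>2) * lam j powr (-2)" unfolding lam_powr_div_sq by simp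
    finally show "I \<le> 4 * (T * (2 / \<alpha>)\<^sup>2) * lam j powr (-2)"
      unfolding I_def by (metis min.cobounded2)
  qed (use dl_bounds nn T assms in auto)
  also have "\<dots> \<le> (C4 + 2 / \<alpha>) powr dl * (4 * (T * (2 / \<alpha>)\<^sup>2)) powr (1 - dl) * ?h powr (2 * dl)
      * (lam 0 powr ((-1) * dl + (-2) * (1 - dl) - (\<gamma> - 1)) * lam j powr (\<gamma> - 1))"
    using dl_bounds \<gamma> by (intro mult_left_mono lam_powr_le) auto
  finally have "lam j powr 0 * I \<le> (P4c * ?h powr (2 * dl)) * lam j powr (\<gamma> - 1)"
    using lam_pos[of j] by (simp add: P4c_def mult_ac)
  moreover have "(\<integral>\<^sup>+r. ennreal ((k2 t j r - k2 s j r)\<^sup>2) \<partial>lborel) \<le> ennreal I"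
    unfolding I_def by (rule ennreal_le_min[OF 1 2])
  ultimately show ?thesis using that I0 by blast
qed

lemma u_increment:
  assumes "0 \<le> s" "s \<le> t" "t \<le> T"
  shows "msq (\<lambda>\<omega>. u t \<omega> - u s \<omega>) \<le> ennreal (CR * (t - s) powr (2 * dl))"
proof -
  have st: "s \<in> {0..T}" "t \<in> {0..T}" using assms by auto
  define H where "H = (t - s) powr (2 * dl)"
  have H0: "H \<ge> 0" by (simp add: H_def)
  have hH: "(t - s)\<^sup>2 \<le> CT * H" unfolding H_def by (rule sq_le_powr) (use assms in auto)
  obtain Z where Z: "\<And>j. wint (\<lambda>r. k2 t j r *\<^sub>R phi j) (Z j)"
    and eq: "AE \<omega> in M. \<forall>j. u t \<omega> \<bullet> phi j = s1 \<alpha> t (lam j) * (u0 \<omega> \<bullet> phi j) + s2 \<alpha> t (lam j) * v0 \<omega> j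
       + (LINT r|tmeas T. k2 t j r * (F (u r \<omega>) \<bullet> phi j)) + Z j \<omega>"
    using u_decomp[OF st(2)] by blast
  obtain Z' where Z': "\<And>j. wint (\<lambda>r. k2 s j r *\<^sub>R phi j) (Z' j)"
    and eq': "AE \<omega> in M. \<forall>j. u s \<omega> \<bullet> phi j = s1 \<alpha> s (lam j) * (u0 \<omega> \<bullet> phi j) + s2 \<alpha> s (lam j) * v0 \<omega> j
       + (LINT r|tmeas T. k2 s j r * (F (u r \<omega>) \<bullet> phi j)) + Z' j \<omega>"
    using u_decomp[OF st(1)] by blast
  have [measurable]: "u t \<in> borel_measurable M" "u s \<in> borel_measurable M"
    using st by measurable
  have [measurable]: "Z j \<in> borel_measurable M" "Z' j \<in> borel_measurable M" for j
    using wint_measurable[OF Z] wint_measurable[OF Z'] by auto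
  define D where "D j \<omega> = (LINT r|tmeas T. (k2 t j r - k2 s j r) * (F (u r \<omega>) \<bullet> phi j))" for j \<omega>
  have [measurable]: "D j \<in> borel_measurable M" for j
    unfolding D_def[abs_def] by (rule drift_measurable[OF Fu_joint]) measurable
  define N where "N j \<omega> = Z j \<omega> + (-1) * Z' j \<omega>" for j \<omega>
  have [measurable]: "N j \<in> borel_measurable M" for j unfolding N_def by measurable
  \<comment> \<open>Both kernels are extended by zero to the whole line, so the difference of the
    two noise terms is one integral of the kernel difference, including the time between
    \<open>s\<close> and \<open>t\<close>.\<close>
  have N: "wint (\<lambda>r. (k2 t j r - k2 s j r) *\<^sub>R phi j) (N j)" for j
    using wint_add[OF Z wint_scale[OF Z', of "-1"]] by (simp add: N_def[abs_def] scaleR_diff_left)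
  have "msq (\<lambda>\<omega>. u t \<omega> - u s \<omega>) = hsum 0 (\<lambda>j \<omega>. (u t \<omega> - u s \<omega>) \<bullet> phi j)"
    by (rule hsum_norm[symmetric]) measurable
  also have "\<dots> = hsum 0 (\<lambda>j \<omega>. ((s1 \<alpha> t (lam j) - s1 \<alpha> s (lam j)) * (u0 \<omega> \<bullet> phi j)
      + (s2 \<alpha> t (lam j) - s2 \<alpha> s (lam j)) * v0 \<omega> j + N j \<omega>) + D j \<omega>)"
  proof (rule hsum_cong_AE)
    fix j
    show "AE \<omega> in M. (u t \<omega> - u s \<omega>) \<bullet> phi j = ((s1 \<alpha> t (lam j) - s1 \<alpha> s (lam j)) * (u0 \<omega> \<bullet> phi j)
      + (s2 \<alpha> t (lam j) - s2 \<alpha> s (lam j)) * v0 \<omega> j + N j \<omega>) + D j \<omega>"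
      using eq eq' usq_finite AE_space
    proof eventually_elim
      case (elim \<omega>)
      have "D j \<omega> = (LINT r|tmeas T. k2 t j r * (F (u r \<omega>) \<bullet> phi j)) - (LINT r|tmeas T. k2 s j r * (F (u r \<omega>) \<bullet> phi j))"
        unfolding D_def left_diff_distrib
        by (intro Bochner_Integration.integral_diff k_integrable elim st)
      then show ?case using elim(1,2) by (simp add: inner_diff_left N_def algebra_simps)
    qed
  qed
  also have "\<dots> \<le> ennreal (2 * (2 * (2 * ((2 / \<alpha>)\<^sup>2 * CT * lam 0 powr (0 - mexp) * H * U0) + 2 * (P2c * H * V0))
      + 2 * (4 * (P4c * H) * q\<^sup>2)) + 2 * (T * (T * (CT * H * CF))))"
  proof (rule hsum_add_le, rule_tac[3] hsum_add_le, rule_tac[5] hsum_add_le)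
    show "hsum 0 (\<lambda>j \<omega>. (s1 \<alpha> t (lam j) - s1 \<alpha> s (lam j)) * (u0 \<omega> \<bullet> phi j))
      \<le> ennreal ((2 / \<alpha>)\<^sup>2 * CT * lam 0 powr (0 - mexp) * H * U0)"
    proof (rule hsum_mult_le)
      fix j
      have "(s1 \<alpha> t (lam j) - s1 \<alpha> s (lam j))\<^sup>2 \<le> (2 / \<alpha> * (t - s))\<^sup>2"
        by (rule square_le[OF s1_diff[OF \<alpha> lam_pos assms(1,2)]])
      also have "\<dots> = (2 / \<alpha>)\<^sup>2 * (t - s)\<^sup>2" by (rule power_mult_distrib)
      also have "\<dots> \<le> (2 / \<alpha>)\<^sup>2 * (CT * H)" by (intro mult_left_mono hH) auto
      finally have "lam j powr 0 * (s1 \<alpha> t (lam j) - s1 \<alpha> s (lam j))\<^sup>2 \<le> lam j powr 0 * ((2 / \<alpha>)\<^sup>2 * (CT * H))"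
        by (intro mult_left_mono) auto
      also have "\<dots> \<le> (lam 0 powr (0 - mexp) * lam j powr mexp) * ((2 / \<alpha>)\<^sup>2 * (CT * H))"
        using mexp_bounds H0 CT_nonneg by (intro mult_right_mono lam_powr_le) auto
      finally show "lam j powr 0 * (s1 \<alpha> t (lam j) - s1 \<alpha> s (lam j))\<^sup>2
        \<le> (2 / \<alpha>)\<^sup>2 * CT * lam 0 powr (0 - mexp) * H * lam j powr mexp"
        by (simp only: mult_ac)
    qed (use U0 U0_nonneg H0 CT_nonneg in auto)
    show "hsum 0 (\<lambda>j \<omega>. (s2 \<alpha> t (lam j) - s2 \<alpha> s (lam j)) * v0 \<omega> j) \<le> ennreal (P2c * H * V0)"
      by (rule hsum_mult_le[OF _ s2_increment[OF assms(1,2), folded H_def]])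
        (use V0 V0_nonneg H0 P2c_nonneg in auto)
    show "hsum 0 N \<le> ennreal (4 * (P4c * H) * q\<^sup>2)"
    proof -
      have "\<forall>j. \<exists>I. (\<integral>\<^sup>+r. ennreal ((k2 t j r - k2 s j r)\<^sup>2) \<partial>lborel) \<le> ennreal I \<and> 0 \<le> I \<and>
          lam j powr 0 * I \<le> (P4c * H) * lam j powr (\<gamma> - 1)"
      proof
        fix j
        obtain I where "(\<integral>\<^sup>+r. ennreal ((k2 t j r - k2 s j r)\<^sup>2) \<partial>lborel) \<le> ennreal I" "0 \<le> I"
          "lam j powr 0 * I \<le> (P4c * (t - s) powr (2 * dl)) * lam j powr (\<gamma> - 1)"
          by (rule k2_increment_noise[OF assms, of j])
        then show "\<exists>I. (\<integral>\<^sup>+r. ennreal ((k2 t j r - k2 s j r)\<^sup>2) \<partial>lborel) \<le> ennreal I \<and> 0 \<le> I \<and>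
          lam j powr 0 * I \<le> (P4c * H) * lam j powr (\<gamma> - 1)"
          unfolding H_def by blast
      qed
      from choice[OF this] obtain I where
        I: "\<And>j. (\<integral>\<^sup>+r. ennreal ((k2 t j r - k2 s j r)\<^sup>2) \<partial>lborel) \<le> ennreal (I j)"
        "\<And>j. 0 \<le> I j" "\<And>j. lam j powr 0 * I j \<le> (P4c * H) * lam j powr (\<gamma> - 1)" by blast
      have "hsum 0 N \<le> ennreal (4 * (P4c * H)) * (\<Sum>j. ennreal (lam j powr (\<gamma> - 1) * (norm (Qh (phi j)))\<^sup>2))"
        by (rule hsum_noise[OF N _ I]) (use P4c_nonneg H0 in auto)
      also have "\<dots> = ennreal (4 * (P4c * H) * q\<^sup>2)"
        unfolding noise_sum using P4c_nonneg H0 by (intro ennreal_mult[symmetric]) auto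
      finally show ?thesis .
    qed
    show "hsum 0 D \<le> ennreal (T * (T * (CT * H * CF)))"
      unfolding D_def
    proof (rule hsum_drift_const[OF Fu_joint])
      fix j r
      have "(k2 t j r - k2 s j r)\<^sup>2 \<le> (t - s)\<^sup>2"
        unfolding k2_def by (rule square_le[OF kern_s2_lipschitz[OF \<alpha> lam_pos assms(2)]])
      then show "lam j powr 0 * (k2 t j r - k2 s j r)\<^sup>2 \<le> CT * H"
        using hH lam_pos[of j] by simp
    qed (use Fu_moment CF_nonneg CT_nonneg H0 in auto)
  qed (use U0_nonneg V0_nonneg H0 CT_nonneg P2c_nonneg P4c_nonneg CF_nonneg T in \<open>auto intro!: add_nonneg_nonneg mult_nonneg_nonneg\<close>)
  also have "2 * (2 * (2 * ((2 / \<alpha>)\<^sup>2 * CT * lam 0 powr (0 - mexp) * H * U0) + 2 * (P2c * H * V0))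
      + 2 * (4 * (P4c * H) * q\<^sup>2)) + 2 * (T * (T * (CT * H * CF))) = CR * H"
    unfolding CR_def distrib_left distrib_right by (simp only: mult_ac)
  finally show ?thesis by (simp only: H_def)
qed

lemma F_increment:
  assumes "s \<in> {0..T}" "t \<in> {0..T}"
  shows "msq (\<lambda>\<omega>. F (u s \<omega>) - F (u t \<omega>)) \<le> ennreal (K\<^sup>2 * (CR * \<bar>t - s\<bar> powr (2 * dl)))"
proof -
  have [measurable]: "u t \<in> borel_measurable M" "u s \<in> borel_measurable M"
    using assms by measurable
  have "msq (\<lambda>\<omega>. F (u s \<omega>) - F (u t \<omega>))
      \<le> (\<integral>\<^sup>+\<omega>. ennreal (K\<^sup>2) * ennreal ((norm (u s \<omega> - u t \<omega>))\<^sup>2) \<partial>M)"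
  proof (rule nn_integral_mono)
    fix \<omega>
    have "(norm (F (u s \<omega>) - F (u t \<omega>)))\<^sup>2 \<le> (K * norm (u s \<omega> - u t \<omega>))\<^sup>2"
      using lip by (intro square_le) simp
    then show "ennreal ((norm (F (u s \<omega>) - F (u t \<omega>)))\<^sup>2) \<le> ennreal (K\<^sup>2) * ennreal ((norm (u s \<omega> - u t \<omega>))\<^sup>2)"
      by (simp add: power_mult_distrib ennreal_leI flip: ennreal_mult)
  qed
  also have "\<dots> = ennreal (K\<^sup>2) * msq (\<lambda>\<omega>. u s \<omega> - u t \<omega>)"
    by (rule nn_integral_cmult) measurable
  also have "\<dots> \<le> ennreal (K\<^sup>2) * ennreal (CR * \<bar>t - s\<bar> powr (2 * dl))"
  proof (rule mult_left_mono)
    show "msq (\<lambda>\<omega>. u s \<omega> - u t \<omega>) \<le> ennreal (CR * \<bar>t - s\<bar> powr (2 * dl))"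
      using u_increment[of s t] u_increment[of t s] assms
      by (cases "s \<le> t") (auto simp: norm_minus_commute)
  qed simp
  finally show ?thesis using CR_nonneg by (simp add: ennreal_mult)
qed

section \<open>Spatial regularity of the velocity\<close>

definition Cx :: real where "Cx = (1 + 2 / \<alpha> * T) / \<alpha>"
definition CV :: real where
  "CV = 2 * (2 * (2 * ((2 / \<alpha>)\<^sup>2 * lam 0 powr (\<gamma> - mexp) * U0) + 2 * (1 * V0)) + 2 * (4 * C4 * q\<^sup>2))
     + 2 * (2 * (T * (T * (lam 0 powr (\<gamma> - 2) * Cx\<^sup>2 * (K\<^sup>2 * CR)))) + 2 * ((2 / \<alpha>)\<^sup>2 * lam 0 powr (\<gamma> - 2) * CF))"

lemma CV_nonneg: "CV \<ge> 0"
  unfolding CV_def using U0_nonneg V0_nonneg C4_nonneg CR_nonneg CF_nonneg T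
  by (intro add_nonneg_nonneg mult_nonneg_nonneg) auto

text \<open>\<open>s2\<close> is an antiderivative of \<open>s4\<close>. Thus a force frozen in time
  can be integrated exactly, and the result has the two orders of smoothing of
  \<open>s2\<close>.\<close>

lemma k4_integral:
  assumes t: "t \<in> {0..T}"
  shows "(LINT r|tmeas T. k4 t j r) = s2 \<alpha> t (lam j)" and "integrable (tmeas T) (k4 t j)"
proof -
  have "has_bochner_integral lborel (\<lambda>r. indicator {0..t} r *\<^sub>R s4 \<alpha> (t - r) (lam j))
      (- s2 \<alpha> (t - t) (lam j) - (- s2 \<alpha> (t - 0) (lam j)))"
  proof (rule has_bochner_integral_FTC_Icc)
    fix r
    show "((\<lambda>r. - s2 \<alpha> (t - r) (lam j)) has_vector_derivative s4 \<alpha> (t - r) (lam j)) (at r within {0..t})"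
      unfolding has_real_derivative_iff_has_vector_derivative[symmetric]
      by (rule has_field_derivative_at_within) (auto intro!: derivative_eq_intros)
    show "continuous_on {0..t} (\<lambda>r. s4 \<alpha> (t - r) (lam j))"
      by (intro continuous_at_imp_continuous_on ballI DERIV_isCont) (auto intro!: derivative_eq_intros)
  qed (use t in auto)
  moreover have "(\<lambda>r. indicator {0..t} r *\<^sub>R s4 \<alpha> (t - r) (lam j)) = (\<lambda>r. indicator {0..T} r *\<^sub>R k4 t j r)"
    using t by (auto simp: k4_def kern_def indicator_def fun_eq_iff)
  ultimately have *: "has_bochner_integral lborel (\<lambda>r. indicator {0..T} r *\<^sub>R k4 t j r) (s2 \<alpha> t (lam j))"
    by simp
  then show "(LINT r|tmeas T. k4 t j r) = s2 \<alpha> t (lam j)"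
    by (simp add: integral_tmeas has_bochner_integral_iff)
  show "integrable (tmeas T) (k4 t j)"
    using * unfolding tmeas_def by (subst integrable_restrict_space) (auto simp: has_bochner_integral_iff)
qed

text \<open>Subtracting the value at the final time compensates the singularity of \<open>A S\<^sub>4\<close>, which is
  not integrable in time; this gives the full smoothing of order \<open>2\<close>.\<close>

lemma v_regularity:
  assumes t: "t \<in> {0..T}" and \<gamma>0: "\<gamma> \<ge> 0"
  shows "hsum \<gamma> (\<lambda>j \<omega>. v t \<omega> j) \<le> ennreal CV"
proof -
  have dl1: "dl = 1" using \<gamma>0 by (simp add: dl_def)
  have \<gamma>m: "\<gamma> \<le> mexp" using \<gamma> by (simp add: mexp_def)
  obtain Z where Z: "\<And>j. wint (\<lambda>r. k4 t j r *\<^sub>R phi j) (Z j)"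
    and eq: "AE \<omega> in M. \<forall>j. v t \<omega> j = s3 \<alpha> t (lam j) * (u0 \<omega> \<bullet> phi j) + s4 \<alpha> t (lam j) * v0 \<omega> j
       + (LINT r|tmeas T. k4 t j r * (F (u r \<omega>) \<bullet> phi j)) + Z j \<omega>"
    using v_decomp[OF t] by blast
  have [measurable]: "u t \<in> borel_measurable M" using t by measurable
  have [measurable]: "Z j \<in> borel_measurable M" for j by (rule wint_measurable[OF Z])
  have G: "(\<lambda>(r, \<omega>). F (u r \<omega>) - F (u t \<omega>)) \<in> borel_measurable (tmeas T \<Otimes>\<^sub>M M)"
    by measurable
  define D where "D j \<omega> = (LINT r|tmeas T. k4 t j r * ((F (u r \<omega>) - F (u t \<omega>)) \<bullet> phi j))" for j \<omega>
  have [measurable]: "D j \<in> borel_measurable M" for j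
    unfolding D_def[abs_def] by (rule drift_measurable[OF G]) measurable
  have "hsum \<gamma> (\<lambda>j \<omega>. v t \<omega> j)
    = hsum \<gamma> (\<lambda>j \<omega>. (s3 \<alpha> t (lam j) * (u0 \<omega> \<bullet> phi j) + s4 \<alpha> t (lam j) * v0 \<omega> j + Z j \<omega>)
       + (D j \<omega> + s2 \<alpha> t (lam j) * (F (u t \<omega>) \<bullet> phi j)))"
  proof (rule hsum_cong_AE)
    fix j
    show "AE \<omega> in M. v t \<omega> j = (s3 \<alpha> t (lam j) * (u0 \<omega> \<bullet> phi j) + s4 \<alpha> t (lam j) * v0 \<omega> j + Z j \<omega>)
       + (D j \<omega> + s2 \<alpha> t (lam j) * (F (u t \<omega>) \<bullet> phi j))"
      using eq usq_finite AE_space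
    proof eventually_elim
      case (elim \<omega>)
      have "D j \<omega> = (LINT r|tmeas T. k4 t j r * (F (u r \<omega>) \<bullet> phi j)) - (LINT r|tmeas T. k4 t j r * (F (u t \<omega>) \<bullet> phi j))"
        unfolding D_def inner_diff_left right_diff_distrib
        by (intro Bochner_Integration.integral_diff k_integrable elim t integrable_mult_left k4_integral)
      also have "(LINT r|tmeas T. k4 t j r * (F (u t \<omega>) \<bullet> phi j)) = s2 \<alpha> t (lam j) * (F (u t \<omega>) \<bullet> phi j)"
        using k4_integral[OF t] by simp
      finally show ?case using elim(1) by simp
    qed
  qed
  also have "\<dots> \<le> ennreal CV"
    unfolding CV_def
  proof (rule hsum_add_le, rule_tac[3] hsum_add_le, rule_tac[5] hsum_add_le)
    show "hsum \<gamma> (\<lambda>j \<omega>. s3 \<alpha> t (lam j) * (u0 \<omega> \<bullet> phi j)) \<le> ennreal ((2 / \<alpha>)\<^sup>2 * lam 0 powr (\<gamma> - mexp) * U0)"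
    proof (rule hsum_mult_le)
      fix j
      have "lam j powr \<gamma> * (s3 \<alpha> t (lam j))\<^sup>2 \<le> (lam 0 powr (\<gamma> - mexp) * lam j powr mexp) * (2 / \<alpha>)\<^sup>2"
        using t by (intro mult_mono lam_powr_le \<gamma>m square_le s3_bound \<alpha> lam_pos) auto
      then show "lam j powr \<gamma> * (s3 \<alpha> t (lam j))\<^sup>2 \<le> (2 / \<alpha>)\<^sup>2 * lam 0 powr (\<gamma> - mexp) * lam j powr mexp"
        by (simp only: mult_ac)
    qed (use U0 U0_nonneg in auto)
    show "hsum \<gamma> (\<lambda>j \<omega>. s4 \<alpha> t (lam j) * v0 \<omega> j) \<le> ennreal (1 * V0)"
    proof (rule hsum_mult_le)
      fix j
      have "(s4 \<alpha> t (lam j))\<^sup>2 \<le> 1"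
        using square_le[OF s4_bound[OF \<alpha> lam_pos, of t j]] t by simp
      then show "lam j powr \<gamma> * (s4 \<alpha> t (lam j))\<^sup>2 \<le> 1 * lam j powr \<gamma>"
        by (simp add: mult_left_le)
    qed (use V0 V0_nonneg in auto)
    show "hsum \<gamma> Z \<le> ennreal (4 * C4 * q\<^sup>2)"
    proof -
      have "hsum \<gamma> Z \<le> ennreal (4 * C4) * (\<Sum>j. ennreal (lam j powr (\<gamma> - 1) * (norm (Qh (phi j)))\<^sup>2))"
      proof (rule hsum_noise[OF Z])
        fix j
        show "(\<integral>\<^sup>+r. ennreal ((k4 t j r)\<^sup>2) \<partial>lborel) \<le> ennreal (C4 / lam j)"
          unfolding k4_def C4_def using t by (intro kern_s4_sq_integral \<alpha> lam_ge lam0) auto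
        show "lam j powr \<gamma> * (C4 / lam j) \<le> C4 * lam j powr (\<gamma> - 1)"
          using lam_pos[of j] by (simp add: powr_diff mult.commute)
      qed (use C4_nonneg lam_pos[THEN less_imp_le] in auto)
      also have "\<dots> = ennreal (4 * C4 * q\<^sup>2)"
        unfolding noise_sum using C4_nonneg by (intro ennreal_mult[symmetric]) auto
      finally show ?thesis .
    qed
    show "hsum \<gamma> (\<lambda>j \<omega>. D j \<omega> + s2 \<alpha> t (lam j) * (F (u t \<omega>) \<bullet> phi j))
      \<le> ennreal (2 * (T * (T * (lam 0 powr (\<gamma> - 2) * Cx\<^sup>2 * (K\<^sup>2 * CR)))) + 2 * ((2 / \<alpha>)\<^sup>2 * lam 0 powr (\<gamma> - 2) * CF))"
    proof (rule hsum_add_le)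
      \<comment> \<open>At \<open>r = t\<close> the kernel is 1 for every \<open>j\<close> and
        admits no uniform bound with the weight. The value infinity is harmless there, as it
        multiplies the increment of \<open>F\<close> over a zero time and the product is 0.\<close>
      define \<kappa> where "\<kappa> r = (if r < t then ennreal (lam 0 powr (\<gamma> - 2) * (Cx / (t - r))\<^sup>2) else if r = t then \<infinity> else 0)" for r
      have "hsum \<gamma> D \<le> ennreal T * (\<integral>\<^sup>+r. \<kappa> r * msq (\<lambda>\<omega>. F (u r \<omega>) - F (u t \<omega>)) \<partial>tmeas T)"
        unfolding D_def
      proof (rule hsum_drift[OF G])
        show "\<kappa> \<in> borel_measurable (tmeas T)" unfolding \<kappa>_def[abs_def] by (intro borel_tmeas) measurable
        fix j r assume r: "r \<in> {0..T}"
        show "ennreal (lam j powr \<gamma> * (k4 t j r)\<^sup>2) \<le> \<kappa> r"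
        proof (cases "r < t")
          case True
          have "\<bar>s4 \<alpha> (t - r) (lam j)\<bar> * lam j * (t - r) \<le> Cx"
            using s4_singular[OF \<alpha> lam_pos, of "t - r" T j] True r t
            by (simp add: Cx_def mult.commute)
          then have "\<bar>s4 \<alpha> (t - r) (lam j)\<bar> \<le> Cx / (t - r) / lam j"
            using True lam_pos[of j] by (simp only: pos_le_divide_eq diff_gt_0_iff_gt)
          then have "lam j powr \<gamma> * (s4 \<alpha> (t - r) (lam j))\<^sup>2 \<le> lam j powr \<gamma> * (Cx / (t - r) / lam j)\<^sup>2"
            by (intro mult_left_mono square_le) auto
          also have "\<dots> = (Cx / (t - r))\<^sup>2 * lam j powr (\<gamma> - 2)" by (rule lam_powr_div_sq)
          also have "\<dots> \<le> (Cx / (t - r))\<^sup>2 * lam 0 powr (\<gamma> - 2)"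
            using lam_powr_le[of "\<gamma> - 2" 0 j] \<gamma> lam_pos[of j] by (intro mult_left_mono) auto
          finally show ?thesis using True r by (simp add: \<kappa>_def k4_def kern_def mult.commute ennreal_leI)
        qed (auto simp: \<kappa>_def k4_def kern_def)
      qed measurable
      also have "\<dots> \<le> ennreal T * (\<integral>\<^sup>+r. ennreal (lam 0 powr (\<gamma> - 2) * Cx\<^sup>2 * (K\<^sup>2 * CR)) \<partial>tmeas T)"
      proof (intro mult_left_mono nn_integral_mono)
        fix r assume "r \<in> space (tmeas T)"
        then have r: "r \<in> {0..T}" by simp
        show "\<kappa> r * msq (\<lambda>\<omega>. F (u r \<omega>) - F (u t \<omega>))
          \<le> ennreal (lam 0 powr (\<gamma> - 2) * Cx\<^sup>2 * (K\<^sup>2 * CR))"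
        proof (cases "r < t")
          case True
          have "\<kappa> r * msq (\<lambda>\<omega>. F (u r \<omega>) - F (u t \<omega>))
            \<le> ennreal (lam 0 powr (\<gamma> - 2) * (Cx / (t - r))\<^sup>2) * ennreal (K\<^sup>2 * (CR * \<bar>t - r\<bar> powr (2 * dl)))"
            using F_increment[OF r t] True by (simp add: \<kappa>_def mult_left_mono)
          also have "\<dots> = ennreal (lam 0 powr (\<gamma> - 2) * (Cx / (t - r))\<^sup>2 * (K\<^sup>2 * (CR * \<bar>t - r\<bar> powr (2 * dl))))"
            using CR_nonneg by (intro ennreal_mult[symmetric]) auto
          \<comment> \<open>For nonnegative \<gamma> the increment of \<open>u\<close> is Lipschitz
            in mean square, so its square exactly cancels the weight
            \<open>1 / (t - r)\<^sup>2\<close> and the integrand is constant.\<close>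
          also have "lam 0 powr (\<gamma> - 2) * (Cx / (t - r))\<^sup>2 * (K\<^sup>2 * (CR * \<bar>t - r\<bar> powr (2 * dl)))
            = lam 0 powr (\<gamma> - 2) * Cx\<^sup>2 * (K\<^sup>2 * CR)"
            using True by (simp add: dl1 power_divide)
          finally show ?thesis .
        qed (auto simp: \<kappa>_def)
      qed auto
      also have "\<dots> = ennreal (T * (T * (lam 0 powr (\<gamma> - 2) * Cx\<^sup>2 * (K\<^sup>2 * CR))))"
        using T CR_nonneg by (simp add: emeasure_tmeas ennreal_mult mult.commute del: space_tmeas)
      finally show "hsum \<gamma> D \<le> ennreal (T * (T * (lam 0 powr (\<gamma> - 2) * Cx\<^sup>2 * (K\<^sup>2 * CR))))" .
      show "hsum \<gamma> (\<lambda>j \<omega>. s2 \<alpha> t (lam j) * (F (u t \<omega>) \<bullet> phi j)) \<le> ennreal ((2 / \<alpha>)\<^sup>2 * lam 0 powr (\<gamma> - 2) * CF)"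
      proof (rule hsum_mult_le[where s' = 0])
        fix j
        have "lam j powr \<gamma> * (s2 \<alpha> t (lam j))\<^sup>2 \<le> lam j powr \<gamma> * (2 / \<alpha> / lam j)\<^sup>2"
          using t by (intro mult_left_mono square_le s2_bound \<alpha> lam_pos) auto
        also have "\<dots> = (2 / \<alpha>)\<^sup>2 * lam j powr (\<gamma> - 2)" by (rule lam_powr_div_sq)
        also have "\<dots> \<le> (2 / \<alpha>)\<^sup>2 * (lam 0 powr (\<gamma> - 2 - 0) * lam j powr 0)"
          using \<gamma> by (intro mult_left_mono lam_powr_le) auto
        finally show "lam j powr \<gamma> * (s2 \<alpha> t (lam j))\<^sup>2 \<le> (2 / \<alpha>)\<^sup>2 * lam 0 powr (\<gamma> - 2) * lam j powr 0"
          by simp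
        show "hsum 0 (\<lambda>j \<omega>. F (u t \<omega>) \<bullet> phi j) \<le> ennreal CF"
          by (subst hsum_norm) (use Fu_moment[OF t] in auto)
      qed (use CF_nonneg in auto)
    qed (use CR_nonneg CF_nonneg T in auto)
  qed (use U0_nonneg V0_nonneg C4_nonneg CR_nonneg CF_nonneg T in \<open>auto intro!: add_nonneg_nonneg mult_nonneg_nonneg\<close>)
  finally show ?thesis .
qed

end

section \<open>The scheme and its error\<close>

context wiener begin

lemma wint_zero: "wint (\<lambda>_. 0) (\<lambda>_. 0)"
  unfolding wint_def by (intro conjI exI[of _ "\<lambda>_. []"]) auto

lemma AE_lborel_neq: "AE r in lborel. (r::real) \<noteq> a"
  by (rule AE_I[of _ _ "{a}"]) auto

end

locale scheme = damped lam phi M T Filt Q Qh W \<alpha> \<gamma> K q f0 F u0 v0 u v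
  for lam :: "nat \<Rightarrow> real" and phi :: "nat \<Rightarrow> 'h::{real_inner,banach,second_countable_topology}"
    and M :: "'w measure" and T :: real and Filt :: "real \<Rightarrow> 'w measure"
    and Q Qh :: "'h \<Rightarrow> 'h" and W :: "real \<Rightarrow> 'h \<Rightarrow> 'w \<Rightarrow> real"
    and \<alpha> \<gamma> K q f0 :: real and F :: "'h \<Rightarrow> 'h"
    and u0 :: "'w \<Rightarrow> 'h" and v0 :: "'w \<Rightarrow> nat \<Rightarrow> real"
    and u :: "real \<Rightarrow> 'w \<Rightarrow> 'h" and v :: "real \<Rightarrow> 'w \<Rightarrow> nat \<Rightarrow> real" +
  fixes N n :: nat and uN vN :: "nat \<Rightarrow> 'w \<Rightarrow> 'h"
  assumes n: "n \<ge> 1" and sch: "exp_Euler_scheme lam phi \<alpha> T M Qh W F u0 v0 N n uN vN"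
begin

definition stp :: real where "stp = T / real n"
definition tp :: "nat \<Rightarrow> real" where "tp i = real i * stp"

lemma stp_pos: "stp > 0" and stp_le: "stp \<le> T"
proof -
  show "stp > 0" using T n by (simp add: stp_def)
  have "T * 1 \<le> T * real n" using T n by (intro mult_left_mono) auto
  then show "stp \<le> T" using n by (simp add: stp_def divide_le_eq)
qed

lemma tp_Suc: "tp (Suc i) = stp + tp i" and tp_0 [simp]: "tp 0 = 0"
  by (simp_all add: tp_def algebra_simps)

lemma tp_mono: "i \<le> j \<Longrightarrow> tp i \<le> tp j"
  using stp_pos by (simp add: tp_def mult_right_mono)

lemma tp_nonneg: "0 \<le> tp i" using tp_mono[of 0 i] by simp

lemma tp_n: "tp n = T" using n by (simp add: tp_def stp_def)

lemma tp_mem: "m \<le> n \<Longrightarrow> tp m \<in> {0..T}"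
  using tp_nonneg tp_mono[of m n] tp_n by simp

lemma uN_measurable [measurable (raw)]: "m \<le> n \<Longrightarrow> uN m \<in> borel_measurable M"
  and vN_measurable [measurable (raw)]: "m \<le> n \<Longrightarrow> vN m \<in> borel_measurable M"
  using sch by (auto simp: exp_Euler_scheme_def Let_def)

lemma scheme_init:
  "AE \<omega> in M. uN 0 \<omega> = PN phi N (coef phi (u0 \<omega>)) \<and> vN 0 \<omega> = PN phi N (v0 \<omega>)"
  using sch by (auto simp: exp_Euler_scheme_def Let_def)

definition sk :: "(real \<Rightarrow> real \<Rightarrow> real \<Rightarrow> real) \<Rightarrow> nat \<Rightarrow> nat \<Rightarrow> real \<Rightarrow> real" where
  "sk c m j r = (if tp m \<le> r \<and> r \<le> tp (Suc m) \<and> j < N then c \<alpha> (tp (Suc m) - r) (lam j) else 0)"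

lemma sk_measurable [measurable]:
  "sk s2 m j \<in> borel_measurable borel" "sk s4 m j \<in> borel_measurable borel"
  unfolding sk_def by measurable

lemma scheme_step_coord:
  assumes m: "m < n"
  obtains Z2 Z4 where "wint (\<lambda>r. sk s2 m j r *\<^sub>R phi j) Z2" "wint (\<lambda>r. sk s4 m j r *\<^sub>R phi j) Z4"
    "AE \<omega> in M. uN (Suc m) \<omega> \<bullet> phi j = (if j < N then s1 \<alpha> stp (lam j) * (uN m \<omega> \<bullet> phi j)
        + s2 \<alpha> stp (lam j) * (vN m \<omega> \<bullet> phi j) + stp * (s2 \<alpha> stp (lam j) * (F (uN m \<omega>) \<bullet> phi j)) else 0) + Z2 \<omega>"
    "AE \<omega> in M. vN (Suc m) \<omega> \<bullet> phi j = (if j < N then s3 \<alpha> stp (lam j) * (uN m \<omega> \<bullet> phi j)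
        + s4 \<alpha> stp (lam j) * (vN m \<omega> \<bullet> phi j) + stp * (s4 \<alpha> stp (lam j) * (F (uN m \<omega>) \<bullet> phi j)) else 0) + Z4 \<omega>"
proof -
  let ?P = "\<lambda>x. PN phi N (coef phi x)" and ?S = "SopN lam phi N"
  obtain I2 I4 :: "'w \<Rightarrow> 'h" where
    I2: "is_stoch_integral lam phi M W Qh 0 (tp m) (tp (Suc m))
          (\<lambda>s x. coef phi (?S (s2 \<alpha> (tp (Suc m) - s)) (?P x))) (\<lambda>\<omega>. coef phi (I2 \<omega>))" and
    I4: "is_stoch_integral lam phi M W Qh 0 (tp m) (tp (Suc m))
          (\<lambda>s x. coef phi (?S (s4 \<alpha> (tp (Suc m) - s)) (?P x))) (\<lambda>\<omega>. coef phi (I4 \<omega>))" and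
    eq: "AE \<omega> in M.
           uN (Suc m) \<omega> = ?S (s1 \<alpha> stp) (uN m \<omega>) + ?S (s2 \<alpha> stp) (vN m \<omega>)
             + stp *\<^sub>R ?S (s2 \<alpha> stp) (?P (F (uN m \<omega>))) + I2 \<omega> \<and>
           vN (Suc m) \<omega> = ?S (s3 \<alpha> stp) (uN m \<omega>) + ?S (s4 \<alpha> stp) (vN m \<omega>)
             + stp *\<^sub>R ?S (s4 \<alpha> stp) (?P (F (uN m \<omega>))) + I4 \<omega>"
    using sch m unfolding exp_Euler_scheme_def Let_def stp_def[symmetric] tp_def[symmetric] by blast
  have b: "0 \<le> tp m" "tp (Suc m) \<le> T" using tp_nonneg tp_mem[of "Suc m"] m by auto
  show ?thesis
  proof (rule that)
    show "wint (\<lambda>r. sk s2 m j r *\<^sub>R phi j) (\<lambda>\<omega>. coef phi (I2 \<omega>) j)"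
    proof (rule is_stoch_integral_coord[OF I2 b])
      show "coef phi (?S (s2 \<alpha> (tp (Suc m) - s)) (?P x)) j = (sk s2 m j s *\<^sub>R phi j) \<bullet> x"
        if "s \<in> {tp m..tp (Suc m)}" for s x
        using that by (simp add: coef_def coef_SopN coef_PN sk_def inner_commute[of "phi j" x])
    qed (auto simp: sk_def)
    show "wint (\<lambda>r. sk s4 m j r *\<^sub>R phi j) (\<lambda>\<omega>. coef phi (I4 \<omega>) j)"
    proof (rule is_stoch_integral_coord[OF I4 b])
      show "coef phi (?S (s4 \<alpha> (tp (Suc m) - s)) (?P x)) j = (sk s4 m j s *\<^sub>R phi j) \<bullet> x"
        if "s \<in> {tp m..tp (Suc m)}" for s x
        using that by (simp add: coef_def coef_SopN coef_PN sk_def inner_commute[of "phi j" x])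
    qed (auto simp: sk_def)
    show "AE \<omega> in M. uN (Suc m) \<omega> \<bullet> phi j = (if j < N then s1 \<alpha> stp (lam j) * (uN m \<omega> \<bullet> phi j)
        + s2 \<alpha> stp (lam j) * (vN m \<omega> \<bullet> phi j) + stp * (s2 \<alpha> stp (lam j) * (F (uN m \<omega>) \<bullet> phi j)) else 0) + coef phi (I2 \<omega>) j"
      using eq by eventually_elim (auto simp: inner_add_left coef_SopN coef_PN coef_def)
    show "AE \<omega> in M. vN (Suc m) \<omega> \<bullet> phi j = (if j < N then s3 \<alpha> stp (lam j) * (uN m \<omega> \<bullet> phi j)
        + s4 \<alpha> stp (lam j) * (vN m \<omega> \<bullet> phi j) + stp * (s4 \<alpha> stp (lam j) * (F (uN m \<omega>) \<bullet> phi j)) else 0) + coef phi (I4 \<omega>) j"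
      using eq by eventually_elim (auto simp: inner_add_left coef_SopN coef_PN coef_def)
  qed
qed

text \<open>The noise variable of a step is only known through its defining integral. Its
  coordinates beyond the truncation are integrals of the zero kernel and vanish by
  uniqueness.\<close>

lemma scheme_high_modes:
  assumes "m \<le> n" "N \<le> j"
  shows "AE \<omega> in M. uN m \<omega> \<bullet> phi j = 0 \<and> vN m \<omega> \<bullet> phi j = 0"
proof (cases m)
  case 0
  show ?thesis unfolding 0 using scheme_init
    by eventually_elim (use assms in \<open>simp add: coef_PN\<close>)
next
  case (Suc m')
  then have m': "m' < n" using assms by simp
  obtain Z2 Z4 where Z: "wint (\<lambda>r. sk s2 m' j r *\<^sub>R phi j) Z2" "wint (\<lambda>r. sk s4 m' j r *\<^sub>R phi j) Z4"
    and eq: "AE \<omega> in M. uN m \<omega> \<bullet> phi j = Z2 \<omega>" "AE \<omega> in M. vN m \<omega> \<bullet> phi j = Z4 \<omega>"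
    using scheme_step_coord[OF m', of j] assms(2) Suc by (auto simp: not_less)
  have "(\<lambda>r. sk s2 m' j r *\<^sub>R phi j) = (\<lambda>_. 0)" "(\<lambda>r. sk s4 m' j r *\<^sub>R phi j) = (\<lambda>_. 0)"
    using assms(2) by (auto simp: sk_def)
  then have "AE \<omega> in M. Z2 \<omega> = 0" "AE \<omega> in M. Z4 \<omega> = 0"
    using wint_unique[OF _ wint_zero] Z by auto
  then show ?thesis using eq by eventually_elim simp
qed

text \<open>The recursion solved in closed form. Both components are carried through one induction
  because a step mixes them. The accumulated noise has the very kernel of the mild solution at
  \<open>tp m\<close>, so it contributes no error in the modes that are kept.\<close>

lemma discrete_mild:
  assumes "m \<le> n" "j < N"
  shows "\<exists>Z2 Z4. wint (\<lambda>r. k2 (tp m) j r *\<^sub>R phi j) Z2 \<and> wint (\<lambda>r. k4 (tp m) j r *\<^sub>R phi j) Z4 \<and>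
    (AE \<omega> in M. uN m \<omega> \<bullet> phi j = s1 \<alpha> (tp m) (lam j) * (u0 \<omega> \<bullet> phi j) + s2 \<alpha> (tp m) (lam j) * v0 \<omega> j
        + (\<Sum>i<m. stp * (s2 \<alpha> (tp m - tp i) (lam j) * (F (uN i \<omega>) \<bullet> phi j))) + Z2 \<omega>) \<and>
    (AE \<omega> in M. vN m \<omega> \<bullet> phi j = s3 \<alpha> (tp m) (lam j) * (u0 \<omega> \<bullet> phi j) + s4 \<alpha> (tp m) (lam j) * v0 \<omega> j
        + (\<Sum>i<m. stp * (s4 \<alpha> (tp m - tp i) (lam j) * (F (uN i \<omega>) \<bullet> phi j))) + Z4 \<omega>)"
  using assms(1)
proof (induction m)
  case 0
  have "wint (\<lambda>r. k2 (tp 0) j r *\<^sub>R phi j) (\<lambda>_. 0)"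
    by (rule wint_cong[OF wint_zero]) (auto simp: k2_def kern_def intro!: AE_I2)
  \<comment> \<open>At time zero this kernel has the value 1 at \<open>r = 0\<close> and vanishes
    elsewhere, so it agrees with the zero kernel only almost everywhere.\<close>
  moreover have "wint (\<lambda>r. k4 (tp 0) j r *\<^sub>R phi j) (\<lambda>_. 0)"
    by (rule wint_cong[OF wint_zero])
      (use AE_lborel_neq[of 0] in \<open>auto simp: k4_def kern_def elim!: eventually_mono\<close>)
  ultimately show ?case
  proof (intro exI[of _ "\<lambda>_. 0"] conjI)
    show "AE \<omega> in M. uN 0 \<omega> \<bullet> phi j = s1 \<alpha> (tp 0) (lam j) * (u0 \<omega> \<bullet> phi j) + s2 \<alpha> (tp 0) (lam j) * v0 \<omega> j
        + (\<Sum>i<0. stp * (s2 \<alpha> (tp 0 - tp i) (lam j) * (F (uN i \<omega>) \<bullet> phi j))) + 0"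
      using scheme_init by eventually_elim (use assms(2) in \<open>simp add: coef_PN coef_def s1_eq\<close>)
    show "AE \<omega> in M. vN 0 \<omega> \<bullet> phi j = s3 \<alpha> (tp 0) (lam j) * (u0 \<omega> \<bullet> phi j) + s4 \<alpha> (tp 0) (lam j) * v0 \<omega> j
        + (\<Sum>i<0. stp * (s4 \<alpha> (tp 0 - tp i) (lam j) * (F (uN i \<omega>) \<bullet> phi j))) + 0"
      using scheme_init by eventually_elim (use assms(2) in \<open>simp add: coef_PN s3_eq\<close>)
  qed
next
  case (Suc m)
  obtain Z2 Z4 where Z: "wint (\<lambda>r. k2 (tp m) j r *\<^sub>R phi j) Z2" "wint (\<lambda>r. k4 (tp m) j r *\<^sub>R phi j) Z4"
    and equ: "AE \<omega> in M. uN m \<omega> \<bullet> phi j = s1 \<alpha> (tp m) (lam j) * (u0 \<omega> \<bullet> phi j) + s2 \<alpha> (tp m) (lam j) * v0 \<omega> j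
        + (\<Sum>i<m. stp * (s2 \<alpha> (tp m - tp i) (lam j) * (F (uN i \<omega>) \<bullet> phi j))) + Z2 \<omega>"
    and eqv: "AE \<omega> in M. vN m \<omega> \<bullet> phi j = s3 \<alpha> (tp m) (lam j) * (u0 \<omega> \<bullet> phi j) + s4 \<alpha> (tp m) (lam j) * v0 \<omega> j
        + (\<Sum>i<m. stp * (s4 \<alpha> (tp m - tp i) (lam j) * (F (uN i \<omega>) \<bullet> phi j))) + Z4 \<omega>"
    using Suc by fastforce
  have m: "m < n" using Suc.prems by simp
  obtain I2 I4 where I: "wint (\<lambda>r. sk s2 m j r *\<^sub>R phi j) I2" "wint (\<lambda>r. sk s4 m j r *\<^sub>R phi j) I4"
    and su: "AE \<omega> in M. uN (Suc m) \<omega> \<bullet> phi j = s1 \<alpha> stp (lam j) * (uN m \<omega> \<bullet> phi j)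
        + s2 \<alpha> stp (lam j) * (vN m \<omega> \<bullet> phi j) + stp * (s2 \<alpha> stp (lam j) * (F (uN m \<omega>) \<bullet> phi j)) + I2 \<omega>"
    and sv: "AE \<omega> in M. vN (Suc m) \<omega> \<bullet> phi j = s3 \<alpha> stp (lam j) * (uN m \<omega> \<bullet> phi j)
        + s4 \<alpha> stp (lam j) * (vN m \<omega> \<bullet> phi j) + stp * (s4 \<alpha> stp (lam j) * (F (uN m \<omega>) \<bullet> phi j)) + I4 \<omega>"
    using scheme_step_coord[OF m, of j] assms(2) by auto
  let ?a = "s1 \<alpha> stp (lam j)" and ?b = "s2 \<alpha> stp (lam j)" and ?c = "s3 \<alpha> stp (lam j)" and ?d = "s4 \<alpha> stp (lam j)"
  have meas: "Z2 \<in> borel_measurable M" "Z4 \<in> borel_measurable M" "I2 \<in> borel_measurable M" "I4 \<in> borel_measurable M"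
    using Z I by (auto dest: wint_measurable)
  note [measurable] = meas
  have tpr: "tp (Suc m) - r = stp + (tp m - r)" for r by (simp add: tp_Suc)
  \<comment> \<open>On the earlier steps the addition formula propagates the old kernels; on the
    newest step \<open>sk\<close> is the kernel itself. At \<open>r = tp m\<close> both contribute
    and the identity fails, hence the null set.\<close>
  have Z2': "wint (\<lambda>r. k2 (tp (Suc m)) j r *\<^sub>R phi j) (\<lambda>\<omega>. ?a * Z2 \<omega> + ?b * Z4 \<omega> + I2 \<omega>)"
  proof (rule wint_cong[OF wint_add[OF wint_add[OF wint_scale[OF Z(1), of ?a] wint_scale[OF Z(2), of ?b]] I(1)]])
    show "AE r in lborel. ?a *\<^sub>R k2 (tp m) j r *\<^sub>R phi j + ?b *\<^sub>R k4 (tp m) j r *\<^sub>R phi j + sk s2 m j r *\<^sub>R phi j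
      = k2 (tp (Suc m)) j r *\<^sub>R phi j"
      using AE_lborel_neq[of "tp m"]
    proof eventually_elim
      case (elim r)
      have "?a * k2 (tp m) j r + ?b * k4 (tp m) j r + sk s2 m j r = k2 (tp (Suc m)) j r"
        using elim assms(2) tp_nonneg[of m] stp_pos
        by (auto simp: k2_def k4_def kern_def sk_def tpr s2_add) (auto simp: tp_Suc)
      then show ?case by (metis scaleR_left_distrib scaleR_scaleR)
    qed
  qed measurable
  have Z4': "wint (\<lambda>r. k4 (tp (Suc m)) j r *\<^sub>R phi j) (\<lambda>\<omega>. ?c * Z2 \<omega> + ?d * Z4 \<omega> + I4 \<omega>)"
  proof (rule wint_cong[OF wint_add[OF wint_add[OF wint_scale[OF Z(1), of ?c] wint_scale[OF Z(2), of ?d]] I(2)]])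
    show "AE r in lborel. ?c *\<^sub>R k2 (tp m) j r *\<^sub>R phi j + ?d *\<^sub>R k4 (tp m) j r *\<^sub>R phi j + sk s4 m j r *\<^sub>R phi j
      = k4 (tp (Suc m)) j r *\<^sub>R phi j"
      using AE_lborel_neq[of "tp m"]
    proof eventually_elim
      case (elim r)
      have "?c * k2 (tp m) j r + ?d * k4 (tp m) j r + sk s4 m j r = k4 (tp (Suc m)) j r"
        using elim assms(2) tp_nonneg[of m] stp_pos
        by (auto simp: k2_def k4_def kern_def sk_def tpr s4_add) (auto simp: tp_Suc)
      then show ?case by (metis scaleR_left_distrib scaleR_scaleR)
    qed
  qed measurable
  have "AE \<omega> in M. uN (Suc m) \<omega> \<bullet> phi j = s1 \<alpha> (tp (Suc m)) (lam j) * (u0 \<omega> \<bullet> phi j) + s2 \<alpha> (tp (Suc m)) (lam j) * v0 \<omega> j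
        + (\<Sum>i<Suc m. stp * (s2 \<alpha> (tp (Suc m) - tp i) (lam j) * (F (uN i \<omega>) \<bullet> phi j))) + (?a * Z2 \<omega> + ?b * Z4 \<omega> + I2 \<omega>)"
    using equ eqv su
  proof eventually_elim
    case (elim \<omega>)
    have "(\<Sum>i<Suc m. stp * (s2 \<alpha> (tp (Suc m) - tp i) (lam j) * (F (uN i \<omega>) \<bullet> phi j)))
      = ?a * (\<Sum>i<m. stp * (s2 \<alpha> (tp m - tp i) (lam j) * (F (uN i \<omega>) \<bullet> phi j)))
      + ?b * (\<Sum>i<m. stp * (s4 \<alpha> (tp m - tp i) (lam j) * (F (uN i \<omega>) \<bullet> phi j)))
      + stp * (?b * (F (uN m \<omega>) \<bullet> phi j))"
    proof -
      have "s2 \<alpha> (tp (Suc m) - tp i) (lam j) = ?a * s2 \<alpha> (tp m - tp i) (lam j) + ?b * s4 \<alpha> (tp m - tp i) (lam j)" for i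
        by (simp only: tpr s2_add)
      moreover have "s2 \<alpha> (tp (Suc m) - tp m) (lam j) = s2 \<alpha> stp (lam j)" by (simp add: tp_Suc)
      ultimately show ?thesis
        by (simp add: sum_distrib_left sum.distrib[symmetric] distrib_left distrib_right mult_ac)
    qed
    then show ?case
      unfolding elim(3) unfolding elim(1,2) by (simp add: tp_Suc s1_add s2_add algebra_simps)
  qed
  moreover have "AE \<omega> in M. vN (Suc m) \<omega> \<bullet> phi j = s3 \<alpha> (tp (Suc m)) (lam j) * (u0 \<omega> \<bullet> phi j) + s4 \<alpha> (tp (Suc m)) (lam j) * v0 \<omega> j
        + (\<Sum>i<Suc m. stp * (s4 \<alpha> (tp (Suc m) - tp i) (lam j) * (F (uN i \<omega>) \<bullet> phi j))) + (?c * Z2 \<omega> + ?d * Z4 \<omega> + I4 \<omega>)"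
    using equ eqv sv
  proof eventually_elim
    case (elim \<omega>)
    have "(\<Sum>i<Suc m. stp * (s4 \<alpha> (tp (Suc m) - tp i) (lam j) * (F (uN i \<omega>) \<bullet> phi j)))
      = ?c * (\<Sum>i<m. stp * (s2 \<alpha> (tp m - tp i) (lam j) * (F (uN i \<omega>) \<bullet> phi j)))
      + ?d * (\<Sum>i<m. stp * (s4 \<alpha> (tp m - tp i) (lam j) * (F (uN i \<omega>) \<bullet> phi j)))
      + stp * (?d * (F (uN m \<omega>) \<bullet> phi j))"
    proof -
      have "s4 \<alpha> (tp (Suc m) - tp i) (lam j) = ?c * s2 \<alpha> (tp m - tp i) (lam j) + ?d * s4 \<alpha> (tp m - tp i) (lam j)" for i
        by (simp only: tpr s4_add)
      moreover have "s4 \<alpha> (tp (Suc m) - tp m) (lam j) = s4 \<alpha> stp (lam j)" by (simp add: tp_Suc)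
      ultimately show ?thesis
        by (simp add: sum_distrib_left sum.distrib[symmetric] distrib_left distrib_right mult_ac)
    qed
    then show ?case
      unfolding elim(3) unfolding elim(1,2) by (simp add: tp_Suc s3_add s4_add algebra_simps)
  qed
  ultimately show ?case using Z2' Z4' by blast
qed

end

text \<open>The sequence \<open>A * (1 + x) ^ m\<close> solves the recursion with equality. Since
  the values are extended reals, the finiteness of each one is a result of the induction, so no
  moment bound for the scheme is required first.\<close>

lemma ennreal_discrete_gronwall:
  fixes f :: "nat \<Rightarrow> ennreal"
  assumes le: "\<And>m. m \<le> n \<Longrightarrow> f m \<le> ennreal A + ennreal x * (\<Sum>i<m. f i)"
    and "0 \<le> A" "0 \<le> x" "m \<le> n"
  shows "f m \<le> ennreal (A * (1 + x) ^ m)"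
  using assms(4)
proof (induction m rule: less_induct)
  case (less m)
  have geo: "A + x * (\<Sum>i<m. A * (1 + x) ^ i) = A * (1 + x) ^ m" for m
    by (induction m) (auto simp: algebra_simps)
  have "f m \<le> ennreal A + ennreal x * (\<Sum>i<m. ennreal (A * (1 + x) ^ i))"
    using le[OF less.prems] by (rule order_trans) (intro add_left_mono mult_left_mono sum_mono less.IH; use less.prems in auto)
  also have "(\<Sum>i<m. ennreal (A * (1 + x) ^ i)) = ennreal (\<Sum>i<m. A * (1 + x) ^ i)"
    using assms by (intro sum_ennreal) auto
  also have "ennreal A + ennreal x * \<dots> = ennreal (A + x * (\<Sum>i<m. A * (1 + x) ^ i))"
    using assms by (intro ennreal_affine sum_nonneg) auto
  finally show ?case by (simp only: geo)
qed

section \<open>The drift of the scheme as a time integral\<close>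

context scheme begin

lemma piece_exists: "0 \<le> r \<Longrightarrow> r < tp m \<Longrightarrow> \<exists>i<m. r \<in> {tp i..<tp (Suc i)}"
proof (induction m)
  case (Suc m)
  show ?case
  proof (cases "r < tp m")
    case True
    then show ?thesis using Suc less_SucI by metis
  qed (use Suc in auto)
qed simp

lemma piece_unique: "r \<in> {tp i..<tp (Suc i)} \<Longrightarrow> r \<in> {tp l..<tp (Suc l)} \<Longrightarrow> l = i"
  using tp_mono[of "Suc l" i] tp_mono[of "Suc i" l] by (cases l i rule: linorder_cases) auto

lemma piece_before: "i < m \<Longrightarrow> r \<in> {tp i..<tp (Suc i)} \<Longrightarrow> r < tp m"
  using tp_mono[of "Suc i" m] by auto

text \<open>Step functions that take the value at the left end of each subinterval and vanish from
  \<open>tp m\<close> on. They turn the sums of the scheme into integrals over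
  \<open>tmeas T\<close>, where they can be subtracted from the drift of the mild solution.\<close>

definition sf :: "nat \<Rightarrow> (nat \<Rightarrow> 'b::real_vector) \<Rightarrow> real \<Rightarrow> 'b" where
  "sf m y r = (\<Sum>l<m. indicator {tp l..<tp (Suc l)} r *\<^sub>R y l)"

lemma sf_piece: "i < m \<Longrightarrow> r \<in> {tp i..<tp (Suc i)} \<Longrightarrow> sf m y r = y i"
proof -
  assume i: "i < m" "r \<in> {tp i..<tp (Suc i)}"
  have "sf m y r = (\<Sum>l<m. if l = i then y i else 0)"
    unfolding sf_def
  proof (rule sum.cong[OF refl])
    fix l
    show "indicator {tp l..<tp (Suc l)} r *\<^sub>R y l = (if l = i then y i else 0)"
    proof (cases "l = i")
      case True
      then show ?thesis using i(2) by simp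
    next
      case False
      then have "r \<notin> {tp l..<tp (Suc l)}" using piece_unique[OF i(2)] by blast
      then show ?thesis using False by simp
    qed
  qed
  then show ?thesis using i by simp
qed

lemma sf_after: "tp m \<le> r \<Longrightarrow> sf m y r = 0"
  unfolding sf_def using piece_before[of _ m r] by (intro sum.neutral) (auto simp: indicator_def)

lemma sf_measurable [measurable]: "sf m (y :: nat \<Rightarrow> real) \<in> borel_measurable borel"
  unfolding sf_def[abs_def] by measurable

lemma sf_bound: "(\<And>i. i < m \<Longrightarrow> \<bar>y i\<bar> \<le> B) \<Longrightarrow> 0 \<le> B \<Longrightarrow> 0 \<le> r \<Longrightarrow> \<bar>sf m y r\<bar> \<le> (B::real)"
  using piece_exists[of r m] sf_piece[of _ m r y] sf_after[of m r y] by (cases "r < tp m") auto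

lemma emeasure_piece: "i < n \<Longrightarrow> emeasure (tmeas T) {tp i..<tp (Suc i)} = ennreal stp"
proof -
  assume i: "i < n"
  have "{tp i..<tp (Suc i)} \<subseteq> {0..T}" using tp_nonneg[of i] tp_mem[of "Suc i"] i by auto
  then have "emeasure (tmeas T) {tp i..<tp (Suc i)} = emeasure lborel {tp i..<tp (Suc i)}"
    unfolding tmeas_def by (intro emeasure_restrict_space) auto
  then show ?thesis using stp_pos by (simp add: tp_Suc)
qed

lemma piece_sets: "i < n \<Longrightarrow> {tp i..<tp (Suc i)} \<in> sets (tmeas T)"
  using tp_nonneg[of i] tp_mem[of "Suc i"] by (auto simp: tmeas_def sets_restrict_space_iff)

lemma sf_integral:
  assumes "m \<le> n"
  shows "integrable (tmeas T) (sf m y)" "(LINT r|tmeas T. sf m y r) = (\<Sum>i<m. stp * (y i :: real))"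
proof -
  have "has_bochner_integral (tmeas T) (sf m y) (\<Sum>i<m. measure (tmeas T) {tp i..<tp (Suc i)} *\<^sub>R y i)"
    unfolding sf_def[abs_def] using assms emeasure_piece piece_sets
    by (intro has_bochner_integral_sum has_bochner_integral_scaleR_left has_bochner_integral_real_indicator) auto
  moreover have "(\<Sum>i<m. measure (tmeas T) {tp i..<tp (Suc i)} *\<^sub>R y i) = (\<Sum>i<m. stp * y i)"
    using assms emeasure_piece stp_pos by (intro sum.cong) (auto simp: measure_def)
  ultimately show "integrable (tmeas T) (sf m y)" "(LINT r|tmeas T. sf m y r) = (\<Sum>i<m. stp * (y i :: real))"
    by (auto simp: has_bochner_integral_iff)
qed

text \<open>The integrand is compared with a step function before anything is split, since
  \<open>nn_integral_mono\<close> asks for no measurability of \<open>h\<close>.\<close>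

lemma nn_integral_step_le:
  assumes "m \<le> n" and le: "\<And>r i. i < m \<Longrightarrow> r \<in> {tp i..<tp (Suc i)} \<Longrightarrow> h r \<le> Y i"
    and 0: "\<And>r. tp m \<le> r \<Longrightarrow> r \<le> T \<Longrightarrow> h r = (0::ennreal)"
  shows "(\<integral>\<^sup>+r. h r \<partial>tmeas T) \<le> (\<Sum>i<m. ennreal stp * Y i)"
proof -
  have "(\<integral>\<^sup>+r. h r \<partial>tmeas T) \<le> (\<integral>\<^sup>+r. (\<Sum>i<m. Y i * indicator {tp i..<tp (Suc i)} r) \<partial>tmeas T)"
  proof (rule nn_integral_mono)
    fix r assume "r \<in> space (tmeas T)"
    then have r: "0 \<le> r" "r \<le> T" by auto
    show "h r \<le> (\<Sum>i<m. Y i * indicator {tp i..<tp (Suc i)} r)"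
    proof (cases "r < tp m")
      case True
      then obtain i where i: "i < m" "r \<in> {tp i..<tp (Suc i)}" using piece_exists r by blast
      have "h r \<le> Y i * indicator {tp i..<tp (Suc i)} r" using le[OF i] i by simp
      also have "\<dots> \<le> (\<Sum>i<m. Y i * indicator {tp i..<tp (Suc i)} r)"
        using i by (intro member_le_sum) auto
      finally show ?thesis .
    qed (use 0 r in auto)
  qed
  also have "\<dots> = (\<Sum>i<m. \<integral>\<^sup>+r. Y i * indicator {tp i..<tp (Suc i)} r \<partial>tmeas T)"
    using assms(1) piece_sets by (intro nn_integral_sum) auto
  also have "\<dots> = (\<Sum>i<m. ennreal stp * Y i)"
    using assms(1) piece_sets emeasure_piece
    by (intro sum.cong refl) (subst nn_integral_cmult_indicator, auto simp: mult.commute)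
  finally show ?thesis .
qed

definition Fd :: "nat \<Rightarrow> real \<Rightarrow> 'w \<Rightarrow> 'h" where
  "Fd m r \<omega> = sf m (\<lambda>i. F (uN i \<omega>)) r"

lemma Fd_joint: "m \<le> n \<Longrightarrow> (\<lambda>(r, \<omega>). Fd m r \<omega>) \<in> borel_measurable (tmeas T \<Otimes>\<^sub>M M)"
proof -
  assume m: "m \<le> n"
  have "(\<lambda>(r, \<omega>). Fd m r \<omega>) = (\<lambda>(r, \<omega>). \<Sum>l<m. (indicator {tp l..<tp (Suc l)} r :: real) *\<^sub>R F (uN l \<omega>))"
    by (simp add: Fd_def sf_def)
  also have "\<dots> \<in> borel_measurable (tmeas T \<Otimes>\<^sub>M M)"
    unfolding case_prod_beta'
  proof (rule borel_measurable_sum)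
    fix l assume "l \<in> {..<m}"
    then have [measurable]: "uN l \<in> borel_measurable M" using m by (intro uN_measurable) auto
    have [measurable]: "(indicator {tp l..<tp (Suc l)} :: real \<Rightarrow> real) \<in> borel_measurable (tmeas T)"
      by (intro borel_tmeas) measurable
    show "(\<lambda>x. (indicator {tp l..<tp (Suc l)} (fst x) :: real) *\<^sub>R F (uN l (snd x))) \<in> borel_measurable (tmeas T \<Otimes>\<^sub>M M)"
      by measurable
  qed
  finally show ?thesis .
qed

lemma sf_Fd: "r \<in> {0..T} \<Longrightarrow> sf m c r * (Fd m r \<omega> \<bullet> phi j) = sf m (\<lambda>i. c i * (F (uN i \<omega>) \<bullet> phi j)) r"
  unfolding Fd_def using piece_exists[of r m] by (cases "r < tp m") (auto simp: sf_piece sf_after)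

lemma discrete_drift:
  assumes "m \<le> n"
  shows "integrable (tmeas T) (\<lambda>r. sf m c r * (Fd m r \<omega> \<bullet> phi j))"
    and "(LINT r|tmeas T. sf m c r * (Fd m r \<omega> \<bullet> phi j)) = (\<Sum>i<m. stp * (c i * (F (uN i \<omega>) \<bullet> phi j)))"
proof -
  have "integrable (tmeas T) (\<lambda>r. sf m c r * (Fd m r \<omega> \<bullet> phi j))
    \<longleftrightarrow> integrable (tmeas T) (sf m (\<lambda>i. c i * (F (uN i \<omega>) \<bullet> phi j)))"
    by (rule Bochner_Integration.integrable_cong) (auto simp: sf_Fd)
  then show "integrable (tmeas T) (\<lambda>r. sf m c r * (Fd m r \<omega> \<bullet> phi j))" using sf_integral[OF assms] by simp
  have "(LINT r|tmeas T. sf m c r * (Fd m r \<omega> \<bullet> phi j))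
    = (LINT r|tmeas T. sf m (\<lambda>i. c i * (F (uN i \<omega>) \<bullet> phi j)) r)"
    by (rule Bochner_Integration.integral_cong) (auto simp: sf_Fd)
  then show "(LINT r|tmeas T. sf m c r * (Fd m r \<omega> \<bullet> phi j)) = (\<Sum>i<m. stp * (c i * (F (uN i \<omega>) \<bullet> phi j)))"
    using sf_integral[OF assms] by simp
qed

lemma path_mult_integrable:
  assumes "\<omega> \<in> space M" "usq \<omega> < \<infinity>" and a [measurable]: "a \<in> borel_measurable (tmeas T)"
    and B: "\<And>r. r \<in> {0..T} \<Longrightarrow> \<bar>a r\<bar> \<le> B"
  shows "integrable (tmeas T) (\<lambda>r. a r * (F (u r \<omega>) \<bullet> phi j))"
proof (rule Bochner_Integration.integrable_bound)
  note [measurable] = u_path_measurable[OF assms(1)]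
  have "integrable (tmeas T) (\<lambda>r. F (u r \<omega>))"
    unfolding integrable_iff_bounded using Fu_path_integrable[OF assms(1,2)] by simp
  then show "integrable (tmeas T) (\<lambda>r. B * norm (F (u r \<omega>)))" by auto
  show "AE r in tmeas T. norm (a r * (F (u r \<omega>) \<bullet> phi j)) \<le> norm (B * norm (F (u r \<omega>)))"
  proof (rule AE_I2)
    fix r assume "r \<in> space (tmeas T)"
    then have "\<bar>a r\<bar> \<le> B" using B by simp
    moreover have "\<bar>F (u r \<omega>) \<bullet> phi j\<bar> \<le> norm (F (u r \<omega>))"
      using Cauchy_Schwarz_ineq2[of "F (u r \<omega>)" "phi j"] by simp
    ultimately have "\<bar>a r\<bar> * \<bar>F (u r \<omega>) \<bullet> phi j\<bar> \<le> B * norm (F (u r \<omega>))"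
      by (intro mult_mono) auto
    then show "norm (a r * (F (u r \<omega>) \<bullet> phi j)) \<le> norm (B * norm (F (u r \<omega>)))"
      using \<open>\<bar>a r\<bar> \<le> B\<close> by (simp add: abs_mult)
  qed
  show "(\<lambda>r. a r * (F (u r \<omega>) \<bullet> phi j)) \<in> borel_measurable (tmeas T)" by measurable
qed

definition EE :: "nat \<Rightarrow> ennreal" where
  "EE m = msq (\<lambda>\<omega>. u (tp m) \<omega> - uN m \<omega>)"

text \<open>The exact solution at the left grid point is inserted: what comes before it is
  regularity in time over at most one step, what comes after is the error already made.\<close>

lemma F_error:
  assumes "i < m" "m \<le> n" "r \<in> {tp i..<tp (Suc i)}"
  shows "msq (\<lambda>\<omega>. F (u r \<omega>) - F (uN i \<omega>))
    \<le> ennreal (K\<^sup>2 * (2 * (CR * stp powr (2 * dl)))) + ennreal (K\<^sup>2 * 2) * EE i"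
proof -
  have ti: "tp i \<in> {0..T}" using assms by (intro tp_mem) auto
  have tSi: "tp (Suc i) \<le> T" using tp_mem[of "Suc i"] assms by auto
  have r: "r \<in> {0..T}" using assms(3) ti tSi by auto
  have [measurable]: "u r \<in> borel_measurable M" "u (tp i) \<in> borel_measurable M" "uN i \<in> borel_measurable M"
    using u_measurable[OF r] u_measurable[OF ti] uN_measurable[of i] assms by auto
  have "msq (\<lambda>\<omega>. F (u r \<omega>) - F (uN i \<omega>))
    \<le> (\<integral>\<^sup>+\<omega>. ennreal (K\<^sup>2 * 2) * ennreal ((norm (u r \<omega> - u (tp i) \<omega>))\<^sup>2)
        + ennreal (K\<^sup>2 * 2) * ennreal ((norm (u (tp i) \<omega> - uN i \<omega>))\<^sup>2) \<partial>M)"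
  proof (rule nn_integral_mono)
    fix \<omega>
    have "(norm (F (u r \<omega>) - F (uN i \<omega>)))\<^sup>2 \<le> (K * norm (u r \<omega> - uN i \<omega>))\<^sup>2"
      using lip by (intro square_le) simp
    also have "\<dots> = K\<^sup>2 * (norm ((u r \<omega> - u (tp i) \<omega>) + (u (tp i) \<omega> - uN i \<omega>)))\<^sup>2"
      by (simp add: power_mult_distrib)
    also have "\<dots> \<le> K\<^sup>2 * (2 * (norm (u r \<omega> - u (tp i) \<omega>))\<^sup>2 + 2 * (norm (u (tp i) \<omega> - uN i \<omega>))\<^sup>2)"
      by (intro mult_left_mono norm_sq_add_le) auto
    finally have "ennreal ((norm (F (u r \<omega>) - F (uN i \<omega>)))\<^sup>2)
      \<le> ennreal (K\<^sup>2 * 2 * (norm (u r \<omega> - u (tp i) \<omega>))\<^sup>2 + K\<^sup>2 * 2 * (norm (u (tp i) \<omega> - uN i \<omega>))\<^sup>2)"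
      by (intro ennreal_leI) (simp add: distrib_left mult.assoc)
    then show "ennreal ((norm (F (u r \<omega>) - F (uN i \<omega>)))\<^sup>2)
      \<le> ennreal (K\<^sup>2 * 2) * ennreal ((norm (u r \<omega> - u (tp i) \<omega>))\<^sup>2)
        + ennreal (K\<^sup>2 * 2) * ennreal ((norm (u (tp i) \<omega> - uN i \<omega>))\<^sup>2)"
      by (subst (asm) ennreal_plus; simp add: ennreal_mult)
  qed
  also have "\<dots> = ennreal (K\<^sup>2 * 2) * msq (\<lambda>\<omega>. u r \<omega> - u (tp i) \<omega>) + ennreal (K\<^sup>2 * 2) * EE i"
    unfolding EE_def by (subst nn_integral_add) (measurable, simp add: nn_integral_cmult)
  also have "\<dots> \<le> ennreal (K\<^sup>2 * 2) * ennreal (CR * stp powr (2 * dl)) + ennreal (K\<^sup>2 * 2) * EE i"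
  proof (intro add_right_mono mult_left_mono)
    have "msq (\<lambda>\<omega>. u r \<omega> - u (tp i) \<omega>) \<le> ennreal (CR * (r - tp i) powr (2 * dl))"
      using assms(3) ti r by (intro u_increment) auto
    also have "\<dots> \<le> ennreal (CR * stp powr (2 * dl))"
      using assms(3) CR_nonneg dl_bounds by (intro ennreal_leI mult_left_mono powr_mono2) (auto simp: tp_Suc)
    finally show "msq (\<lambda>\<omega>. u r \<omega> - u (tp i) \<omega>) \<le> ennreal (CR * stp powr (2 * dl))" .
  qed auto
  also have "ennreal (K\<^sup>2 * 2) * ennreal (CR * stp powr (2 * dl)) = ennreal (K\<^sup>2 * (2 * (CR * stp powr (2 * dl))))"
    using CR_nonneg by (subst ennreal_mult[symmetric]) (auto simp: mult.assoc)
  finally show ?thesis .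
qed

lemma sum_affine_le:
  assumes "m \<le> n" "0 \<le> x" "0 \<le> y"
  shows "(\<Sum>i<m. ennreal stp * (ennreal x + ennreal y * f i)) \<le> ennreal (T * x) + ennreal (y * stp) * (\<Sum>i<m. f i)"
proof -
  have "(\<Sum>i<m. ennreal stp * (ennreal x + ennreal y * f i)) = (\<Sum>i<m. ennreal (stp * x) + ennreal (y * stp) * f i)"
    using stp_pos assms by (simp add: distrib_left ennreal_mult mult_ac)
  also have "\<dots> = (\<Sum>i<m. ennreal (stp * x)) + ennreal (y * stp) * (\<Sum>i<m. f i)"
    by (simp only: sum.distrib sum_distrib_left)
  also have "(\<Sum>i<m. ennreal (stp * x)) = ennreal (tp m * x)"
    using stp_pos assms by (subst sum_ennreal) (auto simp: tp_def)
  also have "\<dots> \<le> ennreal (T * x)"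
    using tp_mem[OF assms(1)] assms by (intro ennreal_leI mult_right_mono) auto
  finally show ?thesis by (simp add: add_right_mono)
qed

text \<open>Here the kernel is already frozen and only the argument of \<open>F\<close> is in error.
  The kernel enters through the bound \<open>B\<close> alone, so the lemma serves \<open>u\<close>
  with \<open>B = T\<close> and the velocity with \<open>B = 1\<close>.\<close>

lemma discretised_drift_error:
  assumes "m \<le> n" and c: "\<And>j i. i < m \<Longrightarrow> \<bar>c j i\<bar> \<le> B"
  shows "hsum 0 (\<lambda>j \<omega>. LINT r|tmeas T. sf m (c j) r * ((F (u r \<omega>) - Fd m r \<omega>) \<bullet> phi j))
    \<le> ennreal T * (ennreal (T * (B\<^sup>2 * (K\<^sup>2 * (2 * (CR * stp powr (2 * dl)))))) + ennreal (B\<^sup>2 * (K\<^sup>2 * 2) * stp) * (\<Sum>i<m. EE i))"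
proof -
  have G: "(\<lambda>(r, \<omega>). F (u r \<omega>) - Fd m r \<omega>) \<in> borel_measurable (tmeas T \<Otimes>\<^sub>M M)"
    using borel_measurable_diff[OF Fu_joint Fd_joint[OF assms(1)]] by (simp add: case_prod_beta')
  have "hsum 0 (\<lambda>j \<omega>. LINT r|tmeas T. sf m (c j) r * ((F (u r \<omega>) - Fd m r \<omega>) \<bullet> phi j))
    \<le> ennreal T * (\<integral>\<^sup>+r. (ennreal (B\<^sup>2) * indicator {..<tp m} r)
        * msq (\<lambda>\<omega>. F (u r \<omega>) - Fd m r \<omega>) \<partial>tmeas T)"
  proof (rule hsum_drift[OF G])
    fix j r assume r: "r \<in> {0..T}"
    show "ennreal (lam j powr 0 * (sf m (c j) r)\<^sup>2) \<le> ennreal (B\<^sup>2) * indicator {..<tp m} r"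
    proof (cases "r < tp m")
      case True
      then obtain i where i: "i < m" "r \<in> {tp i..<tp (Suc i)}" using piece_exists r by auto
      show ?thesis using square_le[OF c[OF i(1)]] True lam_pos[of j] by (simp add: sf_piece[OF i] ennreal_leI)
    qed (simp add: sf_after)
  qed (intro borel_tmeas; measurable)+
  also have "(\<integral>\<^sup>+r. (ennreal (B\<^sup>2) * indicator {..<tp m} r)
        * msq (\<lambda>\<omega>. F (u r \<omega>) - Fd m r \<omega>) \<partial>tmeas T)
    \<le> (\<Sum>i<m. ennreal stp * (ennreal (B\<^sup>2 * (K\<^sup>2 * (2 * (CR * stp powr (2 * dl))))) + ennreal (B\<^sup>2 * (K\<^sup>2 * 2)) * EE i))"
  proof (rule nn_integral_step_le[OF assms(1)])
    fix r i assume i: "i < m" "r \<in> {tp i..<tp (Suc i)}"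
    have "(ennreal (B\<^sup>2) * indicator {..<tp m} r) * msq (\<lambda>\<omega>. F (u r \<omega>) - Fd m r \<omega>)
      \<le> ennreal (B\<^sup>2) * (ennreal (K\<^sup>2 * (2 * (CR * stp powr (2 * dl)))) + ennreal (K\<^sup>2 * 2) * EE i)"
      using F_error[OF i(1) assms(1) i(2)] piece_before[OF i] by (simp add: Fd_def sf_piece[OF i] mult_left_mono)
    also have "\<dots> = ennreal (B\<^sup>2 * (K\<^sup>2 * (2 * (CR * stp powr (2 * dl))))) + ennreal (B\<^sup>2 * (K\<^sup>2 * 2)) * EE i"
      using CR_nonneg by (subst (1 2) ennreal_mult) (auto simp: distrib_left mult.assoc)
    finally show "(ennreal (B\<^sup>2) * indicator {..<tp m} r) * msq (\<lambda>\<omega>. F (u r \<omega>) - Fd m r \<omega>)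
      \<le> ennreal (B\<^sup>2 * (K\<^sup>2 * (2 * (CR * stp powr (2 * dl))))) + ennreal (B\<^sup>2 * (K\<^sup>2 * 2)) * EE i" .
  qed simp
  also have "\<dots> \<le> ennreal (T * (B\<^sup>2 * (K\<^sup>2 * (2 * (CR * stp powr (2 * dl)))))) + ennreal (B\<^sup>2 * (K\<^sup>2 * 2) * stp) * (\<Sum>i<m. EE i)"
    using CR_nonneg by (intro sum_affine_le assms) auto
  finally show ?thesis by (simp add: mult_left_mono)
qed

section \<open>The error of u\<close>

text \<open>The spectral projection as a multiplier on coordinates; \<open>1 - bN\<close> belongs to
  the complementary projection.\<close>

definition bN :: "nat \<Rightarrow> real" where "bN j = (if j < N then 1 else 0)"

lemma hsum_trunc:
  assumes "\<And>j. X j \<in> borel_measurable M" shows "hsum s (\<lambda>j \<omega>. bN j * X j \<omega>) \<le> hsum s X"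
  using hsum_mult[OF assms, of s bN 1 s] by (simp add: bN_def)

text \<open>Indices start at 0, so \<open>N\<close> is the first discarded one and
  \<open>lam N\<close> is the eigenvalue usually numbered N + 1. By monotonicity it is the smallest
  in the tail.\<close>

lemma hsum_tail:
  assumes "\<And>j. X j \<in> borel_measurable M" "0 \<le> s" "hsum s X \<le> ennreal a" "0 \<le> a"
  shows "hsum 0 (\<lambda>j \<omega>. (1 - bN j) * X j \<omega>) \<le> ennreal (lam N powr (- s) * a)"
proof (rule hsum_mult_le[OF assms(1) _ _ assms(3,4)])
  fix j
  show "lam j powr 0 * (1 - bN j)\<^sup>2 \<le> lam N powr - s * lam j powr s"
  proof (cases "j < N")
    case False
    have "lam N powr s \<le> lam j powr s"
      using incseq_lam False assms(2) lam_pos[of N] by (intro powr_mono2) (auto simp: incseq_def)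
    then have "lam N powr (- s) * lam N powr s \<le> lam N powr (- s) * lam j powr s"
      by (intro mult_left_mono) auto
    then show ?thesis using False lam_pos[of N] lam_pos[of j] by (simp add: bN_def flip: powr_add)
  qed (simp add: bN_def)
qed simp

text \<open>On the modes that are kept, initial values and noise cancel. The kernel is frozen in the
  first integral and the error of freezing it is the second, paired with the exact
  \<open>F (u r)\<close>; thus only the first involves the scheme and feeds the Gronwall argument.
  The last term is the truncation error.\<close>

lemma u_error_coord:
  assumes m: "m \<le> n"
  shows "AE \<omega> in M. (u (tp m) \<omega> - uN m \<omega>) \<bullet> phi j =
    bN j * ((LINT r|tmeas T. sf m (\<lambda>i. s2 \<alpha> (tp m - tp i) (lam j)) r * ((F (u r \<omega>) - Fd m r \<omega>) \<bullet> phi j))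
      + (LINT r|tmeas T. (k2 (tp m) j r - sf m (\<lambda>i. s2 \<alpha> (tp m - tp i) (lam j)) r) * (F (u r \<omega>) \<bullet> phi j)))
    + (1 - bN j) * (u (tp m) \<omega> \<bullet> phi j)"
proof (cases "j < N")
  case False
  then show ?thesis
    using scheme_high_modes[OF m, of j] by (auto elim!: eventually_mono simp: bN_def inner_diff_left)
next
  case True
  let ?c = "\<lambda>i. s2 \<alpha> (tp m - tp i) (lam j)"
  obtain Z where Z: "\<And>j. wint (\<lambda>r. k2 (tp m) j r *\<^sub>R phi j) (Z j)"
    and eq: "AE \<omega> in M. \<forall>j. u (tp m) \<omega> \<bullet> phi j = s1 \<alpha> (tp m) (lam j) * (u0 \<omega> \<bullet> phi j) + s2 \<alpha> (tp m) (lam j) * v0 \<omega> j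
       + (LINT r|tmeas T. k2 (tp m) j r * (F (u r \<omega>) \<bullet> phi j)) + Z j \<omega>"
    using u_decomp[OF tp_mem[OF m]] by blast
  obtain Z2 where Z2: "wint (\<lambda>r. k2 (tp m) j r *\<^sub>R phi j) Z2"
    and eq2: "AE \<omega> in M. uN m \<omega> \<bullet> phi j = s1 \<alpha> (tp m) (lam j) * (u0 \<omega> \<bullet> phi j) + s2 \<alpha> (tp m) (lam j) * v0 \<omega> j
        + (\<Sum>i<m. stp * (?c i * (F (uN i \<omega>) \<bullet> phi j))) + Z2 \<omega>"
    using discrete_mild[OF m True] by blast
  have cb: "\<bar>sf m ?c r\<bar> \<le> 2 / \<alpha> / lam j" if "r \<in> {0..T}" for r
    using that \<alpha> lam_pos[of j] tp_mono by (intro sf_bound s2_bound) (auto simp: less_imp_le)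
  have [measurable]: "sf m ?c \<in> borel_measurable (tmeas T)" by (intro borel_tmeas sf_measurable)
  from eq eq2 wint_unique[OF Z Z2] usq_finite AE_space show ?thesis
  proof eventually_elim
    case (elim \<omega>)
    have i1: "integrable (tmeas T) (\<lambda>r. sf m ?c r * (F (u r \<omega>) \<bullet> phi j))"
      by (rule path_mult_integrable[OF elim(5,4) _ cb]) measurable
    have "(LINT r|tmeas T. sf m ?c r * ((F (u r \<omega>) - Fd m r \<omega>) \<bullet> phi j))
      = (LINT r|tmeas T. sf m ?c r * (F (u r \<omega>) \<bullet> phi j)) - (\<Sum>i<m. stp * (?c i * (F (uN i \<omega>) \<bullet> phi j)))"
      unfolding inner_diff_left right_diff_distrib discrete_drift(2)[OF m, symmetric]
      by (intro Bochner_Integration.integral_diff i1 discrete_drift[OF m])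
    moreover have "(LINT r|tmeas T. (k2 (tp m) j r - sf m ?c r) * (F (u r \<omega>) \<bullet> phi j))
      = (LINT r|tmeas T. k2 (tp m) j r * (F (u r \<omega>) \<bullet> phi j)) - (LINT r|tmeas T. sf m ?c r * (F (u r \<omega>) \<bullet> phi j))"
      unfolding left_diff_distrib
      by (intro Bochner_Integration.integral_diff i1 k_integrable elim tp_mem m)
    ultimately show ?case using elim(1,2,3) True by (simp add: bN_def inner_diff_left)
  qed
qed

lemma k2_step_diff:
  assumes "r \<in> {0..T}" "m \<le> n"
  shows "\<bar>k2 (tp m) j r - sf m (\<lambda>i. s2 \<alpha> (tp m - tp i) (lam j)) r\<bar> \<le> stp"
proof (cases "r < tp m")
  case True
  then obtain i where i: "i < m" "r \<in> {tp i..<tp (Suc i)}" using piece_exists assms by auto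
  have "\<bar>s2 \<alpha> (tp m - tp i) (lam j) - s2 \<alpha> (tp m - r) (lam j)\<bar> \<le> (tp m - tp i) - (tp m - r)"
    using True i(2) by (intro s2_diff \<alpha> lam_pos) auto
  also have "\<dots> \<le> stp" using i(2) by (simp add: tp_Suc)
  finally show ?thesis using True assms i by (simp add: k2_def kern_def sf_piece[OF i] abs_minus_commute)
next
  case False
  then show ?thesis using stp_pos by (cases "r = tp m") (auto simp: sf_after k2_def kern_def)
qed

text \<open>Constants of the recursion for the squared error: \<open>E2\<close> is the inhomogeneity
  in units of \<open>rate\<close>, \<open>EB * stp\<close> the growth per step, and
  \<open>CE\<close> follows from bounding \<open>(1 + EB * stp) ^ m\<close> by an
  exponential.\<close>

definition E2 :: real where
  "E2 = 2 * (2 * (T * (T * (T\<^sup>2 * (K\<^sup>2 * (2 * CR))))) + 2 * (T * (T * (CT * CF)))) + 2 * CM"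
definition EB :: real where "EB = 4 * (T * (T\<^sup>2 * (K\<^sup>2 * 2)))"
definition CE :: real where "CE = E2 * exp (EB * T)"

lemma E2_nonneg: "E2 \<ge> 0" and EB_nonneg: "EB \<ge> 0" and CE_nonneg: "CE \<ge> 0"
  using T CR_nonneg CT_nonneg CF_nonneg CM_nonneg
  by (auto simp: E2_def EB_def CE_def intro!: add_nonneg_nonneg mult_nonneg_nonneg)

text \<open>A sum of squares of the two rates of the theorem, since all estimates concern second
  moments; the square root is taken at the very end.\<close>

definition rate :: real where "rate = stp powr (2 * dl) + lam N powr (- mexp)"

lemma rate_nonneg: "rate \<ge> 0" by (simp add: rate_def)

lemma ennreal_error_sum:
  assumes "0 \<le> a" "0 \<le> b" "0 \<le> c" "0 \<le> d" "0 \<le> t"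
  shows "2 * (2 * (ennreal t * (ennreal a + ennreal b * x)) + 2 * ennreal c) + 2 * ennreal d
    = ennreal (2 * (2 * (t * a) + 2 * c) + 2 * d) + ennreal (4 * (t * b)) * x"
  using assms
  by (simp add: ennreal_plus ennreal_mult distrib_left mult.assoc[symmetric])

lemma u_error_recursion:
  assumes m: "m \<le> n"
  shows "EE m \<le> ennreal (E2 * rate) + ennreal (EB * stp) * (\<Sum>i<m. EE i)"
proof -
  let ?c = "\<lambda>j i. s2 \<alpha> (tp m - tp i) (lam j)" and ?H = "stp powr (2 * dl)"
  have [measurable]: "u (tp m) \<in> borel_measurable M" "uN m \<in> borel_measurable M"
    using u_measurable[OF tp_mem[OF m]] uN_measurable[OF m] by auto
  have cm [measurable]: "sf m (?c j) \<in> borel_measurable (tmeas T)" for j by (intro borel_tmeas sf_measurable)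
  have cb: "\<bar>?c j i\<bar> \<le> T" if "i < m" for i j
    using s2_le[OF \<alpha> lam_pos, of "tp m - tp i" j] tp_mono[of i m] tp_nonneg[of i] tp_mem[OF m] that by auto
  have G: "(\<lambda>(r, \<omega>). F (u r \<omega>) - Fd m r \<omega>) \<in> borel_measurable (tmeas T \<Otimes>\<^sub>M M)"
    using borel_measurable_diff[OF Fu_joint Fd_joint[OF m]] by (simp add: case_prod_beta')
  define X where "X j \<omega> = (LINT r|tmeas T. sf m (?c j) r * ((F (u r \<omega>) - Fd m r \<omega>) \<bullet> phi j))" for j \<omega>
  define Y where "Y j \<omega> = (LINT r|tmeas T. (k2 (tp m) j r - sf m (?c j) r) * (F (u r \<omega>) \<bullet> phi j))" for j \<omega>
  have [measurable]: "X j \<in> borel_measurable M" "Y j \<in> borel_measurable M" for j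
    unfolding X_def[abs_def] Y_def[abs_def]
    by (rule drift_measurable[OF G cm], rule drift_measurable[OF Fu_joint]) measurable
  have "EE m = hsum 0 (\<lambda>j \<omega>. (u (tp m) \<omega> - uN m \<omega>) \<bullet> phi j)"
    unfolding EE_def by (rule hsum_norm[symmetric]) measurable
  also have "\<dots> = hsum 0 (\<lambda>j \<omega>. bN j * (X j \<omega> + Y j \<omega>) + (1 - bN j) * (u (tp m) \<omega> \<bullet> phi j))"
    unfolding X_def Y_def by (rule hsum_cong_AE[OF u_error_coord[OF m]])
  also have "\<dots> \<le> 2 * hsum 0 (\<lambda>j \<omega>. bN j * (X j \<omega> + Y j \<omega>)) + 2 * hsum 0 (\<lambda>j \<omega>. (1 - bN j) * (u (tp m) \<omega> \<bullet> phi j))"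
    by (rule hsum_add) measurable
  also have "\<dots> \<le> 2 * (2 * (ennreal T * (ennreal (T * (T\<^sup>2 * (K\<^sup>2 * (2 * (CR * ?H))))) + ennreal (T\<^sup>2 * (K\<^sup>2 * 2) * stp) * (\<Sum>i<m. EE i)))
      + 2 * ennreal (T * (T * (CT * ?H * CF)))) + 2 * ennreal (lam N powr (- mexp) * CM)"
  proof (intro add_mono mult_left_mono)
    have "hsum 0 (\<lambda>j \<omega>. bN j * (X j \<omega> + Y j \<omega>)) \<le> hsum 0 (\<lambda>j \<omega>. X j \<omega> + Y j \<omega>)"
      by (rule hsum_trunc) measurable
    also have "\<dots> \<le> 2 * hsum 0 X + 2 * hsum 0 Y" by (rule hsum_add) measurable
    also have "\<dots> \<le> 2 * (ennreal T * (ennreal (T * (T\<^sup>2 * (K\<^sup>2 * (2 * (CR * ?H))))) + ennreal (T\<^sup>2 * (K\<^sup>2 * 2) * stp) * (\<Sum>i<m. EE i)))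
      + 2 * ennreal (T * (T * (CT * ?H * CF)))"
    proof (intro add_mono mult_left_mono)
      show "hsum 0 X \<le> ennreal T * (ennreal (T * (T\<^sup>2 * (K\<^sup>2 * (2 * (CR * ?H))))) + ennreal (T\<^sup>2 * (K\<^sup>2 * 2) * stp) * (\<Sum>i<m. EE i))"
        unfolding X_def by (rule discretised_drift_error[OF m cb])
      show "hsum 0 Y \<le> ennreal (T * (T * (CT * ?H * CF)))"
        unfolding Y_def
      proof (rule hsum_drift_const[OF Fu_joint])
        fix j r assume r: "r \<in> {0..T}"
        have "(k2 (tp m) j r - sf m (?c j) r)\<^sup>2 \<le> stp\<^sup>2" by (rule square_le[OF k2_step_diff[OF r m]])
        also have "\<dots> \<le> CT * ?H" using stp_pos stp_le by (intro sq_le_powr) auto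
        finally show "lam j powr 0 * (k2 (tp m) j r - sf m (?c j) r)\<^sup>2 \<le> CT * ?H"
          using lam_pos[of j] by simp
      qed (use Fu_moment CF_nonneg CT_nonneg in \<open>auto intro!: borel_measurable_diff\<close>)
    qed auto
    finally show "hsum 0 (\<lambda>j \<omega>. bN j * (X j \<omega> + Y j \<omega>)) \<le> 2 * (ennreal T * (ennreal (T * (T\<^sup>2 * (K\<^sup>2 * (2 * (CR * ?H))))) + ennreal (T\<^sup>2 * (K\<^sup>2 * 2) * stp) * (\<Sum>i<m. EE i)))
      + 2 * ennreal (T * (T * (CT * ?H * CF)))" .
    show "hsum 0 (\<lambda>j \<omega>. (1 - bN j) * (u (tp m) \<omega> \<bullet> phi j)) \<le> ennreal (lam N powr (- mexp) * CM)"
      using mexp_bounds CM_nonneg by (intro hsum_tail u_regularity tp_mem m) auto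
  qed auto
  also have "\<dots> = ennreal (2 * (2 * (T * (T * (T\<^sup>2 * (K\<^sup>2 * (2 * (CR * ?H)))))) + 2 * (T * (T * (CT * ?H * CF)))) + 2 * (lam N powr (- mexp) * CM))
     + ennreal (4 * (T * (T\<^sup>2 * (K\<^sup>2 * 2) * stp))) * (\<Sum>i<m. EE i)"
    using T CR_nonneg CT_nonneg CF_nonneg CM_nonneg stp_pos by (intro ennreal_error_sum) auto
  also have "\<dots> \<le> ennreal (E2 * rate) + ennreal (EB * stp) * (\<Sum>i<m. EE i)"
  proof (intro add_mono ennreal_leI mult_right_mono)
    let ?x = "2 * (2 * (T * (T * (T\<^sup>2 * (K\<^sup>2 * (2 * CR))))) + 2 * (T * (T * (CT * CF))))"
    have "?x \<ge> 0" using T CR_nonneg CT_nonneg CF_nonneg by (intro add_nonneg_nonneg mult_nonneg_nonneg) auto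
    \<comment> \<open>The two missing mixed products are added, which completes the expression to
      the product of a sum of constants with \<open>rate\<close>.\<close>
    then have "?x * ?H + 2 * CM * lam N powr (- mexp) \<le> ?x * ?H + 2 * CM * lam N powr (- mexp) + (?x * lam N powr (- mexp) + 2 * CM * ?H)"
      using CM_nonneg by simp
    also have "\<dots> = E2 * rate" unfolding E2_def rate_def by (simp only: distrib_left distrib_right ac_simps)
    finally show "2 * (2 * (T * (T * (T\<^sup>2 * (K\<^sup>2 * (2 * (CR * ?H)))))) + 2 * (T * (T * (CT * ?H * CF)))) + 2 * (lam N powr (- mexp) * CM) \<le> E2 * rate"
      by (simp add: distrib_left distrib_right ac_simps)
    show "4 * (T * (T\<^sup>2 * (K\<^sup>2 * 2) * stp)) \<le> EB * stp" by (simp add: EB_def ac_simps)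
  qed auto
  finally show ?thesis .
qed

lemma u_error:
  assumes m: "m \<le> n" shows "EE m \<le> ennreal (CE * rate)"
proof -
  have x: "EB * stp \<ge> 0" using EB_nonneg stp_pos by simp
  have "EE m \<le> ennreal (E2 * rate * (1 + EB * stp) ^ m)"
    by (rule ennreal_discrete_gronwall[OF u_error_recursion _ x m]) (use E2_nonneg rate_nonneg in auto)
  also have "\<dots> \<le> ennreal (E2 * rate * exp (EB * T))"
  proof (intro ennreal_leI mult_left_mono)
    have "(1 + EB * stp) ^ m \<le> exp (EB * stp) ^ m"
      using x exp_ge_add_one_self[of "EB * stp"] by (intro power_mono) auto
    also have "\<dots> = exp (EB * tp m)" by (simp add: exp_of_nat_mult[symmetric] tp_def mult_ac)
    also have "\<dots> \<le> exp (EB * T)" using tp_mem[OF m] EB_nonneg by (simp add: mult_left_mono)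
    finally show "(1 + EB * stp) ^ m \<le> exp (EB * T)" .
  qed (use E2_nonneg rate_nonneg in auto)
  finally show ?thesis by (simp add: CE_def mult_ac)
qed

end

text \<open>\<open>Lp_norm\<close> is infinite unless membership in the space is established, so
  integrability and almost sure finiteness have to be derived from the bound before the norm can be
  evaluated.\<close>

lemma (in wiener) Lp_norm_le:
  assumes X: "\<And>j. X j \<in> borel_measurable M" and le: "hsum 0 X \<le> ennreal (R\<^sup>2)" and R: "R \<ge> 0"
  shows "Lp_norm lam M 2 0 (\<lambda>\<omega> j. X j \<omega>) \<le> ennreal R"
proof -
  note [measurable] = X
  define g where "g \<omega> = l2sq (Apow lam (0/2) (\<lambda>j. X j \<omega>))" for \<omega>
  have [measurable]: "g \<in> borel_measurable M"
    unfolding g_def[abs_def] l2sq_def Apow_def by measurable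
  have int: "(\<integral>\<^sup>+\<omega>. g \<omega> \<partial>M) \<le> ennreal (R\<^sup>2)" using le unfolding g_def by (simp add: hsum_l2sq)
  then have fin: "AE \<omega> in M. g \<omega> < \<infinity>"
    using nn_integral_PInf_AE[of g M] le_less_trans[OF int ennreal_less_top] by (auto simp: less_top)
  have pow: "hnorm lam 0 (\<lambda>j. X j \<omega>) powr 2 = enn2real (g \<omega>)" for \<omega>
    by (cases "enn2real (g \<omega>) = 0") (simp_all add: hnorm_def g_def)
  have "(\<integral>\<^sup>+\<omega>. ennreal (enn2real (g \<omega>)) \<partial>M) \<le> (\<integral>\<^sup>+\<omega>. g \<omega> \<partial>M)"
    by (intro nn_integral_mono) (simp add: ennreal_enn2real_if)
  then have int': "(\<integral>\<^sup>+\<omega>. ennreal (enn2real (g \<omega>)) \<partial>M) \<le> ennreal (R\<^sup>2)" using int by (rule order_trans)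
  have "integrable M (\<lambda>\<omega>. enn2real (g \<omega>))"
    unfolding integrable_iff_bounded using le_less_trans[OF int' ennreal_less_top] by simp
  then have "in_Lp lam M 2 0 (\<lambda>\<omega> j. X j \<omega>)"
    using fin unfolding in_Lp_def Hdot_def pow by (simp add: g_def)
  moreover have "(\<integral>\<omega>. enn2real (g \<omega>) \<partial>M) \<le> R\<^sup>2"
    using int' by (subst integral_eq_nn_integral) (auto intro: enn2real_leI)
  then have "(\<integral>\<omega>. enn2real (g \<omega>) \<partial>M) powr (1/2) \<le> (R\<^sup>2) powr (1/2)"
    by (intro powr_mono2) auto
  moreover have "(R\<^sup>2) powr (1/2) = R" using R by (simp add: powr_half_sqrt)
  ultimately show ?thesis unfolding Lp_norm_def pow by (simp add: ennreal_leI)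
qed

section \<open>The error of the velocity\<close>

context scheme begin

text \<open>\<open>Cy\<close> is the constant of \<open>s4_diff'\<close>. \<open>C5\<close> bounds
  the total variation of \<open>s4\<close> in time, 1 from the exponential and the rest from its
  Lipschitz part. \<open>CL\<close> converts the squared rate of \<open>u\<close> into that of the
  velocity.\<close>

definition Cy :: real where "Cy = 4 + 4 / \<alpha> * T"
definition C5 :: real where "C5 = 1 + T * (2 * (2 / \<alpha>))"
definition CL :: real where "CL = 1 + lam 0 powr (- mexp - - \<gamma>)"
definition CW :: real where
  "CW = 2 * (2 * (2 * (T * (T * (K\<^sup>2 * (2 * CR)) + K\<^sup>2 * 2 * (T * (CE * CL)))) + 2 * (T * (T * (Cy\<^sup>2 * (K\<^sup>2 * CR)))))
     + 2 * (C5\<^sup>2 * CF)) + 2 * CV"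
definition vrate :: real where "vrate = stp\<^sup>2 + lam N powr (- \<gamma>)"

lemma vrate_nonneg: "vrate \<ge> 0" and CL_nonneg: "CL \<ge> 0"
  by (simp_all add: vrate_def CL_def)

lemma CW_nonneg: "CW \<ge> 0"
  unfolding CW_def using T CR_nonneg CE_nonneg CL_nonneg CF_nonneg CV_nonneg
  by (intro add_nonneg_nonneg mult_nonneg_nonneg) auto

lemma k4_step_bound:
  assumes r: "r \<in> {0..T}" and i: "i < m" "r \<in> {tp i..<tp (Suc i)}"
  shows "\<bar>k4 (tp m) j r - sf m (\<lambda>i. s4 \<alpha> (tp m - tp i) (lam j)) r\<bar>
    = \<bar>s4 \<alpha> (tp m - tp i) (lam j) - s4 \<alpha> (tp m - r) (lam j)\<bar>"
  using r piece_before[OF i] by (simp add: k4_def kern_def sf_piece[OF i] abs_minus_commute)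

lemma k4_step_after:
  "tp m < r \<Longrightarrow> k4 (tp m) j r - sf m (\<lambda>i. s4 \<alpha> (tp m - tp i) (lam j)) r = 0"
  by (simp add: k4_def kern_def sf_after)

text \<open>The error of the left rectangle rule for \<open>s4\<close>. The exponential increments
  over a step integrate to \<open>(1 - exp (- (c * stp))) / c\<close> with c = \<alpha>
  \<open>lam j\<close>; this is at most \<open>stp\<close>, so the eigenvalue cancels and no
  singular factor appears.\<close>

lemma k4_quadrature:
  assumes m: "m \<le> n"
  shows "\<bar>LINT r|tmeas T. k4 (tp m) j r - sf m (\<lambda>i. s4 \<alpha> (tp m - tp i) (lam j)) r\<bar> \<le> stp * C5"
proof -
  let ?d = "\<lambda>r. k4 (tp m) j r - sf m (\<lambda>i. s4 \<alpha> (tp m - tp i) (lam j)) r" and ?c = "\<alpha> * lam j"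
  have c: "?c > 0" using \<alpha> lam_pos[of j] by simp
  have int: "integrable (tmeas T) ?d"
    by (intro Bochner_Integration.integrable_diff k4_integral tp_mem m sf_integral)
  have "ennreal \<bar>LINT r|tmeas T. ?d r\<bar> \<le> (\<integral>\<^sup>+r. ennreal \<bar>?d r\<bar> \<partial>tmeas T)"
    using integral_norm_bound_ennreal[OF int] by simp
  also have "\<dots> = (\<integral>\<^sup>+r. ennreal \<bar>?d r\<bar> * indicator {0..T} r \<partial>lborel)" by (rule nn_integral_tmeas)
  also have "\<dots> \<le> (\<integral>\<^sup>+r. ennreal ((1 - exp (- (?c * stp))) * exp (- (?c * (tp m - r))) + 2 * (2 / \<alpha>) * stp)
      * indicator {0..tp m} r \<partial>lborel)"
  proof (rule nn_integral_mono_AE, use AE_lborel_neq[of "tp m"] in eventually_elim)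
    case (elim r)
    show ?case
    proof (cases "0 \<le> r \<and> r < tp m")
      case True
      then obtain i where i: "i < m" "r \<in> {tp i..<tp (Suc i)}" using piece_exists by blast
      have rT: "r \<in> {0..T}" using True tp_mem[OF m] by auto
      have y: "tp m - tp i \<le> (tp m - r) + stp" "tp m - r \<le> tp m - tp i" using i(2) by (auto simp: tp_Suc)
      have "\<bar>?d r\<bar> = \<bar>s4 \<alpha> (tp m - tp i) (lam j) - s4 \<alpha> (tp m - r) (lam j)\<bar>" by (rule k4_step_bound[OF rT i])
      also have "\<dots> \<le> exp (- (?c * (tp m - r))) - exp (- (?c * (tp m - tp i)))
          + 2 * (2 / \<alpha>) * ((tp m - tp i) - (tp m - r))"
        using True y by (intro s4_diff \<alpha> lam_pos) auto
      \<comment> \<open>The distance to the left grid point is enlarged to a full step, after which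
        the difference factors into a constant and an exponential in \<open>r\<close>, independently
        of the piece containing \<open>r\<close>.\<close>
      also have "\<dots> \<le> exp (- (?c * (tp m - r))) - exp (- (?c * ((tp m - r) + stp))) + 2 * (2 / \<alpha>) * stp"
      proof -
        have "?c * (tp m - tp i) \<le> ?c * ((tp m - r) + stp)" using y c by (intro mult_left_mono) auto
        moreover have "2 * (2 / \<alpha>) * ((tp m - tp i) - (tp m - r)) \<le> 2 * (2 / \<alpha>) * stp"
          using y \<alpha> by (intro mult_left_mono) auto
        ultimately show ?thesis by (intro add_mono diff_left_mono) auto
      qed
      also have "exp (- (?c * ((tp m - r) + stp))) = exp (- (?c * stp)) * exp (- (?c * (tp m - r)))"
        by (simp add: distrib_left flip: exp_add)
      finally have "\<bar>?d r\<bar> \<le> (1 - exp (- (?c * stp))) * exp (- (?c * (tp m - r))) + 2 * (2 / \<alpha>) * stp"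
        by (simp only: left_diff_distrib mult_1)
      then show ?thesis using True rT by (simp add: ennreal_leI del: ennreal_plus)
    next
      case False
      then show ?thesis using elim k4_step_after[of m r j] by (cases "r < 0") auto
    qed
  qed
  also have "\<dots> \<le> ennreal ((1 - exp (- (?c * stp))) / ?c + T * (2 * (2 / \<alpha>) * stp))"
    using c \<alpha> stp_pos tp_nonneg[of m] tp_mem[OF m] by (intro nn_integral_exp_plus_le) auto
  also have "\<dots> \<le> ennreal (stp * C5)"
  proof (rule ennreal_leI)
    have "1 - exp (- (?c * stp)) \<le> ?c * stp"
      using exp_ge_add_one_self[of "- (?c * stp)"] by linarith
    then have "(1 - exp (- (?c * stp))) / ?c \<le> stp" using c by (simp add: divide_le_eq mult.commute)
    then show "(1 - exp (- (?c * stp))) / ?c + T * (2 * (2 / \<alpha>) * stp) \<le> stp * C5"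
      by (simp add: C5_def distrib_left mult_ac)
  qed
  finally show ?thesis using stp_pos T \<alpha> by (subst (asm) ennreal_le_iff) (auto simp: C5_def)
qed

text \<open>Unlike for \<open>u\<close>, the error of freezing the kernel is not of the order of a
  step uniformly in the eigenvalue. Its term is therefore split at \<open>F (u (tp m))\<close>: one
  part has a factor vanishing at the final time, the other sees the kernel error only through its
  integral.\<close>

lemma v_error_coord:
  assumes m: "m \<le> n"
  shows "AE \<omega> in M. v (tp m) \<omega> j - coef phi (vN m \<omega>) j =
    bN j * ((LINT r|tmeas T. sf m (\<lambda>i. s4 \<alpha> (tp m - tp i) (lam j)) r * ((F (u r \<omega>) - Fd m r \<omega>) \<bullet> phi j))
      + (LINT r|tmeas T. (k4 (tp m) j r - sf m (\<lambda>i. s4 \<alpha> (tp m - tp i) (lam j)) r) * ((F (u r \<omega>) - F (u (tp m) \<omega>)) \<bullet> phi j))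
      + (LINT r|tmeas T. k4 (tp m) j r - sf m (\<lambda>i. s4 \<alpha> (tp m - tp i) (lam j)) r) * (F (u (tp m) \<omega>) \<bullet> phi j))
    + (1 - bN j) * v (tp m) \<omega> j"
proof (cases "j < N")
  case False
  then show ?thesis
    using scheme_high_modes[OF m, of j] by (auto elim!: eventually_mono simp: bN_def coef_def)
next
  case True
  let ?c = "\<lambda>i. s4 \<alpha> (tp m - tp i) (lam j)"
  obtain Z where Z: "\<And>j. wint (\<lambda>r. k4 (tp m) j r *\<^sub>R phi j) (Z j)"
    and eq: "AE \<omega> in M. \<forall>j. v (tp m) \<omega> j = s3 \<alpha> (tp m) (lam j) * (u0 \<omega> \<bullet> phi j) + s4 \<alpha> (tp m) (lam j) * v0 \<omega> j
       + (LINT r|tmeas T. k4 (tp m) j r * (F (u r \<omega>) \<bullet> phi j)) + Z j \<omega>"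
    using v_decomp[OF tp_mem[OF m]] by blast
  obtain Z4 where Z4: "wint (\<lambda>r. k4 (tp m) j r *\<^sub>R phi j) Z4"
    and eq2: "AE \<omega> in M. vN m \<omega> \<bullet> phi j = s3 \<alpha> (tp m) (lam j) * (u0 \<omega> \<bullet> phi j) + s4 \<alpha> (tp m) (lam j) * v0 \<omega> j
        + (\<Sum>i<m. stp * (?c i * (F (uN i \<omega>) \<bullet> phi j))) + Z4 \<omega>"
    using discrete_mild[OF m True] by blast
  have cb: "\<bar>sf m ?c r\<bar> \<le> 1" if "r \<in> {0..T}" for r
    using that tp_mono by (intro sf_bound s4_bound \<alpha> lam_pos) (auto simp: less_imp_le)
  have [measurable]: "sf m ?c \<in> borel_measurable (tmeas T)" by (intro borel_tmeas sf_measurable)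
  have int: "integrable (tmeas T) (\<lambda>r. k4 (tp m) j r - sf m ?c r)"
    by (intro Bochner_Integration.integrable_diff k4_integral tp_mem m sf_integral)
  from eq eq2 wint_unique[OF Z Z4] usq_finite AE_space show ?thesis
  proof eventually_elim
    case (elim \<omega>)
    have i1: "integrable (tmeas T) (\<lambda>r. sf m ?c r * (F (u r \<omega>) \<bullet> phi j))"
      by (rule path_mult_integrable[OF elim(5,4) _ cb]) measurable
    have i2: "integrable (tmeas T) (\<lambda>r. k4 (tp m) j r * (F (u r \<omega>) \<bullet> phi j))"
      by (intro k_integrable elim tp_mem m)
    have i3: "integrable (tmeas T) (\<lambda>r. (k4 (tp m) j r - sf m ?c r) * (F (u r \<omega>) \<bullet> phi j))"
      unfolding left_diff_distrib by (intro Bochner_Integration.integrable_diff i1 i2)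
    have "(LINT r|tmeas T. sf m ?c r * ((F (u r \<omega>) - Fd m r \<omega>) \<bullet> phi j))
      = (LINT r|tmeas T. sf m ?c r * (F (u r \<omega>) \<bullet> phi j)) - (\<Sum>i<m. stp * (?c i * (F (uN i \<omega>) \<bullet> phi j)))"
      unfolding inner_diff_left right_diff_distrib discrete_drift(2)[OF m, symmetric]
      by (intro Bochner_Integration.integral_diff i1 discrete_drift[OF m])
    moreover have "(LINT r|tmeas T. (k4 (tp m) j r - sf m ?c r) * ((F (u r \<omega>) - F (u (tp m) \<omega>)) \<bullet> phi j))
      = (LINT r|tmeas T. (k4 (tp m) j r - sf m ?c r) * (F (u r \<omega>) \<bullet> phi j))
       - (LINT r|tmeas T. (k4 (tp m) j r - sf m ?c r) * (F (u (tp m) \<omega>) \<bullet> phi j))"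
      unfolding inner_diff_left right_diff_distrib[of "k4 (tp m) j _ - sf m ?c _"]
      by (intro Bochner_Integration.integral_diff i3 integrable_mult_left int)
    moreover have "(LINT r|tmeas T. (k4 (tp m) j r - sf m ?c r) * (F (u (tp m) \<omega>) \<bullet> phi j))
      = (LINT r|tmeas T. k4 (tp m) j r - sf m ?c r) * (F (u (tp m) \<omega>) \<bullet> phi j)"
      by (rule Bochner_Integration.integral_mult_left) (rule int)
    moreover have "(LINT r|tmeas T. (k4 (tp m) j r - sf m ?c r) * (F (u r \<omega>) \<bullet> phi j))
      = (LINT r|tmeas T. k4 (tp m) j r * (F (u r \<omega>) \<bullet> phi j)) - (LINT r|tmeas T. sf m ?c r * (F (u r \<omega>) \<bullet> phi j))"
      unfolding left_diff_distrib by (intro Bochner_Integration.integral_diff i1 i2)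
    ultimately show ?case using elim(1,2,3) True by (simp add: bN_def coef_def)
  qed
qed

lemma v_error:
  assumes m: "m \<le> n" and \<gamma>0: "\<gamma> \<ge> 0"
  shows "hsum 0 (\<lambda>j \<omega>. v (tp m) \<omega> j - coef phi (vN m \<omega>) j) \<le> ennreal (CW * vrate)"
proof -
  have dl1: "dl = 1" using \<gamma>0 by (simp add: dl_def)
  have H: "stp powr (2 * dl) = stp\<^sup>2" using stp_pos by (simp add: dl1)
  have Hv: "stp\<^sup>2 \<le> vrate" by (simp add: vrate_def)
  \<comment> \<open>For nonnegative \<gamma> the time orders agree, and in space \<open>u\<close> is
    at least as accurate, because \<open>mexp\<close> is at least \<gamma>.\<close>
  have rate: "rate \<le> CL * vrate"
  proof -
    have "lam N powr (- mexp) \<le> lam 0 powr (- mexp - - \<gamma>) * lam N powr (- \<gamma>)"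
      using \<gamma> by (intro lam_powr_le) (simp add: mexp_def)
    also have "\<dots> \<le> lam 0 powr (- mexp - - \<gamma>) * vrate" by (intro mult_left_mono) (auto simp: vrate_def)
    finally show ?thesis using Hv by (simp add: rate_def H CL_def distrib_right)
  qed
  let ?c = "\<lambda>j i. s4 \<alpha> (tp m - tp i) (lam j)"
  define d where "d j r = k4 (tp m) j r - sf m (?c j) r" for j r
  have [measurable]: "u (tp m) \<in> borel_measurable M" "(\<lambda>\<omega>. v (tp m) \<omega> j) \<in> borel_measurable M" for j
    using u_measurable[OF tp_mem[OF m]] v_measurable[OF tp_mem[OF m]] by auto
  have cm [measurable]: "sf m (?c j) \<in> borel_measurable (tmeas T)" for j by (intro borel_tmeas sf_measurable)
  have dm [measurable]: "d j \<in> borel_measurable (tmeas T)" for j unfolding d_def[abs_def] by measurable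
  have cb: "\<bar>?c j i\<bar> \<le> 1" if "i < m" for i j
    using tp_mono[of i m] that by (intro s4_bound \<alpha> lam_pos) auto
  have G: "(\<lambda>(r, \<omega>). F (u r \<omega>) - Fd m r \<omega>) \<in> borel_measurable (tmeas T \<Otimes>\<^sub>M M)"
    using borel_measurable_diff[OF Fu_joint Fd_joint[OF m]] by (simp add: case_prod_beta')
  have G': "(\<lambda>(r, \<omega>). F (u r \<omega>) - F (u (tp m) \<omega>)) \<in> borel_measurable (tmeas T \<Otimes>\<^sub>M M)"
    by measurable
  define X where "X j \<omega> = (LINT r|tmeas T. sf m (?c j) r * ((F (u r \<omega>) - Fd m r \<omega>) \<bullet> phi j))" for j \<omega>
  define Y where "Y j \<omega> = (LINT r|tmeas T. d j r * ((F (u r \<omega>) - F (u (tp m) \<omega>)) \<bullet> phi j))" for j \<omega>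
  define e where "e j = (LINT r|tmeas T. d j r)" for j
  have [measurable]: "X j \<in> borel_measurable M" "Y j \<in> borel_measurable M" for j
    unfolding X_def[abs_def] Y_def[abs_def]
    by (rule drift_measurable[OF G cm], rule drift_measurable[OF G' dm])
  have "hsum 0 (\<lambda>j \<omega>. v (tp m) \<omega> j - coef phi (vN m \<omega>) j)
    = hsum 0 (\<lambda>j \<omega>. bN j * (X j \<omega> + Y j \<omega> + e j * (F (u (tp m) \<omega>) \<bullet> phi j)) + (1 - bN j) * v (tp m) \<omega> j)"
    unfolding X_def Y_def e_def d_def by (rule hsum_cong_AE[OF v_error_coord[OF m]])
  also have "\<dots> \<le> ennreal (2 * (2 * (2 * (T * (T * (K\<^sup>2 * (2 * CR)) + K\<^sup>2 * 2 * (T * (CE * CL))) * vrate)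
       + 2 * (T * (T * (Cy\<^sup>2 * (K\<^sup>2 * CR))) * vrate)) + 2 * (C5\<^sup>2 * CF * vrate)) + 2 * (CV * vrate))"
  proof (rule hsum_add_le)
    show "hsum 0 (\<lambda>j \<omega>. bN j * (X j \<omega> + Y j \<omega> + e j * (F (u (tp m) \<omega>) \<bullet> phi j)))
      \<le> ennreal (2 * (2 * (T * (T * (K\<^sup>2 * (2 * CR)) + K\<^sup>2 * 2 * (T * (CE * CL))) * vrate)
       + 2 * (T * (T * (Cy\<^sup>2 * (K\<^sup>2 * CR))) * vrate)) + 2 * (C5\<^sup>2 * CF * vrate))"
    proof (rule order_trans[OF hsum_trunc], measurable, rule hsum_add_le, rule_tac[3] hsum_add_le)
      show "hsum 0 X \<le> ennreal (T * (T * (K\<^sup>2 * (2 * CR)) + K\<^sup>2 * 2 * (T * (CE * CL))) * vrate)"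
      proof -
        \<comment> \<open>The errors of \<open>u\<close> at earlier grid points are inserted as
          known; their number times the step size is \<open>tp m\<close> and hence at most
          \<open>T\<close>.\<close>
        have "(\<Sum>i<m. EE i) \<le> (\<Sum>i<m. ennreal (CE * (CL * vrate)))"
        proof (rule sum_mono)
          fix i assume "i \<in> {..<m}"
          then have "EE i \<le> ennreal (CE * rate)" using m by (intro u_error) auto
          also have "\<dots> \<le> ennreal (CE * (CL * vrate))"
            using rate CE_nonneg by (intro ennreal_leI mult_left_mono) auto
          finally show "EE i \<le> ennreal (CE * (CL * vrate))" .
        qed
        also have "\<dots> = ennreal (real m * (CE * (CL * vrate)))"
          using CE_nonneg CL_nonneg vrate_nonneg by (subst sum_ennreal) auto
        finally have S: "(\<Sum>i<m. EE i) \<le> ennreal (real m * (CE * (CL * vrate)))" .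
        have "hsum 0 X \<le> ennreal T * (ennreal (T * (1\<^sup>2 * (K\<^sup>2 * (2 * (CR * stp powr (2 * dl)))))) + ennreal (1\<^sup>2 * (K\<^sup>2 * 2) * stp) * (\<Sum>i<m. EE i))"
          unfolding X_def by (rule discretised_drift_error[OF m cb])
        also have "\<dots> \<le> ennreal T * (ennreal (T * (1\<^sup>2 * (K\<^sup>2 * (2 * (CR * stp powr (2 * dl)))))) + ennreal (1\<^sup>2 * (K\<^sup>2 * 2) * stp) * ennreal (real m * (CE * (CL * vrate))))"
          by (intro mult_left_mono add_left_mono S) auto
        also have "\<dots> = ennreal (T * (T * (1\<^sup>2 * (K\<^sup>2 * (2 * (CR * stp powr (2 * dl))))) + 1\<^sup>2 * (K\<^sup>2 * 2) * stp * (real m * (CE * (CL * vrate)))))"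
          using T CR_nonneg CE_nonneg CL_nonneg vrate_nonneg stp_pos
          by (subst ennreal_affine) (auto intro!: ennreal_mult[symmetric] add_nonneg_nonneg mult_nonneg_nonneg simp del: ennreal_plus)
        also have "\<dots> \<le> ennreal (T * (T * (K\<^sup>2 * (2 * CR)) + K\<^sup>2 * 2 * (T * (CE * CL))) * vrate)"
        proof (rule ennreal_leI)
          have sx: "T * (K\<^sup>2 * (2 * (CR * stp\<^sup>2))) \<le> T * (K\<^sup>2 * (2 * (CR * vrate)))"
            using T CR_nonneg Hv by (intro mult_left_mono) auto
          have "K\<^sup>2 * 2 * (tp m * (CE * (CL * vrate))) \<le> K\<^sup>2 * 2 * (T * (CE * (CL * vrate)))"
            using tp_mem[OF m] CE_nonneg CL_nonneg vrate_nonneg by (intro mult_left_mono mult_right_mono) auto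
          from mult_left_mono[OF add_mono[OF sx this], of T]
          have "T * (T * (K\<^sup>2 * (2 * (CR * stp\<^sup>2))) + K\<^sup>2 * 2 * (tp m * (CE * (CL * vrate))))
            \<le> T * (T * (K\<^sup>2 * (2 * (CR * vrate))) + K\<^sup>2 * 2 * (T * (CE * (CL * vrate))))"
            using T by simp
          then show "T * (T * (1\<^sup>2 * (K\<^sup>2 * (2 * (CR * stp powr (2 * dl))))) + 1\<^sup>2 * (K\<^sup>2 * 2) * stp * (real m * (CE * (CL * vrate))))
            \<le> T * (T * (K\<^sup>2 * (2 * CR)) + K\<^sup>2 * 2 * (T * (CE * CL))) * vrate"
            unfolding H tp_def by (simp add: distrib_left distrib_right mult_ac)
        qed
        finally show ?thesis .
      qed
      show "hsum 0 Y \<le> ennreal (T * (T * (Cy\<^sup>2 * (K\<^sup>2 * CR))) * vrate)"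
      proof -
        \<comment> \<open>The distance from \<open>tp m\<close> to the left grid point of the piece
          containing \<open>r\<close>: the later of the two times compared by
          \<open>s4_diff'\<close>. It is at least one step, also when \<open>r\<close> is close to
          \<open>tp m\<close>.\<close>
        define y where "y r = sf m (\<lambda>i. tp m - tp i) r" for r
        have [measurable]: "y \<in> borel_measurable borel" unfolding y_def[abs_def] by measurable
        define \<kappa> where "\<kappa> r = (if r < tp m then ennreal ((Cy * stp / y r)\<^sup>2) else if r = tp m then \<infinity> else 0)" for r
        have "hsum 0 Y \<le> ennreal T * (\<integral>\<^sup>+r. \<kappa> r * msq (\<lambda>\<omega>. F (u r \<omega>) - F (u (tp m) \<omega>)) \<partial>tmeas T)"
          unfolding Y_def
        proof (rule hsum_drift[OF G' dm])
          show "\<kappa> \<in> borel_measurable (tmeas T)" unfolding \<kappa>_def[abs_def] by (intro borel_tmeas) measurable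
          fix j r assume r: "r \<in> {0..T}"
          show "ennreal (lam j powr 0 * (d j r)\<^sup>2) \<le> \<kappa> r"
          proof (cases "r < tp m")
            case True
            then obtain i where i: "i < m" "r \<in> {tp i..<tp (Suc i)}" using piece_exists r by auto
            have "\<bar>d j r\<bar> = \<bar>s4 \<alpha> (tp m - tp i) (lam j) - s4 \<alpha> (tp m - r) (lam j)\<bar>"
              unfolding d_def by (rule k4_step_bound[OF r i])
            also have "\<dots> \<le> Cy * ((tp m - tp i) - (tp m - r)) / (tp m - tp i)"
              unfolding Cy_def using i(2) True tp_nonneg[of i] tp_mem[OF m]
              by (intro s4_diff' \<alpha> lam_pos) auto
            also have "\<dots> \<le> Cy * stp / (tp m - tp i)"
              using i(2) True \<alpha> T by (intro divide_right_mono mult_left_mono) (auto simp: tp_Suc Cy_def)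
            finally have "(d j r)\<^sup>2 \<le> (Cy * stp / y r)\<^sup>2" unfolding y_def sf_piece[OF i] by (rule square_le)
            then show ?thesis using True lam_pos[of j] by (simp add: \<kappa>_def ennreal_leI)
          next
            case False
            then show ?thesis using k4_step_after[of m r j] by (auto simp: \<kappa>_def d_def)
          qed
        qed
        also have "\<dots> \<le> ennreal T * (\<integral>\<^sup>+r. ennreal (Cy\<^sup>2 * stp\<^sup>2 * (K\<^sup>2 * CR)) \<partial>tmeas T)"
        proof (intro mult_left_mono nn_integral_mono)
          fix r assume "r \<in> space (tmeas T)"
          then have r: "r \<in> {0..T}" by simp
          show "\<kappa> r * msq (\<lambda>\<omega>. F (u r \<omega>) - F (u (tp m) \<omega>))
            \<le> ennreal (Cy\<^sup>2 * stp\<^sup>2 * (K\<^sup>2 * CR))"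
          proof (cases "r < tp m")
            case True
            then obtain i where i: "i < m" "r \<in> {tp i..<tp (Suc i)}" using piece_exists r by auto
            \<comment> \<open>This comparison removes the singularity: the squared increment of
              \<open>u\<close> is of size \<open>(tp m - r)\<^sup>2\<close> and the weight is
              divided by \<open>(y r)\<^sup>2\<close>, so the quotient is at most 1 and integration
              in time yields no logarithm.\<close>
            have y: "0 < tp m - r" "tp m - r \<le> y r" using True i(2) by (auto simp: y_def sf_piece[OF i])
            have "\<kappa> r * msq (\<lambda>\<omega>. F (u r \<omega>) - F (u (tp m) \<omega>))
              \<le> ennreal ((Cy * stp / y r)\<^sup>2) * ennreal (K\<^sup>2 * (CR * \<bar>tp m - r\<bar> powr (2 * dl)))"
              using F_increment[OF r tp_mem[OF m]] True by (simp add: \<kappa>_def mult_left_mono)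
            also have "\<dots> = ennreal ((Cy * stp / y r)\<^sup>2 * (K\<^sup>2 * (CR * \<bar>tp m - r\<bar> powr (2 * dl))))"
              using CR_nonneg by (intro ennreal_mult[symmetric]) auto
            also have "\<dots> \<le> ennreal (Cy\<^sup>2 * stp\<^sup>2 * (K\<^sup>2 * CR))"
            proof (rule ennreal_leI)
              have "(Cy * stp / y r)\<^sup>2 * (K\<^sup>2 * (CR * \<bar>tp m - r\<bar> powr (2 * dl)))
                = Cy\<^sup>2 * stp\<^sup>2 * (K\<^sup>2 * CR) * ((tp m - r) / y r)\<^sup>2"
                using y by (simp add: dl1 power_divide power_mult_distrib)
              also have "\<dots> \<le> Cy\<^sup>2 * stp\<^sup>2 * (K\<^sup>2 * CR) * 1"
                using y CR_nonneg by (intro mult_left_mono) (auto simp: power_le_one)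
              finally show "(Cy * stp / y r)\<^sup>2 * (K\<^sup>2 * (CR * \<bar>tp m - r\<bar> powr (2 * dl))) \<le> Cy\<^sup>2 * stp\<^sup>2 * (K\<^sup>2 * CR)"
                by simp
            qed
            finally show ?thesis .
          qed (auto simp: \<kappa>_def)
        qed auto
        also have "\<dots> = ennreal (T * (T * (Cy\<^sup>2 * stp\<^sup>2 * (K\<^sup>2 * CR))))"
          using T CR_nonneg by (simp add: emeasure_tmeas ennreal_mult mult.commute del: space_tmeas)
        also have "\<dots> \<le> ennreal (T * (T * (Cy\<^sup>2 * (K\<^sup>2 * CR))) * vrate)"
        proof (rule ennreal_leI)
          have "T * (T * (Cy\<^sup>2 * (K\<^sup>2 * CR))) * stp\<^sup>2 \<le> T * (T * (Cy\<^sup>2 * (K\<^sup>2 * CR))) * vrate"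
            using T CR_nonneg Hv by (intro mult_left_mono mult_nonneg_nonneg) auto
          then show "T * (T * (Cy\<^sup>2 * stp\<^sup>2 * (K\<^sup>2 * CR))) \<le> T * (T * (Cy\<^sup>2 * (K\<^sup>2 * CR))) * vrate"
            by (simp only: mult_ac)
        qed
        finally show ?thesis .
      qed
      show "hsum 0 (\<lambda>j \<omega>. e j * (F (u (tp m) \<omega>) \<bullet> phi j)) \<le> ennreal (C5\<^sup>2 * CF * vrate)"
      proof -
        have "hsum 0 (\<lambda>j \<omega>. e j * (F (u (tp m) \<omega>) \<bullet> phi j)) \<le> ennreal ((stp * C5)\<^sup>2 * CF)"
        proof (rule hsum_mult_le[where s' = 0])
          fix j
          show "lam j powr 0 * (e j)\<^sup>2 \<le> (stp * C5)\<^sup>2 * lam j powr 0"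
            using square_le[OF k4_quadrature[OF m, of j]] lam_pos[of j] by (simp add: e_def d_def)
          show "hsum 0 (\<lambda>j \<omega>. F (u (tp m) \<omega>) \<bullet> phi j) \<le> ennreal CF"
            by (subst hsum_norm) (use Fu_moment[OF tp_mem[OF m]] in auto)
        qed (use CF_nonneg in auto)
        also have "(stp * C5)\<^sup>2 * CF = C5\<^sup>2 * CF * stp\<^sup>2" by (simp add: power_mult_distrib)
        also have "ennreal \<dots> \<le> ennreal (C5\<^sup>2 * CF * vrate)"
          using CF_nonneg Hv by (intro ennreal_leI mult_left_mono) auto
        finally show ?thesis .
      qed
    qed (use T CR_nonneg CE_nonneg CL_nonneg CF_nonneg vrate_nonneg in \<open>auto intro!: add_nonneg_nonneg mult_nonneg_nonneg\<close>)
    have "hsum 0 (\<lambda>j \<omega>. (1 - bN j) * v (tp m) \<omega> j) \<le> ennreal (lam N powr (- \<gamma>) * CV)"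
      using \<gamma>0 CV_nonneg by (intro hsum_tail v_regularity tp_mem m) auto
    also have "\<dots> \<le> ennreal (CV * vrate)"
      using mult_right_mono[of "lam N powr (- \<gamma>)" vrate CV] CV_nonneg
      by (intro ennreal_leI) (simp add: vrate_def mult.commute)
    finally show "hsum 0 (\<lambda>j \<omega>. (1 - bN j) * v (tp m) \<omega> j) \<le> ennreal (CV * vrate)" .
  qed (use T CR_nonneg CE_nonneg CL_nonneg CF_nonneg CV_nonneg vrate_nonneg in \<open>auto intro!: add_nonneg_nonneg mult_nonneg_nonneg\<close>)
  also have "2 * (2 * (2 * (T * (T * (K\<^sup>2 * (2 * CR)) + K\<^sup>2 * 2 * (T * (CE * CL))) * vrate)
       + 2 * (T * (T * (Cy\<^sup>2 * (K\<^sup>2 * CR))) * vrate)) + 2 * (C5\<^sup>2 * CF * vrate)) + 2 * (CV * vrate) = CW * vrate"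
    unfolding CW_def distrib_left distrib_right by (simp only: mult_ac)
  finally show ?thesis .
qed

lemma sqrt_rate_le:
  fixes a b c :: real
  assumes "0 \<le> a" "0 \<le> b" "0 \<le> c"
  shows "c * (a\<^sup>2 + b\<^sup>2) \<le> (sqrt c * (a + b))\<^sup>2"
  using assms by (simp add: power_mult_distrib power2_sum mult_left_mono)

lemma errors:
  assumes m: "m \<le> n" and C: "sqrt CE \<le> C" "sqrt CW \<le> C"
  shows "Lp_norm lam M 2 0 (\<lambda>\<omega>. coef phi (u (tp m) \<omega> - uN m \<omega>))
      \<le> ennreal (C * (stp powr (min (1 + \<gamma>) 1) + lam N powr (- ((1 + min \<gamma> 1) / 2))))"
    and "\<gamma> \<ge> 0 \<Longrightarrow> Lp_norm lam M 2 0 (\<lambda>\<omega> j. v (tp m) \<omega> j - coef phi (vN m \<omega>) j)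
      \<le> ennreal (C * (stp + lam N powr (- (\<gamma> / 2))))"
proof -
  have [measurable]: "u (tp m) \<in> borel_measurable M" "uN m \<in> borel_measurable M" "vN m \<in> borel_measurable M"
    "(\<lambda>\<omega>. v (tp m) \<omega> j) \<in> borel_measurable M" for j
    using u_measurable[OF tp_mem[OF m]] v_measurable[OF tp_mem[OF m]] uN_measurable[OF m] vN_measurable[OF m]
    by auto
  have sq: "(x powr y)\<^sup>2 = x powr (2 * y)" for x y :: real
    by (simp add: power2_eq_square flip: powr_add)
  have r: "CE * rate \<le> (sqrt CE * (stp powr dl + lam N powr (- (mexp / 2))))\<^sup>2"
    using sqrt_rate_le[of "stp powr dl" "lam N powr (- (mexp / 2))" CE] CE_nonneg by (simp add: rate_def sq)
  have "Lp_norm lam M 2 0 (\<lambda>\<omega> j. (u (tp m) \<omega> - uN m \<omega>) \<bullet> phi j)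
      \<le> ennreal (sqrt CE * (stp powr dl + lam N powr (- (mexp / 2))))"
  proof (rule Lp_norm_le)
    have "hsum 0 (\<lambda>j \<omega>. (u (tp m) \<omega> - uN m \<omega>) \<bullet> phi j) = EE m"
      unfolding EE_def by (rule hsum_norm) measurable
    also have "\<dots> \<le> ennreal (CE * rate)" by (rule u_error[OF m])
    also have "\<dots> \<le> ennreal ((sqrt CE * (stp powr dl + lam N powr (- (mexp / 2))))\<^sup>2)"
      by (rule ennreal_leI[OF r])
    finally show "hsum 0 (\<lambda>j \<omega>. (u (tp m) \<omega> - uN m \<omega>) \<bullet> phi j)
      \<le> ennreal ((sqrt CE * (stp powr dl + lam N powr (- (mexp / 2))))\<^sup>2)" .
  qed (use CE_nonneg in auto)
  also have "\<dots> \<le> ennreal (C * (stp powr dl + lam N powr (- (mexp / 2))))"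
    using C by (intro ennreal_leI mult_right_mono) auto
  also have "mexp / 2 = (1 + min \<gamma> 1) / 2" by (simp add: mexp_def min_def)
  finally show "Lp_norm lam M 2 0 (\<lambda>\<omega>. coef phi (u (tp m) \<omega> - uN m \<omega>))
      \<le> ennreal (C * (stp powr (min (1 + \<gamma>) 1) + lam N powr (- ((1 + min \<gamma> 1) / 2))))"
    by (simp add: coef_def[abs_def] dl_def)
  assume \<gamma>0: "\<gamma> \<ge> 0"
  have r: "CW * vrate \<le> (sqrt CW * (stp + lam N powr (- (\<gamma> / 2))))\<^sup>2"
    using sqrt_rate_le[of stp "lam N powr (- (\<gamma> / 2))" CW] CW_nonneg stp_pos by (simp add: vrate_def sq)
  have "Lp_norm lam M 2 0 (\<lambda>\<omega> j. v (tp m) \<omega> j - coef phi (vN m \<omega>) j)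
      \<le> ennreal (sqrt CW * (stp + lam N powr (- (\<gamma> / 2))))"
  proof (rule Lp_norm_le[OF _ order_trans[OF v_error[OF m \<gamma>0] ennreal_leI[OF r]]])
    show "(\<lambda>\<omega>. v (tp m) \<omega> j - coef phi (vN m \<omega>) j) \<in> borel_measurable M" for j
      unfolding coef_def by measurable
  qed (use CW_nonneg stp_pos in auto)
  also have "\<dots> \<le> ennreal (C * (stp + lam N powr (- (\<gamma> / 2))))"
    using C stp_pos by (intro ennreal_leI mult_right_mono) auto
  finally show "Lp_norm lam M 2 0 (\<lambda>\<omega> j. v (tp m) \<omega> j - coef phi (vN m \<omega>) j)
      \<le> ennreal (C * (stp + lam N powr (- (\<gamma> / 2))))" .
qed

end

theorem theorem3p1:
  fixes D :: "(real ^ 'd) set"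
    and l :: "'d \<Rightarrow> 'd \<Rightarrow> real ^ 'd \<Rightarrow> real"
    and J :: "'h::{real_inner,banach,second_countable_topology} \<Rightarrow> real ^ 'd \<Rightarrow> real"
    and lam :: "nat \<Rightarrow> real" and phi :: "nat \<Rightarrow> 'h"
    and \<alpha> T \<gamma> \<theta> K f0 q :: real
    and M :: "'w measure"
    and u0 :: "'w \<Rightarrow> 'h" and v0 :: "'w \<Rightarrow> nat \<Rightarrow> real"
  assumes "CARD('d) \<in> {1, 2, 3}"
    and "open D" and "bounded D" and "D \<noteq> {}"
    and "elliptic_coefficients D l"
    and "L2_space D J"
    and "self_adjoint_graph (A_graph D l J)" and "pos_def_graph (A_graph D l J)"
    and "eigenbasis (A_graph D l J) lam phi"
    and "\<alpha> > 0" and "T > 0" and "K > 0"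
    and "-1 < \<gamma>" and "\<gamma> \<le> 2"
    and "1 \<le> \<theta>" and "\<theta> < 2"
    and "prob_space M"
  shows "\<exists>C::real. \<forall>(Filt :: real \<Rightarrow> 'w measure) (Q :: 'h \<Rightarrow> 'h) (Qh :: 'h \<Rightarrow> 'h)
           (W :: real \<Rightarrow> 'h \<Rightarrow> 'w \<Rightarrow> real) (F :: 'h \<Rightarrow> 'h)
           (u :: real \<Rightarrow> 'w \<Rightarrow> 'h) (v :: real \<Rightarrow> 'w \<Rightarrow> nat \<Rightarrow> real).
       normal_filtration T M Filt \<and>
       cond_N lam phi T M Filt \<gamma> q Q Qh W \<and>
       cond_F lam phi \<gamma> \<theta> K F \<and> norm (F 0) = f0 \<and>
       cond_I lam phi M Filt \<gamma> u0 v0 \<and>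
       mild_solution lam phi \<alpha> T M Filt \<gamma> Qh W F u0 v0 u v \<longrightarrow>
       (\<forall>(N::nat) (n::nat) (uN :: nat \<Rightarrow> 'w \<Rightarrow> 'h) (vN :: nat \<Rightarrow> 'w \<Rightarrow> 'h).
          n \<ge> 1 \<and> exp_Euler_scheme lam phi \<alpha> T M Qh W F u0 v0 N n uN vN \<longrightarrow>
          (\<forall>m\<le>n. (let k = T / real n; t = real m * k in
             Lp_norm lam M 2 0 (\<lambda>\<omega>. coef phi (u t \<omega> - uN m \<omega>))
               \<le> ennreal (C * (k powr (min (1 + \<gamma>) 1)
                              + lam N powr (- ((1 + min \<gamma> 1) / 2)))) \<and>
             (\<gamma> \<ge> 0 \<longrightarrow>
              Lp_norm lam M 2 0 (\<lambda>\<omega> j. v t \<omega> j - coef phi (vN m \<omega>) j)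
               \<le> ennreal (C * (k + lam N powr (- (\<gamma> / 2))))))))"
proof -
  have eig: "eigen lam phi"
    using assms(9) unfolding eigenbasis_def by unfold_locales auto
  \<comment> \<open>Outside its locale each constant depends only on the parameters listed here.
    None of them is the filtration, the noise, the nonlinearity, the solution or the discretisation,
    so \<open>C\<close> may be fixed before these are introduced. The maximum serves both
    estimates.\<close>
  define C where "C = max (sqrt (scheme.CE lam phi M T \<alpha> \<gamma> K q f0 u0 v0))
    (sqrt (scheme.CW lam phi M T \<alpha> \<gamma> K q f0 u0 v0))"
  show ?thesis
  proof (intro exI[of _ C] allI impI)
    fix Filt Q Qh W F u v N n uN vN m
    assume A: "normal_filtration T M Filt \<and>
       cond_N lam phi T M Filt \<gamma> q Q Qh W \<and>
       cond_F lam phi \<gamma> \<theta> K F \<and> norm (F 0) = f0 \<and>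
       cond_I lam phi M Filt \<gamma> u0 v0 \<and>
       mild_solution lam phi \<alpha> T M Filt \<gamma> Qh W F u0 v0 u v"
      and B: "n \<ge> 1 \<and> exp_Euler_scheme lam phi \<alpha> T M Qh W F u0 v0 N n uN vN"
      and m: "m \<le> n"
    have "wiener lam phi M T Filt Q Qh W"
      using A assms(11) by (intro wiener.intro eig assms(17) wiener_axioms.intro) (auto simp: cond_N_def)
    then have "damped lam phi M T Filt Q Qh W \<alpha> \<gamma> K q f0 F u0 v0 u v"
      using A assms(10,12-14)
      by (intro damped.intro damped_axioms.intro) (auto simp: cond_N_def cond_F_def Let_def)
    then interpret scheme lam phi M T Filt Q Qh W \<alpha> \<gamma> K q f0 F u0 v0 u v N n uN vN
      using B by (intro scheme.intro scheme_axioms.intro) auto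
    have C: "sqrt CE \<le> C" "sqrt CW \<le> C" by (simp_all add: C_def)
    show "let k = T / real n; t = real m * k in
        Lp_norm lam M 2 0 (\<lambda>\<omega>. coef phi (u t \<omega> - uN m \<omega>))
          \<le> ennreal (C * (k powr (min (1 + \<gamma>) 1) + lam N powr (- ((1 + min \<gamma> 1) / 2)))) \<and>
        (\<gamma> \<ge> 0 \<longrightarrow> Lp_norm lam M 2 0 (\<lambda>\<omega> j. v t \<omega> j - coef phi (vN m \<omega>) j)
          \<le> ennreal (C * (k + lam N powr (- (\<gamma> / 2)))))"
      using errors[OF m C] unfolding Let_def tp_def stp_def by blast
  qed
qed

end
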